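(* Let $u$ be an entropy solution of $u_t+\operatorname{div}A(u)=0$ in $(0,\infty)\times\mathbb{R}^d$ with initial data $u_0:=u(0,\cdot)\in L^1(\mathbb{R}^d)\cap L^\infty(\mathbb{R}^d)$. Let $I\subset\mathbb{R}$ be a bounded closed interval in which $u$ takes its values, let $a=A'$, and assume that there is a positive integer $m$ such that $a$ is of class $C^m(I)$ and, with $\tilde a(v):=(1,a(v))\in\mathbb{R}^{d+1}$, for every $v\in I$ the vectors $\{\tilde a(v),\tilde a'(v),\dots,\tilde a^{(m)}(v)\}$ span $\mathbb{R}^{d+1}$. Let $$\gamma_0:=\left(1+\frac{d(2m-d+1)}{2}\right)^{-1}.$$ Then for any $\gamma\in(0,\gamma_0)$ there is a constant $C$, depending on $\gamma$, $\|u_0\|_{L^\infty}$ and the function $a$, such that for all $t>0$ and almost every $x\in\mathbb{R}^d$, $$|u(t,x)|\le C\,\|u_0\|_{L^1}^{\gamma}\,t^{-d\gamma}.$$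
   Context: $A:\mathbb{R}\to\mathbb{R}^d$ is a given function. For $u_0\in L^1(\mathbb{R}^d)\cap L^\infty(\mathbb{R}^d)$, the entropy solution is the unique $u\in C([0,\infty),L^1(\mathbb{R}^d))\cap L^\infty([0,\infty)\times\mathbb{R}^d)$ with $u(0,\cdot)=u_0$ such that for every convex $\eta:\mathbb{R}\to\mathbb{R}$, with $q_i'(v)=\eta'(v)a_i(v)$ for $i=1,\dots,d$, and every smooth $\varphi\ge0$ compactly supported in $(0,\infty)\times\mathbb{R}^d$, one has $\iint \big(\eta(u)\,\partial_t\varphi+q(u)\cdot\nabla_x\varphi\big)\,dx\,dt\ge0$. *)

theory Defs
  imports "HOL-Analysis.Analysis" "HOL-Probability.Essential_Supremum"
begin

text \<open>Derivatives relative to a set \<open>S\<close> of reals; at the endpoints of a closed interval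
  these are the one-sided derivatives.\<close>

primrec nth_deriv_on :: "real set \<Rightarrow> nat \<Rightarrow> (real \<Rightarrow> 'a::real_normed_vector) \<Rightarrow> real \<Rightarrow> 'a" where
  "nth_deriv_on S 0 f = f"
| "nth_deriv_on S (Suc k) f = (\<lambda>v. vector_derivative (nth_deriv_on S k f) (at v within S))"

definition class_C_on :: "nat \<Rightarrow> real set \<Rightarrow> (real \<Rightarrow> 'a::real_normed_vector) \<Rightarrow> bool" where
  "class_C_on m S f \<longleftrightarrow>
     (\<forall>k<m. \<forall>v\<in>S. nth_deriv_on S k f differentiable (at v within S)) \<and>
     (\<forall>k\<le>m. continuous_on S (nth_deriv_on S k f))"

primrec class_C :: "nat \<Rightarrow> ('a::euclidean_space \<Rightarrow> real) \<Rightarrow> bool" where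
  "class_C 0 f = continuous_on UNIV f"
| "class_C (Suc k) f \<longleftrightarrow>
     (\<forall>x. f differentiable (at x)) \<and>
     (\<forall>b\<in>Basis. class_C k (\<lambda>x. frechet_derivative f (at x) b))"

definition smooth :: "('a::euclidean_space \<Rightarrow> real) \<Rightarrow> bool" where
  "smooth f \<longleftrightarrow> (\<forall>k. class_C k f)"

definition L1_norm :: "('a::euclidean_space \<Rightarrow> real) \<Rightarrow> real" where
  "L1_norm f = (LINT x|lebesgue. \<bar>f x\<bar>)"

definition Linf_norm :: "('a::euclidean_space \<Rightarrow> real) \<Rightarrow> real" where
  "Linf_norm f = real_of_ereal (esssup lebesgue (\<lambda>x. ereal \<bar>f x\<bar>))"

definition in_L1_Linf :: "('a::euclidean_space \<Rightarrow> real) \<Rightarrow> bool" where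
  "in_L1_Linf f \<longleftrightarrow> integrable lebesgue f \<and> esssup lebesgue (\<lambda>x. ereal \<bar>f x\<bar>) < \<infinity>"

definition time_deriv :: "(real \<times> (real^'n) \<Rightarrow> real) \<Rightarrow> real \<times> (real^'n) \<Rightarrow> real" where
  "time_deriv \<phi> p = frechet_derivative \<phi> (at p) (1, 0)"

definition space_grad :: "(real \<times> (real^'n) \<Rightarrow> real) \<Rightarrow> real \<times> (real^'n) \<Rightarrow> real^'n" where
  "space_grad \<phi> p = (\<chi> i. frechet_derivative \<phi> (at p) (0, axis i 1))"

definition test_function :: "(real \<times> (real^'n) \<Rightarrow> real) \<Rightarrow> bool" where
  "test_function \<phi> \<longleftrightarrow> smooth \<phi> \<and> (\<forall>p. 0 \<le> \<phi> p) \<and>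
     compact (closure {p. \<phi> p \<noteq> 0}) \<and> closure {p. \<phi> p \<noteq> 0} \<subseteq> {0<..} \<times> UNIV"

text \<open>A convex \<open>\<eta>\<close> is differentiable off a countable set. The condition \<open>q' = \<eta>' A'\<close> is imposed
  wherever \<open>\<eta>'\<close> exists; together with continuity of \<open>q\<close> this determines \<open>q\<close> on an interval \<open>S\<close>
  up to an additive constant, also for nonsmooth entropies such as Kruzkov's
  \<open>\<eta>(v) = \<bar>v - c\<bar>\<close>. When \<open>A'\<close> is continuous on \<open>S\<close>, such a \<open>q\<close> exists for every \<open>\<eta>\<close>.\<close>

definition entropy_flux_pair_on ::
    "real set \<Rightarrow> (real \<Rightarrow> real^'n) \<Rightarrow> (real \<Rightarrow> real) \<Rightarrow> (real \<Rightarrow> real^'n) \<Rightarrow> bool" where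
  "entropy_flux_pair_on S A \<eta> q \<longleftrightarrow>
     convex_on UNIV \<eta> \<and> continuous_on S q \<and>
     (\<forall>v\<in>S. \<forall>D. (\<eta> has_real_derivative D) (at v) \<longrightarrow>
        (q has_vector_derivative D *\<^sub>R vector_derivative A (at v within S)) (at v within S))"

text \<open>Entropy solutions \<open>u\<close> (first argument time, second argument space) of
  \<open>u\<^sub>t + div A(u) = 0\<close>, \<open>u(0,\<cdot>) = u\<^sub>0\<close>, with values in \<open>S\<close>. Only the values of the flux on \<open>S\<close>
  matter for such \<open>u\<close>, so \<open>A\<close> need only be regular on \<open>S\<close>; \<open>S = UNIV\<close> imposes no restriction
  on the values. Since \<open>q\<close> is controlled on \<open>S\<close> only and \<open>u\<close> takes values in \<open>S\<close> up to a null
  set, completeness of Lebesgue measure is what makes \<open>q(u)\<close> measurable.\<close>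

definition entropy_solution_in ::
    "real set \<Rightarrow> (real \<Rightarrow> real^'n) \<Rightarrow> (real^'n \<Rightarrow> real) \<Rightarrow> (real \<Rightarrow> real^'n \<Rightarrow> real) \<Rightarrow> bool" where
  "entropy_solution_in S A u\<^sub>0 u \<longleftrightarrow>
     in_L1_Linf u\<^sub>0 \<and>
     (\<forall>t\<ge>0. integrable lebesgue (u t)) \<and>
     (\<forall>s\<ge>0. ((\<lambda>t. L1_norm (\<lambda>x. u t x - u s x)) \<longlongrightarrow> 0) (at s within {0..})) \<and>
     (\<lambda>p. u (fst p) (snd p)) \<in> borel_measurable (lebesgue_on ({0..} \<times> UNIV)) \<and>
     (\<exists>M. AE p in lebesgue_on ({0..} \<times> UNIV). \<bar>u (fst p) (snd p)\<bar> \<le> M) \<and>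
     (AE p in lebesgue_on ({0..} \<times> UNIV). u (fst p) (snd p) \<in> S) \<and>
     (AE x in lebesgue. u 0 x = u\<^sub>0 x) \<and>
     (\<forall>\<eta> q \<phi>. entropy_flux_pair_on S A \<eta> q \<longrightarrow> test_function \<phi> \<longrightarrow>
        0 \<le> (LINT p|lebesgue_on ({0<..} \<times> UNIV).
               \<eta> (u (fst p) (snd p)) * time_deriv \<phi> p
               + q (u (fst p) (snd p)) \<bullet> space_grad \<phi> p))"

end

theory Submission
  imports Defs
begin

text \<open>On a short band \<open>[c, c + \<delta>]\<close> of values the nondegenerate curve \<open>(1, a(v))\<close> admits linear coordinates
  in which its second moments against a tent function are \<open>\<delta>\<close> times the identity, at a volume cost \<open>\<delta>\<^sup>K\<close>
  with \<open>K = d(2m - d + 1)/2\<close>. Testing the entropy inequalities with derivatives of a convex potential, whose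
  Laplacian is large near a prescribed finite set of grid points, bounds the measure of the set
  \<open>{u \<ge> c + \<delta>}\<close> by a power greater than one of the truncated mass at an earlier time. A De Giorgi iteration then
  halves the supremum of \<open>u\<close> after a time determined by that supremum and the mass, and iterating the halving
  gives the decay rate; the lower bound follows by applying this to \<open>-u\<close>.\<close>


text \<open>In n = d + 1 space-time dimensions the fluxes of n entropies oscillating on a band form,
  in adapted coordinates, a positive semidefinite matrix that equals \<delta> times the identity
  wherever the solution exceeds the band. A volume bound then calls for a convex potential with
  bounded gradient and a Hessian as large as possible on the superlevel set, ideally a solution of a
  Monge-Ampere equation. Since only the trace of the Hessian enters, and only near finitely many
  points, a nearly optimal semi-discrete transport from the unit ball onto N equally weighted
  points, mollified at unit scale, supplies a Laplacian of order N^(-1/n). The exponent K is the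
  largest possible total order of n independent derivatives of (1, a): order 0 always occurs because
  the first component is constant, so the others are at worst m, m - 1, ..., m - d + 1. Mass M and
  level V give a halving time of order M^(1/d) V^(-(1 + K)/d), hence decay with exponent 1/(1 + K),
  which is the critical exponent of the statement. This endpoint is itself reached; smaller
  exponents follow by interpolation with the bounded range.\<close>

abbreviation pderiv_dir :: "'a::euclidean_space \<Rightarrow> ('a \<Rightarrow> real) \<Rightarrow> 'a \<Rightarrow> real" where
  "pderiv_dir b f \<equiv> (\<lambda>x. frechet_derivative f (at x) b)"

lemma has_frechet_derivative:
  "f differentiable (at x) \<Longrightarrow> (f has_derivative frechet_derivative f (at x)) (at x)"
  by (simp add: frechet_derivative_works)

lemma pderiv_dir_eq:
  assumes "\<And>x. (f has_derivative D x) (at x)"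
  shows "pderiv_dir b f = (\<lambda>x. D x b)"
  using frechet_derivative_at[OF assms] by metis

lemma class_C_continuous: "class_C k f \<Longrightarrow> continuous_on UNIV f"
  by (cases k) (auto simp: continuous_on_eq_continuous_within intro: differentiable_imp_continuous_within)

lemma class_C_SucD: "class_C (Suc k) f \<Longrightarrow> class_C k f"
proof (induction k arbitrary: f)
  case 0
  then show ?case using class_C_continuous[OF 0] by simp
next
  case (Suc k)
  have "class_C k (pderiv_dir b f)" if "b \<in> Basis" for b
    using Suc.IH[of "pderiv_dir b f"] Suc.prems that by simp
  then show ?case using Suc.prems by simp
qed

lemma class_C_const: "class_C k (\<lambda>x::'a::euclidean_space. c)"
proof (induction k arbitrary: c)
  case (Suc k)
  then show ?case by simp
qed simp

lemma class_C_inner: "class_C k (\<lambda>x::'a::euclidean_space. x \<bullet> v)"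
proof (cases k)
  case (Suc j)
  have d: "((\<lambda>x. x \<bullet> v) has_derivative (\<lambda>h. h \<bullet> v)) (at x)" for x :: 'a
    by (auto intro!: derivative_eq_intros)
  have "(\<lambda>x::'a. x \<bullet> v) differentiable (at x)" for x
    using d differentiable_def by blast
  then show ?thesis using Suc by (simp add: pderiv_dir_eq[OF d] class_C_const)
qed (auto intro: continuous_intros)

lemma class_C_add:
  assumes "class_C k f" "class_C k g"
  shows "class_C k (\<lambda>x. f x + g x)"
  using assms
proof (induction k arbitrary: f g)
  case (Suc k)
  have d: "((\<lambda>x. f x + g x) has_derivative (\<lambda>h. frechet_derivative f (at x) h + frechet_derivative g (at x) h)) (at x)" for x
    using Suc.prems by (auto intro!: has_derivative_add has_frechet_derivative)
  have "(\<lambda>x. f x + g x) differentiable (at x)" for x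
    using d differentiable_def by blast
  then show ?case using Suc by (simp add: pderiv_dir_eq[OF d])
qed (auto intro: continuous_intros)

lemma class_C_mult:
  assumes "class_C k f" "class_C k g"
  shows "class_C k (\<lambda>x. f x * g x)"
  using assms
proof (induction k arbitrary: f g)
  case (Suc k)
  have d: "((\<lambda>x. f x * g x) has_derivative (\<lambda>h. f x * frechet_derivative g (at x) h + frechet_derivative f (at x) h * g x)) (at x)" for x
    using Suc.prems by (auto intro!: has_derivative_mult has_frechet_derivative)
  then have "(\<lambda>x. f x * g x) differentiable (at x)" for x
    using d differentiable_def by blast
  moreover have "class_C k f" "class_C k g" using Suc.prems class_C_SucD by blast+
  ultimately show ?case using Suc by (simp add: pderiv_dir_eq[OF d] class_C_add)
qed (auto intro: continuous_intros)

lemma class_C_sum: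
  assumes "\<And>i. i \<in> S \<Longrightarrow> class_C k (f i)"
  shows "class_C k (\<lambda>x. \<Sum>i\<in>S. f i x)"
  using assms by (induction S rule: infinite_finite_induct) (auto intro: class_C_const class_C_add)

lemma frechet_derivative_basis_expansion:
  fixes f :: "'a::euclidean_space \<Rightarrow> real"
  assumes "f differentiable (at x)"
  shows "frechet_derivative f (at x) h = (\<Sum>b\<in>Basis. (h \<bullet> b) * frechet_derivative f (at x) b)"
proof -
  interpret linear "frechet_derivative f (at x)"
    using has_frechet_derivative[OF assms] has_derivative_linear by blast
  have "frechet_derivative f (at x) (\<Sum>b\<in>Basis. (h \<bullet> b) *\<^sub>R b) = (\<Sum>b\<in>Basis. (h \<bullet> b) * frechet_derivative f (at x) b)"
    by (simp add: sum scale)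
  then show ?thesis by (simp add: euclidean_representation)
qed

lemma class_C_compose_affine:
  fixes P :: "'a::euclidean_space \<Rightarrow> 'b::euclidean_space"
  assumes "class_C k f" "linear P"
  shows "class_C k (\<lambda>x. f (P x + v))"
  using assms(1)
proof (induction k arbitrary: f)
  case 0
  have "continuous_on UNIV P" using assms(2) linear_continuous_on linear_linear by blast
  then have "continuous_on UNIV (\<lambda>x. P x + v)" by (intro continuous_intros)
  then show ?case using 0 continuous_on_compose2[of UNIV f UNIV "\<lambda>x. P x + v"] by simp
next
  case (Suc k)
  have P: "((\<lambda>x. P x + v) has_derivative P) (at x)" for x
    using has_derivative_add[OF linear_imp_has_derivative[OF assms(2), of "at x"] has_derivative_const[of v]] by simp
  have d: "((\<lambda>x. f (P x + v)) has_derivative (\<lambda>h. frechet_derivative f (at (P x + v)) (P h))) (at x)" for x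
    using Suc.prems by (intro has_derivative_compose[OF P has_frechet_derivative]) auto
  have diff: "(\<lambda>x. f (P x + v)) differentiable (at x)" for x
    using d differentiable_def by blast
  have "class_C k (\<lambda>x. frechet_derivative f (at (P x + v)) (P b))" if "b \<in> Basis" for b
    by (subst frechet_derivative_basis_expansion)
       (use Suc that in \<open>auto intro!: class_C_sum class_C_mult class_C_const\<close>)
  then show ?case using diff by (simp add: pderiv_dir_eq[OF d])
qed

lemma class_C_compose_real:
  fixes g :: "'a::euclidean_space \<Rightarrow> real"
  assumes "class_C k f" "class_C k g"
  shows "class_C k (\<lambda>x. f (g x))"
  using assms
proof (induction k arbitrary: f g)
  case 0
  then show ?case using continuous_on_compose2[of UNIV f UNIV g] by simp
next
  case (Suc k)
  have d: "((\<lambda>x. f (g x)) has_derivative (\<lambda>h. frechet_derivative f (at (g x)) (frechet_derivative g (at x) h))) (at x)" for x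
    using Suc.prems by (intro has_derivative_compose[OF has_frechet_derivative has_frechet_derivative]) auto
  have diff: "(\<lambda>x. f (g x)) differentiable (at x)" for x
    using d differentiable_def by blast
  have "class_C k (\<lambda>x. frechet_derivative f (at (g x)) (frechet_derivative g (at x) b))" if "b \<in> Basis" for b
  proof -
    have f1: "class_C k (pderiv_dir 1 f)" and g1: "class_C k (pderiv_dir b g)" using Suc.prems that by auto
    have "class_C k g" using Suc.prems(2) by (rule class_C_SucD)
    then have "class_C k (\<lambda>x. pderiv_dir 1 f (g x))" by (rule Suc.IH[OF f1])
    then have "class_C k (\<lambda>x. pderiv_dir b g x * pderiv_dir 1 f (g x))"
      by (rule class_C_mult[OF g1])
    moreover have "frechet_derivative f (at (g x)) (frechet_derivative g (at x) b) = pderiv_dir b g x * pderiv_dir 1 f (g x)" for x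
    proof -
      have "f differentiable (at (g x))" using Suc.prems(1) by auto
      from frechet_derivative_basis_expansion[OF this, of "frechet_derivative g (at x) b"]
      show ?thesis by simp
    qed
    ultimately show ?thesis by (simp only:)
  qed
  then show ?case using diff by (simp add: pderiv_dir_eq[OF d])
qed

lemma smooth_const: "smooth (\<lambda>x. c)" by (simp add: smooth_def class_C_const)
lemma smooth_inner: "smooth (\<lambda>x. x \<bullet> v)" by (simp add: smooth_def class_C_inner)
lemma smooth_add: "smooth f \<Longrightarrow> smooth g \<Longrightarrow> smooth (\<lambda>x. f x + g x)" by (simp add: smooth_def class_C_add)
lemma smooth_mult: "smooth f \<Longrightarrow> smooth g \<Longrightarrow> smooth (\<lambda>x. f x * g x)" by (simp add: smooth_def class_C_mult)
lemma smooth_sum: "(\<And>i. i \<in> S \<Longrightarrow> smooth (f i)) \<Longrightarrow> smooth (\<lambda>x. \<Sum>i\<in>S. f i x)" by (simp add: smooth_def class_C_sum)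
lemma smooth_diff: "smooth f \<Longrightarrow> smooth g \<Longrightarrow> smooth (\<lambda>x. f x - g x)"
  using smooth_add[of f "\<lambda>x. - 1 * g x"] smooth_mult[of "\<lambda>x. -1" g, OF smooth_const] by simp
lemma smooth_compose_affine: "smooth f \<Longrightarrow> linear P \<Longrightarrow> smooth (\<lambda>x. f (P x + v))"
  by (simp add: smooth_def class_C_compose_affine)
lemma smooth_compose_real: "smooth f \<Longrightarrow> smooth g \<Longrightarrow> smooth (\<lambda>x. f (g x))"
  for f :: "real \<Rightarrow> real" by (simp add: smooth_def class_C_compose_real)

lemma smooth_norm_sq: "smooth (\<lambda>x::'a::euclidean_space. x \<bullet> x)"
proof -
  have "smooth (\<lambda>x::'a. \<Sum>b\<in>Basis. (x \<bullet> b) * (x \<bullet> b))"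
    by (intro smooth_sum smooth_mult smooth_inner)
  then show ?thesis by (subst euclidean_inner)
qed

lemma smooth_differentiable: "smooth f \<Longrightarrow> f differentiable (at x)"
  using class_C.simps(2)[of 0 f] by (simp add: smooth_def del: class_C.simps)

lemma smooth_pderiv_dir: 
  assumes "smooth f" shows "smooth (pderiv_dir h f)"
proof -
  have "smooth (\<lambda>x. \<Sum>b\<in>Basis. (h \<bullet> b) * pderiv_dir b f x)"
  proof (intro smooth_sum smooth_mult smooth_const)
    fix b :: 'a assume "b \<in> Basis"
    then show "smooth (pderiv_dir b f)"
      unfolding smooth_def using assms[unfolded smooth_def, rule_format, of "Suc _"] by auto
  qed
  moreover have "pderiv_dir h f = (\<lambda>x. \<Sum>b\<in>Basis. (h \<bullet> b) * pderiv_dir b f x)"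
    by (rule ext) (rule frechet_derivative_basis_expansion[OF smooth_differentiable[OF assms]])
  ultimately show ?thesis by simp
qed

lemma smooth_continuous: "smooth f \<Longrightarrow> continuous_on UNIV f"
  using class_C_continuous smooth_def by blast

lemma smooth_has_derivative: "smooth f \<Longrightarrow> (f has_derivative frechet_derivative f (at x)) (at x)"
  using smooth_differentiable has_frechet_derivative by blast

text \<open>Closure of a class under differentiation gives all orders by induction. This suits
  \<open>flat_exp\<close>: its derivatives are no longer of the same form, but they all stay in one
  explicit family.\<close>

lemma smooth_real_coinduct:
  assumes "Q f" and step: "\<And>f. Q f \<Longrightarrow> \<exists>f'. Q f' \<and> (\<forall>x. (f has_real_derivative f' x) (at x))"
  shows "smooth f"
proof -
  have "class_C k f" if "Q f" for k f
    using that
  proof (induction k arbitrary: f)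
    case 0
    then show ?case using step[OF 0]
      by (auto simp: continuous_on_eq_continuous_within intro: DERIV_isCont)
  next
    case (Suc k)
    then obtain f' where f': "Q f'" "\<And>x. (f has_real_derivative f' x) (at x)" using step by blast
    have d: "(f has_derivative (\<lambda>h. f' x * h)) (at x)" for x
      using f'(2)[of x] by (simp add: has_field_derivative_def)
    have "f differentiable (at x)" for x using d differentiable_def by blast
    then show ?case using Suc.IH[OF f'(1)] by (simp add: pderiv_dir_eq[OF d])
  qed
  then show ?thesis using assms(1) by (simp add: smooth_def)
qed

subsection \<open>A smooth step\<close>

definition flat_exp :: "real \<Rightarrow> real" where "flat_exp x = (if 0 < x then exp (- (1 / x)) else 0)"

lemma poly_flat_exp_tendsto:
  fixes p :: "real poly"
  shows "((\<lambda>x. poly p (1 / x) * exp (- (1 / x))) \<longlongrightarrow> 0) (at_right 0)"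
proof -
  have "((\<lambda>y. poly p y * exp (- y)) \<longlongrightarrow> 0) at_top"
  proof -
    have "((\<lambda>y. \<Sum>i\<le>degree p. coeff p i * (y ^ i / exp y)) \<longlongrightarrow> (\<Sum>i\<le>degree p. coeff p i * 0)) at_top"
      by (intro tendsto_sum tendsto_mult tendsto_const tendsto_power_div_exp_0)
    moreover have "(\<Sum>i\<le>degree p. coeff p i * (y ^ i / exp y)) = poly p y * exp (- y)" for y
      unfolding poly_altdef sum_distrib_right exp_minus divide_inverse by (simp only: mult.assoc)
    ultimately show ?thesis by simp
  qed
  from filterlim_compose[OF this filterlim_inverse_at_top_right]
  show ?thesis by (simp add: inverse_eq_divide)
qed

text \<open>In the variable y = 1/x the derivative acts on the polynomial factor as p \<mapsto> y^2
  (p - p'), so the family is closed under differentiation. At 0 the difference quotient from the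
  right is again a member of the family, with p replaced by y p, and therefore tends to 0.\<close>

lemma poly_flat_exp_deriv:
  fixes p :: "real poly"
  defines "g \<equiv> \<lambda>(p::real poly) x. if 0 < x then poly p (1 / x) * exp (- (1 / x)) else 0"
  shows "(g p has_real_derivative g (monom 1 2 * (p - pderiv p)) x) (at x)"
proof -
  consider "x > 0" | "x < 0" | "x = 0" by linarith
  then show ?thesis
  proof cases
    case 1
    have "((\<lambda>x. poly p (1 / x) * exp (- (1 / x))) has_real_derivative
        poly (monom 1 2 * (p - pderiv p)) (1 / x) * exp (- (1 / x))) (at x)"
    proof -
      have a: "((\<lambda>x. 1 / x) has_real_derivative - (1 / x\<^sup>2)) (at x)"
        using 1 by (auto intro!: derivative_eq_intros simp: power2_eq_square)
      have b: "((\<lambda>x. poly p (1 / x)) has_real_derivative poly (pderiv p) (1 / x) * (- (1 / x\<^sup>2))) (at x)"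
        by (rule DERIV_chain2[OF poly_DERIV a])
      have c: "((\<lambda>x. exp (- (1 / x))) has_real_derivative exp (- (1 / x)) * (1 / x\<^sup>2)) (at x)"
        using DERIV_chain2[OF DERIV_exp DERIV_minus[OF a]] by simp
      show ?thesis
        using DERIV_mult[OF b c] by (simp add: poly_monom algebra_simps power_divide)
    qed
    moreover have "eventually (\<lambda>y. g p y = poly p (1 / y) * exp (- (1 / y))) (nhds x)"
      using eventually_nhds_in_open[of "{0<..}" x] 1 by (auto elim!: eventually_mono simp: g_def)
    ultimately show ?thesis using 1 by (subst DERIV_cong_ev[OF refl _ refl]) (auto simp: g_def)
  next
    case 2
    have "eventually (\<lambda>y. g p y = 0) (nhds x)"
      using eventually_nhds_in_open[of "{..<0}" x] 2 by (auto elim!: eventually_mono simp: g_def)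
    then show ?thesis using 2 by (subst DERIV_cong_ev[OF refl _ refl]) (auto simp: g_def)
  next
    case 3
    have "((\<lambda>y. g p y / y) \<longlongrightarrow> 0) (at_right 0)"
      using poly_flat_exp_tendsto[of "monom 1 1 * p"]
      by (rule Lim_transform_eventually)
         (auto simp: eventually_at_right_field g_def poly_monom intro!: exI[of _ 1])
    moreover have "((\<lambda>y. g p y / y) \<longlongrightarrow> 0) (at_left 0)"
      by (rule tendsto_eventually) (auto simp: eventually_at_left_field g_def intro!: exI[of _ "-1"])
    ultimately have "((\<lambda>y. g p y / y) \<longlongrightarrow> 0) (at 0)"
      using filterlim_split_at by blast
    then show ?thesis using 3 by (auto simp: has_field_derivative_iff g_def)
  qed
qed

lemma smooth_flat_exp: "smooth flat_exp"
proof (rule smooth_real_coinduct)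
  let ?g = "\<lambda>(p::real poly) x. if 0 < x then poly p (1 / x) * exp (- (1 / x)) else 0"
  show "\<exists>p. flat_exp = ?g p" by (intro exI[of _ 1]) (auto simp: flat_exp_def)
  show "\<exists>f'. (\<exists>p. f' = ?g p) \<and> (\<forall>x. (f has_real_derivative f' x) (at x))" if "\<exists>p. f = ?g p" for f
    using that poly_flat_exp_deriv by blast
qed

definition bump :: "real \<Rightarrow> real" where "bump x = flat_exp x * flat_exp (1 - x)"

lemma smooth_bump: "smooth bump"
  using smooth_mult[OF smooth_flat_exp smooth_compose_affine[OF smooth_flat_exp linear_uminus, of 1]]
  by (simp add: bump_def[abs_def])

lemma bump_nonneg: "0 \<le> bump x" and bump_pos: "0 < x \<Longrightarrow> x < 1 \<Longrightarrow> 0 < bump x"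
  and bump_zero: "x \<le> 0 \<or> 1 \<le> x \<Longrightarrow> bump x = 0"
  by (auto simp: bump_def flat_exp_def)

lemma bump_continuous: "continuous_on S bump"
  using smooth_continuous[OF smooth_bump] continuous_on_subset by blast

lemma bump_integral_pos: "0 < integral {0..1} bump"
proof (rule ccontr)
  assume "\<not> ?thesis"
  moreover have "0 \<le> integral {0..1} bump"
    by (intro integral_nonneg integrable_continuous_interval bump_continuous) (auto simp: bump_nonneg)
  ultimately have "(bump has_integral 0) (cbox 0 1)"
    using integrable_integral[OF integrable_continuous_interval[OF bump_continuous[of "{0..1}"]]] by auto
  then have "bump (1/2) = 0"
    using has_integral_0_cbox_imp_0[of 0 1 bump "1/2"] bump_continuous bump_nonneg by auto
  then show False using bump_pos[of "1/2"] by auto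
qed

definition step :: "real \<Rightarrow> real" where
  "step x = (if x \<le> 0 then 0 else integral {0..x} bump / integral {0..1} bump)"

definition step' :: "real \<Rightarrow> real" where "step' x = bump x / integral {0..1} bump"

lemma step_deriv: "(step has_real_derivative step' x) (at x)"
proof -
  \<comment> \<open>The lower limit of integration is moved to -r, below both 0 and x. This costs
    nothing because \<open>bump\<close> vanishes on the negative axis, and it makes x an interior
    point, so that the fundamental theorem gives a two-sided derivative.\<close>
  define r where "r = \<bar>x\<bar> + 1"
  have st: "step y = integral {-r..y} bump / integral {0..1} bump" if "y \<ge> -r" for y
  proof (cases "y \<le> 0")
    case True
    have "integral {-r..y} bump = integral {-r..y} (\<lambda>x. 0)"
      by (intro Henstock_Kurzweil_Integration.integral_cong) (use True in \<open>auto simp: bump_zero\<close>)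
    then show ?thesis using True by (simp add: step_def)
  next
    case False
    have "integral {-r..0} bump = integral {-r..0} (\<lambda>x. 0)"
      by (intro Henstock_Kurzweil_Integration.integral_cong) (use False in \<open>auto simp: bump_zero\<close>)
    then have "integral {-r..y} bump = integral {0..y} bump"
      using Henstock_Kurzweil_Integration.integral_combine[of "-r" 0 y bump] False that integrable_continuous_interval[OF bump_continuous[of "{-r..y}"]]
      by (auto simp: r_def)
    then show ?thesis using False by (simp add: step_def)
  qed
  have "((\<lambda>y. integral {-r..y} bump) has_real_derivative bump x) (at x within {-r..r})"
    by (rule integral_has_real_derivative[OF bump_continuous]) (auto simp: r_def)
  then have "((\<lambda>y. integral {-r..y} bump) has_real_derivative bump x) (at x)"
    by (subst (asm) at_within_interior) (auto simp: r_def)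
  then have "((\<lambda>y. integral {-r..y} bump / integral {0..1} bump) has_real_derivative step' x) (at x)"
    unfolding step'_def by (rule DERIV_cdivide)
  moreover have "-r < x" by (simp add: r_def)
  then have "eventually (\<lambda>y. step y = integral {-r..y} bump / integral {0..1} bump) (nhds x)"
    using eventually_nhds_in_open[of "{-r<..}" x] by (auto elim!: eventually_mono simp: st)
  ultimately show ?thesis by (subst DERIV_cong_ev[OF refl _ refl]) auto
qed

lemma smooth_step': "smooth step'"
  using smooth_mult[OF smooth_bump smooth_const[of "1 / integral {0..1} bump"]] by (simp add: step'_def[abs_def])

lemma smooth_step: "smooth step"
proof -
  have d: "(step has_derivative (\<lambda>h. step' x * h)) (at x)" for x
    using step_deriv[of x] by (simp add: has_field_derivative_def)
  have "class_C k step" for k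
  proof (cases k)
    case 0
    then show ?thesis using step_deriv by (auto simp: continuous_on_eq_continuous_within intro: DERIV_isCont)
  next
    case (Suc j)
    have "step differentiable (at x)" for x using d differentiable_def by blast
    then show ?thesis using Suc smooth_step' by (simp add: pderiv_dir_eq[OF d] smooth_def)
  qed
  then show ?thesis by (simp add: smooth_def)
qed

lemma step'_nonneg: "0 \<le> step' x" and step'_pos: "0 < x \<Longrightarrow> x < 1 \<Longrightarrow> 0 < step' x"
  and step'_zero: "x \<le> 0 \<or> 1 \<le> x \<Longrightarrow> step' x = 0"
  using bump_integral_pos by (auto simp: step'_def bump_nonneg bump_pos bump_zero)

lemma step_mono: "x \<le> y \<Longrightarrow> step x \<le> step y"
  using DERIV_nonneg_imp_nondecreasing[of x y step] step_deriv step'_nonneg by blast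

lemma step_less: "x < y \<Longrightarrow> 0 \<le> x \<Longrightarrow> y \<le> 1 \<Longrightarrow> step x < step y"
proof (rule DERIV_pos_imp_increasing_open[of x y step])
  fix z assume "0 \<le> x" "y \<le> 1" "x < z" "z < y"
  then have "0 < step' z" by (intro step'_pos) auto
  then show "\<exists>l. (step has_real_derivative l) (at z) \<and> 0 < l" using step_deriv by blast
qed (auto intro: continuous_on_subset[OF smooth_continuous[OF smooth_step] subset_UNIV])

lemma step_0: "x \<le> 0 \<Longrightarrow> step x = 0" by (simp add: step_def)

lemma step_1: "1 \<le> x \<Longrightarrow> step x = 1"
proof -
  assume x: "1 \<le> x"
  have "step x = step 1"
  proof (cases "x = 1")
    case False
    then obtain z where "1 < z" "step x - step 1 = (x - 1) * step' z"
      using MVT2[of 1 x step step'] step_deriv x by auto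
    then show ?thesis using step'_zero[of z] by simp
  qed simp
  then show ?thesis using bump_integral_pos by (simp add: step_def)
qed

lemma step_bounds: "0 \<le> step x" "step x \<le> 1"
proof -
  show "0 \<le> step x" using step_mono[of "min x 0" x] step_0[of "min x 0"] by linarith
  show "step x \<le> 1" using step_mono[of x "max x 1"] step_1[of "max x 1"] by linarith
qed

subsection \<open>Convolution\<close>

lemma lborel_integral_affine:
  fixes f :: "'a::euclidean_space \<Rightarrow> real"
  assumes "f \<in> borel_measurable borel" "c \<noteq> 0"
  shows "(LINT x|lborel. f (t + c *\<^sub>R x)) = (LINT x|lborel. f x) / \<bar>c\<bar> ^ DIM('a)"
proof -
  have "(LINT x|lborel. f x) = (LINT x|density (distr lborel borel (\<lambda>x. t + c *\<^sub>R x)) (\<lambda>_. ennreal (\<bar>c\<bar> ^ DIM('a))). f x)"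
    using lborel_affine[OF assms(2), of t] by simp
  also have "\<dots> = (LINT x|distr lborel borel (\<lambda>x. t + c *\<^sub>R x). (\<bar>c\<bar> ^ DIM('a)) *\<^sub>R f x)"
    using assms by (intro integral_density) auto
  also have "\<dots> = (LINT x|lborel. (\<bar>c\<bar> ^ DIM('a)) *\<^sub>R f (t + c *\<^sub>R x))"
    using assms by (intro integral_distr) auto
  finally show ?thesis using assms by (simp add: field_simps)
qed

lemma integrable_continuous_bounded_support:
  fixes f :: "'a::euclidean_space \<Rightarrow> real"
  assumes "continuous_on UNIV f" "\<And>z. R < norm z \<Longrightarrow> f z = 0"
  shows "integrable lborel f"
proof -
  have "integrable lborel (\<lambda>x. indicator (cball 0 R) x *\<^sub>R f x)"
    by (intro borel_integrable_compact) (auto intro: continuous_on_subset[OF assms(1)])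
  moreover have "(\<lambda>x. indicator (cball 0 R) x *\<^sub>R f x) = f"
    using assms(2) by (auto simp: indicator_def fun_eq_iff not_le)
  ultimately show ?thesis by simp
qed

lemma lborel_integral_eq_integral_cbox:
  fixes f :: "'a::euclidean_space \<Rightarrow> real"
  assumes "continuous_on UNIV f" "\<And>z. z \<notin> cbox a b \<Longrightarrow> f z = 0"
  shows "(LINT z|lborel. f z) = integral (cbox a b) f"
proof -
  obtain R where R: "\<forall>x\<in>cbox a b. norm x \<le> R" using bounded_cbox[of a b] unfolding bounded_iff by blast
  have "integrable lborel f"
  proof (rule integrable_continuous_bounded_support[OF assms(1), of R])
    fix z :: 'a assume "R < norm z"
    then have "z \<notin> cbox a b" using R not_le by blast
    then show "f z = 0" by (rule assms(2))
  qed
  then have "(LINT z|lborel. f z) = integral UNIV f" by (rule integral_lborel[symmetric])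
  also have "integral UNIV f = integral UNIV (\<lambda>x. if x \<in> cbox a b then f x else 0)"
  proof (rule arg_cong[where f="integral UNIV"], rule ext)
    show "f z = (if z \<in> cbox a b then f z else 0)" for z using assms(2)[of z] by (cases "z \<in> cbox a b") simp_all
  qed
  also have "integral UNIV (\<lambda>x. if x \<in> cbox a b then f x else 0) = integral (cbox a b) f"
    by (rule integral_restrict_UNIV)
  finally show ?thesis .
qed

text \<open>Convolution with the reflected kernel. Derivatives in \<open>x\<close> fall on
  \<open>g\<close> with a minus sign, while after translation (\<open>cv_shift\<close>) convexity
  and Lipschitz bounds of \<open>\<phi>\<close> pass on under the integral.\<close>

definition cv :: "('a::euclidean_space \<Rightarrow> real) \<Rightarrow> ('a \<Rightarrow> real) \<Rightarrow> 'a \<Rightarrow> real" where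
  "cv \<phi> g x = (LINT z|lborel. \<phi> z * g (z - x))"

lemma continuous_on_shift: 
  fixes g :: "'a::real_normed_vector \<Rightarrow> 'b::topological_space"
  shows "continuous_on UNIV g \<Longrightarrow> continuous_on S (\<lambda>z. g (z - x))"
  by (rule continuous_on_compose2[of UNIV g]) (auto intro: continuous_intros)

lemma cv_shift:
  fixes \<phi> g :: "'a::euclidean_space \<Rightarrow> real"
  assumes "continuous_on UNIV \<phi>" "continuous_on UNIV g"
  shows "cv \<phi> g x = (LINT z|lborel. \<phi> (x + z) * g z)"
proof -
  have "continuous_on UNIV (\<lambda>z. \<phi> z * g (z - x))"
    by (intro continuous_intros assms continuous_on_shift)
  then have "(\<lambda>z. \<phi> z * g (z - x)) \<in> borel_measurable borel" by (rule borel_measurable_continuous_onI)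
  from lborel_integral_affine[OF this, of 1 x] show ?thesis by (simp add: cv_def)
qed

lemma cv_integrable:
  fixes \<phi> g :: "'a::euclidean_space \<Rightarrow> real"
  assumes "continuous_on UNIV \<phi>" "continuous_on UNIV g" "\<And>z. R < norm z \<Longrightarrow> g z = 0"
  shows "integrable lborel (\<lambda>z. \<phi> z * g (z - x))" "integrable lborel (\<lambda>z. \<phi> (x + z) * g z)"
proof -
  show "integrable lborel (\<lambda>z. \<phi> z * g (z - x))"
  proof (rule integrable_continuous_bounded_support[of _ "R + norm x"])
    show "continuous_on UNIV (\<lambda>z. \<phi> z * g (z - x))"
      by (intro continuous_intros assms continuous_on_shift)
    show "\<phi> z * g (z - x) = 0" if "R + norm x < norm z" for z
      using assms(3)[of "z - x"] that norm_triangle_ineq2[of z x] by auto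
  qed
  have c: "continuous_on UNIV (\<lambda>z. \<phi> (x + z))"
    by (rule continuous_on_compose2[OF assms(1)]) (auto intro: continuous_intros)
  show "integrable lborel (\<lambda>z. \<phi> (x + z) * g z)"
    using assms(3) by (intro integrable_continuous_bounded_support[of _ R] continuous_on_mult c assms(2)) auto
qed

lemma smooth_pderiv_dir_support:
  assumes "smooth g" "\<And>z. R < norm z \<Longrightarrow> g z = 0" "R < norm z"
  shows "pderiv_dir h g z = 0"
proof -
  have "open {z::'a. R < norm z}" by (intro open_Collect_less continuous_intros)
  then have "(g has_derivative (\<lambda>_. 0)) (at z)"
    using assms by (intro has_derivative_transform_within_open[OF has_derivative_const[of 0]]) auto
  from frechet_derivative_at[OF this] show ?thesis by (simp add: fun_eq_iff)
qed

lemma pderiv_dir_inner_grad: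
  assumes "smooth g"
  shows "frechet_derivative g (at z) h = (\<Sum>b\<in>Basis. pderiv_dir b g z *\<^sub>R b) \<bullet> h"
  by (subst frechet_derivative_basis_expansion[OF smooth_differentiable[OF assms]])
     (simp add: inner_commute[of _ h] inner_sum_right mult.commute)

text \<open>\<open>\<phi>\<close> is merely continuous, so all derivatives must fall on
  \<open>g\<close>. For x in the unit ball around x0 the supports of the translated kernels lie in
  one box, and the Leibniz rule for compact boxes applies there.\<close>

lemma cv_has_derivative:
  fixes \<phi> g :: "'a::euclidean_space \<Rightarrow> real"
  assumes \<phi>: "continuous_on UNIV \<phi>" and g: "smooth g" "\<And>z. R < norm z \<Longrightarrow> g z = 0"
  shows "(cv \<phi> g has_derivative (\<lambda>h. - cv \<phi> (pderiv_dir h g) x0)) (at x0)"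
proof -
  obtain a where a: "cball x0 (R + 1) \<subseteq> cbox (-a) a"
    by (rule bounded_subset_cbox_symmetric[OF bounded_cball[of x0 "R + 1"]])
  define grad where "grad z = (\<Sum>b\<in>Basis. pderiv_dir b g z *\<^sub>R b)" for z
  have gradc: "continuous_on UNIV grad" unfolding grad_def
    by (intro continuous_intros smooth_continuous smooth_pderiv_dir g)
  have gg: "frechet_derivative g (at z) h = grad z \<bullet> h" for z h
    unfolding grad_def by (rule pderiv_dir_inner_grad[OF g(1)])
  define fx where "fx x t = \<phi> t *\<^sub>R blinfun_inner_right (- grad (t - x))" for x t
  have gc: "continuous_on UNIV g" by (rule smooth_continuous[OF g(1)])
  have zero: "g' (z - x) = 0" if "x \<in> ball x0 1" "z \<notin> cbox (-a) a" "\<And>z. R < norm z \<Longrightarrow> g' z = 0" for g' :: "'a \<Rightarrow> real" and x z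
  proof -
    have "R + 1 < dist x0 z" using a that(2) by (auto simp: subset_iff not_le)
    then have "R < norm (z - x)" using that(1) dist_triangle[of x0 z x] by (auto simp: dist_norm norm_minus_commute)
    then show ?thesis using that(3) by simp
  qed
  have cvI: "cv \<phi> g' x = integral (cbox (-a) a) (\<lambda>t. \<phi> t * g' (t - x))"
    if xb: "x \<in> ball x0 1" and gc': "continuous_on UNIV g'" and gz: "\<And>z. R < norm z \<Longrightarrow> g' z = 0" for g' x
    unfolding cv_def
  proof (rule lborel_integral_eq_integral_cbox)
    show "continuous_on UNIV (\<lambda>z. \<phi> z * g' (z - x))"
      by (intro continuous_intros \<phi> continuous_on_shift gc')
    show "\<phi> z * g' (z - x) = 0" if z: "z \<notin> cbox (- a) a" for z
      using zero[of x z g', OF xb z gz] by simp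
  qed
  have fxc: "continuous_on (ball x0 1 \<times> cbox (-a) a) (\<lambda>(x, t). fx x t)"
    unfolding fx_def split_beta
    by (intro continuous_intros continuous_on_compose2[OF \<phi>] continuous_on_compose2[OF gradc]
        bounded_linear.continuous_on[OF bounded_linear_blinfun_inner_right]) auto
  have "((\<lambda>x. integral (cbox (-a) a) (\<lambda>t. \<phi> t * g (t - x))) has_derivative blinfun_apply (integral (cbox (-a) a) (fx x0))) (at x0 within ball x0 1)"
  proof (rule leibniz_rule[OF _ _ fxc])
    fix x t :: 'a
    have i: "((\<lambda>x. t - x) has_derivative (\<lambda>h. - h)) (at x within ball x0 1)"
      by (auto intro!: derivative_eq_intros)
    show "((\<lambda>x. \<phi> t * g (t - x)) has_derivative blinfun_apply (fx x t)) (at x within ball x0 1)"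
      by (rule has_derivative_eq_rhs, rule has_derivative_mult_right, rule has_derivative_compose[OF i smooth_has_derivative[OF g(1)]])
         (auto simp: fx_def gg scaleR_blinfun.rep_eq)
  next
    fix x
    show "(\<lambda>t. \<phi> t * g (t - x)) integrable_on cbox (-a) a"
      by (intro integrable_continuous continuous_intros continuous_on_shift gc continuous_on_subset[OF \<phi>]) auto
  qed auto
  then have d: "((\<lambda>x. integral (cbox (-a) a) (\<lambda>t. \<phi> t * g (t - x))) has_derivative blinfun_apply (integral (cbox (-a) a) (fx x0))) (at x0)"
    by (simp add: at_within_open[of x0 "ball x0 1"])
  have d2: "(cv \<phi> g has_derivative blinfun_apply (integral (cbox (-a) a) (fx x0))) (at x0)"
  proof (rule has_derivative_transform_within_open[OF d, of "ball x0 1"])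
    show "integral (cbox (- a) a) (\<lambda>t. \<phi> t * g (t - x)) = cv \<phi> g x" if "x \<in> ball x0 1" for x
      using cvI[OF that gc g(2)] by simp
  qed auto
  have "blinfun_apply (integral (cbox (-a) a) (fx x0)) h = - cv \<phi> (pderiv_dir h g) x0" for h
  proof -
    have c0: "continuous_on (cbox (-a) a) (fx x0)"
      unfolding fx_def by (intro continuous_intros continuous_on_subset[OF \<phi>] continuous_on_compose2[OF gradc]
        bounded_linear.continuous_on[OF bounded_linear_blinfun_inner_right]) auto
    have bl: "bounded_linear (\<lambda>F::'a \<Rightarrow>\<^sub>L real. blinfun_apply F h)" by (rule blinfun.bounded_linear_left)
    have "blinfun_apply (integral (cbox (-a) a) (fx x0)) h = integral (cbox (-a) a) (\<lambda>t. blinfun_apply (fx x0 t) h)"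
      using integral_linear[OF integrable_continuous[OF c0] bl] by (simp add: o_def)
    also have "\<dots> = integral (cbox (-a) a) (\<lambda>t. - (\<phi> t * pderiv_dir h g (t - x0)))"
      by (simp add: fx_def gg scaleR_blinfun.rep_eq)
    also have "\<dots> = - integral (cbox (-a) a) (\<lambda>t. (\<phi> t * pderiv_dir h g (t - x0)))" by simp
    also have "\<dots> = - cv \<phi> (pderiv_dir h g) x0"
      by (subst cvI[OF _ smooth_continuous[OF smooth_pderiv_dir[OF g(1)]] smooth_pderiv_dir_support[OF g]]) auto
    finally show ?thesis .
  qed
  then have "blinfun_apply (integral (cbox (-a) a) (fx x0)) = (\<lambda>h. - cv \<phi> (pderiv_dir h g) x0)" by (rule ext)
  then show ?thesis using d2 by (simp only:)
qed

lemma pderiv_dir_cv: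
  fixes \<phi> g :: "'a::euclidean_space \<Rightarrow> real"
  assumes \<phi>: "continuous_on UNIV \<phi>" and g: "smooth g" "\<And>z. R < norm z \<Longrightarrow> g z = 0"
  shows "pderiv_dir h (cv \<phi> g) x = - cv \<phi> (pderiv_dir h g) x"
  by (rule fun_cong[OF pderiv_dir_eq[OF cv_has_derivative[OF assms]]])

lemma smooth_cv:
  fixes \<phi> g :: "'a::euclidean_space \<Rightarrow> real"
  assumes \<phi>: "continuous_on UNIV \<phi>" and g: "smooth g" "\<And>z. R < norm z \<Longrightarrow> g z = 0"
  shows "smooth (cv \<phi> g)"
proof -
  have "class_C k (cv \<phi> g)" for k
    using g
  proof (induction k arbitrary: g)
    case 0
    have "continuous_on UNIV (cv \<phi> g)"
      by (rule has_derivative_continuous_on[OF cv_has_derivative[OF \<phi> 0]])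
    then show ?case by simp
  next
    case (Suc k)
    have "cv \<phi> g differentiable (at x)" for x
      using cv_has_derivative[OF \<phi> Suc.prems] differentiable_def by blast
    moreover have "class_C k (pderiv_dir b (cv \<phi> g))" for b
    proof -
      have "class_C k (cv \<phi> (pderiv_dir b g))"
        using Suc.IH smooth_pderiv_dir[OF Suc.prems(1)] smooth_pderiv_dir_support[OF Suc.prems] by blast
      then have "class_C k (\<lambda>x. -1 * cv \<phi> (pderiv_dir b g) x)" by (intro class_C_mult class_C_const)
      then show ?thesis using pderiv_dir_cv[OF \<phi> Suc.prems] by simp
    qed
    ultimately show ?case by simp
  qed
  then show ?thesis by (simp add: smooth_def)
qed

section \<open>Laplacians and convex functions\<close>

definition lap :: "('a::euclidean_space \<Rightarrow> real) \<Rightarrow> 'a \<Rightarrow> real" where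
  "lap f x = (\<Sum>b\<in>Basis. pderiv_dir b (pderiv_dir b f) x)"

lemma smooth_lap: "smooth f \<Longrightarrow> smooth (lap f)"
  unfolding lap_def[abs_def] by (intro smooth_sum smooth_pderiv_dir)

lemma lap_support:
  assumes "smooth g" "\<And>z. R < norm z \<Longrightarrow> g z = 0" "R < norm z"
  shows "lap g z = 0"
  unfolding lap_def
  by (intro sum.neutral ballI smooth_pderiv_dir_support[of "pderiv_dir _ g" R] smooth_pderiv_dir smooth_pderiv_dir_support[of g R] assms)

lemma lap_cv:
  fixes \<phi> g :: "'a::euclidean_space \<Rightarrow> real"
  assumes \<phi>: "continuous_on UNIV \<phi>" and g: "smooth g" "\<And>z. R < norm z \<Longrightarrow> g z = 0"
  shows "lap (cv \<phi> g) x = cv \<phi> (lap g) x"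
proof -
  have s: "smooth (pderiv_dir b g)" "smooth (pderiv_dir b (pderiv_dir b g))" for b by (intro smooth_pderiv_dir g)+
  have z: "pderiv_dir b g z = 0" "pderiv_dir b (pderiv_dir b g) z = 0" if "R < norm z" for b z
    using smooth_pderiv_dir_support[OF g that] smooth_pderiv_dir_support[OF s(1) smooth_pderiv_dir_support[OF g] that] by auto
  have n: "pderiv_dir b (\<lambda>x. - f x) x = - pderiv_dir b f x" if "smooth f" for f and b x :: 'a
    by (rule fun_cong[OF pderiv_dir_eq]) (intro has_derivative_minus smooth_has_derivative that)
  have "pderiv_dir b (pderiv_dir b (cv \<phi> g)) x = cv \<phi> (pderiv_dir b (pderiv_dir b g)) x" for b
    by (simp only: pderiv_dir_cv[OF \<phi> g] n[OF smooth_cv[OF \<phi> s(1) z(1)]] pderiv_dir_cv[OF \<phi> s(1) z(1)] minus_minus)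
  then show ?thesis unfolding lap_def cv_def
    by (simp add: sum_distrib_left, subst Bochner_Integration.integral_sum)
       (auto intro!: cv_integrable[OF \<phi> smooth_continuous[OF s(2)] z(2)])
qed

lemma lipschitz_deriv_bound:
  fixes f :: "real \<Rightarrow> real"
  assumes "(f has_real_derivative D) (at x)" "\<And>s t. \<bar>f s - f t\<bar> \<le> L * \<bar>s - t\<bar>"
  shows "\<bar>D\<bar> \<le> L"
proof -
  have "((\<lambda>h. \<bar>(f (x + h) - f x) / h\<bar>) \<longlongrightarrow> \<bar>D\<bar>) (at 0)"
    using assms(1) unfolding DERIV_def by (intro tendsto_rabs)
  moreover have "\<forall>\<^sub>F h in at 0. \<bar>(f (x + h) - f x) / h\<bar> \<le> L"
    unfolding eventually_at using assms(2)[of "x + _" x] by (intro exI[of _ 1]) (auto simp: divide_simps)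
  ultimately show ?thesis by (rule tendsto_upperbound) auto
qed

lemma smooth_along_line:
  fixes f :: "'a::euclidean_space \<Rightarrow> real"
  assumes "smooth f"
  shows "((\<lambda>t. f (x + t *\<^sub>R h)) has_real_derivative pderiv_dir h f (x + t *\<^sub>R h)) (at t)"
proof -
  have l: "((\<lambda>t. x + t *\<^sub>R h) has_derivative (\<lambda>s. s *\<^sub>R h)) (at t)"
    by (auto intro!: derivative_eq_intros)
  interpret linear "frechet_derivative f (at (x + t *\<^sub>R h))"
    using smooth_has_derivative[OF assms] has_derivative_linear by blast
  show ?thesis unfolding has_field_derivative_def
    by (rule has_derivative_eq_rhs[OF has_derivative_compose[OF l smooth_has_derivative[OF assms]]]) (simp add: scale fun_eq_iff)
qed

lemma smooth_lipschitz_pderiv: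
  fixes f :: "'a::euclidean_space \<Rightarrow> real"
  assumes "smooth f" "\<And>x y. \<bar>f x - f y\<bar> \<le> norm (x - y)"
  shows "\<bar>pderiv_dir h f x\<bar> \<le> norm h"
proof (rule lipschitz_deriv_bound)
  show "((\<lambda>t. f (x + t *\<^sub>R h)) has_real_derivative pderiv_dir h f x) (at 0)"
    using smooth_along_line[OF assms(1), of x h 0] by simp
  show "\<bar>f (x + s *\<^sub>R h) - f (x + t *\<^sub>R h)\<bar> \<le> norm h * \<bar>s - t\<bar>" for s t
    using assms(2)[of "x + s *\<^sub>R h" "x + t *\<^sub>R h"]
    by (simp add: scaleR_diff_left[symmetric] mult.commute)
qed

text \<open>On a line, adding the tangent inequalities at two points shows that the first
  directional derivative is monotone.\<close>

lemma smooth_convex_second_deriv: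
  fixes F :: "'a::euclidean_space \<Rightarrow> real"
  assumes F: "smooth F" "convex_on UNIV F"
  shows "0 \<le> pderiv_dir h (pderiv_dir h F) x"
proof -
  define G where "G t = F (x + t *\<^sub>R h)" for t
  define G1 where "G1 t = pderiv_dir h F (x + t *\<^sub>R h)" for t
  have G1: "(G has_real_derivative G1 t) (at t)" for t
    unfolding G_def[abs_def] G1_def by (rule smooth_along_line[OF F(1)])
  have G2: "(G1 has_real_derivative pderiv_dir h (pderiv_dir h F) (x + t *\<^sub>R h)) (at t)" for t
    unfolding G1_def[abs_def] by (rule smooth_along_line[OF smooth_pderiv_dir[OF F(1)]])
  have conv: "convex_on UNIV G"
  proof (rule convex_onI)
    fix t a b :: real assume t: "0 < t" "t < 1"
    have "x + ((1 - t) *\<^sub>R a + t *\<^sub>R b) *\<^sub>R h = (1 - t) *\<^sub>R (x + a *\<^sub>R h) + t *\<^sub>R (x + b *\<^sub>R h)"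
      by (simp add: algebra_simps)
    then show "G ((1 - t) *\<^sub>R a + t *\<^sub>R b) \<le> (1 - t) * G a + t * G b"
      using convex_onD[OF F(2), of t "x + a *\<^sub>R h" "x + b *\<^sub>R h"] t by (simp add: G_def)
  qed simp
  have tan: "G1 s * (t - s) \<le> G t - G s" for s t
    using convex_on_imp_above_tangent[OF conv, of s t "G1 s"] G1[of s] by (auto simp: convex_connected)
  have "mono G1"
  proof
    fix s t :: real assume st: "s \<le> t"
    have "G1 s * (t - s) + G1 t * (s - t) \<le> 0" using tan[of s t] tan[of t s] by simp
    then have "0 \<le> (G1 t - G1 s) * (t - s)" by (simp add: algebra_simps)
    then show "G1 s \<le> G1 t" using st by (cases "s = t") (auto simp: zero_le_mult_iff)
  qed
  then have "0 \<le> pderiv_dir h (pderiv_dir h F) (x + 0 *\<^sub>R h)"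
    using mono_on_imp_deriv_nonneg[of UNIV G1 _ 0] G2[of 0] by auto
  then show ?thesis by simp
qed

lemma cv_convex:
  fixes \<phi> g :: "'a::euclidean_space \<Rightarrow> real"
  assumes \<phi>: "continuous_on UNIV \<phi>" "convex_on UNIV \<phi>" and g: "continuous_on UNIV g" "\<And>z. R < norm z \<Longrightarrow> g z = 0" "\<And>z. 0 \<le> g z"
  shows "convex_on UNIV (cv \<phi> g)"
proof (rule convex_onI)
  fix t :: real and x y :: 'a assume t: "0 < t" "t < 1"
  note I = cv_integrable(2)[OF \<phi>(1) g(1,2)]
  have "cv \<phi> g ((1 - t) *\<^sub>R x + t *\<^sub>R y) \<le> (LINT z|lborel. (1 - t) * (\<phi> (x + z) * g z) + t * (\<phi> (y + z) * g z))"
    unfolding cv_shift[OF \<phi>(1) g(1)]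
  proof (rule integral_mono)
    fix z
    have e: "(1 - t) *\<^sub>R x + t *\<^sub>R y + z = (1 - t) *\<^sub>R (x + z) + t *\<^sub>R (y + z)"
      by (simp add: algebra_simps)
    have "\<phi> ((1 - t) *\<^sub>R x + t *\<^sub>R y + z) * g z \<le> ((1 - t) * \<phi> (x + z) + t * \<phi> (y + z)) * g z"
      unfolding e using convex_onD[OF \<phi>(2), of t "x + z" "y + z"] t g(3) by (intro mult_right_mono) auto
    then show "\<phi> ((1 - t) *\<^sub>R x + t *\<^sub>R y + z) * g z \<le> (1 - t) * (\<phi> (x + z) * g z) + t * (\<phi> (y + z) * g z)"
      by (simp add: algebra_simps)
  qed (auto intro!: Bochner_Integration.integrable_add integrable_mult_right I)
  also have "\<dots> = (1 - t) * cv \<phi> g x + t * cv \<phi> g y"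
    unfolding cv_shift[OF \<phi>(1) g(1)] using I by simp
  finally show "cv \<phi> g ((1 - t) *\<^sub>R x + t *\<^sub>R y) \<le> (1 - t) * cv \<phi> g x + t * cv \<phi> g y" .
qed simp

text \<open>The distributional Laplacian of a convex function is nonnegative, even when the function
  is not differentiable: the integral is the Laplacian at 0 of \<open>cv \<phi> f\<close>, which is
  smooth and convex.\<close>

lemma convex_integral_lap_nonneg:
  fixes \<phi> f :: "'a::euclidean_space \<Rightarrow> real"
  assumes \<phi>: "continuous_on UNIV \<phi>" "convex_on UNIV \<phi>" and f: "smooth f" "\<And>z. R < norm z \<Longrightarrow> f z = 0" "\<And>z. 0 \<le> f z"
  shows "0 \<le> (LINT z|lborel. \<phi> z * lap f z)"
proof -
  have "0 \<le> lap (cv \<phi> f) 0" unfolding lap_def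
    by (intro sum_nonneg smooth_convex_second_deriv smooth_cv[OF \<phi>(1) f(1,2)] cv_convex[OF \<phi> smooth_continuous[OF f(1)] f(2,3)])
  also have "\<dots> = (LINT z|lborel. \<phi> z * lap f z)"
    by (simp add: lap_cv[OF \<phi>(1) f(1,2)] cv_def)
  finally show ?thesis .
qed

lemma pderiv_dir_affine:
  fixes f :: "'a::euclidean_space \<Rightarrow> real"
  assumes "smooth f"
  shows "pderiv_dir h (\<lambda>z. f (m *\<^sub>R z + v)) x = m * pderiv_dir h f (m *\<^sub>R x + v)"
proof (rule fun_cong[OF pderiv_dir_eq])
  fix z
  have l: "((\<lambda>z. m *\<^sub>R z + v) has_derivative (\<lambda>h. m *\<^sub>R h)) (at z)"
    by (auto intro!: derivative_eq_intros)
  interpret linear "frechet_derivative f (at (m *\<^sub>R z + v))"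
    using smooth_has_derivative[OF assms] has_derivative_linear by blast
  show "((\<lambda>z. f (m *\<^sub>R z + v)) has_derivative (\<lambda>h. m * frechet_derivative f (at (m *\<^sub>R z + v)) h)) (at z)"
    using has_derivative_compose[OF l smooth_has_derivative[OF assms]] by (simp add: scale)
qed

lemma smooth_cmult: "smooth f \<Longrightarrow> smooth (\<lambda>x. c * f x)"
  by (intro smooth_mult smooth_const)

lemma smooth_scale_shift:
  fixes f :: "'a::euclidean_space \<Rightarrow> real"
  assumes "smooth f" shows "smooth (\<lambda>z. f (m *\<^sub>R z + v))"
  by (intro smooth_compose_affine[OF assms]) (simp add: linear_iff scaleR_add_right)

lemma pderiv_dir_cmult: 
  assumes "smooth f" shows "pderiv_dir h (\<lambda>x. c * f x) x = c * pderiv_dir h f x"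
  by (rule fun_cong[OF pderiv_dir_eq]) (intro has_derivative_mult_right smooth_has_derivative assms)

lemma pderiv_dir_diff:
  assumes "smooth f" "smooth g" shows "pderiv_dir h (\<lambda>x. f x - g x) x = pderiv_dir h f x - pderiv_dir h g x"
  by (rule fun_cong[OF pderiv_dir_eq]) (intro has_derivative_diff smooth_has_derivative assms)

lemma lap_cmult:
  assumes "smooth f" shows "lap (\<lambda>x. c * f x) x = c * lap f x"
  by (simp add: lap_def pderiv_dir_cmult[OF assms] pderiv_dir_cmult[OF smooth_pderiv_dir[OF assms]] sum_distrib_left)

lemma lap_affine:
  fixes f :: "'a::euclidean_space \<Rightarrow> real"
  assumes "smooth f"
  shows "lap (\<lambda>z. f (m *\<^sub>R z + v)) x = m\<^sup>2 * lap f (m *\<^sub>R x + v)"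
proof -
  have s: "smooth (pderiv_dir b f)" "smooth (\<lambda>z. pderiv_dir b f (m *\<^sub>R z + v))" for b 
    by (intro smooth_scale_shift smooth_pderiv_dir assms)+
  show ?thesis
    by (simp add: lap_def pderiv_dir_affine[OF assms] pderiv_dir_cmult[OF s(2)] pderiv_dir_affine[OF s(1)]
       sum_distrib_left power2_eq_square mult.assoc)
qed

lemma lap_diff_cmult:
  assumes "smooth f" "smooth g"
  shows "lap (\<lambda>x. f x - c * g x) x = lap f x - c * lap g x"
proof -
  have s: "smooth (\<lambda>x. c * g x)" "smooth (pderiv_dir b f)" "smooth (\<lambda>x. c * pderiv_dir b g x)" "smooth (pderiv_dir b g)" for b
    by (intro smooth_cmult smooth_pderiv_dir assms)+
  show ?thesis
    by (simp add: lap_def pderiv_dir_diff[OF assms(1) s(1)] pderiv_dir_cmult[OF assms(2)] pderiv_dir_diff[OF s(2,3)] pderiv_dir_cmult[OF s(4)]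
       sum_distrib_left sum_subtractf)
qed

section \<open>A radial kernel and the kinks of convex functions\<close>

definition rho :: "'a::euclidean_space \<Rightarrow> real" where "rho z = 1 - step (z \<bullet> z)"
text \<open>The weight for which the gradient of \<open>rho\<close> at z is -\<open>rho_w z\<close>
  times z.\<close>

definition rho_w :: "'a::euclidean_space \<Rightarrow> real" where "rho_w z = 2 * step' (z \<bullet> z)"

lemma smooth_rho: "smooth rho"
  unfolding rho_def[abs_def] by (intro smooth_diff smooth_const smooth_compose_real[OF smooth_step smooth_norm_sq])

lemma smooth_rho_w: "smooth rho_w"
  unfolding rho_w_def[abs_def] by (intro smooth_cmult smooth_compose_real[OF smooth_step' smooth_norm_sq])

lemma inner_self_ge_1: "1 < norm z \<Longrightarrow> 1 \<le> z \<bullet> z"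
  for z :: "'a::euclidean_space"
  by (simp add: power2_norm_eq_inner[symmetric] power_le_one_iff)

lemma rho_zero: "1 < norm z \<Longrightarrow> rho z = 0"
  using inner_self_ge_1[of z] by (simp add: rho_def step_1)

lemma rho_w_zero: "1 < norm z \<Longrightarrow> rho_w z = 0"
  using inner_self_ge_1[of z] by (simp add: rho_w_def step'_zero)

lemma rho_nonneg: "0 \<le> rho z" and rho_le_1: "rho z \<le> 1" and rho_w_nonneg: "0 \<le> rho_w z"
  using step_bounds[of "z \<bullet> z"] step'_nonneg[of "z \<bullet> z"] by (auto simp: rho_def rho_w_def)

lemma rho_ge: assumes "norm z \<le> 1/2" shows "1 - step (1/4) \<le> rho z"
proof -
  have "(norm z)\<^sup>2 \<le> (1/2)\<^sup>2" using assms by (intro power_mono) auto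
  then have "z \<bullet> z \<le> 1/4" unfolding power2_norm_eq_inner by (simp add: power2_eq_square)
  then show ?thesis using step_mono by (simp add: rho_def)
qed

lemma pderiv_dir_rho: "pderiv_dir h rho z = - (rho_w z * (z \<bullet> h))"
proof (rule fun_cong[OF pderiv_dir_eq])
  fix z :: 'a
  have i: "((\<lambda>z. z \<bullet> z) has_derivative (\<lambda>h. 2 * (z \<bullet> h))) (at z)"
    by (rule has_derivative_eq_rhs, rule has_derivative_inner[OF has_derivative_ident has_derivative_ident])
       (simp add: fun_eq_iff inner_commute)
  have s: "(step has_derivative (\<lambda>h. step' (z \<bullet> z) * h)) (at (z \<bullet> z))"
    using step_deriv by (simp add: has_field_derivative_def)
  have "((\<lambda>z. 1 - step (z \<bullet> z)) has_derivative (\<lambda>h. 0 - step' (z \<bullet> z) * (2 * (z \<bullet> h)))) (at z)"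
    by (intro has_derivative_diff has_derivative_const has_derivative_compose[OF i s])
  then show "(rho has_derivative (\<lambda>h. - (rho_w z * (z \<bullet> h)))) (at z)"
    by (simp add: rho_def[abs_def] rho_w_def mult.assoc mult.left_commute)
qed

text \<open>Minus the divergence of z \<mapsto> \<open>rho_w z\<close> z. With n the dimension, it
  is also minus the derivative at \<sigma> = 1 of \<sigma>^n \<open>rho_w\<close>(\<sigma> z), the
  form in which it meets convexity along rays.\<close>

lemma lap_rho:
  "lap rho z = - (real DIM('a) * rho_w z + frechet_derivative rho_w (at z) z)" for z :: "'a::euclidean_space"
proof -
  have "pderiv_dir b (pderiv_dir b rho) z = - (rho_w z * (b \<bullet> b) + pderiv_dir b rho_w z * (z \<bullet> b))" for b
    unfolding pderiv_dir_rho
    by (rule fun_cong[OF pderiv_dir_eq[of "\<lambda>z. - (rho_w z * (z \<bullet> b))" "\<lambda>z h. - (rho_w z * (h \<bullet> b) + frechet_derivative rho_w (at z) h * (z \<bullet> b))" b]])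
       (intro has_derivative_minus has_derivative_mult smooth_has_derivative smooth_rho_w has_derivative_inner_left has_derivative_ident)
  then have "lap rho z = (\<Sum>b\<in>Basis. - (rho_w z + (z \<bullet> b) * pderiv_dir b rho_w z))"
    unfolding lap_def by (intro sum.cong) (simp_all add: inner_Basis mult.commute)
  also have "\<dots> = - (real DIM('a) * rho_w z + frechet_derivative rho_w (at z) z)"
    by (subst frechet_derivative_basis_expansion[OF smooth_differentiable[OF smooth_rho_w], of z z])
       (simp add: sum_subtractf)
  finally show ?thesis .
qed

text \<open>It suffices to integrate over the ball of radius 0.1 around the point of norm 0.7 in the
  direction of e. There |e . z| is at least 0.6 |e|, and z . z lies in [0.36, 0.64], an interval on
  which \<open>step'\<close> has a positive minimum.\<close>

lemma rho_w_integral_lower: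
  "\<exists>k>0. \<forall>e::'a::euclidean_space. k * norm e \<le> (LINT z|lborel. \<bar>e \<bullet> z\<bar> * rho_w z)"
proof -
  have "continuous_on {0.36..0.64} step'"
    by (rule continuous_on_subset[OF smooth_continuous[OF smooth_step']]) auto
  then obtain t where t: "t \<in> {0.36..0.64}" "\<And>s. s \<in> {0.36..0.64} \<Longrightarrow> step' t \<le> step' s"
    using continuous_attains_inf[of "{0.36..0.64::real}" step'] by auto
  define m where "m = 0.6 * (2 * step' t) * measure lborel (cball (0::'a) 0.1)"
  have vol: "measure lborel (cball (0::'a) 0.1) > 0"
    by (simp add: content_cball unit_ball_vol_pos)
  have tp: "step' t > 0" using t(1) by (intro step'_pos) auto
  have "m * norm e \<le> (LINT z|lborel. \<bar>e \<bullet> z\<bar> * rho_w z)" for e :: 'a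
  proof (cases "e = 0")
    case False
    define c where "c = (0.7 / norm e) *\<^sub>R e"
    have nc: "norm c = 0.7" using False by (simp add: c_def)
    have lower: "(0.6 * (2 * step' t) * norm e) * indicator (cball c 0.1) z \<le> \<bar>e \<bullet> z\<bar> * rho_w z" for z
    proof (cases "z \<in> cball c 0.1")
      case True
      then have d: "norm (z - c) \<le> 0.1" by (simp add: dist_norm norm_minus_commute)
      have nz: "0.6 \<le> norm z" "norm z \<le> 0.8"
        using d nc norm_triangle_ineq2[of c z] norm_triangle_ineq2[of z c] by (auto simp: norm_minus_commute)
      have "(0.6)\<^sup>2 \<le> (norm z)\<^sup>2" "(norm z)\<^sup>2 \<le> (0.8)\<^sup>2" using nz by (auto intro!: power_mono)
      then have "z \<bullet> z \<in> {0.36..0.64}" unfolding power2_norm_eq_inner by (simp add: power2_eq_square)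
      then have w: "2 * step' t \<le> rho_w z" using t(2) by (simp add: rho_w_def)
      have ec: "e \<bullet> c = 0.7 * norm e" using False by (simp add: c_def power2_norm_eq_inner[symmetric] power2_eq_square)
      have "\<bar>e \<bullet> (z - c)\<bar> \<le> norm e * 0.1"
        using Cauchy_Schwarz_ineq2[of e "z - c"] mult_left_mono[OF d, of "norm e"] by simp
      then have "0.6 * norm e \<le> \<bar>e \<bullet> z\<bar>" using ec unfolding inner_diff_right abs_le_iff by linarith
      from mult_mono[OF this w] tp True show ?thesis by (simp add: mult_ac)
    qed (simp add: rho_w_nonneg)
    have int1: "integrable lborel (\<lambda>z. (0.6 * (2 * step' t) * norm e) * indicator (cball c 0.1) z)"
      by (intro integrable_mult_right integrable_real_indicator) (auto simp: emeasure_cball)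
    have int2: "integrable lborel (\<lambda>z. \<bar>e \<bullet> z\<bar> * rho_w z)"
      by (rule integrable_continuous_bounded_support[of _ 1])
         (auto intro!: continuous_intros smooth_continuous[OF smooth_rho_w] simp: rho_w_zero)
    have "measure lborel (cball c 0.1) = measure lborel (cball (0::'a) 0.1)" by (simp add: content_cball)
    then have "m * norm e = (LINT z|lborel. (0.6 * (2 * step' t) * norm e) * indicator (cball c 0.1) z)"
      by (simp add: m_def)
    also have "\<dots> \<le> (LINT z|lborel. \<bar>e \<bullet> z\<bar> * rho_w z)"
      by (rule integral_mono[OF int1 int2 lower])
    finally show ?thesis .
  qed simp
  moreover have "m > 0" using tp vol by (simp add: m_def)
  ultimately show ?thesis by blast
qed

text \<open>The scaled integral \<open>\<integral>\<phi>(z/\<sigma>) w(z) dz\<close> is minimal-slope at \<open>\<sigma> = 1\<close>: by convexity along rays,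
  \<open>\<phi>(z) \<le> \<sigma> \<phi>(z/\<sigma>) + (1 - \<sigma>) \<phi>(0)\<close>, and differentiating at \<open>\<sigma> = 1\<close> produces the Laplacian of \<open>\<rho>\<close>.\<close>

lemma convex_lap_rho_ge:
  fixes \<phi> :: "'a::euclidean_space \<Rightarrow> real"
  assumes c: "continuous_on UNIV \<phi>" and conv: "convex_on UNIV \<phi>"
  shows "(LINT z|lborel. (\<phi> z - \<phi> 0) * rho_w z) \<le> (LINT z|lborel. \<phi> z * lap rho z)"
proof -
  let ?n = "DIM('a)"
  obtain a :: 'a where a: "cball 0 2 \<subseteq> cbox (-a) a"
    by (rule bounded_subset_cbox_symmetric[OF bounded_cball[of "0::'a" 2]])
  note wc = smooth_continuous[OF smooth_rho_w]
  \<comment> \<open>By the change of variables in \<open>kI\<close> below this is the integral of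
    \<phi>(z/\<sigma>) against \<open>rho_w\<close>; in the present form only the smooth factor
    depends on \<sigma>, so it can be differentiated under the integral. The derivative at 1 is
    minus the integral of \<open>\<phi>\<close> times \<open>lap rho\<close>.\<close>
  define k where "k \<sigma> = integral (cbox (-a) a) (\<lambda>z. \<phi> z * (\<sigma> ^ ?n * rho_w (\<sigma> *\<^sub>R z)))" for \<sigma> :: real
  define k' where "k' \<sigma> z = \<phi> z * (real ?n * \<sigma> ^ (?n - 1) * rho_w (\<sigma> *\<^sub>R z) + \<sigma> ^ ?n * frechet_derivative rho_w (at (\<sigma> *\<^sub>R z)) z)" for \<sigma> :: real and z
  have k'c: "continuous_on ({1/2<..<2} \<times> cbox (-a) a) (\<lambda>(\<sigma>, z). k' \<sigma> z)"
  proof -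
    have e: "(\<lambda>(\<sigma>, z). k' \<sigma> z) = (\<lambda>p. \<phi> (snd p) * (real ?n * fst p ^ (?n - 1) * rho_w (fst p *\<^sub>R snd p)
        + fst p ^ ?n * (\<Sum>b\<in>Basis. (snd p \<bullet> b) * pderiv_dir b rho_w (fst p *\<^sub>R snd p))))"
      unfolding k'_def split_beta
      by (subst frechet_derivative_basis_expansion[OF smooth_differentiable[OF smooth_rho_w]]) simp
    have s: "continuous_on S (\<lambda>p::real \<times> 'a. fst p *\<^sub>R snd p)" "continuous_on S (\<lambda>p::real \<times> 'a. snd p)" for S
      by (intro continuous_intros)+
    show ?thesis unfolding e
      by (intro continuous_intros continuous_on_compose2[OF c s(2)] continuous_on_compose2[OF wc s(1)]
           continuous_on_compose2[OF smooth_continuous[OF smooth_pderiv_dir[OF smooth_rho_w]] s(1)]) auto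
  qed
  have "(k has_field_derivative integral (cbox (-a) a) (k' 1)) (at 1 within {1/2<..<2})"
    unfolding k_def[abs_def]
  proof (rule leibniz_rule_field_derivative[OF _ _ k'c])
    fix \<sigma> :: real and z :: 'a
    have l: "((\<lambda>\<sigma>. \<sigma> *\<^sub>R z) has_derivative (\<lambda>s. s *\<^sub>R z)) (at \<sigma>)" by (auto intro!: derivative_eq_intros)
    interpret linear "frechet_derivative rho_w (at (\<sigma> *\<^sub>R z))"
      using smooth_has_derivative[OF smooth_rho_w] has_derivative_linear by blast
    have d1: "((\<lambda>\<sigma>. rho_w (\<sigma> *\<^sub>R z)) has_real_derivative frechet_derivative rho_w (at (\<sigma> *\<^sub>R z)) z) (at \<sigma>)"
      unfolding has_field_derivative_def
      by (rule has_derivative_eq_rhs[OF has_derivative_compose[OF l smooth_has_derivative[OF smooth_rho_w]]]) (simp add: scale fun_eq_iff)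
    have "((\<lambda>\<sigma>. \<phi> z * (\<sigma> ^ ?n * rho_w (\<sigma> *\<^sub>R z))) has_real_derivative k' \<sigma> z) (at \<sigma>)"
      unfolding k'_def
      by (rule DERIV_cmult, rule DERIV_cong, rule DERIV_mult[OF DERIV_pow d1]) (simp add: algebra_simps)
    then show "((\<lambda>\<sigma>. \<phi> z * (\<sigma> ^ ?n * rho_w (\<sigma> *\<^sub>R z))) has_real_derivative k' \<sigma> z) (at \<sigma> within {1/2<..<2})"
      by (rule has_field_derivative_at_within)
  next
    fix \<sigma> :: real
    have s: "continuous_on (cbox (-a) a) (\<lambda>z. \<sigma> *\<^sub>R z)" by (intro continuous_intros)
    show "(\<lambda>z. \<phi> z * (\<sigma> ^ ?n * rho_w (\<sigma> *\<^sub>R z))) integrable_on cbox (-a) a"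
      by (intro integrable_continuous continuous_intros continuous_on_subset[OF c] continuous_on_compose2[OF wc s]) auto
  qed auto
  then have kd: "(k has_real_derivative integral (cbox (-a) a) (k' 1)) (at 1)"
    by (simp add: at_within_open[of 1 "{1/2<..<2::real}"])
  have zero: "rho_w (\<sigma> *\<^sub>R z) = 0" if "z \<notin> cbox (-a) a" "1/2 < \<sigma>" for z \<sigma>
  proof (rule rho_w_zero)
    have "2 < norm z" using a that(1) by (auto simp: subset_iff not_le)
    then have "1 < (1/2) * norm z" by simp
    also have "\<dots> \<le> \<sigma> * norm z" using that(2) by (intro mult_right_mono) auto
    finally show "1 < norm (\<sigma> *\<^sub>R z)" using that(2) by simp
  qed
  have lapc: "continuous_on UNIV (\<lambda>z. \<phi> z * lap rho z)"
    by (intro continuous_intros c smooth_continuous smooth_lap smooth_rho)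
  have lz: "lap rho z = 0" if "1 < norm z" for z :: 'a
    using lap_support[OF smooth_rho rho_zero that] .
  have "(LINT z|lborel. \<phi> z * lap rho z) = integral (cbox (-a) a) (\<lambda>z. \<phi> z * lap rho z)"
  proof (rule lborel_integral_eq_integral_cbox[OF lapc])
    fix z assume "z \<notin> cbox (-a) a"
    then have "2 < norm z" using a by (auto simp: subset_iff not_le)
    then show "\<phi> z * lap rho z = 0" using lz[of z] by simp
  qed
  also have "\<dots> = - integral (cbox (-a) a) (k' 1)"
    unfolding Henstock_Kurzweil_Integration.integral_neg[symmetric]
    by (intro Henstock_Kurzweil_Integration.integral_cong) (simp add: k'_def lap_rho algebra_simps)
  finally have D: "integral (cbox (-a) a) (k' 1) = - (LINT z|lborel. \<phi> z * lap rho z)" by simp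
  have kI: "k \<sigma> = (LINT z|lborel. \<phi> ((1/\<sigma>) *\<^sub>R z) * rho_w z)" if "1/2 < \<sigma>" for \<sigma>
  proof -
    have s: "continuous_on UNIV (\<lambda>z::'a. \<sigma> *\<^sub>R z)" by (intro continuous_intros)
    have s2: "continuous_on UNIV (\<lambda>z::'a. (1/\<sigma>) *\<^sub>R z)" by (intro continuous_intros)
    have "k \<sigma> = (LINT z|lborel. \<phi> z * (\<sigma> ^ ?n * rho_w (\<sigma> *\<^sub>R z)))"
      unfolding k_def
    proof (rule lborel_integral_eq_integral_cbox[symmetric])
      show "continuous_on UNIV (\<lambda>z. \<phi> z * (\<sigma> ^ ?n * rho_w (\<sigma> *\<^sub>R z)))"
        by (intro continuous_intros c continuous_on_compose2[OF wc s]) auto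
      show "\<phi> z * (\<sigma> ^ ?n * rho_w (\<sigma> *\<^sub>R z)) = 0" if "z \<notin> cbox (-a) a" for z
        using zero[OF that \<open>1/2 < \<sigma>\<close>] by simp
    qed
    also have "\<dots> = \<sigma> ^ ?n * (LINT z|lborel. \<phi> ((1/\<sigma>) *\<^sub>R (0 + \<sigma> *\<^sub>R z)) * rho_w (0 + \<sigma> *\<^sub>R z))"
      using that by (simp add: mult.left_commute flip: integral_mult_right_zero)
    also have "(LINT z|lborel. \<phi> ((1/\<sigma>) *\<^sub>R (0 + \<sigma> *\<^sub>R z)) * rho_w (0 + \<sigma> *\<^sub>R z)) = (LINT z|lborel. \<phi> ((1/\<sigma>) *\<^sub>R z) * rho_w z) / \<bar>\<sigma>\<bar> ^ ?n"
    proof (rule lborel_integral_affine)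
      have "continuous_on UNIV (\<lambda>z. \<phi> ((1/\<sigma>) *\<^sub>R z) * rho_w z)"
        by (intro continuous_on_mult wc continuous_on_compose2[OF c s2]) auto
      then show "(\<lambda>z. \<phi> ((1/\<sigma>) *\<^sub>R z) * rho_w z) \<in> borel_measurable borel" by (rule borel_measurable_continuous_onI)
    qed (use that in auto)
    finally show ?thesis using that by simp
  qed
  define h0 where "h0 = \<phi> 0 * (LINT z|lborel. rho_w (z::'a))"
  \<comment> \<open>Integrating the ray inequality shows that T 1 \<le> T \<sigma> for \<sigma>
    slightly below 1. Hence T'(1) \<le> 0, which is exactly the claim.\<close>
  define T where "T \<sigma> = \<sigma> * k \<sigma> + (1 - \<sigma>) * h0" for \<sigma>
  have wint: "integrable lborel (rho_w :: 'a \<Rightarrow> real)"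
    by (rule integrable_continuous_bounded_support[OF wc rho_w_zero])
  have pint: "integrable lborel (\<lambda>z::'a. \<phi> (s *\<^sub>R z) * rho_w z)" for s
  proof (rule integrable_continuous_bounded_support[of _ 1])
    have s2: "continuous_on UNIV (\<lambda>z::'a. s *\<^sub>R z)" by (intro continuous_intros)
    show "continuous_on UNIV (\<lambda>z::'a. \<phi> (s *\<^sub>R z) * rho_w z)"
      by (intro continuous_on_mult wc continuous_on_compose2[OF c s2]) auto
  qed (simp add: rho_w_zero)
  have Tge: "T 1 \<le> T \<sigma>" if s: "1/2 < \<sigma>" "\<sigma> < 1" for \<sigma>
  proof -
    have "T 1 = (LINT z|lborel. \<phi> z * rho_w z)" by (simp add: T_def kI)
    also have "\<dots> \<le> (LINT z|lborel. \<sigma> * (\<phi> ((1/\<sigma>) *\<^sub>R z) * rho_w z) + (1 - \<sigma>) * \<phi> 0 * rho_w z)"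
    proof (rule integral_mono)
      fix z :: 'a
      have "\<phi> ((1 - \<sigma>) *\<^sub>R 0 + \<sigma> *\<^sub>R ((1/\<sigma>) *\<^sub>R z)) \<le> (1 - \<sigma>) * \<phi> 0 + \<sigma> * \<phi> ((1/\<sigma>) *\<^sub>R z)"
        using s by (intro convex_onD[OF conv]) auto
      then have "\<phi> z \<le> (1 - \<sigma>) * \<phi> 0 + \<sigma> * \<phi> ((1/\<sigma>) *\<^sub>R z)" using s by simp
      from mult_right_mono[OF this rho_w_nonneg[of z]]
      show "\<phi> z * rho_w z \<le> \<sigma> * (\<phi> ((1/\<sigma>) *\<^sub>R z) * rho_w z) + (1 - \<sigma>) * \<phi> 0 * rho_w z"
        by (simp add: algebra_simps)
    qed (use pint[of 1] pint[of "1/\<sigma>"] wint in \<open>auto intro!: Bochner_Integration.integrable_add integrable_mult_right simp: mult.assoc\<close>)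
    also have "\<dots> = T \<sigma>"
      using pint[of "1/\<sigma>"] wint s by (simp add: T_def kI h0_def)
    finally show ?thesis .
  qed
  have Td: "(T has_real_derivative (k 1 - (LINT z|lborel. \<phi> z * lap rho z) - h0)) (at 1)"
    unfolding T_def[abs_def]
    by (rule DERIV_cong, rule DERIV_add[OF DERIV_mult[OF DERIV_ident kd]], rule DERIV_cmult_right, rule DERIV_diff[OF DERIV_const DERIV_ident])
       (simp add: D)
  have "k 1 - (LINT z|lborel. \<phi> z * lap rho z) - h0 \<le> 0"
  proof (rule ccontr)
    assume "\<not> ?thesis"
    then obtain d where d: "d > 0" "\<And>h. h > 0 \<Longrightarrow> h < d \<Longrightarrow> T (1 - h) < T 1"
      using DERIV_pos_inc_left[OF Td] by auto
    define h where "h = min (d/2) (1/4)"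
    have "T (1 - h) < T 1" using d by (auto simp: h_def)
    moreover have "T 1 \<le> T (1 - h)" using d(1) by (intro Tge) (auto simp: h_def)
    ultimately show False by simp
  qed
  moreover have "(LINT z|lborel. (\<phi> z - \<phi> 0) * rho_w z) = k 1 - h0"
    using pint[of 1] wint by (simp add: kI h0_def left_diff_distrib)
  ultimately show ?thesis by simp
qed

text \<open>If y and y' are both subgradients at p up to the error s, then \<phi> has a kink near p,
  and a kink of strength |y - y'| carries a comparable amount of Laplacian. The kernel centred at x
  dominates a multiple of a fourfold smaller kernel centred at p, and since the Laplacian of \<phi>
  is a nonnegative measure the kernels may be exchanged.\<close>

lemma lap_cv_rho_lower:
  "\<exists>c>0. \<exists>C\<ge>0. \<forall>(\<phi>::'a::euclidean_space \<Rightarrow> real) p y y' s x.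
     continuous_on UNIV \<phi> \<longrightarrow> convex_on UNIV \<phi> \<longrightarrow> (\<forall>z. \<phi> p + y \<bullet> (z - p) - s \<le> \<phi> z) \<longrightarrow>
     (\<forall>z. \<phi> p + y' \<bullet> (z - p) - s \<le> \<phi> z) \<longrightarrow> norm (x - p) \<le> 1/4 \<longrightarrow>
     c * norm (y - y') - C * s \<le> lap (cv \<phi> rho) x"
proof -
  obtain k where k: "k > 0" "\<And>e::'a. k * norm e \<le> (LINT z|lborel. \<bar>e \<bullet> z\<bar> * rho_w z)"
    using rho_w_integral_lower by blast
  define c0 where "c0 = 1 - step (1/4)"
  have c0: "c0 > 0" using step_less[of "1/4" 1] step_1[of 1] by (simp add: c0_def)
  define W where "W = (LINT z|lborel. rho_w (z::'a))"
  have wc: "continuous_on UNIV (rho_w::'a \<Rightarrow> real)" by (rule smooth_continuous[OF smooth_rho_w])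
  have W: "0 \<le> W" unfolding W_def by (intro Bochner_Integration.integral_nonneg rho_w_nonneg)
  \<comment> \<open>The factor 16 comes from the Laplacian of a fourfold dilation, and the power of
    4 from the volume change when this dilation is undone.\<close>
  define A where "A = 16 * c0 / 4 ^ DIM('a)"
  have A: "A > 0" using c0 by (simp add: A_def)
  have main: "A * k / 8 * norm (y - y') - A * W * s \<le> lap (cv \<phi> rho) x"
    if c: "continuous_on UNIV \<phi>" and conv: "convex_on UNIV \<phi>" and y: "\<And>z. \<phi> p + y \<bullet> (z - p) - s \<le> \<phi> z"
     and y': "\<And>z. \<phi> p + y' \<bullet> (z - p) - s \<le> \<phi> z" and x: "norm (x - p) \<le> 1/4" for \<phi> :: "'a \<Rightarrow> real" and p y y' s x
  proof -
    define f1 where "f1 z = rho (z - x)" for z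
    define f2 where "f2 z = rho (4 *\<^sub>R z - 4 *\<^sub>R p)" for z
    have f1s: "smooth f1" unfolding f1_def[abs_def] using smooth_scale_shift[OF smooth_rho, of 1 "-x"] by simp
    have f2s: "smooth f2" unfolding f2_def[abs_def] using smooth_scale_shift[OF smooth_rho, of 4 "- (4 *\<^sub>R p)"] by simp
    have lap1: "lap f1 z = lap rho (z - x)" for z
      unfolding f1_def[abs_def] using lap_affine[OF smooth_rho, of 1 "-x" z] by simp
    have lap2: "lap f2 z = 16 * lap rho (4 *\<^sub>R z - 4 *\<^sub>R p)" for z
      unfolding f2_def[abs_def] using lap_affine[OF smooth_rho, of 4 "- (4 *\<^sub>R p)" z] by simp
    define R where "R = norm x + norm p + 1"
    have n4: "norm (4 *\<^sub>R z - 4 *\<^sub>R p) = 4 * norm (z - p)" for z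
      by (simp add: scaleR_diff_right[symmetric])
    have z1: "f1 z = 0" if "R < norm z" for z
      unfolding f1_def using that norm_triangle_ineq2[of z x] norm_ge_zero[of p] unfolding R_def by (intro rho_zero) linarith
    have z2: "f2 z = 0" if "R < norm z" for z
      unfolding f2_def using that norm_triangle_ineq2[of z p] norm_ge_zero[of x] unfolding R_def by (intro rho_zero, unfold n4) linarith
    have nn: "0 \<le> f1 z - c0 * f2 z" for z
    proof (cases "1 < norm (4 *\<^sub>R z - 4 *\<^sub>R p)")
      case True
      then show ?thesis using rho_nonneg by (simp add: f1_def f2_def rho_zero)
    next
      case False
      then have "norm (z - p) \<le> 1/4" by (simp add: n4)
      then have "norm (z - x) \<le> 1/2" using x norm_triangle_ineq4[of "z - p" "x - p"] by auto
      then have "c0 \<le> f1 z" unfolding c0_def f1_def by (rule rho_ge)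
      moreover have "c0 * f2 z \<le> c0 * 1" using c0 rho_le_1 by (intro mult_left_mono) (auto simp: f2_def)
      ultimately show ?thesis by simp
    qed
    have "0 \<le> (LINT z|lborel. \<phi> z * lap (\<lambda>z. f1 z - c0 * f2 z) z)"
    proof (rule convex_integral_lap_nonneg[OF c conv, of _ R])
      show "smooth (\<lambda>z. f1 z - c0 * f2 z)" by (intro smooth_diff smooth_cmult f1s f2s)
      show "f1 z - c0 * f2 z = 0" if "R < norm z" for z using z1[OF that] z2[OF that] by simp
    qed (rule nn)
    also have "\<dots> = (LINT z|lborel. \<phi> z * lap f1 z - c0 * (\<phi> z * lap f2 z))"
      by (simp add: lap_diff_cmult[OF f1s f2s] algebra_simps)
    also have "\<dots> = (LINT z|lborel. \<phi> z * lap f1 z) - c0 * (LINT z|lborel. \<phi> z * lap f2 z)"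
    proof -
      have "integrable lborel (\<lambda>z. \<phi> z * lap f z)" if "smooth f" "\<And>z. R < norm z \<Longrightarrow> f z = 0" for f
      proof (rule integrable_continuous_bounded_support[of _ R])
        show "continuous_on UNIV (\<lambda>z. \<phi> z * lap f z)" by (intro continuous_intros c smooth_continuous smooth_lap that(1))
        show "\<phi> z * lap f z = 0" if "R < norm z" for z using lap_support[OF \<open>smooth f\<close> _ that] \<open>\<And>z. R < norm z \<Longrightarrow> f z = 0\<close> by simp
      qed
      from this[OF f1s z1] this[OF f2s z2] show ?thesis by simp
    qed
    also have "(LINT z|lborel. \<phi> z * lap f1 z) = lap (cv \<phi> rho) x"
      by (subst lap_cv[OF c smooth_rho rho_zero]) (simp_all add: cv_def lap1)
    finally have L1: "c0 * (LINT z|lborel. \<phi> z * lap f2 z) \<le> lap (cv \<phi> rho) x" by simp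
    define \<psi> where "\<psi> z = \<phi> (p + (1/4) *\<^sub>R z)" for z
    have \<psi>c: "continuous_on UNIV \<psi>" unfolding \<psi>_def
      by (rule continuous_on_compose2[OF c]) (auto intro!: continuous_intros)
    have \<psi>conv: "convex_on UNIV \<psi>"
    proof (rule convex_onI)
      fix t :: real and u v :: 'a assume t: "0 < t" "t < 1"
      have "p + (1/4) *\<^sub>R ((1 - t) *\<^sub>R u + t *\<^sub>R v) = (1 - t) *\<^sub>R (p + (1/4) *\<^sub>R u) + t *\<^sub>R (p + (1/4) *\<^sub>R v)"
        by (rule euclidean_eqI) (simp add: inner_add_left inner_diff_left field_simps)
      then show "\<psi> ((1 - t) *\<^sub>R u + t *\<^sub>R v) \<le> (1 - t) * \<psi> u + t * \<psi> v"
        using t by (simp add: \<psi>_def convex_onD[OF conv])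
    qed simp
    have "(LINT z|lborel. \<phi> z * lap f2 z) = 16 * (LINT z|lborel. \<psi> (- (4 *\<^sub>R p) + 4 *\<^sub>R z) * lap rho (- (4 *\<^sub>R p) + 4 *\<^sub>R z))"
    proof -
      have "p + (1/4) *\<^sub>R (- (4 *\<^sub>R p) + 4 *\<^sub>R z) = z" for z by (simp add: scaleR_add_right scaleR_diff_right)
      then have "(\<lambda>z. \<phi> z * lap f2 z) = (\<lambda>z. 16 * (\<psi> (- (4 *\<^sub>R p) + 4 *\<^sub>R z) * lap rho (- (4 *\<^sub>R p) + 4 *\<^sub>R z)))"
        by (simp add: lap2 \<psi>_def fun_eq_iff)
      then show ?thesis by (simp only: integral_mult_right_zero)
    qed
    also have "(LINT z|lborel. \<psi> (- (4 *\<^sub>R p) + 4 *\<^sub>R z) * lap rho (- (4 *\<^sub>R p) + 4 *\<^sub>R z)) = (LINT z|lborel. \<psi> z * lap rho z) / \<bar>4\<bar> ^ DIM('a)"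
      by (rule lborel_integral_affine)
         (auto intro!: borel_measurable_continuous_onI continuous_on_mult \<psi>c smooth_continuous[OF smooth_lap[OF smooth_rho]])
    finally have L2: "(LINT z|lborel. \<phi> z * lap f2 z) = 16 / 4 ^ DIM('a) * (LINT z|lborel. \<psi> z * lap rho z)" by simp
    have pint: "integrable lborel (\<lambda>z::'a. g z * rho_w z)" if "continuous_on UNIV g" for g :: "'a \<Rightarrow> real"
      by (rule integrable_continuous_bounded_support[of _ 1]) (auto intro!: continuous_intros that wc simp: rho_w_zero)
    have \<psi>c': "continuous_on UNIV (\<lambda>z. \<psi> (- z))"
      by (rule continuous_on_compose2[OF \<psi>c]) (auto intro: continuous_intros)
    \<comment> \<open>Averaging over z and -z allows one subgradient to be used at z and the other
      at -z. The sum of the two increments then dominates |(y - y') . z|/4 up to the error 2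
      s.\<close>
    have "(LINT z|lborel. (\<psi> z - \<psi> 0) * rho_w z) = (LINT z|lborel. (\<psi> (0 + (-1) *\<^sub>R z) - \<psi> 0) * rho_w (0 + (-1) *\<^sub>R z))"
      by (subst lborel_integral_affine) (auto intro!: borel_measurable_continuous_onI continuous_intros \<psi>c wc)
    also have "\<dots> = (LINT z|lborel. (\<psi> (- z) - \<psi> 0) * rho_w z)" by (simp add: rho_w_def)
    finally have refl: "(LINT z|lborel. (\<psi> z - \<psi> 0) * rho_w z) = (LINT z|lborel. (\<psi> (- z) - \<psi> 0) * rho_w z)" .
    have "k * norm (y - y') / 4 - 2 * s * W \<le> (LINT z|lborel. \<bar>(y - y') \<bullet> z\<bar> * rho_w z) / 4 - 2 * s * W"
      using k(2)[of "y - y'"] by simp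
    also have "\<dots> = (LINT z|lborel. (\<bar>(y - y') \<bullet> z\<bar> / 4 - 2 * s) * rho_w z)"
    proof -
      have i: "integrable lborel (\<lambda>z. \<bar>(y - y') \<bullet> z\<bar> * rho_w z)" "integrable lborel (rho_w::'a\<Rightarrow>real)"
        using pint[of "\<lambda>_. 1"] by (auto intro!: continuous_intros pint)
      have "(LINT z|lborel. (\<bar>(y - y') \<bullet> z\<bar> / 4 - 2 * s) * rho_w z) = (LINT z|lborel. \<bar>(y - y') \<bullet> z\<bar> * rho_w z / 4 - (2 * s) * rho_w z)"
        by (simp add: left_diff_distrib)
      also have "\<dots> = (LINT z|lborel. \<bar>(y - y') \<bullet> z\<bar> * rho_w z) / 4 - (2 * s) * W"
        unfolding W_def using i by (subst Bochner_Integration.integral_diff) auto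
      finally show ?thesis by simp
    qed
    also have "\<dots> \<le> (LINT z|lborel. ((\<psi> z - \<psi> 0) + (\<psi> (- z) - \<psi> 0)) * rho_w z)"
    proof (intro integral_mono pint continuous_intros \<psi>c \<psi>c' mult_right_mono rho_w_nonneg)
      fix z :: 'a
      have "\<phi> p + y \<bullet> (p + (1/4) *\<^sub>R z - p) - s \<le> \<psi> z" "\<phi> p + y' \<bullet> (p + (1/4) *\<^sub>R z - p) - s \<le> \<psi> z"
        "\<phi> p + y \<bullet> (p + (1/4) *\<^sub>R (-z) - p) - s \<le> \<psi> (-z)" "\<phi> p + y' \<bullet> (p + (1/4) *\<^sub>R (-z) - p) - s \<le> \<psi> (-z)"
        unfolding \<psi>_def by (rule y y')+
      moreover have "\<psi> 0 = \<phi> p" by (simp add: \<psi>_def)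
      ultimately show "\<bar>(y - y') \<bullet> z\<bar> / 4 - 2 * s \<le> \<psi> z - \<psi> 0 + (\<psi> (- z) - \<psi> 0)"
        by (simp add: inner_diff_left abs_if diff_divide_distrib)
    qed simp_all
    also have "\<dots> = 2 * (LINT z|lborel. (\<psi> z - \<psi> 0) * rho_w z)"
    proof -
      have i: "integrable lborel (\<lambda>z. (\<psi> z - \<psi> 0) * rho_w z)" "integrable lborel (\<lambda>z. (\<psi> (- z) - \<psi> 0) * rho_w z)"
        by (intro pint continuous_intros \<psi>c \<psi>c')+
      show ?thesis unfolding distrib_right Bochner_Integration.integral_add[OF i] refl[symmetric] by simp
    qed
    finally have "k * norm (y - y') / 8 - s * W \<le> (LINT z|lborel. (\<psi> z - \<psi> 0) * rho_w z)" by simp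
    also have "\<dots> \<le> (LINT z|lborel. \<psi> z * lap rho z)" by (rule convex_lap_rho_ge[OF \<psi>c \<psi>conv])
    finally have "A * (k * norm (y - y') / 8 - s * W) \<le> A * (LINT z|lborel. \<psi> z * lap rho z)"
      using A by (intro mult_left_mono) auto
    also have "\<dots> = c0 * (LINT z|lborel. \<phi> z * lap f2 z)" unfolding L2 by (simp add: A_def)
    also have "\<dots> \<le> lap (cv \<phi> rho) x" by (rule L1)
    finally show ?thesis by (simp add: algebra_simps)
  qed
  have "\<forall>(\<phi>::'a \<Rightarrow> real) p y y' s x. continuous_on UNIV \<phi> \<longrightarrow> convex_on UNIV \<phi> \<longrightarrow> (\<forall>z. \<phi> p + y \<bullet> (z - p) - s \<le> \<phi> z) \<longrightarrow>
     (\<forall>z. \<phi> p + y' \<bullet> (z - p) - s \<le> \<phi> z) \<longrightarrow> norm (x - p) \<le> 1/4 \<longrightarrow>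
     A * k / 8 * norm (y - y') - A * W * s \<le> lap (cv \<phi> rho) x"
  proof (intro allI impI)
    fix \<phi> :: "'a \<Rightarrow> real" and p y y' s x
    assume a: "continuous_on UNIV \<phi>" "convex_on UNIV \<phi>" "\<forall>z. \<phi> p + y \<bullet> (z - p) - s \<le> \<phi> z"
      "\<forall>z. \<phi> p + y' \<bullet> (z - p) - s \<le> \<phi> z" "norm (x - p) \<le> 1/4"
    show "A * k / 8 * norm (y - y') - A * W * s \<le> lap (cv \<phi> rho) x"
      by (rule main[OF a(1,2) _ _ a(5)]) (rule a(3)[rule_format], rule a(4)[rule_format])
  qed
  moreover have "A * k / 8 > 0" "A * W \<ge> 0" using A k(1) W by auto
  ultimately show ?thesis by blast
qed

subsection \<open>A discrete Monge-Ampere potential\<close>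

text \<open>\<open>\<psi>\<close> is the dual potential with heights \<open>c\<close> at the points of \<open>P\<close>; \<open>G\<close> is the semi-discrete
  Kantorovich functional. Lowering one height of a near-minimiser can raise \<open>G\<close> only a little, which
  bounds the measure of the corresponding contact set from below.\<close>

definition dual_pot :: "'a::euclidean_space set \<Rightarrow> ('a \<Rightarrow> real) \<Rightarrow> 'a \<Rightarrow> real" where
  "dual_pot P c y = Max ((\<lambda>p. p \<bullet> y - c p) ` P)"

lemma dual_pot_ge: "finite P \<Longrightarrow> p \<in> P \<Longrightarrow> p \<bullet> y - c p \<le> dual_pot P c y"
  by (simp add: dual_pot_def)

lemma dual_pot_attained: "finite P \<Longrightarrow> P \<noteq> {} \<Longrightarrow> \<exists>p\<in>P. dual_pot P c y = p \<bullet> y - c p"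
  unfolding dual_pot_def using Max_in[of "(\<lambda>p. p \<bullet> y - c p) ` P"] by (auto simp del: Max_in)

lemma dual_pot_continuous:
  assumes "finite P" "P \<noteq> {}"
  shows "continuous_on S (dual_pot P c)"
  using assms unfolding dual_pot_def[abs_def]
proof (induction P rule: finite_ne_induct)
  case (singleton p)
  show ?case by (simp add: continuous_intros)
next
  case (insert p P)
  have "continuous_on S (\<lambda>y. max (p \<bullet> y - c p) (Max ((\<lambda>p. p \<bullet> y - c p) ` P)))"
    by (intro continuous_intros insert.IH)
  then show ?case using insert by (simp add: image_insert)
qed

lemma set_integrable_cball:
  fixes f :: "'a::euclidean_space \<Rightarrow> real"
  assumes "continuous_on UNIV f"
  shows "integrable lborel (\<lambda>y. indicator (cball 0 1) y * f y)"
  using borel_integrable_compact[of "cball 0 1" f] continuous_on_subset[OF assms, of "cball 0 1"] by simp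

lemma dual_pot_contact_sets:
  fixes P :: "'a::euclidean_space set"
  assumes P: "finite P" "P \<noteq> {}" and s: "s > 0"
  defines "w \<equiv> measure lborel (cball (0::'a) 1)"
  shows "\<exists>c. \<forall>p\<in>P. w / (2 * card P) \<le> measure lborel {y \<in> cball 0 1. dual_pot P c y \<le> p \<bullet> y - c p + s}"
proof -
  let ?B = "cball (0::'a) 1"
  have w: "w > 0" by (simp add: w_def content_cball unit_ball_vol_pos)
  define N where "N = real (card P)"
  have N: "N > 0" using P by (simp add: N_def card_gt_0_iff)
  \<comment> \<open>Every point of P receives the same weight w/N, where w is the volume of the unit
    ball. The functional is bounded below, because the maximum defining \<open>dual_pot\<close> is
    at least the average over P.\<close>
  define G where "G c = (LINT y|lborel. indicator ?B y * dual_pot P c y) + w / N * (\<Sum>p\<in>P. c p)" for c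
  obtain R where R: "\<And>p. p \<in> P \<Longrightarrow> norm p \<le> R"
    using finite_imp_bounded[OF P(1)] unfolding bounded_iff by blast
  have int: "integrable lborel (\<lambda>y. indicator ?B y * dual_pot P c y)" for c
    by (rule set_integrable_cball[OF dual_pot_continuous[OF P]])
  have Bint: "integrable lborel (\<lambda>y. indicator ?B y * k)" for k :: real
    by (rule set_integrable_cball) simp
  have lower: "- R * w \<le> G c" for c
  proof -
    have "(LINT y|lborel. indicator ?B y * (- R - (\<Sum>p\<in>P. c p) / N)) \<le> (LINT y|lborel. indicator ?B y * dual_pot P c y)"
    proof (rule integral_mono[OF Bint int])
      fix y
      show "indicator ?B y * (- R - (\<Sum>p\<in>P. c p) / N) \<le> indicator ?B y * dual_pot P c y"
      proof (cases "y \<in> ?B")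
        case True
        have "(\<Sum>p\<in>P. - R - c p) \<le> (\<Sum>p\<in>P. dual_pot P c y)"
        proof (rule sum_mono)
          fix p assume p: "p \<in> P"
          have "\<bar>p \<bullet> y\<bar> \<le> norm p * norm y" by (rule Cauchy_Schwarz_ineq2)
          also have "\<dots> \<le> R * 1" using R[OF p] True by (intro mult_mono) (auto intro: order_trans[OF norm_ge_zero])
          finally show "- R - c p \<le> dual_pot P c y" using dual_pot_ge[OF P(1) p, of y c] by linarith
        qed
        then have "- N * R - (\<Sum>p\<in>P. c p) \<le> N * dual_pot P c y" by (simp add: sum_subtractf sum_negf N_def)
        then have "- R - (\<Sum>p\<in>P. c p) / N \<le> dual_pot P c y" using N by (simp add: field_simps)
        then show ?thesis using True by simp
      qed simp
    qed
    moreover have "(LINT y|lborel. indicator ?B y * k) = w * k" for k :: real by (simp add: w_def)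
    ultimately have "w * (- R - (\<Sum>p\<in>P. c p) / N) \<le> (LINT y|lborel. indicator ?B y * dual_pot P c y)" by metis
    then show ?thesis by (simp add: G_def algebra_simps)
  qed
  \<comment> \<open>Half of the first-order loss s w/N, so that a contact set keeps at least half of
    its fair share w/N.\<close>
  define \<eta> where "\<eta> = s * w / (2 * N)"
  have \<eta>: "\<eta> > 0" using s w N by (simp add: \<eta>_def)
  have bdd: "bdd_below (range G)" using lower by (auto intro!: bdd_belowI2)
  then obtain c where c: "G c < (INF c. G c) + \<eta>"
    using cInf_lessD[of "range G" "(INF c. G c) + \<eta>"] \<eta> by auto
  have near: "G c \<le> G c' + \<eta>" for c'
    using c cINF_lower[OF bdd, of c'] by simp
  have "w / (2 * N) \<le> measure lborel {y \<in> ?B. dual_pot P c y \<le> p \<bullet> y - c p + s}" if p: "p \<in> P" for p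
  proof -
    let ?C = "{y \<in> ?B. dual_pot P c y \<le> p \<bullet> y - c p + s}"
    \<comment> \<open>Lowering the height at p by s raises the potential by at most s, and only at
      points of the contact set ?C. The linear term of G drops by w s/N, and near-minimality
      compares the two.\<close>
    define c' where "c' = c(p := c p - s)"
    have "closed {y. dual_pot P c y \<le> p \<bullet> y - c p + s}"
      by (intro closed_Collect_le dual_pot_continuous P continuous_intros)
    then have Cm: "?C \<in> sets lborel" by (simp add: Collect_conj_eq sets.Int borel_closed)
    have Cint: "integrable lborel (\<lambda>y. s * indicator ?C y)"
    proof (intro integrable_mult_right integrable_real_indicator Cm)
      have "emeasure lborel ?C \<le> emeasure lborel ?B" by (intro emeasure_mono) auto
      then show "emeasure lborel ?C < \<infinity>" by (auto simp: emeasure_cball le_less_trans)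
    qed
    have "(LINT y|lborel. indicator ?B y * dual_pot P c' y) \<le> (LINT y|lborel. indicator ?B y * dual_pot P c y + s * indicator ?C y)"
    proof (rule integral_mono[OF int Bochner_Integration.integrable_add[OF int Cint]])
      fix y
      obtain q where q: "q \<in> P" "dual_pot P c' y = q \<bullet> y - c' q" using dual_pot_attained[OF P] by blast
      have "dual_pot P c' y \<le> dual_pot P c y + s * indicator ?C y" if "y \<in> ?B"
      proof (cases "q = p")
        case True
        then have e: "dual_pot P c' y = p \<bullet> y - c p + s" using q by (simp add: c'_def)
        show ?thesis
        proof (cases "y \<in> ?C")
          case True
          then show ?thesis using e dual_pot_ge[OF P(1) p, of y c] by simp
        next
          case False
          then show ?thesis using e that by simp
        qed
      next
        case False
        then show ?thesis using q dual_pot_ge[OF P(1) q(1), of y c] s by (simp add: c'_def indicator_def)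
      qed
      then show "indicator ?B y * dual_pot P c' y \<le> indicator ?B y * dual_pot P c y + s * indicator ?C y"
        by (cases "y \<in> ?B") auto
    qed
    also have "\<dots> = (LINT y|lborel. indicator ?B y * dual_pot P c y) + s * measure lborel ?C"
      using Bochner_Integration.integral_add[OF int Cint, of c] by simp
    finally have I: "(LINT y|lborel. indicator ?B y * dual_pot P c' y) \<le> (LINT y|lborel. indicator ?B y * dual_pot P c y) + s * measure lborel ?C" .
    have sm: "(\<Sum>q\<in>P. c' q) = (\<Sum>q\<in>P. c q) - s"
    proof -
      have "(\<Sum>q\<in>P. c' q) = (\<Sum>q\<in>P. c q - (if q = p then s else 0))" by (intro sum.cong) (auto simp: c'_def)
      then show ?thesis using P p by (simp add: sum_subtractf)
    qed
    have "G c' \<le> G c + s * measure lborel ?C - w / N * s"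
      using I by (simp add: G_def sm algebra_simps)
    then have "w / N * s - \<eta> \<le> s * measure lborel ?C" using near[of c'] by linarith
    then have "s * (w / (2 * N)) \<le> s * measure lborel ?C" by (simp add: \<eta>_def algebra_simps)
    then show ?thesis by (rule mult_left_le_imp_le[OF _ s])
  qed
  then show ?thesis unfolding N_def by auto
qed

text \<open>The function is the Legendre transform, over the unit ball, of the potential from
  \<open>dual_pot_contact_sets\<close>; hence it is convex and 1-Lipschitz. Since its value at p is
  at most the height of p, every point of the contact set is a subgradient at p up to s. That set is
  too large in volume to fit into a ball of radius r, so two of its points are at least r
  apart.\<close>

lemma discrete_monge_ampere:
  fixes P :: "'a::euclidean_space set" and r s :: real
  assumes P: "finite P" "P \<noteq> {}" and s: "s > 0" and r: "r > 0" "2 * card P * r ^ DIM('a) < 1"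
  shows "\<exists>\<phi>. convex_on UNIV \<phi> \<and> (\<forall>x y. \<bar>\<phi> x - \<phi> y\<bar> \<le> norm (x - y)) \<and>
    (\<forall>p\<in>P. \<exists>y y'. r \<le> norm (y - y') \<and> (\<forall>z. \<phi> p + y \<bullet> (z - p) - s \<le> \<phi> z) \<and> (\<forall>z. \<phi> p + y' \<bullet> (z - p) - s \<le> \<phi> z))"
proof -
  let ?B = "cball (0::'a) 1"
  define w where "w = measure lborel ?B"
  have w: "w > 0" by (simp add: w_def content_cball unit_ball_vol_pos)
  obtain c where c: "\<And>p. p \<in> P \<Longrightarrow> w / (2 * card P) \<le> measure lborel {y \<in> ?B. dual_pot P c y \<le> p \<bullet> y - c p + s}"
    using dual_pot_contact_sets[OF P s] unfolding w_def by blast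
  define \<phi> where "\<phi> x = (SUP y\<in>?B. x \<bullet> y - dual_pot P c y)" for x
  obtain p0 where p0: "p0 \<in> P" using P by blast
  have bdd: "bdd_above ((\<lambda>y. x \<bullet> y - dual_pot P c y) ` ?B)" for x
  proof -
    have "compact ((\<lambda>y. x \<bullet> y - dual_pot P c y) ` ?B)"
      by (intro compact_continuous_image continuous_intros dual_pot_continuous P compact_cball)
    then show ?thesis by (rule compact_imp_bounded[THEN bounded_imp_bdd_above])
  qed
  have ge: "x \<bullet> y - dual_pot P c y \<le> \<phi> x" if "y \<in> ?B" for x y
    unfolding \<phi>_def by (rule cSUP_upper[OF that bdd])
  have le: "\<phi> x \<le> M" if "\<And>y. y \<in> ?B \<Longrightarrow> x \<bullet> y - dual_pot P c y \<le> M" for x M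
    unfolding \<phi>_def by (rule cSUP_least) (use that in auto)
  have conv: "convex_on UNIV \<phi>"
  proof (rule convex_onI)
    fix t :: real and u v :: 'a assume t: "0 < t" "t < 1"
    show "\<phi> ((1 - t) *\<^sub>R u + t *\<^sub>R v) \<le> (1 - t) * \<phi> u + t * \<phi> v"
    proof (rule le)
      fix y assume y: "y \<in> ?B"
      have "(1 - t) * (u \<bullet> y - dual_pot P c y) + t * (v \<bullet> y - dual_pot P c y) \<le> (1 - t) * \<phi> u + t * \<phi> v"
        using t ge[OF y] by (intro add_mono mult_left_mono) auto
      then show "((1 - t) *\<^sub>R u + t *\<^sub>R v) \<bullet> y - dual_pot P c y \<le> (1 - t) * \<phi> u + t * \<phi> v"
        by (simp add: inner_add_left algebra_simps)
    qed
  qed simp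
  have lip1: "\<phi> x \<le> \<phi> x' + norm (x - x')" for x x'
  proof (rule le)
    fix y assume y: "y \<in> ?B"
    have "(x - x') \<bullet> y \<le> norm (x - x') * norm y" by (rule norm_cauchy_schwarz)
    also have "\<dots> \<le> norm (x - x') * 1" using y by (intro mult_left_mono) auto
    finally show "x \<bullet> y - dual_pot P c y \<le> \<phi> x' + norm (x - x')" using ge[OF y, of x'] by (simp add: inner_diff_left)
  qed
  have lip: "\<bar>\<phi> x - \<phi> y\<bar> \<le> norm (x - y)" for x y
    using lip1[of x y] lip1[of y x] by (simp add: norm_minus_commute abs_le_iff)
  have \<phi>p: "\<phi> p \<le> c p" if "p \<in> P" for p
    using dual_pot_ge[OF P(1) that, of _ c] by (intro le) (simp add: algebra_simps)
  have sub: "\<phi> p + y \<bullet> (z - p) - s \<le> \<phi> z" if "p \<in> P" "y \<in> {y \<in> ?B. dual_pot P c y \<le> p \<bullet> y - c p + s}" for p y z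
    using ge[of y z] \<phi>p[OF that(1)] that(2) by (simp add: inner_diff_right inner_commute)
  have "\<exists>y y'. r \<le> norm (y - y') \<and> (\<forall>z. \<phi> p + y \<bullet> (z - p) - s \<le> \<phi> z) \<and> (\<forall>z. \<phi> p + y' \<bullet> (z - p) - s \<le> \<phi> z)"
    if p: "p \<in> P" for p
  proof (rule ccontr)
    assume neg: "\<not> ?thesis"
    let ?C = "{y \<in> ?B. dual_pot P c y \<le> p \<bullet> y - c p + s}"
    have d: "norm (y - y') < r" if "y \<in> ?C" "y' \<in> ?C" for y y'
      using neg sub[OF p that(1)] sub[OF p that(2)] by (meson not_le)
    have "w / (2 * card P) > 0" using w P by (simp add: card_gt_0_iff)
    then have "?C \<noteq> {}" using c[OF p] by (metis measure_empty not_le)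
    then obtain y0 where y0: "y0 \<in> ?C" by blast
    have "?C \<subseteq> cball y0 r"
    proof
      fix y assume "y \<in> ?C"
      from d[OF y0 this] show "y \<in> cball y0 r" by (simp add: dist_norm)
    qed
    moreover have "closed {y. dual_pot P c y \<le> p \<bullet> y - c p + s}"
      by (intro closed_Collect_le dual_pot_continuous P continuous_intros)
    ultimately have "measure lborel ?C \<le> measure lborel (cball y0 r)"
      by (intro measure_mono_fmeasurable fmeasurableI) (auto simp: Collect_conj_eq emeasure_cball r(1)[THEN less_imp_le])
    also have "\<dots> = w * r ^ DIM('a)" using r(1) by (simp add: content_cball w_def)
    finally have "w / (2 * card P) \<le> w * r ^ DIM('a)" using c[OF p] by simp
    then have "1 \<le> 2 * card P * r ^ DIM('a)" using w P by (simp add: field_simps card_gt_0_iff)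
    then show False using r(2) by simp
  qed
  then show ?thesis using conv lip by blast
qed

text \<open>The subgradients lie in the unit ball, and each of the N points of P owns a set of them
  of volume comparable to 1/N, hence of diameter at least of order N^(-1/n). Mollification at unit
  scale converts this spread into a Laplacian of the same order on the balls of radius 1/4. Bounded
  gradient together with this rate is what the volume estimate exploits.\<close>

lemma concentrated_convex_potential:
  "\<exists>c>0. \<forall>P::'a::euclidean_space set. finite P \<longrightarrow> P \<noteq> {} \<longrightarrow>
    (\<exists>\<Phi>. smooth \<Phi> \<and> convex_on UNIV \<Phi> \<and> (\<forall>h x. \<bar>pderiv_dir h \<Phi> x\<bar> \<le> norm h) \<and>
      (\<forall>p\<in>P. \<forall>x\<in>cball p (1/4). c * root DIM('a) (1 / card P) \<le> lap \<Phi> x))"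
proof -
  let ?n = "DIM('a)"
  obtain c C where cC: "c > 0" "C \<ge> 0" and L: "\<And>(\<phi>::'a \<Rightarrow> real) p y y' s x.
     continuous_on UNIV \<phi> \<Longrightarrow> convex_on UNIV \<phi> \<Longrightarrow> (\<forall>z. \<phi> p + y \<bullet> (z - p) - s \<le> \<phi> z) \<Longrightarrow>
     (\<forall>z. \<phi> p + y' \<bullet> (z - p) - s \<le> \<phi> z) \<Longrightarrow> norm (x - p) \<le> 1/4 \<Longrightarrow>
     c * norm (y - y') - C * s \<le> lap (cv \<phi> rho) x"
    using lap_cv_rho_lower[where ?'a='a] by blast
  define m where "m = (LINT z|lborel. rho (z::'a))"
  have rc: "continuous_on UNIV (rho::'a\<Rightarrow>real)" by (rule smooth_continuous[OF smooth_rho])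
  have rint: "integrable lborel (rho::'a\<Rightarrow>real)" by (rule integrable_continuous_bounded_support[OF rc rho_zero])
  have m: "m > 0"
  proof -
    have c0: "1 - step (1/4) > 0" using step_less[of "1/4" 1] step_1[of 1] by simp
    have "0 < (1 - step (1/4)) * measure lborel (cball (0::'a) (1/2))"
      using c0 by (simp add: content_cball unit_ball_vol_pos)
    also have "\<dots> = (LINT z|lborel. (1 - step (1/4)) * indicator (cball (0::'a) (1/2)) z)" by simp
    also have "\<dots> \<le> m" unfolding m_def
    proof (rule integral_mono[OF _ rint])
      show "integrable lborel (\<lambda>z. (1 - step (1/4)) * indicator (cball (0::'a) (1/2)) z)"
        by (intro integrable_mult_right integrable_real_indicator) (auto simp: emeasure_cball)
      show "(1 - step (1/4)) * indicator (cball (0::'a) (1/2)) z \<le> rho z" for z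
        using rho_ge[of z] rho_nonneg[of z] by (cases "z \<in> cball 0 (1/2)") auto
    qed
    finally show ?thesis .
  qed
  have main: "\<exists>\<Phi>. smooth \<Phi> \<and> convex_on UNIV \<Phi> \<and> (\<forall>h x. \<bar>pderiv_dir h \<Phi> x\<bar> \<le> norm h) \<and>
      (\<forall>p\<in>P. \<forall>x\<in>cball p (1/4). (c / (8 * m)) * root ?n (1 / card P) \<le> lap \<Phi> x)"
    if P: "finite P" "P \<noteq> {}" for P :: "'a set"
  proof -
    define q where "q = root ?n (1 / card P)"
    have N: "real (card P) > 0" using P by (simp add: card_gt_0_iff)
    have q: "q > 0" using N by (simp add: q_def)
    have qn: "q ^ ?n = 1 / card P" using N by (simp add: q_def)
    \<comment> \<open>The quarter makes 2 N r^n equal to 2/4^n, which is below 1 in every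
      dimension.\<close>
    define r where "r = q / 4"
    have r: "r > 0" using q by (simp add: r_def)
    have "2 * card P * r ^ ?n = 2 / 4 ^ ?n" using N by (simp add: r_def power_divide qn)
    also have "\<dots> < 1"
    proof -
      have "(4::real) ^ 1 \<le> 4 ^ ?n" by (intro power_increasing) (auto simp: Suc_leI)
      then show ?thesis by (simp add: field_simps)
    qed
    finally have r2: "2 * card P * r ^ ?n < 1" .
    \<comment> \<open>Small enough for the error term C s to absorb at most half of the gain c
      r.\<close>
    define s where "s = c * r / (2 * (C + 1))"
    have s: "s > 0" using cC r by (simp add: s_def)
    have Cs: "C * s \<le> c * r / 2"
    proof -
      have "C * s \<le> (C + 1) * s" using s by simp
      also have "\<dots> = c * r / 2" using cC by (simp add: s_def divide_simps)
      finally show ?thesis .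
    qed
    obtain \<phi> where \<phi>: "convex_on UNIV \<phi>" "\<And>x y. \<bar>\<phi> x - \<phi> y\<bar> \<le> norm (x - y)"
      and sub: "\<And>p. p \<in> P \<Longrightarrow> \<exists>y y'. r \<le> norm (y - y') \<and> (\<forall>z. \<phi> p + y \<bullet> (z - p) - s \<le> \<phi> z) \<and> (\<forall>z. \<phi> p + y' \<bullet> (z - p) - s \<le> \<phi> z)"
      using discrete_monge_ampere[OF P s r r2] by blast
    have \<phi>c: "continuous_on UNIV \<phi>"
    proof -
      have "1-lipschitz_on UNIV \<phi>" by (rule lipschitz_onI) (use \<phi>(2) in \<open>auto simp: dist_norm\<close>)
      then show ?thesis by (rule lipschitz_on_continuous_on)
    qed
    define \<Phi> where "\<Phi> x = (1/m) * cv \<phi> rho x" for x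
    have cs: "smooth (cv \<phi> rho)" by (rule smooth_cv[OF \<phi>c smooth_rho rho_zero])
    have S: "smooth \<Phi>" unfolding \<Phi>_def[abs_def] by (rule smooth_cmult[OF cs])
    have "convex_on UNIV (cv \<phi> rho)" by (rule cv_convex[OF \<phi>c \<phi>(1) rc rho_zero rho_nonneg])
    then have V: "convex_on UNIV \<Phi>" unfolding \<Phi>_def[abs_def] using m by (intro convex_on_cmul) auto
    have lip1: "\<Phi> x \<le> \<Phi> y + norm (x - y)" for x y
    proof -
      note I = cv_integrable(2)[OF \<phi>c rc rho_zero]
      have "cv \<phi> rho x \<le> (LINT z|lborel. \<phi> (y + z) * rho z + norm (x - y) * rho z)"
        unfolding cv_shift[OF \<phi>c rc]
      proof (rule integral_mono)
        fix z
        have "\<phi> (x + z) \<le> \<phi> (y + z) + norm (x - y)" using \<phi>(2)[of "x + z" "y + z"] by simp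
        from mult_right_mono[OF this rho_nonneg[of z]]
        show "\<phi> (x + z) * rho z \<le> \<phi> (y + z) * rho z + norm (x - y) * rho z" by (simp add: algebra_simps)
      qed (auto intro!: Bochner_Integration.integrable_add I integrable_mult_right rint)
      also have "\<dots> = cv \<phi> rho y + norm (x - y) * m"
        unfolding cv_shift[OF \<phi>c rc] m_def using I rint by simp
      finally show ?thesis using m by (simp add: \<Phi>_def field_simps)
    qed
    have lip: "\<bar>\<Phi> x - \<Phi> y\<bar> \<le> norm (x - y)" for x y
      using lip1[of x y] lip1[of y x] by (simp add: norm_minus_commute abs_le_iff)
    have "(c / (8 * m)) * q \<le> lap \<Phi> x" if p: "p \<in> P" and x: "x \<in> cball p (1/4)" for p x
    proof -
      obtain y y' where y: "r \<le> norm (y - y')" "\<forall>z. \<phi> p + y \<bullet> (z - p) - s \<le> \<phi> z" "\<forall>z. \<phi> p + y' \<bullet> (z - p) - s \<le> \<phi> z"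
        using sub[OF p] by blast
      have "c * r / 2 \<le> c * norm (y - y') - C * s"
      proof -
        have "c * r \<le> c * norm (y - y')" by (rule mult_left_mono[OF y(1)]) (use cC in simp)
        then show ?thesis using Cs by linarith
      qed
      also have "\<dots> \<le> lap (cv \<phi> rho) x"
        using x by (intro L[OF \<phi>c \<phi>(1) y(2,3)]) (simp add: dist_norm norm_minus_commute)
      finally have "c * r / 2 \<le> lap (cv \<phi> rho) x" .
      moreover have "lap \<Phi> x = (1/m) * lap (cv \<phi> rho) x"
        unfolding \<Phi>_def[abs_def] by (rule lap_cmult[OF cs])
      ultimately show ?thesis using m by (simp add: r_def field_simps)
    qed
    then show ?thesis using S V smooth_lipschitz_pderiv[OF S lip] unfolding q_def by blast
  qed
  have "c / (8 * m) > 0" using cC m by simp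
  then show ?thesis using main by (intro exI[of _ "c / (8 * m)"]) blast
qed

subsection \<open>Linear images of Lebesgue measure\<close>

lemma nn_integral_lborel_shift:
  fixes f :: "'a::euclidean_space \<Rightarrow> ennreal"
  assumes "f \<in> borel_measurable borel"
  shows "(\<integral>\<^sup>+x. f (a + x) \<partial>lborel) = (\<integral>\<^sup>+x. f x \<partial>lborel)"
proof -
  have "(\<integral>\<^sup>+x. f x \<partial>lborel) = (\<integral>\<^sup>+x. f x \<partial>distr lborel borel ((+) a))"
    by (simp add: lborel_distr_plus)
  also have "\<dots> = (\<integral>\<^sup>+x. f (a + x) \<partial>lborel)"
    using assms by (intro nn_integral_distr) auto
  finally show ?thesis by simp
qed

text \<open>Uniqueness of translation-invariant measures: for \<open>\<mu>\<close> the pull-back of Lebesgue measure by \<open>f\<close>,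
  Tonelli's theorem gives \<open>\<lambda>(A) \<mu>(B) = \<mu>(-A) \<lambda>(B)\<close>.\<close>

lemma linear_lborel_swap:
  fixes f :: "'a::euclidean_space \<Rightarrow> 'a"
  assumes f: "linear f" and gf: "\<And>x. f (g x) = x" and A: "A \<in> sets borel" and B: "B \<in> sets borel"
  shows "emeasure lborel A * emeasure lborel {y. f y \<in> B} = emeasure lborel {y. - f y \<in> A} * emeasure lborel B"
proof -
  have [measurable]: "f \<in> borel_measurable borel"
    using linear_continuous_on[OF f[unfolded linear_conv_bounded_linear]] by (rule borel_measurable_continuous_onI)
  note [measurable] = A B
  have add: "f (x + y) = f x + f y" for x y
    using f by (simp add: linear_add)
  have "emeasure lborel A * emeasure lborel {y. f y \<in> B} = (\<integral>\<^sup>+x. indicator A x * (\<integral>\<^sup>+y. indicator B (f y) \<partial>lborel) \<partial>lborel)"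
  proof -
    have "emeasure lborel {y. f y \<in> B} = (\<integral>\<^sup>+y. indicator {y. f y \<in> B} y \<partial>lborel)"
      by (intro nn_integral_indicator[symmetric]) measurable
    also have "\<dots> = (\<integral>\<^sup>+y. indicator B (f y) \<partial>lborel)" by (intro nn_integral_cong) (auto simp: indicator_def)
    finally show ?thesis by (simp add: nn_integral_multc)
  qed
  also have "\<dots> = (\<integral>\<^sup>+x. (\<integral>\<^sup>+y. indicator A x * indicator B (x + f y) \<partial>lborel) \<partial>lborel)"
  proof (rule nn_integral_cong)
    fix x
    have "(\<integral>\<^sup>+y. indicator B (f (g x + y)) \<partial>lborel) = (\<integral>\<^sup>+y. (indicator B (f y) :: ennreal) \<partial>lborel)"
      by (rule nn_integral_lborel_shift) measurable
    then show "indicator A x * (\<integral>\<^sup>+y. indicator B (f y) \<partial>lborel) = (\<integral>\<^sup>+y. indicator A x * indicator B (x + f y) \<partial>lborel)"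
      by (simp add: add gf nn_integral_cmult)
  qed
  also have "\<dots> = (\<integral>\<^sup>+y. (\<integral>\<^sup>+x. indicator A x * indicator B (x + f y) \<partial>lborel) \<partial>lborel)"
    by (rule lborel_pair.Fubini'[symmetric]) measurable
  also have "\<dots> = (\<integral>\<^sup>+y. (\<integral>\<^sup>+x. indicator A (- f y + x) * indicator B x \<partial>lborel) \<partial>lborel)"
  proof (rule nn_integral_cong)
    fix y
    have "(\<integral>\<^sup>+x. indicator A (- f y + (f y + x)) * indicator B (f y + x) \<partial>lborel) = (\<integral>\<^sup>+x. (indicator A (- f y + x) * indicator B x :: ennreal) \<partial>lborel)"
      by (rule nn_integral_lborel_shift[of "\<lambda>x. indicator A (- f y + x) * indicator B x"]) measurable
    then show "(\<integral>\<^sup>+x. indicator A x * indicator B (x + f y) \<partial>lborel) = (\<integral>\<^sup>+x. (indicator A (- f y + x) * indicator B x :: ennreal) \<partial>lborel)"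
      by (simp add: add.commute)
  qed
  also have "\<dots> = (\<integral>\<^sup>+x. (\<integral>\<^sup>+y. indicator A (- f y + x) * indicator B x \<partial>lborel) \<partial>lborel)"
    by (rule lborel_pair.Fubini') measurable
  also have "\<dots> = (\<integral>\<^sup>+x. (\<integral>\<^sup>+y. indicator A (- f y) \<partial>lborel) * indicator B x \<partial>lborel)"
  proof (rule nn_integral_cong)
    fix x
    have "(\<integral>\<^sup>+y. indicator A (- f (g x + y) + x) \<partial>lborel) = (\<integral>\<^sup>+y. (indicator A (- f y + x) :: ennreal) \<partial>lborel)"
      by (rule nn_integral_lborel_shift[of "\<lambda>y. indicator A (- f y + x)"]) measurable
    then show "(\<integral>\<^sup>+y. indicator A (- f y + x) * indicator B x \<partial>lborel) = (\<integral>\<^sup>+y. indicator A (- f y) \<partial>lborel) * (indicator B x :: ennreal)"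
      by (simp add: add gf nn_integral_multc)
  qed
  also have "\<dots> = emeasure lborel {y. - f y \<in> A} * emeasure lborel B"
  proof -
    have "emeasure lborel {y. - f y \<in> A} = (\<integral>\<^sup>+y. indicator {y. - f y \<in> A} y \<partial>lborel)"
      by (intro nn_integral_indicator[symmetric]) measurable
    also have "\<dots> = (\<integral>\<^sup>+y. indicator A (- f y) \<partial>lborel)" by (intro nn_integral_cong) (auto simp: indicator_def)
    finally show ?thesis by (simp add: nn_integral_cmult)
  qed
  finally show ?thesis .
qed

text \<open>For a bijective linear map this is the reciprocal of the absolute value of its
  determinant, expressed through volumes of preimages.\<close>

definition vfac :: "('a::euclidean_space \<Rightarrow> 'a) \<Rightarrow> real" where
  "vfac f = measure lborel {y. f y \<in> cball 0 1} / measure lborel (cball (0::'a) 1)"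

lemma linear_borel_measurable: "linear f \<Longrightarrow> f \<in> borel_measurable borel"
  for f :: "'a::euclidean_space \<Rightarrow> 'b::euclidean_space"
  using linear_continuous_on[of f] by (auto simp: linear_conv_bounded_linear intro: borel_measurable_continuous_onI)

lemma linear_vimage_borel:
  fixes f :: "'a::euclidean_space \<Rightarrow> 'b::euclidean_space"
  assumes "linear f" "B \<in> sets borel" shows "{y. f y \<in> B} \<in> sets borel"
  using measurable_sets[OF linear_borel_measurable[OF assms(1)] assms(2)] by (simp add: vimage_def)

lemma linear_bij_lower_bound:
  fixes f :: "'a::euclidean_space \<Rightarrow> 'a"
  assumes "linear f" "inj f"
  shows "\<exists>k>0. \<forall>x. k * norm x \<le> norm (f x)"
  using linear_inj_bounded_below_pos[OF assms] by metis

text \<open>In \<open>linear_lborel_swap\<close> take A to be the unit ball, which is symmetric, so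
  that the sign in front of \<open>f\<close> disappears. The lower bound on \<open>f\<close> makes
  the preimage of the ball bounded, so the factors are finite and the volume of the ball can be
  cancelled.\<close>

lemma vfac_emeasure:
  fixes f :: "'a::euclidean_space \<Rightarrow> 'a"
  assumes f: "linear f" "inj f" and B: "B \<in> sets borel"
  shows "emeasure lborel {y. f y \<in> B} = ennreal (vfac f) * emeasure lborel B"
proof -
  let ?A = "cball (0::'a) 1"
  obtain k where k: "k > 0" "\<And>x. k * norm x \<le> norm (f x)" using linear_bij_lower_bound[OF f] by blast
  have "{y. f y \<in> ?A} \<subseteq> cball 0 (1/k)"
  proof
    fix y assume "y \<in> {y. f y \<in> ?A}"
    then have "k * norm y \<le> 1" using k(2)[of y] by simp
    then show "y \<in> cball 0 (1/k)" using k(1) by (simp add: field_simps)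
  qed
  then have fin: "emeasure lborel {y. f y \<in> ?A} < \<infinity>"
    using emeasure_mono[of "{y. f y \<in> ?A}" "cball 0 (1/k)" lborel] emeasure_lborel_cball_finite[of "0::'a" "1/k"]
    by (auto simp: le_less_trans)
  have w: "measure lborel ?A > 0" by (simp add: content_cball unit_ball_vol_pos)
  obtain g where g: "\<And>x. f (g x) = x"
    using linear_injective_imp_surjective[OF f] by (metis surjD)
  have "emeasure lborel ?A * emeasure lborel {y. f y \<in> B} = emeasure lborel {y. f y \<in> ?A} * emeasure lborel B"
    using linear_lborel_swap[OF f(1) g, of ?A B] B by simp
  moreover have "emeasure lborel ?A = ennreal (measure lborel ?A)"
    by (intro emeasure_eq_ennreal_measure) (simp add: emeasure_cball)
  moreover have "emeasure lborel {y. f y \<in> ?A} = ennreal (measure lborel ?A) * ennreal (vfac f)"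
  proof -
    have "emeasure lborel {y. f y \<in> ?A} = ennreal (measure lborel {y. f y \<in> ?A})"
      using fin by (intro emeasure_eq_ennreal_measure) auto
    also have "measure lborel {y. f y \<in> ?A} = measure lborel ?A * vfac f" using w by (simp add: vfac_def)
    finally show ?thesis using w by (simp add: ennreal_mult')
  qed
  ultimately have "ennreal (measure lborel ?A) * emeasure lborel {y. f y \<in> B} = ennreal (measure lborel ?A) * (ennreal (vfac f) * emeasure lborel B)"
    by (simp only: mult.assoc)
  then show ?thesis using w by (simp add: ennreal_mult_cancel_left)
qed

lemma vfac_pos:
  fixes f :: "'a::euclidean_space \<Rightarrow> 'a"
  assumes f: "linear f" "inj f"
  shows "0 < vfac f"
proof -
  have "emeasure lborel {y. f y \<in> (UNIV :: 'a set)} = ennreal (vfac f) * emeasure lborel (UNIV :: 'a set)"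
    by (rule vfac_emeasure[OF f]) simp
  then have "vfac f \<noteq> 0" by auto
  then show ?thesis by (simp add: vfac_def less_le)
qed

lemma vfac_measure:
  fixes f :: "'a::euclidean_space \<Rightarrow> 'a"
  assumes f: "linear f" "inj f" and B: "B \<in> sets borel"
  shows "measure lborel {y. f y \<in> B} = vfac f * measure lborel B"
  using vfac_emeasure[OF assms] vfac_pos[OF f] by (simp add: measure_def enn2real_mult)

lemma vfac_compose:
  fixes f g :: "'a::euclidean_space \<Rightarrow> 'a"
  assumes f: "linear f" "inj f" and g: "linear g" "inj g"
  shows "vfac (\<lambda>x. f (g x)) = vfac f * vfac g"
proof -
  have "measure lborel {y. g y \<in> {y. f y \<in> cball 0 1}} = vfac g * measure lborel {y. f y \<in> cball 0 1}"
    by (intro vfac_measure[OF g] linear_vimage_borel[OF f(1)]) simp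
  then show ?thesis by (simp add: vfac_def)
qed

lemma vfac_le:
  fixes f :: "'a::euclidean_space \<Rightarrow> 'a"
  assumes f: "linear f" and k: "k > 0" "\<And>x. k * norm x \<le> norm (f x)"
  shows "vfac f \<le> 1 / k ^ DIM('a)"
proof -
  have w: "measure lborel (cball (0::'a) 1) > 0" by (simp add: content_cball unit_ball_vol_pos)
  have "{y. f y \<in> cball 0 1} \<subseteq> cball 0 (1/k)"
  proof
    fix y assume "y \<in> {y. f y \<in> cball 0 1}"
    then have "k * norm y \<le> 1" using k(2)[of y] by simp
    then show "y \<in> cball 0 (1/k)" using k(1) by (simp add: field_simps)
  qed
  then have "measure lborel {y. f y \<in> cball 0 1} \<le> measure lborel (cball (0::'a) (1/k))"
  proof (rule measure_mono_fmeasurable)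
    show "{y. f y \<in> cball 0 1} \<in> sets lborel" using linear_vimage_borel[OF f, of "cball 0 1"] by simp
    show "cball (0::'a) (1/k) \<in> fmeasurable lborel" using k(1) by (intro fmeasurableI) (simp_all add: emeasure_cball)
  qed
  also have "\<dots> = (1 / k ^ DIM('a)) * measure lborel (cball (0::'a) 1)"
    using k(1) by (simp add: content_cball power_one_over)
  finally show ?thesis using w by (simp add: vfac_def field_simps)
qed

definition unit_cube :: "'a::euclidean_space set" where "unit_cube = cbox (- One) One"

lemma measure_unit_cube: "measure lborel (unit_cube :: 'a::euclidean_space set) = 2 ^ DIM('a)"
  by (simp add: unit_cube_def content_cbox_if box_ne_empty inner_diff_left)

lemma mem_unit_cube: "x \<in> unit_cube \<longleftrightarrow> (\<forall>b\<in>Basis. \<bar>x \<bullet> b\<bar> \<le> 1)"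
  by (auto simp: unit_cube_def mem_box abs_le_iff)

lemma vfac_ge_1:
  fixes f :: "'a::euclidean_space \<Rightarrow> 'a"
  assumes f: "linear f" "inj f" and "\<And>x. x \<in> unit_cube \<Longrightarrow> f x \<in> unit_cube"
  shows "1 \<le> vfac f"
proof -
  have "emeasure lborel (unit_cube :: 'a set) \<le> emeasure lborel {y. f y \<in> (unit_cube :: 'a set)}"
    using assms(3) linear_vimage_borel[OF f(1), of unit_cube] by (intro emeasure_mono) (auto simp: unit_cube_def)
  also have "\<dots> = ennreal (vfac f) * emeasure lborel (unit_cube :: 'a set)"
    by (rule vfac_emeasure[OF f]) (simp add: unit_cube_def)
  also have "emeasure lborel (unit_cube :: 'a set) = ennreal (2 ^ DIM('a))"
    using measure_unit_cube[where ?'a='a] by (metis emeasure_eq_ennreal_measure emeasure_lborel_cbox_finite less_irrefl unit_cube_def infinity_ennreal_def)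
  finally show ?thesis using vfac_pos[OF f] by (simp flip: ennreal_mult)
qed

lemma vfac_diagonal:
  fixes e :: "'a::euclidean_space \<Rightarrow> real"
  assumes e: "\<And>b. b \<in> Basis \<Longrightarrow> 0 < e b"
  defines "f \<equiv> \<lambda>x::'a. \<Sum>b\<in>Basis. (e b * (x \<bullet> b)) *\<^sub>R b"
  shows "linear f" "inj f" "vfac f = 1 / (\<Prod>b\<in>Basis. e b)"
proof -
  have fb: "f x \<bullet> b = e b * (x \<bullet> b)" if "b \<in> Basis" for x b
    using that by (simp add: f_def inner_sum_left inner_Basis if_distrib cong: if_cong)
  show l: "linear f"
    by (rule linearI) (simp_all add: f_def algebra_simps sum.distrib scaleR_sum_right)
  show i: "inj f"
  proof (rule injI)
    fix x y assume "f x = f y"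
    then have "e b * (x \<bullet> b) = e b * (y \<bullet> b)" if "b \<in> Basis" for b using fb[OF that, of x] fb[OF that, of y] by presburger
    then have "x \<bullet> b = y \<bullet> b" if "b \<in> Basis" for b using that e[OF that] by force
    then show "x = y" by (rule euclidean_eqI)
  qed
  define c where "c = (\<Sum>b\<in>Basis. (1 / e b) *\<^sub>R b)"
  have cb: "c \<bullet> b = 1 / e b" if "b \<in> Basis" for b
    using that by (simp add: c_def inner_sum_left inner_Basis if_distrib cong: if_cong)
  have "{y. f y \<in> unit_cube} = cbox (- c) c"
  proof -
    have "\<bar>f y \<bullet> b\<bar> \<le> 1 \<longleftrightarrow> - c \<bullet> b \<le> y \<bullet> b \<and> y \<bullet> b \<le> c \<bullet> b" if b: "b \<in> Basis" for y b
      unfolding fb[OF b] inner_minus_left cb[OF b] using e[OF b] by (auto simp: abs_le_iff field_simps)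
    then show ?thesis unfolding set_eq_iff mem_Collect_eq mem_unit_cube mem_box by blast
  qed
  moreover have "measure lborel (cbox (- c) c) = (\<Prod>b\<in>Basis. 2 / e b)"
  proof -
    have p: "0 < c \<bullet> b" if "b \<in> Basis" for b using e[OF that] by (simp add: cb[OF that])
    have "\<forall>b\<in>Basis. - c \<bullet> b \<le> c \<bullet> b"
    proof
      fix b :: 'a assume "b \<in> Basis"
      from p[OF this] show "- c \<bullet> b \<le> c \<bullet> b" by simp
    qed
    moreover have "(\<Prod>b\<in>Basis. (c - - c) \<bullet> b) = (\<Prod>b\<in>Basis. 2 / e b)"
      by (rule prod.cong) (simp_all add: inner_add_left cb)
    ultimately show ?thesis by (simp add: measure_lborel_cbox_eq)
  qed
  ultimately have "(\<Prod>b\<in>Basis. 2 / e b) = vfac f * 2 ^ DIM('a)"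
    using vfac_measure[OF l i, of unit_cube] measure_unit_cube[where ?'a='a] by (simp add: unit_cube_def)
  then show "vfac f = 1 / (\<Prod>b\<in>Basis. e b)"
    by (simp add: prod_dividef) (metis mult_cancel_right nonzero_mult_div_cancel_right power_not_zero zero_neq_numeral divide_inverse inverse_eq_divide mult.commute)
qed

subsection \<open>Grid cubes of high density\<close>

text \<open>The lower corner of the grid cell of side \<open>h\<close> that contains
  \<open>x\<close>; the half-open cells of the grid are the fibres of this map.\<close>

definition corner :: "real \<Rightarrow> 'a::euclidean_space \<Rightarrow> 'a" where
  "corner h x = (\<Sum>b\<in>Basis. (h * of_int \<lfloor>x \<bullet> b / h\<rfloor>) *\<^sub>R b)"

lemma corner_inner: "b \<in> Basis \<Longrightarrow> corner h x \<bullet> b = h * of_int \<lfloor>x \<bullet> b / h\<rfloor>"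
  by (simp add: corner_def inner_sum_left inner_Basis if_distrib cong: if_cong)

lemma corner_inner_bounds:
  assumes "h > 0" "b \<in> Basis"
  shows "corner h x \<bullet> b \<le> x \<bullet> b" "x \<bullet> b < corner h x \<bullet> b + h"
proof -
  have "of_int \<lfloor>x \<bullet> b / h\<rfloor> \<le> x \<bullet> b / h" "x \<bullet> b / h < of_int \<lfloor>x \<bullet> b / h\<rfloor> + 1" by linarith+
  then show "corner h x \<bullet> b \<le> x \<bullet> b" "x \<bullet> b < corner h x \<bullet> b + h"
    using assms mult_left_mono[of "of_int \<lfloor>x \<bullet> b / h\<rfloor>" "x \<bullet> b / h" h] mult_strict_left_mono[of "x \<bullet> b / h" "of_int \<lfloor>x \<bullet> b / h\<rfloor> + 1" h]
    by (simp_all add: corner_inner distrib_left)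
qed

lemma dist_corner:
  fixes x :: "'a::euclidean_space" and h :: real
  assumes "h > 0" shows "norm (x - corner h x) \<le> DIM('a) * h"
proof -
  have "norm (x - corner h x) \<le> (\<Sum>b\<in>Basis. \<bar>(x - corner h x) \<bullet> b\<bar>)" by (rule norm_le_l1)
  also have "\<dots> \<le> (\<Sum>b\<in>(Basis::'a set). h)"
  proof (rule sum_mono)
    fix b :: 'a assume "b \<in> Basis"
    from corner_inner_bounds[OF assms this, of x] show "\<bar>(x - corner h x) \<bullet> b\<bar> \<le> h"
      by (simp add: inner_diff_left abs_le_iff)
  qed
  finally show ?thesis by simp
qed

lemma corner_measurable [measurable]: "corner h \<in> borel_measurable borel"
  unfolding corner_def[abs_def] by measurable

lemma emeasure_grid_cell:
  fixes x :: "'a::euclidean_space"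
  assumes "h > 0"
  shows "measure lborel {y. corner h y = corner h x} = h ^ DIM('a)" "{y. corner h y = corner h x} \<in> fmeasurable lborel"
proof -
  let ?Q = "{y. corner h y = corner h x}"
  have s: "?Q \<subseteq> cbox (corner h x) (corner h x + h *\<^sub>R One)"
  proof
    fix y assume "y \<in> ?Q"
    then have e: "corner h x = corner h y" by simp
    show "y \<in> cbox (corner h x) (corner h x + h *\<^sub>R One)"
      unfolding e using corner_inner_bounds[OF assms, of _ y] by (auto simp: mem_box inner_add_left less_imp_le)
  qed
  have m: "?Q \<in> sets borel" by measurable
  show fm: "?Q \<in> fmeasurable lborel"
    by (rule fmeasurableI2[OF fmeasurable_cbox s]) (simp add: m)
  have "measure lborel ?Q \<le> measure lborel (cbox (corner h x) (corner h x + h *\<^sub>R One))"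
    by (rule measure_mono_fmeasurable[OF s _ fmeasurable_cbox]) (simp add: m)
  also have "\<dots> = h ^ DIM('a)"
    using assms by (simp add: content_cbox_if box_ne_empty inner_add_left)
  finally have le: "measure lborel ?Q \<le> h ^ DIM('a)" .
  have "box (corner h x) (corner h x + h *\<^sub>R One) \<subseteq> ?Q"
  proof
    fix y assume y: "y \<in> box (corner h x) (corner h x + h *\<^sub>R One)"
    have "\<lfloor>y \<bullet> b / h\<rfloor> = \<lfloor>x \<bullet> b / h\<rfloor>" if b: "b \<in> Basis" for b
    proof (rule floor_unique)
      have "corner h x \<bullet> b < y \<bullet> b" "y \<bullet> b < corner h x \<bullet> b + h"
        using y b by (auto simp: mem_box inner_add_left)
      then show "of_int \<lfloor>x \<bullet> b / h\<rfloor> \<le> y \<bullet> b / h" "y \<bullet> b / h < of_int \<lfloor>x \<bullet> b / h\<rfloor> + 1"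
        using assms b by (simp_all add: corner_inner field_simps)
    qed
    then show "y \<in> ?Q" by (simp add: corner_def)
  qed
  then have "measure lborel (box (corner h x) (corner h x + h *\<^sub>R One)) \<le> measure lborel ?Q"
    by (rule measure_mono_fmeasurable[OF _ _ fm]) simp
  moreover have "measure lborel (box (corner h x) (corner h x + h *\<^sub>R One)) = h ^ DIM('a)"
    using assms by (simp add: inner_add_left)
  ultimately show "measure lborel ?Q = h ^ DIM('a)" using le by simp
qed

lemma finite_corners: 
  fixes U :: "'a::euclidean_space set"
  assumes "bounded U" "h > 0" shows "finite (corner h ` U)"
proof -
  obtain R where R: "\<And>x. x \<in> U \<Longrightarrow> norm x \<le> R" using assms(1) bounded_iff by blast
  define F where "F = (\<lambda>k::'a \<Rightarrow> int. \<Sum>b\<in>Basis. (h * of_int (k b)) *\<^sub>R b)"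
  have "corner h x \<in> F ` (PiE Basis (\<lambda>_. {\<lfloor>- R / h\<rfloor>..\<lfloor>R / h\<rfloor>}))" if "x \<in> U" for x
  proof
    show "corner h x = F (restrict (\<lambda>b. \<lfloor>x \<bullet> b / h\<rfloor>) Basis)" by (simp add: F_def corner_def)
    have "x \<bullet> b \<le> R" "- R \<le> x \<bullet> b" if "b \<in> Basis" for b using Basis_le_norm[OF that, of x] R[OF \<open>x \<in> U\<close>] by auto
    then show "restrict (\<lambda>b. \<lfloor>x \<bullet> b / h\<rfloor>) Basis \<in> PiE Basis (\<lambda>_. {\<lfloor>- R / h\<rfloor>..\<lfloor>R / h\<rfloor>})"
      using assms(2) by (auto intro!: floor_mono simp: pos_divide_le_eq pos_le_divide_eq simp flip: minus_divide_left)
  qed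
  then have "corner h ` U \<subseteq> F ` (PiE Basis (\<lambda>_. {\<lfloor>- R / h\<rfloor>..\<lfloor>R / h\<rfloor>}))" by blast
  then show ?thesis by (rule finite_subset) (intro finite_imageI finite_PiE finite_Basis finite_atLeastAtMost_int)
qed

text \<open>Outer regularity gives an open U around S with |U| < (5/4) |S|. For a fine grid the
  cells inside U still cover 7/8 of S. A cell outside G contains at most half a cell of S, so the
  cells contribute at most |U|/2 plus half a cell volume for each member of G. Thus 7/8 - 5/8 = 1/4
  of |S| is bounded by half the total volume of the cells in G.\<close>

lemma grid_density:
  fixes S :: "'a::euclidean_space set"
  assumes S: "bounded S" "S \<in> sets borel" and pos: "measure lborel S > 0"
  shows "\<exists>h::real. h > 0 \<and> (\<exists>G. finite G \<and> G \<noteq> {} \<and> measure lborel S / 2 \<le> card G * h ^ DIM('a) \<and>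
     (\<forall>p\<in>G. h ^ DIM('a) / 2 \<le> measure lborel (S \<inter> {x. corner h x = p})))"
proof -
  let ?n = "DIM('a)" and ?m = "measure lborel :: 'a set \<Rightarrow> real"
  have Sfm: "S \<in> fmeasurable lborel" using S by (auto intro: fmeasurableI emeasure_bounded_finite)
  obtain r where r: "\<And>x. x \<in> S \<Longrightarrow> norm x < r" using S(1) bounded_pos_less by blast
  have "?m S / 4 > 0" using pos by simp
  from outer_regular_lborel[OF S(2) this] obtain U0 where U0: "open U0" "S \<subseteq> U0" "emeasure lborel (U0 - S) < ennreal (?m S / 4)" by blast
  define U where "U = U0 \<inter> ball 0 r"
  have U: "open U" "S \<subseteq> U" "bounded U" using U0 r by (auto simp: U_def intro: bounded_subset[OF bounded_ball])
  have Ufm: "U \<in> fmeasurable lborel" using U by (auto intro: fmeasurableI emeasure_bounded_finite)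
  have "emeasure lborel (U - S) \<le> emeasure lborel (U0 - S)" using U0 S by (intro emeasure_mono) (auto simp: U_def)
  with U0 have "emeasure lborel (U - S) < ennreal (?m S / 4)" by simp
  then have "?m (U - S) < ?m S / 4"
    using fmeasurable.Diff[OF Ufm Sfm] by (simp add: emeasure_eq_measure2 ennreal_less_iff)
  moreover have "?m (U - S) = ?m U - ?m S" using U(2) Ufm Sfm by (intro measurable_measure_Diff) auto
  ultimately have mU: "?m U < 5/4 * ?m S" by simp
  have "U \<noteq> UNIV" using U(3) not_bounded_UNIV[where ?'a='a] by metis
  then have neU: "- U \<noteq> {}" by auto
  \<comment> \<open>The points of S so far from the complement of U that every grid cell of side
    1/(k + 1) meeting them is contained in U. These sets increase to S, so some k already captures
    7/8 of its measure.\<close>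
  define T where "T k = S \<inter> {x. 2 * ?n / real (Suc k) < infdist x (- U)}" for k
  have Tm: "T k \<in> sets lborel" for k
  proof -
    have "open {x. 2 * ?n / real (Suc k) < infdist x (- U)}" by (intro open_Collect_less continuous_intros)
    then show ?thesis using S by (auto simp: T_def)
  qed
  have "incseq T"
  proof (rule incseq_SucI, rule subsetI)
    fix k x assume "x \<in> T k"
    moreover have "2 * ?n / real (Suc (Suc k)) \<le> 2 * ?n / real (Suc k)" by (intro divide_left_mono) auto
    ultimately show "x \<in> T (Suc k)" by (auto simp: T_def)
  qed
  moreover have UT: "(\<Union>k. T k) = S"
  proof (intro equalityI subsetI)
    fix x assume x: "x \<in> S"
    have "infdist x (- U) > 0"
      using in_closed_iff_infdist_zero[of "- U" x] U x neU infdist_nonneg[of x "- U"] by (auto simp: less_le)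
    then obtain k where "2 * ?n / infdist x (- U) < real k" using reals_Archimedean2 by blast
    then have "2 * ?n / real (Suc k) < infdist x (- U)" using \<open>infdist x (- U) > 0\<close> by (simp add: field_simps)
    then show "x \<in> (\<Union>k. T k)" using x by (auto simp: T_def)
  qed (auto simp: T_def)
  ultimately have "(\<lambda>k. ?m (T k)) \<longlonglongrightarrow> ?m (\<Union>k. T k)"
    using Tm Sfm by (intro Lim_measure_incseq) (auto simp: emeasure_eq_measure2)
  then have "eventually (\<lambda>k. 7/8 * ?m S < ?m (T k)) sequentially"
    unfolding UT using pos by (intro order_tendstoD(1)) auto
  then obtain k where k: "7/8 * ?m S < ?m (T k)" using eventually_happens by force
  define h where "h = 1 / real (Suc k)"
  have h: "h > 0" by (simp add: h_def)
  define Q where "Q p = {x::'a. corner h x = p}" for p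
  define L where "L = {p \<in> corner h ` U. Q p \<subseteq> U}"
  define G where "G = {p \<in> L. h ^ ?n / 2 \<le> ?m (S \<inter> Q p)}"
  have finL: "finite L" unfolding L_def using finite_corners[OF U(3) h] by simp
  then have finG: "finite G" by (simp add: G_def)
  have Qfm: "Q p \<in> fmeasurable lborel" "?m (Q p) = h ^ ?n" if "p \<in> L" for p
    using that emeasure_grid_cell[OF h] by (auto simp: L_def Q_def)
  have SQ: "S \<inter> Q p \<in> fmeasurable lborel" if "p \<in> L" for p using Qfm[OF that] Sfm by auto
  have "T k \<subseteq> (\<Union>p\<in>L. S \<inter> Q p)"
  proof
    fix x assume x: "x \<in> T k"
    have "Q (corner h x) \<subseteq> U"
    proof
      fix y assume "y \<in> Q (corner h x)"
      then have c: "corner h y = corner h x" by (simp add: Q_def)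
      show "y \<in> U"
      proof (rule ccontr)
        assume "y \<notin> U"
        then have "infdist x (- U) \<le> dist x y" by (intro infdist_le) auto
        also have "\<dots> \<le> norm (x - corner h x) + norm (y - corner h y)"
          using norm_triangle_ineq4[of "x - corner h x" "y - corner h y"] by (simp add: dist_norm c)
        also have "\<dots> \<le> ?n * h + ?n * h" by (intro add_mono dist_corner h)
        finally show False using x by (simp add: T_def h_def)
      qed
    qed
    then show "x \<in> (\<Union>p\<in>L. S \<inter> Q p)" using x U(2) by (auto simp: T_def L_def Q_def)
  qed
  then have "?m (T k) \<le> ?m (\<Union>p\<in>L. S \<inter> Q p)"
    using Tm[of k] SQ finL by (intro measure_mono_fmeasurable fmeasurable.finite_UN) auto
  also have "\<dots> \<le> (\<Sum>p\<in>L. ?m (S \<inter> Q p))"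
    using fmeasurableD[OF SQ] by (intro measure_UNION_le finL) auto
  also have "\<dots> \<le> (\<Sum>p\<in>L. h ^ ?n / 2 + (if p \<in> G then h ^ ?n / 2 else 0))"
  proof (rule sum_mono)
    fix p assume p: "p \<in> L"
    have "?m (S \<inter> Q p) \<le> ?m (Q p)" using SQ[OF p] Qfm[OF p] by (intro measure_mono_fmeasurable) auto
    then show "?m (S \<inter> Q p) \<le> h ^ ?n / 2 + (if p \<in> G then h ^ ?n / 2 else 0)"
      using p Qfm[OF p] by (auto simp: G_def)
  qed
  also have "\<dots> = card L * h ^ ?n / 2 + card G * h ^ ?n / 2"
  proof -
    have "(\<Sum>p\<in>L. if p \<in> G then h ^ ?n / 2 else 0) = (\<Sum>p\<in>G. h ^ ?n / 2)"
      using finL by (intro sum.mono_neutral_cong_right) (auto simp: G_def)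
    then show ?thesis by (simp add: sum.distrib)
  qed
  also have "card L * h ^ ?n \<le> ?m U"
  proof -
    have "card L * h ^ ?n = (\<Sum>p\<in>L. ?m (Q p))" using Qfm by simp
    also have "\<dots> = ?m (\<Union>p\<in>L. Q p)"
      using Qfm finL by (intro measure_finite_Union[symmetric]) (auto simp: disjoint_family_on_def Q_def emeasure_eq_measure2)
    also have "\<dots> \<le> ?m U"
    proof (rule measure_mono_fmeasurable[OF _ _ Ufm])
      show "(\<Union>p\<in>L. Q p) \<in> sets lborel" using fmeasurableD[OF Qfm(1)] finL by (intro sets.finite_UN) auto
    qed (auto simp: L_def)
    finally show ?thesis .
  qed
  finally have main: "?m S / 2 \<le> card G * h ^ ?n" using k mU by simp
  then have "G \<noteq> {}" using pos by auto
  then show ?thesis using h finG main by (intro exI[of _ h] conjI exI[of _ G]) (auto simp: G_def Q_def)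
qed

subsection \<open>Nondegenerate curves\<close>

text \<open>The Gram-Schmidt process for the inner product \<open>B\<close>, with the span recorded
  at each stage so that the resulting vectors generate the whole space.\<close>

lemma bilinear_orthonormal_basis:
  fixes B :: "'a::euclidean_space \<Rightarrow> 'a \<Rightarrow> real"
  assumes lin: "\<And>x. linear (B x)" and sym: "\<And>x y. B x y = B y x" and pos: "\<And>x. x \<noteq> 0 \<Longrightarrow> 0 < B x x"
  shows "\<exists>y::'a \<Rightarrow> 'a. (\<forall>b\<in>Basis. \<forall>b'\<in>Basis. B (y b) (y b') = (if b = b' then 1 else 0)) \<and> span (y ` Basis) = UNIV"
proof -
  have "\<exists>y::'a \<Rightarrow> 'a. (\<forall>b\<in>S. \<forall>b'\<in>S. B (y b) (y b') = (if b = b' then 1 else 0)) \<and> span (y ` S) = span S"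
    if "S \<subseteq> Basis" for S :: "'a set"
    using finite_subset[OF that finite_Basis] that
  proof (induction S rule: finite_induct)
    case (insert b0 S)
    then obtain y where y: "\<forall>b\<in>S. \<forall>b'\<in>S. B (y b) (y b') = (if b = b' then 1 else 0)" "span (y ` S) = span S" by auto
    have ndep: "b0 \<notin> span S"
      using independent_Basis insert by (metis dependent_def Diff_insert_absorb independent_mono insertCI insert_subset)
    define p where "p = (\<Sum>b\<in>S. B b0 (y b) *\<^sub>R y b)"
    have pS: "p \<in> span S" unfolding p_def y(2)[symmetric] by (intro span_sum span_scale span_base) auto
    define z where "z = b0 - p"
    have z0: "z \<noteq> 0" using ndep pS by (auto simp: z_def)
    have Bz: "B (y b) z = 0" if b: "b \<in> S" for b
    proof -
      have "B (y b) p = (\<Sum>b'\<in>S. B b0 (y b') * B (y b) (y b'))"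
        unfolding p_def linear_sum[OF lin] by (simp add: linear_scale[OF lin])
      also have "\<dots> = (\<Sum>b'\<in>S. if b = b' then B b0 (y b') else 0)"
        by (intro sum.cong) (use y(1) b in auto)
      also have "\<dots> = B b0 (y b)" using b insert.hyps(1) by simp
      finally show ?thesis by (simp add: z_def linear_diff[OF lin] sym)
    qed
    define z' where "z' = (1 / sqrt (B z z)) *\<^sub>R z"
    have sq: "sqrt (B z z) > 0" using pos[OF z0] by simp
    have Bz': "B z' z' = 1"
      using sq pos[OF z0] unfolding z'_def linear_scale[OF lin] by (subst sym) (simp add: linear_scale[OF lin])
    have Byz': "B (y b) z' = 0" "B z' (y b) = 0" if "b \<in> S" for b
      using Bz[OF that] sym[of z' "y b"] by (simp_all add: z'_def linear_scale[OF lin])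
    define y' where "y' = y(b0 := z')"
    have y'S: "y' b = y b" if "b \<in> S" for b using that insert.hyps(2) by (auto simp: y'_def)
    have y'0: "y' b0 = z'" by (simp add: y'_def)
    have 1: "\<forall>b\<in>insert b0 S. \<forall>b'\<in>insert b0 S. B (y' b) (y' b') = (if b = b' then 1 else 0)"
      using y(1) y'S y'0 Bz' Byz' insert.hyps(2) by auto
    have "y' ` insert b0 S = insert z' (y ` S)" using y'S y'0 by auto
    also have "span \<dots> = span (insert b0 S)"
    proof -
      have "span (insert z' (y ` S)) = span (insert z' S)"
        unfolding span_insert y(2) ..
      also have "\<dots> = span (insert b0 S)"
      proof (rule span_eq[THEN iffD2], intro conjI)
        have "z \<in> span (insert b0 S)" unfolding z_def
        proof (rule span_diff)
          show "b0 \<in> span (insert b0 S)" by (rule span_base) simp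
          show "p \<in> span (insert b0 S)" using pS span_mono[OF subset_insertI[of S b0]] by blast
        qed
        then have "z' \<in> span (insert b0 S)" unfolding z'_def by (rule span_scale)
        then show "insert z' S \<subseteq> span (insert b0 S)" by (auto intro: span_base)
        have "b0 = sqrt (B z z) *\<^sub>R z' + p" using sq by (simp add: z'_def z_def)
        moreover have "sqrt (B z z) *\<^sub>R z' + p \<in> span (insert z' S)"
        proof (rule span_add)
          show "sqrt (B z z) *\<^sub>R z' \<in> span (insert z' S)" by (intro span_scale span_base) simp
          show "p \<in> span (insert z' S)" using pS span_mono[OF subset_insertI[of S z']] by blast
        qed
        ultimately show "insert b0 S \<subseteq> span (insert z' S)" by (auto intro: span_base)
      qed
      finally show ?thesis .
    qed
    finally have 2: "span (y' ` insert b0 S) = span (insert b0 S)" .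
    show ?case using 1 2 by blast
  qed auto
  from this[of Basis, OF subset_refl] show ?thesis unfolding span_Basis .
qed

text \<open>The piecewise linear hat on the band [c, c + \<delta>] with peak value 1 at the
  midpoint. It vanishes at both ends, so profiles multiplied by it extend continuously by
  zero.\<close>

definition tent :: "real \<Rightarrow> real \<Rightarrow> real \<Rightarrow> real" where
  "tent c \<delta> v = max 0 (1 - \<bar>2 * (v - c) / \<delta> - 1\<bar>)"

lemma tent_bounds: "0 \<le> tent c \<delta> v" "tent c \<delta> v \<le> 1"
  by (auto simp: tent_def)

lemma tent_zero: assumes "\<delta> > 0" "v \<le> c \<or> c + \<delta> \<le> v" shows "tent c \<delta> v = 0"
  using assms by (auto simp: tent_def field_simps abs_if)

lemma tent_le: assumes "\<delta> > 0" "c \<le> v" shows "tent c \<delta> v \<le> 2 * (v - c) / \<delta>"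
  using assms by (auto simp: tent_def)

lemma hat_lipschitz: "\<bar>max 0 (1 - \<bar>x\<bar>) - max 0 (1 - \<bar>y\<bar>)\<bar> \<le> \<bar>x - y\<bar>" for x y :: real
  unfolding max_def by (simp split: abs_split)

lemma tent_lipschitz: assumes "\<delta> > 0" shows "\<bar>tent c \<delta> v - tent c \<delta> w\<bar> \<le> 2 / \<delta> * \<bar>v - w\<bar>"
proof -
  have "\<bar>tent c \<delta> v - tent c \<delta> w\<bar> \<le> \<bar>(2 * (v - c) / \<delta> - 1) - (2 * (w - c) / \<delta> - 1)\<bar>"
    unfolding tent_def by (rule hat_lipschitz)
  also have "\<dots> = 2 / \<delta> * \<bar>v - w\<bar>"
  proof -
    have "(2 * (v - c) / \<delta> - 1) - (2 * (w - c) / \<delta> - 1) = 2 / \<delta> * (v - w)" using assms by (simp add: field_simps)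
    then show ?thesis using assms by (simp only: abs_mult) simp
  qed
  finally show ?thesis .
qed

lemma tent_mid: assumes "\<delta> > 0" "c + \<delta> / 4 \<le> v" "v \<le> c + 3 * \<delta> / 4" shows "1/2 \<le> tent c \<delta> v"
proof -
  define x where "x = 2 * (v - c) / \<delta> - 1"
  have "- (1/2) \<le> x" "x \<le> 1/2" using assms by (auto simp: x_def field_simps)
  then have "1/2 \<le> 1 - \<bar>x\<bar>" by (simp add: abs_if)
  then show ?thesis unfolding tent_def x_def[symmetric] by (simp add: max_def)
qed

lemma tent_continuous: "continuous_on S (tent c \<delta>)"
  unfolding tent_def[abs_def] divide_inverse by (intro continuous_intros)

text \<open>The linear map whose matrix has the vectors \<open>y b\<close> as rows.\<close>

definition coords :: "('a::euclidean_space \<Rightarrow> 'a) \<Rightarrow> 'a \<Rightarrow> 'a" where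
  "coords y x = (\<Sum>b\<in>Basis. (y b \<bullet> x) *\<^sub>R b)"

lemma coords_inner: "b \<in> Basis \<Longrightarrow> coords y x \<bullet> b = y b \<bullet> x"
  by (simp add: coords_def inner_sum_left inner_Basis if_distrib cong: if_cong)

lemma linear_coords: "linear (coords y)"
  by (rule linearI) (simp_all add: coords_def inner_add_right scaleR_add_left sum.distrib scaleR_sum_right)

lemma inj_coords:
  assumes "span (y ` Basis) = UNIV" shows "inj (coords y)"
proof -
  have "x = 0" if "coords y x = 0" for x
  proof -
    have "orthogonal x z" if "z \<in> y ` Basis" for z
      using that coords_inner[of _ y x] \<open>coords y x = 0\<close> by (auto simp: orthogonal_def inner_commute)
    then have "orthogonal x x" using orthogonal_to_span[of x "y ` Basis" x] assms by auto
    then show ?thesis by (simp add: orthogonal_self)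
  qed
  then show ?thesis using linear_injective_0[OF linear_coords] by blast
qed

text \<open>On every short interval \<open>[c, c + \<delta>]\<close> of parameters the curve becomes uniformly nondegenerate in
  suitable coordinates, at the price of a volume distortion of order \<open>\<delta>\<^sup>K\<close>.\<close>

definition adapted_coords ::
    "(real \<Rightarrow> 'a::euclidean_space) \<Rightarrow> real \<Rightarrow> real \<Rightarrow> nat \<Rightarrow> real \<Rightarrow> real \<Rightarrow> real \<Rightarrow> bool" where
  "adapted_coords g \<alpha> \<beta> K \<delta>0 C k \<longleftrightarrow> (\<forall>c \<delta>. 0 < \<delta> \<longrightarrow> \<delta> \<le> \<delta>0 \<longrightarrow> \<alpha> \<le> c \<longrightarrow> c + \<delta> \<le> \<beta> \<longrightarrow>
     (\<exists>y. inj (coords y) \<and> k * \<delta> ^ K \<le> vfac (coords y) \<and>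
       (\<forall>b\<in>Basis. \<forall>b'\<in>Basis. ((\<lambda>v. tent c \<delta> v * (g v \<bullet> y b) * (g v \<bullet> y b')) has_integral (if b = b' then \<delta> else 0)) {c..c + \<delta>}) \<and>
       (\<forall>b\<in>Basis. \<forall>v\<in>{c..c + \<delta>}. \<bar>g v \<bullet> y b\<bar> \<le> C) \<and>
       (\<forall>b\<in>Basis. \<forall>v\<in>{c..c + \<delta>}. \<forall>w\<in>{c..c + \<delta>}. \<bar>g v \<bullet> y b - g w \<bullet> y b\<bar> \<le> C / \<delta> * \<bar>v - w\<bar>)))"

text \<open>\<open>D k\<close> is the derivative of order k of the curve \<open>D 0\<close>. The
  vector \<open>e0\<close> records a direction in which the curve has a constant component;
  derivatives of positive order are orthogonal to it, so order 0 has to belong to every basis made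
  of derivatives. This lowers the total order that enters the final exponent.\<close>

locale nondeg_curve =
  fixes D :: "nat \<Rightarrow> real \<Rightarrow> 'a::euclidean_space" and \<alpha> \<beta> :: real and m :: nat and e0 :: 'a
  assumes ab: "\<alpha> < \<beta>" and m: "0 < m"
    and deriv: "\<And>k v. k < m \<Longrightarrow> v \<in> {\<alpha>..\<beta>} \<Longrightarrow> (D k has_vector_derivative D (Suc k) v) (at v within {\<alpha>..\<beta>})"
    and cont: "\<And>k. k \<le> m \<Longrightarrow> continuous_on {\<alpha>..\<beta>} (D k)"
    and span_D: "\<And>v. v \<in> {\<alpha>..\<beta>} \<Longrightarrow> span {D k v | k. k \<le> m} = UNIV"
    and e0: "e0 \<noteq> 0" "\<And>k v. 0 < k \<Longrightarrow> k \<le> m \<Longrightarrow> v \<in> {\<alpha>..\<beta>} \<Longrightarrow> D k v \<bullet> e0 = 0"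
begin

lemma deriv_inner:
  assumes "k < m" "{p..q} \<subseteq> {\<alpha>..\<beta>}" "v \<in> {p..q}"
  shows "((\<lambda>v. D k v \<bullet> y) has_real_derivative D (Suc k) v \<bullet> y) (at v within {p..q})"
proof -
  have "(D k has_vector_derivative D (Suc k) v) (at v within {p..q})"
    using deriv[OF assms(1), of v] assms(2,3) has_vector_derivative_within_subset by blast
  then show ?thesis
    unfolding has_real_derivative_iff_has_vector_derivative
    by (rule bounded_linear.has_vector_derivative[OF bounded_linear_inner_left])
qed

lemma mvt_inner:
  assumes "k < m" "\<alpha> \<le> p" "p < q" "q \<le> \<beta>"
  shows "\<exists>\<xi>\<in>{p<..<q}. D k q \<bullet> y - D k p \<bullet> y = (q - p) * (D (Suc k) \<xi> \<bullet> y)"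
proof -
  have "\<exists>x\<in>{p<..<q}. D k q \<bullet> y - D k p \<bullet> y = (\<lambda>h. (D (Suc k) x \<bullet> y) * h) (q - p)"
  proof (rule mvt_simple[OF assms(3)])
    fix x assume "p \<le> x" "x \<le> q"
    then show "((\<lambda>v. D k v \<bullet> y) has_derivative (\<lambda>h. (D (Suc k) x \<bullet> y) * h)) (at x within {p..q})"
      using deriv_inner[OF assms(1), of p q x y] assms by (simp add: has_field_derivative_def)
  qed
  then show ?thesis by (simp add: mult.commute)
qed

text \<open>An interpolation inequality at a single point, by induction on the order: pick good
  points for order k in the first and in the last third of the interval and apply the mean value
  theorem between them. The points are at least \<delta>/3 apart, so each step costs a factor 2
  \<sqdot> 3^(k + 1).\<close>

lemma landau_point:
  "k \<le> m \<Longrightarrow> \<exists>A\<ge>0. \<forall>c \<delta> y S. 0 < \<delta> \<longrightarrow> \<alpha> \<le> c \<longrightarrow> c + \<delta> \<le> \<beta> \<longrightarrow> (\<forall>v\<in>{c..c+\<delta>}. \<bar>D 0 v \<bullet> y\<bar> \<le> S) \<longrightarrow>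
     (\<exists>\<xi>\<in>{c..c+\<delta>}. \<bar>D k \<xi> \<bullet> y\<bar> \<le> A * S / \<delta> ^ k)"
proof (induction k)
  case 0
  show ?case by (intro exI[of _ 1]) auto
next
  case (Suc k)
  then obtain A where A: "A \<ge> 0" and IH: "\<And>c \<delta> y S. 0 < \<delta> \<Longrightarrow> \<alpha> \<le> c \<Longrightarrow> c + \<delta> \<le> \<beta> \<Longrightarrow> (\<forall>v\<in>{c..c+\<delta>}. \<bar>D 0 v \<bullet> y\<bar> \<le> S) \<Longrightarrow>
     (\<exists>\<xi>\<in>{c..c+\<delta>}. \<bar>D k \<xi> \<bullet> y\<bar> \<le> A * S / \<delta> ^ k)" by auto
  define A' where "A' = 2 * A * 3 ^ Suc k"
  have "\<exists>\<xi>\<in>{c..c+\<delta>}. \<bar>D (Suc k) \<xi> \<bullet> y\<bar> \<le> A' * S / \<delta> ^ Suc k"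
    if d: "0 < \<delta>" "\<alpha> \<le> c" "c + \<delta> \<le> \<beta>" and S: "\<forall>v\<in>{c..c+\<delta>}. \<bar>D 0 v \<bullet> y\<bar> \<le> S" for c \<delta> y S
  proof -
    define M where "M = A * S / (\<delta> / 3) ^ k"
    obtain p where p: "p \<in> {c..c+\<delta>/3}" "\<bar>D k p \<bullet> y\<bar> \<le> M"
      using IH[of "\<delta>/3" c y S] d S unfolding M_def by auto
    have "\<exists>\<xi>\<in>{(c + 2*\<delta>/3)..(c + 2*\<delta>/3) + \<delta>/3}. \<bar>D k \<xi> \<bullet> y\<bar> \<le> A * S / (\<delta>/3) ^ k"
      using d S by (intro IH) auto
    then obtain q where q: "q \<in> {c + 2*\<delta>/3..c+\<delta>}" "\<bar>D k q \<bullet> y\<bar> \<le> M"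
      unfolding M_def by force
    have pq: "\<delta> / 3 \<le> q - p" using p q by auto
    then have "p < q" using d by linarith
    then obtain \<xi> where x: "\<xi> \<in> {p<..<q}" "D k q \<bullet> y - D k p \<bullet> y = (q - p) * (D (Suc k) \<xi> \<bullet> y)"
      using mvt_inner[of k p q y] Suc.prems d p q by auto
    have "(\<delta> / 3) * \<bar>D (Suc k) \<xi> \<bullet> y\<bar> \<le> (q - p) * \<bar>D (Suc k) \<xi> \<bullet> y\<bar>"
      using pq by (intro mult_right_mono) auto
    also have "\<dots> = \<bar>D k q \<bullet> y - D k p \<bullet> y\<bar>" using x \<open>p < q\<close> by (simp add: abs_mult)
    also have "\<dots> \<le> 2 * M" using p q by linarith
    finally have "\<bar>D (Suc k) \<xi> \<bullet> y\<bar> \<le> 2 * M * (3 / \<delta>)" using d by (simp add: field_simps)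
    also have "\<dots> = A' * S / \<delta> ^ Suc k" by (simp add: M_def A'_def power_divide field_simps)
    finally show ?thesis using x p q by (intro bexI[of _ \<xi>]) auto
  qed
  moreover have "A' \<ge> 0" using A by (simp add: A'_def)
  ultimately show ?case by blast
qed

text \<open>The sum over k of |D k v . y| is continuous and, by the spanning condition, positive on
  the compact product of the interval and the unit sphere. One of the m + 1 summands is at least the
  average.\<close>

lemma uniform_nondeg: "\<exists>\<kappa>>0. \<forall>v\<in>{\<alpha>..\<beta>}. \<forall>y. \<exists>k\<le>m. \<kappa> * norm y \<le> \<bar>D k v \<bullet> y\<bar>"
proof -
  define F where "F p = (\<Sum>k\<le>m. \<bar>D k (fst p) \<bullet> snd p\<bar>)" for p :: "real \<times> 'a"
  obtain b :: 'a where b: "b \<in> Basis" by (rule SOME_Basis[THEN that])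
  have "continuous_on ({\<alpha>..\<beta>} \<times> sphere 0 1) F" unfolding F_def
    by (intro continuous_intros continuous_on_compose2[OF cont]) auto
  moreover have "compact ({\<alpha>..\<beta>} \<times> sphere (0::'a) 1)" by (intro compact_Times compact_Icc compact_sphere)
  moreover have "{\<alpha>..\<beta>} \<times> sphere (0::'a) 1 \<noteq> {}" using ab b by (auto intro!: exI[of _ b])
  ultimately obtain p where p: "p \<in> {\<alpha>..\<beta>} \<times> sphere 0 1" "\<And>q. q \<in> {\<alpha>..\<beta>} \<times> sphere 0 1 \<Longrightarrow> F p \<le> F q"
    using continuous_attains_inf[of "{\<alpha>..\<beta>} \<times> sphere 0 1" F] by blast
  have "F p \<noteq> 0"
  proof
    assume "F p = 0"
    then have z: "D k (fst p) \<bullet> snd p = 0" if "k \<le> m" for k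
      using that unfolding F_def by (subst (asm) sum_nonneg_eq_0_iff) auto
    have "orthogonal (snd p) z" if "z \<in> {D k (fst p) | k. k \<le> m}" for z
      using that z by (auto simp: orthogonal_def inner_commute)
    moreover have "snd p \<in> span {D k (fst p) | k. k \<le> m}" using span_D[of "fst p"] p(1) by (simp add: mem_Times_iff)
    ultimately have "orthogonal (snd p) (snd p)" by (intro orthogonal_to_span[of "snd p" "{D k (fst p) | k. k \<le> m}"])
    then show False using p by (auto simp: orthogonal_self)
  qed
  moreover have "F p \<ge> 0" by (simp add: F_def sum_nonneg)
  ultimately have Fp: "F p > 0" by simp
  define \<kappa> where "\<kappa> = F p / (m + 1)"
  have "\<exists>k\<le>m. \<kappa> * norm y \<le> \<bar>D k v \<bullet> y\<bar>" if v: "v \<in> {\<alpha>..\<beta>}" for v y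
  proof (rule ccontr)
    assume "\<not> ?thesis"
    then have lt: "\<bar>D k v \<bullet> y\<bar> < \<kappa> * norm y" if "k \<le> m" for k using that by (meson not_le)
    have y: "y \<noteq> 0" using lt[of 0] by auto
    have "F (v, y) < (\<Sum>k\<le>m. \<kappa> * norm y)" unfolding F_def by (intro sum_strict_mono) (auto simp: lt)
    then have "F (v, y) < F p * norm y" by (simp add: \<kappa>_def)
    moreover have "F (v, y) = norm y * F (v, (1 / norm y) *\<^sub>R y)"
      using y by (simp add: F_def sum_distrib_left abs_mult)
    moreover have "F p \<le> F (v, (1 / norm y) *\<^sub>R y)" using v y by (intro p) auto
    ultimately show False using y mult_left_mono[of "F p" "F (v, (1 / norm y) *\<^sub>R y)" "norm y"] by (simp add: mult.commute)
  qed
  moreover have "\<kappa> > 0" using Fp by (simp add: \<kappa>_def)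
  ultimately show ?thesis by blast
qed


text \<open>On short intervals v \<mapsto> D 0 v . y behaves like a polynomial of degree at most m:
  control on the middle half controls all derivatives on the whole interval. By
  \<open>landau_point\<close> every order is controlled at some point; nondegeneracy at c, together
  with the small oscillation of the \<open>D k\<close>, turns this into a bound of order
  S/\<delta>^m for |y|. That bounds the derivative of order m everywhere, and the mean value theorem
  then descends to lower orders.\<close>

lemma derivative_bounds:
  "\<exists>\<delta>0 C. 0 < \<delta>0 \<and> \<delta>0 \<le> 1 \<and> 1 \<le> C \<and> (\<forall>c \<delta> y S. 0 < \<delta> \<longrightarrow> \<delta> \<le> \<delta>0 \<longrightarrow> \<alpha> \<le> c \<longrightarrow> c + \<delta> \<le> \<beta> \<longrightarrow>
     (\<forall>v\<in>{c+\<delta>/4..c+3*\<delta>/4}. \<bar>D 0 v \<bullet> y\<bar> \<le> S) \<longrightarrow> (\<forall>k\<le>m. \<forall>v\<in>{c..c+\<delta>}. \<bar>D k v \<bullet> y\<bar> \<le> C * S / \<delta> ^ k))"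
proof -
  obtain A where A: "\<And>k. k \<le> m \<Longrightarrow> A k \<ge> 0" "\<And>k c \<delta> y S. k \<le> m \<Longrightarrow> 0 < \<delta> \<Longrightarrow> \<alpha> \<le> c \<Longrightarrow> c + \<delta> \<le> \<beta> \<Longrightarrow> (\<forall>v\<in>{c..c+\<delta>}. \<bar>D 0 v \<bullet> y\<bar> \<le> S) \<Longrightarrow>
     (\<exists>\<xi>\<in>{c..c+\<delta>}. \<bar>D k \<xi> \<bullet> y\<bar> \<le> A k * S / \<delta> ^ k)"
  proof -
    define Q where "Q k A \<longleftrightarrow> A \<ge> 0 \<and> (\<forall>c \<delta> y S. 0 < \<delta> \<longrightarrow> \<alpha> \<le> c \<longrightarrow> c + \<delta> \<le> \<beta> \<longrightarrow> (\<forall>v\<in>{c..c+\<delta>}. \<bar>D 0 v \<bullet> y\<bar> \<le> S) \<longrightarrow>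
     (\<exists>\<xi>\<in>{c..c+\<delta>}. \<bar>D k \<xi> \<bullet> y\<bar> \<le> A * S / \<delta> ^ k))" for k A
    have "\<exists>A. Q k A" if "k \<le> m" for k using landau_point[OF that] unfolding Q_def .
    then obtain A where A: "\<And>k. k \<le> m \<Longrightarrow> Q k (A k)" by metis
    show ?thesis
    proof (rule that[of A])
      show "0 \<le> A k" if "k \<le> m" for k using A[OF that] by (simp add: Q_def)
      fix k c \<delta> y S
      assume k: "k \<le> m" and h: "0 < \<delta>" "\<alpha> \<le> c" "c + \<delta> \<le> \<beta>" "\<forall>v\<in>{c..c+\<delta>}. \<bar>D 0 v \<bullet> y\<bar> \<le> S"
      show "\<exists>\<xi>\<in>{c..c+\<delta>}. \<bar>D k \<xi> \<bullet> y\<bar> \<le> A k * S / \<delta> ^ k"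
        using A[OF k, unfolded Q_def, THEN conjunct2, THEN spec, THEN spec, THEN spec, THEN spec, THEN mp, OF h(1), THEN mp, OF h(2), THEN mp, OF h(3), THEN mp, OF h(4)] .
    qed
  qed
  \<comment> \<open>The powers of 2 arise because \<open>landau_point\<close> is applied on the
    middle half, whose length is \<delta>/2.\<close>
  define B where "B = (\<Sum>k\<le>m. A k * 2 ^ k)"
  have AB: "A k * 2 ^ k \<le> B" if "k \<le> m" for k
    unfolding B_def using that A(1) by (intro member_le_sum) auto
  have B: "B \<ge> 0" unfolding B_def using A(1) by (intro sum_nonneg) auto
  from uniform_nondeg obtain \<kappa> where \<kappa>': "\<kappa> > 0 \<and> (\<forall>v\<in>{\<alpha>..\<beta>}. \<forall>y. \<exists>k\<le>m. \<kappa> * norm y \<le> \<bar>D k v \<bullet> y\<bar>)" ..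
  have \<kappa>: "\<kappa> > 0" "\<And>v y. v \<in> {\<alpha>..\<beta>} \<Longrightarrow> \<exists>k\<le>m. \<kappa> * norm y \<le> \<bar>D k v \<bullet> y\<bar>"
    using \<kappa>' by simp_all
  have "\<exists>d>0. \<forall>v\<in>{\<alpha>..\<beta>}. \<forall>w\<in>{\<alpha>..\<beta>}. \<bar>v - w\<bar> < d \<longrightarrow> norm (D k v - D k w) < \<kappa> / 2" if "k \<le> m" for k
  proof -
    have uc: "uniformly_continuous_on {\<alpha>..\<beta>} (D k)" by (rule compact_uniformly_continuous[OF cont[OF that] compact_Icc])
    have "0 < \<kappa> / 2" using \<kappa>(1) by simp
    from uc[unfolded uniformly_continuous_on_def, THEN spec, THEN mp, OF this] obtain d where d': "d > 0 \<and> (\<forall>x\<in>{\<alpha>..\<beta>}. \<forall>x'\<in>{\<alpha>..\<beta>}. dist x' x < d \<longrightarrow> dist (D k x') (D k x) < \<kappa> / 2)" ..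
    have d: "d > 0" "\<And>x x'. x \<in> {\<alpha>..\<beta>} \<Longrightarrow> x' \<in> {\<alpha>..\<beta>} \<Longrightarrow> dist x' x < d \<Longrightarrow> dist (D k x') (D k x) < \<kappa> / 2"
      using d' by auto
    show ?thesis
    proof (intro exI[of _ d] conjI ballI impI d(1))
      fix v w assume "v \<in> {\<alpha>..\<beta>}" "w \<in> {\<alpha>..\<beta>}" "\<bar>v - w\<bar> < d"
      then show "norm (D k v - D k w) < \<kappa> / 2" using d(2)[of w v] by (simp add: dist_norm)
    qed
  qed
  note uc = this
  have "\<forall>k\<in>{..m}. \<exists>d>0. \<forall>v\<in>{\<alpha>..\<beta>}. \<forall>w\<in>{\<alpha>..\<beta>}. \<bar>v - w\<bar> < d \<longrightarrow> norm (D k v - D k w) < \<kappa> / 2"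
    by (rule ballI, rule uc) simp
  from bchoice[OF this] obtain d where d': "\<forall>k\<in>{..m}. d k > 0 \<and> (\<forall>v\<in>{\<alpha>..\<beta>}. \<forall>w\<in>{\<alpha>..\<beta>}. \<bar>v - w\<bar> < d k \<longrightarrow> norm (D k v - D k w) < \<kappa> / 2)" ..
  have d: "\<And>k. k \<le> m \<Longrightarrow> d k > 0"
    "\<And>k v w. k \<le> m \<Longrightarrow> v \<in> {\<alpha>..\<beta>} \<Longrightarrow> w \<in> {\<alpha>..\<beta>} \<Longrightarrow> \<bar>v - w\<bar> < d k \<Longrightarrow> norm (D k v - D k w) < \<kappa> / 2"
    using d' unfolding Ball_def atMost_iff by blast+
  define d0 where "d0 = Min (d ` {..m})"
  have d0: "d0 > 0" "\<And>k. k \<le> m \<Longrightarrow> d0 \<le> d k" using d(1) by (auto simp: d0_def)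
  \<comment> \<open>Below \<open>d0\<close> each \<open>D k\<close> oscillates by less than
    \<kappa>/2 over the interval, so the lower bound at c survives at the good point. The bound 1
    allows negative powers of \<delta> of order k \<le> m to be replaced by the power of order
    m.\<close>
  define \<delta>0 where "\<delta>0 = min 1 (d0 / 2)"
  have \<delta>0: "0 < \<delta>0" "\<delta>0 \<le> 1" "\<delta>0 < d0" using d0(1) by (auto simp: \<delta>0_def)
  have "bounded (D m ` {\<alpha>..\<beta>})" by (rule compact_imp_bounded[OF compact_continuous_image[OF cont[OF order_refl] compact_Icc]])
  then obtain L where L: "\<And>v. v \<in> {\<alpha>..\<beta>} \<Longrightarrow> norm (D m v) \<le> L" unfolding bounded_iff by blast
  have L0: "L \<ge> 0" using order_trans[OF norm_ge_zero L[of \<alpha>]] ab by simp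
  define hyp where "hyp c \<delta> y S \<longleftrightarrow> 0 < \<delta> \<and> \<delta> \<le> \<delta>0 \<and> \<alpha> \<le> c \<and> c + \<delta> \<le> \<beta> \<and> (\<forall>v\<in>{c+\<delta>/4..c+3*\<delta>/4}. \<bar>D 0 v \<bullet> y\<bar> \<le> S)" for c \<delta> y S
  have hypD: "0 < \<delta> \<and> \<delta> \<le> \<delta>0 \<and> \<alpha> \<le> c \<and> c + \<delta> \<le> \<beta>" if "hyp c \<delta> y S" for c \<delta> y S
    using that by (simp add: hyp_def)
  have S0: "S \<ge> 0" if "hyp c \<delta> y S" for c \<delta> y S
  proof -
    have "c + \<delta>/2 \<in> {c+\<delta>/4..c+3*\<delta>/4}" using hypD[OF that] by auto
    then have "\<bar>D 0 (c + \<delta>/2) \<bullet> y\<bar> \<le> S" using that unfolding hyp_def by blast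
    then show ?thesis by linarith
  qed
  have pt: "\<exists>\<xi>\<in>{c..c+\<delta>}. \<bar>D k \<xi> \<bullet> y\<bar> \<le> B * S / \<delta> ^ k" if h: "hyp c \<delta> y S" and k: "k \<le> m" for c \<delta> y S k
  proof -
    have e: "(c+\<delta>/4) + \<delta>/2 = c+3*\<delta>/4" by simp
    have "\<exists>\<xi>\<in>{c+\<delta>/4..(c+\<delta>/4) + \<delta>/2}. \<bar>D k \<xi> \<bullet> y\<bar> \<le> A k * S / (\<delta>/2) ^ k"
    proof (rule A(2)[OF k])
      show "\<forall>v\<in>{c+\<delta>/4..(c+\<delta>/4) + \<delta>/2}. \<bar>D 0 v \<bullet> y\<bar> \<le> S" using h unfolding hyp_def e by blast
    qed (use hypD[OF h] in auto)
    then obtain \<xi> where x: "\<xi> \<in> {c+\<delta>/4..(c+\<delta>/4) + \<delta>/2}" "\<bar>D k \<xi> \<bullet> y\<bar> \<le> A k * S / (\<delta>/2) ^ k" by blast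
    have "A k * S / (\<delta>/2) ^ k = (A k * 2 ^ k) * S / \<delta> ^ k" by (simp add: power_divide)
    also have "\<dots> \<le> B * S / \<delta> ^ k"
      using AB[OF k] S0[OF h] hypD[OF h] by (intro divide_right_mono mult_right_mono) auto
    finally show ?thesis using x hypD[OF h] by (intro bexI[of _ \<xi>]) auto
  qed
  have ny: "norm y \<le> (2 * B / \<kappa>) * S / \<delta> ^ m" if h: "hyp c \<delta> y S" for c \<delta> y S
  proof -
    have cI: "c \<in> {\<alpha>..\<beta>}" and dl: "0 < \<delta>" "\<delta> \<le> 1" using hypD[OF h] \<delta>0 by auto
    obtain k where k: "k \<le> m" "\<kappa> * norm y \<le> \<bar>D k c \<bullet> y\<bar>" using \<kappa>(2)[OF cI] by blast
    obtain \<xi> where x: "\<xi> \<in> {c..c+\<delta>}" "\<bar>D k \<xi> \<bullet> y\<bar> \<le> B * S / \<delta> ^ k" using pt[OF h k(1)] by blast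
    have "norm (D k c - D k \<xi>) < \<kappa> / 2"
      using x hypD[OF h] \<delta>0 d0(2)[OF k(1)] cI by (intro d(2) k) auto
    then have "\<bar>(D k c - D k \<xi>) \<bullet> y\<bar> \<le> \<kappa> / 2 * norm y"
      by (intro order_trans[OF Cauchy_Schwarz_ineq2] mult_right_mono) auto
    then have "\<bar>D k c \<bullet> y - D k \<xi> \<bullet> y\<bar> \<le> \<kappa> * norm y / 2" by (simp add: inner_diff_left)
    then have "\<kappa> * norm y / 2 \<le> B * S / \<delta> ^ k" using k(2) x(2) by linarith
    also have "\<dots> \<le> B * S / \<delta> ^ m"
      using dl k(1) B S0[OF h] by (intro divide_left_mono power_decreasing mult_nonneg_nonneg mult_pos_pos zero_less_power) auto
    finally have "\<kappa> * norm y \<le> 2 * (B * S / \<delta> ^ m)" by linarith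
    then have "norm y \<le> 2 * (B * S / \<delta> ^ m) / \<kappa>" using \<kappa>(1) by (simp only: pos_le_divide_eq mult.commute)
    then show ?thesis by (simp add: mult.commute mult.left_commute)
  qed
  \<comment> \<open>Downward induction starting at k = m, where the bound on |y| is used. At lower
    orders the value at the good point of \<open>pt\<close> is propagated by the derivative already
    bounded.\<close>
  have claim: "\<exists>C\<ge>0. \<forall>c \<delta> y S v. hyp c \<delta> y S \<longrightarrow> v \<in> {c..c+\<delta>} \<longrightarrow> \<bar>D k v \<bullet> y\<bar> \<le> C * S / \<delta> ^ k" if "k \<le> m" for k
    using that
  proof (induction k rule: inc_induct)
    case base
    have "\<bar>D m v \<bullet> y\<bar> \<le> (L * (2 * B / \<kappa>)) * S / \<delta> ^ m" if h: "hyp c \<delta> y S" and v: "v \<in> {c..c+\<delta>}" for c \<delta> y S v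
    proof -
      have "\<bar>D m v \<bullet> y\<bar> \<le> norm (D m v) * norm y" by (rule Cauchy_Schwarz_ineq2)
      also have "\<dots> \<le> L * ((2 * B / \<kappa>) * S / \<delta> ^ m)"
        using L[of v] L0 ny[OF h] hypD[OF h] v by (intro mult_mono) auto
      finally show ?thesis by (simp add: mult.assoc)
    qed
    moreover have "L * (2 * B / \<kappa>) \<ge> 0" using L0 B \<kappa>(1) by simp
    ultimately show ?case by (intro exI[of _ "L * (2 * B / \<kappa>)"] conjI allI impI)
  next
    case (step k)
    from step.IH obtain C where C: "C \<ge> 0" "\<And>c \<delta> y S v. hyp c \<delta> y S \<Longrightarrow> v \<in> {c..c+\<delta>} \<Longrightarrow> \<bar>D (Suc k) v \<bullet> y\<bar> \<le> C * S / \<delta> ^ Suc k" by (elim exE conjE) blast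
    have "\<bar>D k v \<bullet> y\<bar> \<le> (B + C) * S / \<delta> ^ k" if h: "hyp c \<delta> y S" and v: "v \<in> {c..c+\<delta>}" for c \<delta> y S v
    proof -
      have dl: "0 < \<delta>" using hypD[OF h] by simp
      have km: "k \<le> m" using step by simp
      obtain \<xi> where x: "\<xi> \<in> {c..c+\<delta>}" "\<bar>D k \<xi> \<bullet> y\<bar> \<le> B * S / \<delta> ^ k" using pt[OF h km] by blast
      have mv: "\<bar>D k q \<bullet> y - D k p \<bullet> y\<bar> \<le> C * S / \<delta> ^ k" if "p \<in> {c..c+\<delta>}" "q \<in> {c..c+\<delta>}" "p < q" for p q
      proof -
        have "\<alpha> \<le> p" "q \<le> \<beta>" "k < m" using that hypD[OF h] step by auto
        then obtain \<zeta> where z: "\<zeta> \<in> {p<..<q}" "D k q \<bullet> y - D k p \<bullet> y = (q - p) * (D (Suc k) \<zeta> \<bullet> y)"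
          using mvt_inner[of k p q y] \<open>p < q\<close> by blast
        have "\<bar>D k q \<bullet> y - D k p \<bullet> y\<bar> = (q - p) * \<bar>D (Suc k) \<zeta> \<bullet> y\<bar>" using z that by (simp add: abs_mult)
        also have "\<dots> \<le> \<delta> * (C * S / \<delta> ^ Suc k)"
          using that z C(2)[OF h, of \<zeta>] dl by (intro mult_mono) auto
        also have "\<dots> = C * S / \<delta> ^ k" using dl by simp
        finally show ?thesis .
      qed
      have "\<bar>D k v \<bullet> y - D k \<xi> \<bullet> y\<bar> \<le> C * S / \<delta> ^ k"
      proof (cases "v = \<xi>")
        case True
        then show ?thesis using C(1) S0[OF h] dl by simp
      next
        case False
        then show ?thesis using mv[of v \<xi>] mv[of \<xi> v] v x(1) by (cases "v < \<xi>") (auto simp: abs_minus_commute)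
      qed
      then have "\<bar>D k v \<bullet> y\<bar> \<le> B * S / \<delta> ^ k + C * S / \<delta> ^ k" using x(2) by linarith
      then show ?thesis by (simp add: distrib_right add_divide_distrib)
    qed
    moreover have "B + C \<ge> 0" using B C by simp
    ultimately show ?case by (intro exI[of _ "B + C"] conjI allI impI)
  qed
  then obtain C where C: "\<And>k. k \<le> m \<Longrightarrow> C k \<ge> 0" "\<And>k c \<delta> y S v. k \<le> m \<Longrightarrow> hyp c \<delta> y S \<Longrightarrow> v \<in> {c..c+\<delta>} \<Longrightarrow> \<bar>D k v \<bullet> y\<bar> \<le> C k * S / \<delta> ^ k"
  proof -
    define Q where "Q k C \<longleftrightarrow> C \<ge> 0 \<and> (\<forall>c \<delta> y S v. hyp c \<delta> y S \<longrightarrow> v \<in> {c..c+\<delta>} \<longrightarrow> \<bar>D k v \<bullet> y\<bar> \<le> C * S / \<delta> ^ k)" for k C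
    have "\<exists>C. Q k C" if "k \<le> m" for k using claim[OF that] unfolding Q_def .
    then obtain C where C: "\<And>k. k \<le> m \<Longrightarrow> Q k (C k)" by metis
    show ?thesis
    proof (rule that[of C])
      show "0 \<le> C k" if "k \<le> m" for k using C[OF that] by (simp add: Q_def)
      fix k c \<delta> y S v
      assume k: "k \<le> m" and h: "hyp c \<delta> y S" "v \<in> {c..c+\<delta>}"
      show "\<bar>D k v \<bullet> y\<bar> \<le> C k * S / \<delta> ^ k"
        using C[OF k, unfolded Q_def, THEN conjunct2, rule_format, OF h] .
    qed
  qed
  define C0 where "C0 = 1 + (\<Sum>k\<le>m. C k)"
  have CC: "C k \<le> C0" if "k \<le> m" for k
  proof -
    have "C k \<le> (\<Sum>k\<le>m. C k)" using that C(1) by (intro member_le_sum) auto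
    then show ?thesis by (simp add: C0_def)
  qed
  have "0 \<le> (\<Sum>k\<le>m. C k)" by (rule sum_nonneg) (simp add: C(1))
  then have C01: "1 \<le> C0" unfolding C0_def by simp
  have "\<bar>D k v \<bullet> y\<bar> \<le> C0 * S / \<delta> ^ k" if "k \<le> m" "hyp c \<delta> y S" "v \<in> {c..c+\<delta>}" for k c \<delta> y S v
  proof -
    have "C k * S / \<delta> ^ k \<le> C0 * S / \<delta> ^ k"
      using CC[OF that(1)] S0[OF that(2)] hypD[OF that(2)] by (intro divide_right_mono mult_right_mono) auto
    then show ?thesis using C(2)[OF that] by linarith
  qed
  note fin = this
  show ?thesis
  proof (rule exI[of _ \<delta>0], rule exI[of _ C0], intro conjI allI impI ballI \<delta>0(1,2) C01)
    fix c \<delta> y S k v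
    assume "0 < \<delta>" "\<delta> \<le> \<delta>0" "\<alpha> \<le> c" "c + \<delta> \<le> \<beta>" "\<forall>v\<in>{c+\<delta>/4..c+3*\<delta>/4}. \<bar>D 0 v \<bullet> y\<bar> \<le> S" "k \<le> m" "v \<in> {c..c+\<delta>}"
    then show "\<bar>D k v \<bullet> y\<bar> \<le> C0 * S / \<delta> ^ k" by (intro fin) (simp_all add: hyp_def)
  qed
qed

text \<open>The linear map whose columns are the derivatives of orders \<open>sel b\<close>; it is
  injective exactly when these derivatives form a basis.\<close>

definition frame :: "('a \<Rightarrow> nat) \<Rightarrow> real \<Rightarrow> 'a \<Rightarrow> 'a" where
  "frame sel v x = (\<Sum>b\<in>Basis. (x \<bullet> b) *\<^sub>R D (sel b) v)"

lemma linear_frame: "linear (frame sel v)"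
  by (rule linearI) (simp_all add: frame_def inner_add_left scaleR_add_left sum.distrib scaleR_sum_right)

lemma frame_Basis: "b \<in> Basis \<Longrightarrow> frame sel v b = D (sel b) v"
proof -
  assume b: "b \<in> Basis"
  have "frame sel v b = (\<Sum>b'\<in>Basis. if b' = b then D (sel b') v else 0)"
    unfolding frame_def
  proof (rule sum.cong[OF refl])
    fix b' :: 'a assume "b' \<in> Basis"
    then show "(b \<bullet> b') *\<^sub>R D (sel b') v = (if b' = b then D (sel b') v else 0)"
      using b by (cases "b' = b") (simp_all add: inner_same_Basis inner_not_same_Basis)
  qed
  also have "\<dots> = D (sel b) v" using b by (simp add: sum.delta)
  finally show ?thesis .
qed

end

context nondeg_curve
begin

lemma frame_at_point:
  assumes v: "v \<in> {\<alpha>..\<beta>}"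
  shows "\<exists>sel k. inj_on sel Basis \<and> sel ` Basis \<subseteq> {..m} \<and> 0 < k \<and> (\<forall>x. k * norm x \<le> norm (frame sel v x))"
proof -
  obtain T where T: "T \<subseteq> {D k v | k. k \<le> m}" "independent T" "{D k v | k. k \<le> m} \<subseteq> span T"
    by (rule maximal_independent_subset)
  have spT: "span T = UNIV"
  proof -
    have "span {D k v | k. k \<le> m} \<subseteq> span T" using T(3) by (rule span_minimal) (rule subspace_span)
    then show ?thesis unfolding span_D[OF v] by (rule top.extremum_uniqueI)
  qed
  have "card T = dim (span T)" using dim_eq_card_independent[OF T(2)] by (simp only: dim_span)
  then have "card T = DIM('a)" unfolding spT by (simp only: dim_UNIV)
  then have "card (Basis::'a set) = card T" by simp
  from finite_same_card_bij[OF finite_Basis independent_imp_finite[OF T(2)] this]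
  obtain h where h: "bij_betw h (Basis::'a set) T" ..
  have "\<exists>k\<le>m. D k v = h b" if "b \<in> Basis" for b
  proof -
    have "h b \<in> {D k v | k. k \<le> m}" using T(1) bij_betwE[OF h] that by (meson subsetD)
    then show ?thesis by (elim CollectE exE conjE) (metis)
  qed
  then have "\<forall>b\<in>Basis. \<exists>k. k \<le> m \<and> D k v = h b" by simp
  from bchoice[OF this] obtain sel where sel': "\<forall>b\<in>Basis. sel b \<le> m \<and> D (sel b) v = h b" ..
  then have sel: "\<And>b. b \<in> Basis \<Longrightarrow> sel b \<le> m \<and> D (sel b) v = h b" by simp
  have inj: "inj_on sel Basis"
  proof (rule inj_onI)
    fix b b' :: 'a assume b: "b \<in> Basis" "b' \<in> Basis" "sel b = sel b'"
    then have "h b = h b'" using sel[of b] sel[of b'] by simp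
    then show "b = b'" using bij_betw_imp_inj_on[OF h] b by (simp add: inj_on_eq_iff)
  qed
  have "range (frame sel v) = UNIV"
  proof -
    have "T \<subseteq> range (frame sel v)"
    proof
      fix t assume "t \<in> T"
      then obtain b where b: "b \<in> Basis" "t = h b" using h by (auto simp: bij_betw_def)
      then have "t = frame sel v b" using frame_Basis[OF b(1)] sel by simp
      then show "t \<in> range (frame sel v)" by blast
    qed
    moreover have "subspace (range (frame sel v))" by (rule linear_subspace_image[OF linear_frame subspace_UNIV])
    ultimately have "span T \<subseteq> range (frame sel v)" by (rule span_minimal)
    then show ?thesis using spT by auto
  qed
  then have "inj (frame sel v)" using linear_surjective_imp_injective[OF linear_frame] by auto
  then obtain k where "k > 0" "\<And>x. k * norm x \<le> norm (frame sel v x)"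
    using linear_bij_lower_bound[OF linear_frame] by blast
  then show ?thesis using inj sel by blast
qed

text \<open>A choice of orders that gives a basis at v still works nearby with half the lower bound,
  by continuity of the derivatives involved. Finitely many such neighbourhoods cover the interval;
  the orders may change from one to the next, but the lower bound is the minimum of finitely
  many.\<close>

lemma uniform_frame:
  "\<exists>\<kappa>>0. \<forall>v\<in>{\<alpha>..\<beta>}. \<exists>sel. inj_on sel Basis \<and> sel ` Basis \<subseteq> {..m} \<and> (\<forall>x. \<kappa> * norm x \<le> norm (frame sel v x))"
proof -
  define good where "good k w \<longleftrightarrow> (\<exists>sel. inj_on sel Basis \<and> sel ` Basis \<subseteq> {..m} \<and> (\<forall>x. k * norm x \<le> norm (frame sel w x)))" for k w
  have "\<exists>e>0. \<exists>k>0. \<forall>w\<in>{\<alpha>..\<beta>}. \<bar>v - w\<bar> < e \<longrightarrow> good k w"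
    if v: "v \<in> {\<alpha>..\<beta>}" for v
  proof -
    obtain sel k where s: "inj_on sel Basis" "sel ` Basis \<subseteq> {..m}" "0 < k" "\<And>x. k * norm x \<le> norm (frame sel v x)"
      using frame_at_point[OF v] by (elim exE conjE) (rule that, auto)
    define n where "n = real DIM('a)"
    have n: "n > 0" by (simp add: n_def)
    have "\<exists>d>0. \<forall>w\<in>{\<alpha>..\<beta>}. \<bar>v - w\<bar> < d \<longrightarrow> norm (D (sel b) v - D (sel b) w) < k / (2 * n)" if "b \<in> Basis" for b
    proof -
      have "continuous_on {\<alpha>..\<beta>} (D (sel b))" using s(2) that by (intro cont) auto
      moreover have "k / (2 * n) > 0" using s(3) n by simp
      ultimately obtain d where d: "d > 0" "\<And>w. w \<in> {\<alpha>..\<beta>} \<Longrightarrow> dist w v < d \<Longrightarrow> dist (D (sel b) w) (D (sel b) v) < k / (2 * n)"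
        using v unfolding continuous_on_iff by blast
      show ?thesis
      proof (intro exI[of _ d] conjI ballI impI d(1))
        fix w assume "w \<in> {\<alpha>..\<beta>}" "\<bar>v - w\<bar> < d"
        then show "norm (D (sel b) v - D (sel b) w) < k / (2 * n)" using d(2)[of w] by (simp add: dist_norm norm_minus_commute[of "D (sel b) v"] abs_minus_commute[of v])
      qed
    qed
    note dd = this
    obtain d where d: "\<And>b. b \<in> Basis \<Longrightarrow> d b > 0"
      "\<And>b w. b \<in> Basis \<Longrightarrow> w \<in> {\<alpha>..\<beta>} \<Longrightarrow> \<bar>v - w\<bar> < d b \<Longrightarrow> norm (D (sel b) v - D (sel b) w) < k / (2 * n)"
    proof -
      define Q where "Q b d \<longleftrightarrow> d > 0 \<and> (\<forall>w\<in>{\<alpha>..\<beta>}. \<bar>v - w\<bar> < d \<longrightarrow> norm (D (sel b) v - D (sel b) w) < k / (2 * n))" for b d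
      assume r: "\<And>d. (\<And>b. b \<in> Basis \<Longrightarrow> d b > 0) \<Longrightarrow> (\<And>b w. b \<in> Basis \<Longrightarrow> w \<in> {\<alpha>..\<beta>} \<Longrightarrow> \<bar>v - w\<bar> < d b \<Longrightarrow> norm (D (sel b) v - D (sel b) w) < k / (2 * n)) \<Longrightarrow> thesis"
      have "\<forall>b\<in>Basis. \<exists>d. Q b d" unfolding Q_def by (rule ballI) (rule dd)
      from bchoice[OF this] obtain d where d: "\<forall>b\<in>Basis. Q b (d b)" ..
      show thesis by (rule r[of d]) (use d in \<open>simp_all add: Q_def\<close>)
    qed
    define e where "e = Min (d ` (Basis :: 'a set))"
    have e: "e > 0" "\<And>b. b \<in> Basis \<Longrightarrow> e \<le> d b" using d(1) by (auto simp: e_def)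
    have "k / 2 * norm x \<le> norm (frame sel w x)" if w: "w \<in> {\<alpha>..\<beta>}" "\<bar>v - w\<bar> < e" for w x
    proof -
      have "frame sel v x - frame sel w x = (\<Sum>b\<in>Basis. (x \<bullet> b) *\<^sub>R (D (sel b) v - D (sel b) w))"
        by (simp add: frame_def sum_subtractf scaleR_diff_right)
      also have "norm \<dots> \<le> (\<Sum>b\<in>(Basis::'a set). norm x * (k / (2 * n)))"
      proof (rule sum_norm_le)
        fix b :: 'a assume b: "b \<in> Basis"
        have "norm (D (sel b) v - D (sel b) w) \<le> k / (2 * n)" using d(2)[OF b w(1)] w(2) e(2)[OF b] by auto
        then show "norm ((x \<bullet> b) *\<^sub>R (D (sel b) v - D (sel b) w)) \<le> norm x * (k / (2 * n))"
          unfolding norm_scaleR using Basis_le_norm[OF b, of x] by (intro mult_mono) auto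
      qed
      also have "\<dots> = k / 2 * norm x" using n by (simp add: n_def)
      finally have "norm (frame sel v x - frame sel w x) \<le> k / 2 * norm x" .
      moreover have "norm (frame sel v x) \<le> norm (frame sel w x) + norm (frame sel v x - frame sel w x)"
        using norm_triangle_ineq[of "frame sel w x" "frame sel v x - frame sel w x"] by simp
      ultimately show ?thesis using s(4)[of x] by (simp add: field_simps)
    qed
    then have "good (k / 2) w" if "w \<in> {\<alpha>..\<beta>}" "\<bar>v - w\<bar> < e" for w
      unfolding good_def using s(1,2) that by (intro exI[of _ sel]) simp
    then show ?thesis using e(1) s(3) by (intro exI[of _ e] conjI exI[where x="k/2"] ballI impI) simp_all
  qed
  then have "\<exists>p. fst p > 0 \<and> snd p > 0 \<and> (\<forall>w\<in>{\<alpha>..\<beta>}. \<bar>v - w\<bar> < fst p \<longrightarrow> good (snd p) w)" if "v \<in> {\<alpha>..\<beta>}" for v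
    using that by (metis fst_conv snd_conv)
  then have "\<forall>v\<in>{\<alpha>..\<beta>}. \<exists>p. fst p > 0 \<and> snd p > 0 \<and> (\<forall>w\<in>{\<alpha>..\<beta>}. \<bar>v - w\<bar> < fst p \<longrightarrow> good (snd p) w)" by (rule ballI)
  from bchoice[OF this] obtain q where q: "\<forall>v\<in>{\<alpha>..\<beta>}. fst (q v) > 0 \<and> snd (q v) > 0 \<and> (\<forall>w\<in>{\<alpha>..\<beta>}. \<bar>v - w\<bar> < fst (q v) \<longrightarrow> good (snd (q v)) w)" ..
  define e k where "e v = fst (q v)" and "k v = snd (q v)" for v
  have ek: "\<And>v. v \<in> {\<alpha>..\<beta>} \<Longrightarrow> e v > 0" "\<And>v. v \<in> {\<alpha>..\<beta>} \<Longrightarrow> k v > 0"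
    "\<And>v w. v \<in> {\<alpha>..\<beta>} \<Longrightarrow> w \<in> {\<alpha>..\<beta>} \<Longrightarrow> \<bar>v - w\<bar> < e v \<Longrightarrow> good (k v) w"
    using q unfolding e_def k_def by simp_all
  have "{\<alpha>..\<beta>} \<subseteq> (\<Union>v\<in>{\<alpha>..\<beta>}. ball v (e v))" using ek(1) by auto
  then obtain C where C: "C \<subseteq> {\<alpha>..\<beta>}" "finite C" "{\<alpha>..\<beta>} \<subseteq> (\<Union>v\<in>C. ball v (e v))"
    using compactE_image[of "{\<alpha>..\<beta>}" "{\<alpha>..\<beta>}" "\<lambda>v. ball v (e v)"] by auto
  define \<kappa> where "\<kappa> = Min (insert 1 (k ` C))"
  have \<kappa>: "\<kappa> > 0" "\<And>v. v \<in> C \<Longrightarrow> \<kappa> \<le> k v" using C ek(2) by (auto simp: \<kappa>_def)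
  have "\<exists>sel. inj_on sel Basis \<and> sel ` Basis \<subseteq> {..m} \<and> (\<forall>x. \<kappa> * norm x \<le> norm (frame sel w x))" if w: "w \<in> {\<alpha>..\<beta>}" for w
  proof -
    obtain v where v: "v \<in> C" "w \<in> ball v (e v)" using C(3) w by blast
    then obtain sel where sel: "inj_on sel Basis" "sel ` Basis \<subseteq> {..m}" "\<And>x. k v * norm x \<le> norm (frame sel w x)"
    proof -
      have "\<bar>v - w\<bar> < e v" using v(2) by (simp add: dist_real_def)
      then have "good (k v) w" using v(1) C(1) w by (intro ek(3)) auto
      then show ?thesis unfolding good_def using that by blast
    qed
    have "\<kappa> * norm x \<le> norm (frame sel w x)" for x
      using sel(3)[of x] mult_right_mono[OF \<kappa>(2)[OF v(1)], of "norm x"] by simp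
    then show ?thesis using sel(1,2) by (intro exI[of _ sel]) simp
  qed
  then show ?thesis using \<kappa>(1) by (intro exI[of _ \<kappa>]) simp
qed

end

section \<open>The total order of a frame\<close>

lemma sum_le_top_sum:
  fixes T :: "nat set"
  assumes "finite T" "T \<subseteq> {..m}"
  shows "\<Sum>T \<le> (\<Sum>i<card T. m - i)"
  using assms
proof (induction "card T" arbitrary: T)
  case (Suc j)
  define x where "x = Min T"
  have ne: "T \<noteq> {}" using Suc.hyps(2) by auto
  have x: "x \<in> T" "\<And>t. t \<in> T \<Longrightarrow> x \<le> t" using ne Suc.prems by (auto simp: x_def)
  have "T \<subseteq> {x..m}" using x Suc.prems by auto
  then have "card T \<le> card {x..m}" by (intro card_mono) auto
  \<comment> \<open>The smallest of j + 1 distinct numbers up to m is at most m - j. Removing it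
    leaves the induction hypothesis for j numbers.\<close>
  then have xm: "x \<le> m - j" using Suc.hyps(2) x Suc.prems by auto
  have c: "card (T - {x}) = j" using x(1) Suc.hyps(2) Suc.prems by simp
  have "\<Sum>T = x + \<Sum>(T - {x})" using x(1) Suc.prems by (simp add: sum.remove)
  also have "\<dots> \<le> (m - j) + (\<Sum>i<j. m - i)"
    using xm Suc.hyps(1)[of "T - {x}"] c Suc.prems by (intro add_mono) auto
  finally show ?case using Suc.hyps(2)[symmetric] by simp
qed simp

context nondeg_curve
begin

text \<open>The vector \<open>e0\<close> lies in the range of an injective frame, yet it is
  orthogonal to all derivatives of positive order, so order 0 must be among those selected. The
  remaining orders are distinct and at most m, and the largest sum they can have is the weight on
  the right.\<close>

lemma frame_weight:
  assumes v: "v \<in> {\<alpha>..\<beta>}" and sel: "inj_on sel Basis" "sel ` Basis \<subseteq> {..m}" and k: "0 < k" "\<And>x. k * norm x \<le> norm (frame sel v x)"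
  shows "DIM('a) \<le> Suc m" "(\<Sum>b\<in>Basis. sel b) \<le> (\<Sum>i<DIM('a) - 1. m - i)"
proof -
  have "frame sel v x = 0 \<Longrightarrow> x = 0" for x using k(2)[of x] k(1) by (simp add: mult_le_0_iff)
  then have "inj (frame sel v)" using linear_injective_0[OF linear_frame] by blast
  then have "surj (frame sel v)" using linear_injective_imp_surjective[OF linear_frame] by blast
  then obtain x where x: "frame sel v x = e0" by (metis surjD)
  have "0 \<in> sel ` Basis"
  proof (rule ccontr)
    assume "0 \<notin> sel ` Basis"
    have "D (sel b) v \<bullet> e0 = 0" if "b \<in> Basis" for b
    proof (rule e0(2)[OF _ _ v])
      show "0 < sel b" using that \<open>0 \<notin> sel ` Basis\<close> by (metis gr0I imageI)
      show "sel b \<le> m" using that sel(2) by auto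
    qed
    then have "frame sel v x \<bullet> e0 = 0" by (simp add: frame_def inner_sum_left)
    then show False using x e0(1) by simp
  qed
  then have c: "card (sel ` Basis - {0}) = DIM('a) - 1" using card_image[OF sel(1)] by simp
  have "card (sel ` Basis) \<le> card {..m}" using sel(2) by (intro card_mono) auto
  then show "DIM('a) \<le> Suc m" using card_image[OF sel(1)] by simp
  have "(\<Sum>b\<in>Basis. sel b) = \<Sum>(sel ` Basis)" using sel(1) by (simp add: sum.reindex)
  also have "\<dots> = \<Sum>(sel ` Basis - {0})" by (rule sum.mono_neutral_right) auto
  also have "\<dots> \<le> (\<Sum>i<DIM('a) - 1. m - i)" using sum_le_top_sum[of "sel ` Basis - {0}" m] sel(2) c by auto
  finally show "(\<Sum>b\<in>Basis. sel b) \<le> (\<Sum>i<DIM('a) - 1. m - i)" .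
qed

end

context nondeg_curve
begin

text \<open>Let S be the maximum of |D 0 v . y| over the middle half. The derivative is at most C
  S/\<delta>, so the function stays above S/2 on an interval of length \<delta>/(4 C), where the
  tent is at least 1/2. That interval alone contributes \<delta> S^2/(32 C) to the energy.\<close>

lemma curve_energy_bound:
  assumes C: "1 \<le> C" and bd: "\<And>y S. (\<forall>v\<in>{c+\<delta>/4..c+3*\<delta>/4}. \<bar>D 0 v \<bullet> y\<bar> \<le> S) \<Longrightarrow> (\<forall>v\<in>{c..c+\<delta>}. \<bar>D 1 v \<bullet> y\<bar> \<le> C * S / \<delta>)"
    and d: "0 < \<delta>" "\<alpha> \<le> c" "c + \<delta> \<le> \<beta>"
  shows "\<exists>S\<ge>0. (\<forall>v\<in>{c+\<delta>/4..c+3*\<delta>/4}. \<bar>D 0 v \<bullet> y\<bar> \<le> S) \<and>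
    S\<^sup>2 \<le> 32 * C * (1 / \<delta> * integral {c..c+\<delta>} (\<lambda>v. tent c \<delta> v * (D 0 v \<bullet> y) * (D 0 v \<bullet> y)))"
proof -
  let ?J = "{c+\<delta>/4..c+3*\<delta>/4}"
  have sub: "{c..c+\<delta>} \<subseteq> {\<alpha>..\<beta>}" using d by auto
  have fc: "continuous_on {c..c+\<delta>} (\<lambda>v. D 0 v \<bullet> y)"
    by (intro continuous_intros continuous_on_subset[OF cont[of 0] sub]) simp
  have subJ: "?J \<subseteq> {c..c+\<delta>}" using d by auto
  have "continuous_on ?J (\<lambda>v. \<bar>D 0 v \<bullet> y\<bar>)" by (intro continuous_intros continuous_on_subset[OF fc subJ])
  then obtain vs where vs: "vs \<in> ?J" "\<forall>v\<in>?J. \<bar>D 0 v \<bullet> y\<bar> \<le> \<bar>D 0 vs \<bullet> y\<bar>"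
    using continuous_attains_sup[of ?J "\<lambda>v. \<bar>D 0 v \<bullet> y\<bar>"] d by auto
  define S where "S = \<bar>D 0 vs \<bullet> y\<bar>"
  have S0: "0 \<le> S" by (simp add: S_def)
  have S: "\<forall>v\<in>?J. \<bar>D 0 v \<bullet> y\<bar> \<le> S" using vs by (simp add: S_def)
  have D1: "\<bar>D 1 v \<bullet> y\<bar> \<le> C * S / \<delta>" if "v \<in> {c..c+\<delta>}" for v using bd[OF S] that by blast
  define \<rho> where "\<rho> = \<delta> / (4 * C)"
  have \<rho>: "0 < \<rho>" "\<rho> \<le> \<delta> / 4" using d C by (auto simp: \<rho>_def field_simps)
  \<comment> \<open>The interval is placed on that side of the maximiser on which it fits into the
    middle half; one side always works because \<rho> \<le> \<delta>/4.\<close>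
  obtain p where p: "{p..p+\<rho>} \<subseteq> ?J" "vs = p \<or> vs = p + \<rho>"
  proof (cases "vs + \<rho> \<le> c+3*\<delta>/4")
    case True
    then show ?thesis using vs(1) \<rho> by (intro that[of vs]) auto
  next
    case False
    then show ?thesis using vs(1) \<rho> by (intro that[of "vs - \<rho>"]) auto
  qed
  have lower: "S / 2 \<le> \<bar>D 0 v \<bullet> y\<bar>" if v: "v \<in> {p..p+\<rho>}" for v
  proof (cases "v = vs")
    case True
    then show ?thesis by (simp add: S_def)
  next
    case False
    have vJ: "v \<in> {c..c+\<delta>}" "vs \<in> {c..c+\<delta>}" using v p(1) vs(1) subJ by auto
    have mv: "\<bar>D 0 q \<bullet> y - D 0 r \<bullet> y\<bar> \<le> (q - r) * (C * S / \<delta>)" if r: "r \<in> {c..c+\<delta>}" "q \<in> {c..c+\<delta>}" "r < q" for r q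
    proof -
      have "\<alpha> \<le> r" "q \<le> \<beta>" using r d by auto
      then obtain x where x: "x \<in> {r<..<q}" "D 0 q \<bullet> y - D 0 r \<bullet> y = (q - r) * (D (Suc 0) x \<bullet> y)"
        using mvt_inner[OF m, of r q y] r(3) by blast
      have "\<bar>D 1 x \<bullet> y\<bar> \<le> C * S / \<delta>" using x(1) r by (intro D1) auto
      then have "(q - r) * \<bar>D 1 x \<bullet> y\<bar> \<le> (q - r) * (C * S / \<delta>)" using r(3) by (intro mult_left_mono) auto
      then show ?thesis using x(2) r(3) by (simp add: abs_mult)
    qed
    have "\<bar>D 0 v \<bullet> y - D 0 vs \<bullet> y\<bar> \<le> \<bar>v - vs\<bar> * (C * S / \<delta>)"
    proof (cases "v < vs")
      case True
      then show ?thesis using mv[OF vJ True] by (simp add: abs_minus_commute)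
    next
      case f: False
      then have "vs < v" using False by simp
      then show ?thesis using mv[OF vJ(2,1)] by simp
    qed
    also have "\<dots> \<le> \<rho> * (C * S / \<delta>)"
      using v p(2) \<rho> C S0 d by (intro mult_right_mono) auto
    also have "\<dots> = S / 4" using C d by (simp add: \<rho>_def)
    finally have "\<bar>D 0 v \<bullet> y - D 0 vs \<bullet> y\<bar> \<le> S / 4" .
    then show ?thesis using S0 unfolding S_def by linarith
  qed
  have ic: "continuous_on {c..c+\<delta>} (\<lambda>v. tent c \<delta> v * (D 0 v \<bullet> y) * (D 0 v \<bullet> y))"
    by (intro continuous_on_mult tent_continuous fc)
  have subK: "{p..p+\<rho>} \<subseteq> {c..c+\<delta>}" using p(1) subJ by (rule subset_trans)
  have "\<rho> * (S\<^sup>2 / 8) = integral {p..p+\<rho>} (\<lambda>v. S\<^sup>2 / 8)" using \<rho> by simp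
  also have "\<dots> \<le> integral {p..p+\<rho>} (\<lambda>v. tent c \<delta> v * (D 0 v \<bullet> y) * (D 0 v \<bullet> y))"
  proof (rule integral_le)
    show "(\<lambda>v. tent c \<delta> v * (D 0 v \<bullet> y) * (D 0 v \<bullet> y)) integrable_on {p..p+\<rho>}"
      by (rule integrable_continuous_real[OF continuous_on_subset[OF ic subK]])
    fix v assume v: "v \<in> {p..p+\<rho>}"
    then have "v \<in> ?J" using p(1) by blast
    then have t: "1/2 \<le> tent c \<delta> v" using d by (intro tent_mid) auto
    have "(S / 2)\<^sup>2 \<le> (\<bar>D 0 v \<bullet> y\<bar>)\<^sup>2" using lower[OF v] S0 by (intro power_mono) auto
    then have "S\<^sup>2 / 4 \<le> (D 0 v \<bullet> y) * (D 0 v \<bullet> y)" by (simp add: power2_eq_square)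
    with t have "1/2 * (S\<^sup>2 / 4) \<le> tent c \<delta> v * ((D 0 v \<bullet> y) * (D 0 v \<bullet> y))" by (intro mult_mono) auto
    then show "S\<^sup>2 / 8 \<le> tent c \<delta> v * (D 0 v \<bullet> y) * (D 0 v \<bullet> y)" by (simp add: mult.assoc)
  qed (intro integrable_continuous_real continuous_on_const)
  also have "\<dots> \<le> integral {c..c+\<delta>} (\<lambda>v. tent c \<delta> v * (D 0 v \<bullet> y) * (D 0 v \<bullet> y))"
  proof (rule integral_subset_le[OF subK])
    show "(\<lambda>v. tent c \<delta> v * (D 0 v \<bullet> y) * (D 0 v \<bullet> y)) integrable_on {p..p+\<rho>}"
      by (rule integrable_continuous_real[OF continuous_on_subset[OF ic subK]])
    show "(\<lambda>v. tent c \<delta> v * (D 0 v \<bullet> y) * (D 0 v \<bullet> y)) integrable_on {c..c+\<delta>}"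
      by (rule integrable_continuous_real[OF ic])
    show "\<forall>v\<in>{c..c+\<delta>}. 0 \<le> tent c \<delta> v * (D 0 v \<bullet> y) * (D 0 v \<bullet> y)"
      unfolding mult.assoc by (rule ballI) (rule mult_nonneg_nonneg[OF tent_bounds(1) zero_le_square])
  qed
  finally have "\<rho> * (S\<^sup>2 / 8) \<le> integral {c..c+\<delta>} (\<lambda>v. tent c \<delta> v * (D 0 v \<bullet> y) * (D 0 v \<bullet> y))" .
  then have "S\<^sup>2 \<le> 32 * C * (1 / \<delta> * integral {c..c+\<delta>} (\<lambda>v. tent c \<delta> v * (D 0 v \<bullet> y) * (D 0 v \<bullet> y)))"
    using d C by (simp add: \<rho>_def field_simps)
  then show ?thesis using S S0 by (intro exI[of _ S]) simp
qed

text \<open>Precede \<open>coords y\<close> by the frame at v and by a diagonal scaling. The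
  composite maps the unit cube into itself, so its \<open>vfac\<close> is at least 1; since
  \<open>vfac\<close> is multiplicative, dividing by the known factors of frame and scaling leaves a
  lower bound for \<open>coords y\<close>. The scaling contributes \<delta> to the total order of
  the frame.\<close>

lemma vfac_coords_lower:
  assumes v: "v \<in> {\<alpha>..\<beta>}" and sel: "inj_on sel Basis" "sel ` Basis \<subseteq> {..m}" and \<kappa>: "0 < \<kappa>" "\<And>x. \<kappa> * norm x \<le> norm (frame sel v x)"
    and y: "inj (coords y)" "\<And>k b. k \<le> m \<Longrightarrow> b \<in> Basis \<Longrightarrow> \<bar>D k v \<bullet> y b\<bar> \<le> C / \<delta> ^ k" and C: "0 < C" and \<delta>: "0 < \<delta>" "\<delta> \<le> 1"
  shows "(\<kappa> / (C * DIM('a))) ^ DIM('a) * \<delta> ^ (\<Sum>i<DIM('a) - 1. m - i) \<le> vfac (coords y)"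
proof -
  let ?n = "DIM('a)"
  \<comment> \<open>The power of \<delta> undoes the growth of the derivative of order
    \<open>sel b\<close> against \<open>y\<close>, and the dimension in the denominator pays for the
    number of summands.\<close>
  define e where "e b = \<delta> ^ sel b / (C * ?n)" for b
  have e: "0 < e b" for b using C \<delta> by (simp add: e_def)
  define Dg where "Dg = (\<lambda>x::'a. \<Sum>b\<in>Basis. (e b * (x \<bullet> b)) *\<^sub>R b)"
  have Dg: "linear Dg" "inj Dg" "vfac Dg = 1 / (\<Prod>b\<in>Basis. e b)"
    unfolding Dg_def using vfac_diagonal[of e] e by auto
  have Dgb: "Dg x \<bullet> b = e b * (x \<bullet> b)" if "b \<in> Basis" for x b
    using that by (simp add: Dg_def inner_sum_left inner_Basis if_distrib cong: if_cong)
  have "x = 0" if "frame sel v x = 0" for x using \<kappa>(2)[of x] that \<kappa>(1) by (simp add: mult_le_0_iff)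
  then have fi: "inj (frame sel v)" using linear_injective_0[OF linear_frame] by blast
  have l2: "linear (\<lambda>x. frame sel v (Dg x))" using linear_compose[OF Dg(1) linear_frame] by (simp add: o_def)
  have i2: "inj (\<lambda>x. frame sel v (Dg x))" using inj_compose[OF fi Dg(2)] by (simp add: o_def)
  have l3: "linear (\<lambda>x. coords y (frame sel v (Dg x)))" using linear_compose[OF l2 linear_coords] by (simp add: o_def)
  have i3: "inj (\<lambda>x. coords y (frame sel v (Dg x)))" using inj_compose[OF y(1) i2] by (simp add: o_def)
  have "1 \<le> vfac (\<lambda>x. coords y (frame sel v (Dg x)))"
  proof (rule vfac_ge_1[OF l3 i3])
    fix x :: 'a assume x: "x \<in> unit_cube"
    show "coords y (frame sel v (Dg x)) \<in> unit_cube"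
      unfolding mem_unit_cube
    proof
      fix b :: 'a assume b: "b \<in> Basis"
      have "coords y (frame sel v (Dg x)) \<bullet> b = (\<Sum>b'\<in>Basis. (Dg x \<bullet> b') * (D (sel b') v \<bullet> y b))"
        by (simp add: coords_inner[OF b] frame_def inner_sum_right inner_commute[of "y b"])
      also have "\<bar>\<dots>\<bar> \<le> (\<Sum>b'\<in>(Basis::'a set). 1 / ?n)"
      proof (rule order_trans[OF sum_abs], rule sum_mono)
        fix b' :: 'a assume b': "b' \<in> Basis"
        have sm: "sel b' \<le> m" using sel(2) b' by auto
        have "\<bar>Dg x \<bullet> b'\<bar> \<le> e b' * 1"
          unfolding Dgb[OF b'] abs_mult using e[of b'] x b' by (intro mult_mono) (auto simp: mem_unit_cube)
        then have "\<bar>(Dg x \<bullet> b') * (D (sel b') v \<bullet> y b)\<bar> \<le> (e b' * 1) * (C / \<delta> ^ sel b')"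
          unfolding abs_mult using y(2)[OF sm b] e[of b'] by (intro mult_mono) auto
        also have "\<dots> = 1 / ?n" using C \<delta> by (simp add: e_def)
        finally show "\<bar>(Dg x \<bullet> b') * (D (sel b') v \<bullet> y b)\<bar> \<le> 1 / ?n" .
      qed
      also have "\<dots> = 1" by simp
      finally show "\<bar>coords y (frame sel v (Dg x)) \<bullet> b\<bar> \<le> 1" .
    qed
  qed
  also have "vfac (\<lambda>x. coords y (frame sel v (Dg x))) = vfac (coords y) * (vfac (frame sel v) * vfac Dg)"
    using vfac_compose[OF linear_coords y(1) l2 i2] vfac_compose[OF linear_frame fi Dg(1,2)] by simp
  also have "\<dots> \<le> vfac (coords y) * (1 / \<kappa> ^ ?n * vfac Dg)"
    using vfac_le[OF linear_frame \<kappa>] vfac_pos[OF linear_coords y(1)] vfac_pos[OF Dg(1,2)]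
    by (intro mult_left_mono mult_right_mono) auto
  finally have main: "\<kappa> ^ ?n * (\<Prod>b\<in>Basis. e b) \<le> vfac (coords y)"
    using \<kappa>(1) prod_pos[of "Basis::'a set" e] e by (simp add: Dg(3) field_simps)
  have "(\<Prod>b\<in>Basis. e b) = \<delta> ^ (\<Sum>b\<in>Basis. sel b) / (C * ?n) ^ ?n"
    by (simp add: e_def prod_dividef power_sum)
  also have "\<dots> \<ge> \<delta> ^ (\<Sum>i<DIM('a) - 1. m - i) / (C * ?n) ^ ?n"
    using frame_weight(2)[OF v sel \<kappa>] \<delta> C by (intro divide_right_mono power_decreasing) auto
  finally have "\<kappa> ^ ?n * (\<delta> ^ (\<Sum>i<DIM('a) - 1. m - i) / (C * ?n) ^ ?n) \<le> \<kappa> ^ ?n * (\<Prod>b\<in>Basis. e b)"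
    using \<kappa>(1) by (intro mult_left_mono) auto
  then show ?thesis using main by (simp add: power_divide)
qed

text \<open>The vectors \<open>y b\<close> are orthonormal for the energy form weighted by the tent.
  Unit energy bounds D 0 v . y b on the middle half of the band, and
  \<open>derivative_bounds\<close> extends this to all derivatives on the whole band, which gives
  both the regularity and the volume bound.\<close>

lemma adapted_coords_exist:
  "\<exists>\<delta>0 C k. 0 < \<delta>0 \<and> 1 \<le> C \<and> 0 < k \<and> adapted_coords (D 0) \<alpha> \<beta> (\<Sum>i<DIM('a) - 1. m - i) \<delta>0 C k"
proof -
  obtain \<delta>0 C0 where b: "0 < \<delta>0" "\<delta>0 \<le> 1" "1 \<le> C0" and bds: "\<forall>c \<delta> y S. 0 < \<delta> \<longrightarrow> \<delta> \<le> \<delta>0 \<longrightarrow> \<alpha> \<le> c \<longrightarrow> c + \<delta> \<le> \<beta> \<longrightarrow>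
     (\<forall>v\<in>{c+\<delta>/4..c+3*\<delta>/4}. \<bar>D 0 v \<bullet> y\<bar> \<le> S) \<longrightarrow> (\<forall>k\<le>m. \<forall>v\<in>{c..c+\<delta>}. \<bar>D k v \<bullet> y\<bar> \<le> C0 * S / \<delta> ^ k)"
    using derivative_bounds by (elim exE conjE) (rule that)
  obtain \<kappa>1 where \<kappa>1: "0 < \<kappa>1" "\<forall>v\<in>{\<alpha>..\<beta>}. \<forall>y. \<exists>k\<le>m. \<kappa>1 * norm y \<le> \<bar>D k v \<bullet> y\<bar>"
    using uniform_nondeg by (elim exE conjE) (rule that)
  obtain \<kappa> where \<kappa>: "0 < \<kappa>" "\<forall>v\<in>{\<alpha>..\<beta>}. \<exists>sel. inj_on sel Basis \<and> sel ` Basis \<subseteq> {..m} \<and> (\<forall>x. \<kappa> * norm x \<le> norm (frame sel v x))"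
    using uniform_frame by (elim exE conjE) (rule that)
  \<comment> \<open>The bound that \<open>curve_energy_bound\<close> gives on the middle half for a
    vector of unit energy.\<close>
  define E where "E = sqrt (32 * C0)"
  have E: "1 \<le> E" "E\<^sup>2 = 32 * C0" using b by (auto simp: E_def)
  define C where "C = C0 * E"
  have C1: "1 * 1 \<le> C0 * E" using b(3) E(1) by (intro mult_mono) auto
  then have C: "1 \<le> C" by (simp add: C_def)
  have "adapted_coords (D 0) \<alpha> \<beta> (\<Sum>i<DIM('a) - 1. m - i) \<delta>0 C ((\<kappa> / (C * DIM('a))) ^ DIM('a))"
    unfolding adapted_coords_def
  proof (intro allI impI)
    fix c \<delta> :: real assume d: "0 < \<delta>" "\<delta> \<le> \<delta>0" "\<alpha> \<le> c" "c + \<delta> \<le> \<beta>"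
    have cI: "c \<in> {\<alpha>..\<beta>}" using d by auto
    have sub: "{c..c+\<delta>} \<subseteq> {\<alpha>..\<beta>}" using d by auto
    have bd: "\<bar>D k v \<bullet> y\<bar> \<le> C0 * S / \<delta> ^ k" if "\<forall>v\<in>{c+\<delta>/4..c+3*\<delta>/4}. \<bar>D 0 v \<bullet> y\<bar> \<le> S" "k \<le> m" "v \<in> {c..c+\<delta>}" for k v y S
      using bds[THEN spec, THEN spec, THEN spec, THEN spec, THEN mp, OF d(1), THEN mp, OF d(2), THEN mp, OF d(3), THEN mp, OF d(4), THEN mp, OF that(1)] that(2,3) by simp
    have fc: "continuous_on {c..c+\<delta>} (\<lambda>v. D 0 v \<bullet> y)" for y
      by (intro continuous_intros continuous_on_subset[OF cont[of 0] sub]) simp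
    define B where "B y y' = 1 / \<delta> * integral {c..c+\<delta>} (\<lambda>v. tent c \<delta> v * (D 0 v \<bullet> y) * (D 0 v \<bullet> y'))" for y y'
    have int: "(\<lambda>v. tent c \<delta> v * (D 0 v \<bullet> y) * (D 0 v \<bullet> y')) integrable_on {c..c+\<delta>}" for y y'
      by (intro integrable_continuous_real continuous_on_mult tent_continuous fc)
    have lin: "linear (B y)" for y
    proof (rule linearI)
      fix u v
      have "integral {c..c+\<delta>} (\<lambda>w. tent c \<delta> w * (D 0 w \<bullet> y) * (D 0 w \<bullet> (u + v))) =
        integral {c..c+\<delta>} (\<lambda>w. tent c \<delta> w * (D 0 w \<bullet> y) * (D 0 w \<bullet> u) + tent c \<delta> w * (D 0 w \<bullet> y) * (D 0 w \<bullet> v))"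
        by (simp add: inner_add_right distrib_left)
      also have "\<dots> = integral {c..c+\<delta>} (\<lambda>w. tent c \<delta> w * (D 0 w \<bullet> y) * (D 0 w \<bullet> u)) + integral {c..c+\<delta>} (\<lambda>w. tent c \<delta> w * (D 0 w \<bullet> y) * (D 0 w \<bullet> v))"
        by (rule Henstock_Kurzweil_Integration.integral_add[OF int int])
      finally show "B y (u + v) = B y u + B y v" by (simp only: B_def distrib_left)
    next
      fix r u
      have "integral {c..c+\<delta>} (\<lambda>w. tent c \<delta> w * (D 0 w \<bullet> y) * (D 0 w \<bullet> (r *\<^sub>R u))) =
        integral {c..c+\<delta>} (\<lambda>w. r * (tent c \<delta> w * (D 0 w \<bullet> y) * (D 0 w \<bullet> u)))"
        by (simp add: mult.left_commute)
      also have "\<dots> = r * integral {c..c+\<delta>} (\<lambda>w. tent c \<delta> w * (D 0 w \<bullet> y) * (D 0 w \<bullet> u))" by simp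
      finally show "B y (r *\<^sub>R u) = r *\<^sub>R B y u" by (simp add: B_def)
    qed
    have sym: "B y y' = B y' y" for y y' by (simp add: B_def mult.assoc mult.commute[of "D 0 _ \<bullet> y"])
    have en: "\<exists>S\<ge>0. (\<forall>v\<in>{c+\<delta>/4..c+3*\<delta>/4}. \<bar>D 0 v \<bullet> y\<bar> \<le> S) \<and> S\<^sup>2 \<le> 32 * C0 * B y y" for y
      unfolding B_def
    proof (rule curve_energy_bound[OF b(3) _ d(1,3,4)], rule ballI)
      fix y' S v assume "\<forall>v\<in>{c+\<delta>/4..c+3*\<delta>/4}. \<bar>D 0 v \<bullet> y'\<bar> \<le> S" "v \<in> {c..c+\<delta>}"
      from bd[OF this(1) _ this(2), of 1] m show "\<bar>D 1 v \<bullet> y'\<bar> \<le> C0 * S / \<delta>" by simp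
    qed
    \<comment> \<open>Zero energy would make D 0 v . y vanish on the middle half, hence by
      \<open>bd\<close> all derivatives of v \<mapsto> D 0 v . y at c, contradicting nondegeneracy
      there.\<close>
    have pos: "0 < B y y" if y: "y \<noteq> 0" for y
    proof (rule ccontr)
      assume n: "\<not> 0 < B y y"
      obtain S where S: "0 \<le> S" "\<forall>v\<in>{c+\<delta>/4..c+3*\<delta>/4}. \<bar>D 0 v \<bullet> y\<bar> \<le> S" "S\<^sup>2 \<le> 32 * C0 * B y y"
        using en[of y] by (elim exE conjE) (rule that)
      have "32 * C0 * B y y \<le> 0" using n b(3) by (simp add: mult_le_0_iff)
      then have "S\<^sup>2 \<le> 0" using S(3) by linarith
      then have "S = 0" by simp
      obtain k where k: "k \<le> m" "\<kappa>1 * norm y \<le> \<bar>D k c \<bullet> y\<bar>" using \<kappa>1(2) cI by blast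
      have "\<bar>D k c \<bullet> y\<bar> \<le> C0 * S / \<delta> ^ k" using d by (intro bd[OF S(2) k(1)]) auto
      then have "\<kappa>1 * norm y \<le> 0" using k(2) \<open>S = 0\<close> by simp
      then show False using \<kappa>1(1) y by (simp add: mult_le_0_iff)
    qed
    have "\<exists>y::'a \<Rightarrow> 'a. (\<forall>b\<in>Basis. \<forall>b'\<in>Basis. B (y b) (y b') = (if b = b' then 1 else 0)) \<and> span (y ` Basis) = UNIV"
      by (rule bilinear_orthonormal_basis[of B, OF lin sym]) (rule pos)
    then obtain y :: "'a \<Rightarrow> 'a" where y': "(\<forall>b\<in>Basis. \<forall>b'\<in>Basis. B (y b) (y b') = (if b = b' then 1 else 0)) \<and> span (y ` Basis) = UNIV" by (rule exE)
    note y = y'[THEN conjunct1] y'[THEN conjunct2]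
    have yi: "inj (coords y)" by (rule inj_coords[OF y(2)])
    have ybd: "\<bar>D k v \<bullet> y b\<bar> \<le> C / \<delta> ^ k" if k: "k \<le> m" and bB: "b \<in> Basis" and v: "v \<in> {c..c+\<delta>}" for k b v
    proof -
      obtain S where S: "0 \<le> S" "\<forall>v\<in>{c+\<delta>/4..c+3*\<delta>/4}. \<bar>D 0 v \<bullet> y b\<bar> \<le> S" "S\<^sup>2 \<le> 32 * C0 * B (y b) (y b)"
        using en[of "y b"] by (elim exE conjE) (rule that)
      have "S\<^sup>2 \<le> E\<^sup>2" using S(3) y(1) bB E(2) by simp
      then have "S \<le> E" by (rule power2_le_imp_le) (use E(1) in simp)
      have "\<bar>D k v \<bullet> y b\<bar> \<le> C0 * S / \<delta> ^ k" by (rule bd[OF S(2) k v])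
      also have "\<dots> \<le> C / \<delta> ^ k"
        unfolding C_def using \<open>S \<le> E\<close> b d by (intro divide_right_mono mult_left_mono) auto
      finally show ?thesis .
    qed
    have ort: "((\<lambda>v. tent c \<delta> v * (D 0 v \<bullet> y b) * (D 0 v \<bullet> y b')) has_integral (if b = b' then \<delta> else 0)) {c..c + \<delta>}"
      if "b \<in> Basis" "b' \<in> Basis" for b b'
    proof -
      have "integral {c..c+\<delta>} (\<lambda>v. tent c \<delta> v * (D 0 v \<bullet> y b) * (D 0 v \<bullet> y b')) = \<delta> * B (y b) (y b')"
        using d(1) by (simp add: B_def)
      also have "\<dots> = (if b = b' then \<delta> else 0)" using y(1) that by simp
      finally show ?thesis using integrable_integral[OF int, of "y b" "y b'"] by simp
    qed
    have lip: "\<bar>D 0 v \<bullet> y b - D 0 w \<bullet> y b\<bar> \<le> C / \<delta> * \<bar>v - w\<bar>" if bB: "b \<in> Basis" and vw: "v \<in> {c..c+\<delta>}" "w \<in> {c..c+\<delta>}" for b v w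
    proof -
      have mv: "\<bar>D 0 q \<bullet> y b - D 0 r \<bullet> y b\<bar> \<le> C / \<delta> * (q - r)" if r: "r \<in> {c..c+\<delta>}" "q \<in> {c..c+\<delta>}" "r < q" for r q
      proof -
        have "\<alpha> \<le> r" "q \<le> \<beta>" using r d by auto
        then obtain x where x: "x \<in> {r<..<q}" "D 0 q \<bullet> y b - D 0 r \<bullet> y b = (q - r) * (D (Suc 0) x \<bullet> y b)"
          using mvt_inner[OF m, of r q "y b"] r(3) by blast
        have "\<bar>D (Suc 0) x \<bullet> y b\<bar> \<le> C / \<delta> ^ Suc 0" using x(1) r m by (intro ybd bB) auto
        then have "(q - r) * \<bar>D (Suc 0) x \<bullet> y b\<bar> \<le> (q - r) * (C / \<delta>)" using r(3) by (intro mult_left_mono) auto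
        then show ?thesis using x(2) r(3) by (simp add: abs_mult mult.commute)
      qed
      consider "v < w" | "w < v" | "v = w" by linarith
      then show ?thesis
      proof cases
        case 1 then show ?thesis using mv[OF vw 1] by (simp add: abs_minus_commute)
      next
        case 2 then show ?thesis using mv[OF vw(2,1) 2] by simp
      qed simp
    qed
    obtain sel where sel: "inj_on sel Basis" "sel ` Basis \<subseteq> {..m}" "\<And>x. \<kappa> * norm x \<le> norm (frame sel c x)"
      using bspec[OF \<kappa>(2) cI] by (elim exE conjE) (rule that, assumption, assumption, rule spec)
    have "(\<kappa> / (C * DIM('a))) ^ DIM('a) * \<delta> ^ (\<Sum>i<DIM('a) - 1. m - i) \<le> vfac (coords y)"
    proof (rule vfac_coords_lower[OF cI sel(1,2) \<kappa>(1) sel(3) yi])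
      show "\<bar>D k c \<bullet> y b\<bar> \<le> C / \<delta> ^ k" if "k \<le> m" "b \<in> Basis" for k b using d by (intro ybd that) auto
    qed (use C d b in auto)
    moreover have "\<bar>D 0 v \<bullet> y b\<bar> \<le> C" if "b \<in> Basis" "v \<in> {c..c+\<delta>}" for b v using ybd[of 0 b v] that by simp
    ultimately show "\<exists>y. inj (coords y) \<and> (\<kappa> / (C * DIM('a))) ^ DIM('a) * \<delta> ^ (\<Sum>i<DIM('a) - 1. m - i) \<le> vfac (coords y) \<and>
       (\<forall>b\<in>Basis. \<forall>b'\<in>Basis. ((\<lambda>v. tent c \<delta> v * (D 0 v \<bullet> y b) * (D 0 v \<bullet> y b')) has_integral (if b = b' then \<delta> else 0)) {c..c + \<delta>}) \<and>
       (\<forall>b\<in>Basis. \<forall>v\<in>{c..c + \<delta>}. \<bar>D 0 v \<bullet> y b\<bar> \<le> C) \<and>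
       (\<forall>b\<in>Basis. \<forall>v\<in>{c..c + \<delta>}. \<forall>w\<in>{c..c + \<delta>}. \<bar>D 0 v \<bullet> y b - D 0 w \<bullet> y b\<bar> \<le> C / \<delta> * \<bar>v - w\<bar>)"
      using yi ort lip by (intro exI[of _ y] conjI ballI)
  qed
  moreover have "0 < (\<kappa> / (C * DIM('a))) ^ DIM('a)" using \<kappa>(1) C by simp
  ultimately have "0 < \<delta>0 \<and> 1 \<le> C \<and> 0 < (\<kappa> / (C * DIM('a))) ^ DIM('a) \<and> adapted_coords (D 0) \<alpha> \<beta> (\<Sum>i<DIM('a) - 1. m - i) \<delta>0 C ((\<kappa> / (C * DIM('a))) ^ DIM('a))"
    using b(1) C by (intro conjI)
  then show ?thesis by (rule_tac exI[of _ \<delta>0], rule_tac exI[of _ C], rule exI)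
qed

end

section \<open>The space-time curve of the velocity\<close>

lemma nth_deriv_on_Pair:
  fixes a :: "real \<Rightarrow> 'b::euclidean_space"
  assumes ab: "\<alpha> < \<beta>" and cl: "class_C_on m {\<alpha>..\<beta>} a" and "k \<le> m" "v \<in> {\<alpha>..\<beta>}"
  shows "nth_deriv_on {\<alpha>..\<beta>} k (\<lambda>v. (1::real, a v)) v = (if k = 0 then 1 else 0, nth_deriv_on {\<alpha>..\<beta>} k a v)"
  using assms(3,4)
proof (induction k arbitrary: v)
  case (Suc k)
  let ?I = "{\<alpha>..\<beta>}"
  have "nth_deriv_on ?I k a differentiable (at v within ?I)"
    using cl Suc.prems unfolding class_C_on_def by auto
  then have "(nth_deriv_on ?I k a has_vector_derivative nth_deriv_on ?I (Suc k) a v) (at v within ?I)"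
    by (simp add: vector_derivative_works)
  then have "((\<lambda>v. (if k = 0 then 1 else 0 :: real, nth_deriv_on ?I k a v)) has_vector_derivative (0, nth_deriv_on ?I (Suc k) a v)) (at v within ?I)"
    by (intro has_vector_derivative_Pair has_vector_derivative_const)
  then have "(nth_deriv_on ?I k (\<lambda>v. (1::real, a v)) has_vector_derivative (0, nth_deriv_on ?I (Suc k) a v)) (at v within ?I)"
    by (rule has_vector_derivative_transform[OF Suc.prems(2), rotated]) (use Suc in simp)
  from vector_derivative_within_closed_interval[OF ab Suc.prems(2) this] show ?case by simp
qed simp

lemma nondeg_curve_lift:
  fixes a :: "real \<Rightarrow> 'b::euclidean_space"
  assumes ab: "\<alpha> < \<beta>" and m: "0 < m" and cl: "class_C_on m {\<alpha>..\<beta>} a"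
    and sp: "\<And>v. v \<in> {\<alpha>..\<beta>} \<Longrightarrow> span {nth_deriv_on {\<alpha>..\<beta>} k (\<lambda>v. (1::real, a v)) v | k. k \<le> m} = UNIV"
  shows "nondeg_curve (\<lambda>k. nth_deriv_on {\<alpha>..\<beta>} k (\<lambda>v. (1::real, a v))) \<alpha> \<beta> m (1, 0)"
proof
  let ?I = "{\<alpha>..\<beta>}" and ?D = "\<lambda>k. nth_deriv_on {\<alpha>..\<beta>} k (\<lambda>v. (1::real, a v))"
  have P: "?D k v = (if k = 0 then 1 else 0, nth_deriv_on ?I k a v)" if "k \<le> m" "v \<in> ?I" for k v
    by (rule nth_deriv_on_Pair[OF ab cl that])
  show "(?D k has_vector_derivative ?D (Suc k) v) (at v within ?I)" if k: "k < m" and v: "v \<in> ?I" for k v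
  proof -
    have "nth_deriv_on ?I k a differentiable (at v within ?I)"
      using cl k v unfolding class_C_on_def by auto
    then have "(nth_deriv_on ?I k a has_vector_derivative nth_deriv_on ?I (Suc k) a v) (at v within ?I)"
      by (simp add: vector_derivative_works)
    then have "((\<lambda>v. (if k = 0 then 1 else 0 :: real, nth_deriv_on ?I k a v)) has_vector_derivative (0, nth_deriv_on ?I (Suc k) a v)) (at v within ?I)"
      by (intro has_vector_derivative_Pair has_vector_derivative_const)
    moreover have "?D (Suc k) v = (0, nth_deriv_on ?I (Suc k) a v)" using P[of "Suc k" v] k v by simp
    ultimately have "((\<lambda>v. (if k = 0 then 1 else 0 :: real, nth_deriv_on ?I k a v)) has_vector_derivative ?D (Suc k) v) (at v within ?I)"
      by (simp only:)
    then show ?thesis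
      by (rule has_vector_derivative_transform[OF v, rotated]) (use P k in simp)
  qed
  show "continuous_on ?I (?D k)" if k: "k \<le> m" for k
  proof -
    have "continuous_on ?I (nth_deriv_on ?I k a)" using cl k unfolding class_C_on_def by auto
    then have "continuous_on ?I (\<lambda>v. (if k = 0 then 1 else 0 :: real, nth_deriv_on ?I k a v))"
      by (intro continuous_on_Pair continuous_on_const)
    then show ?thesis by (rule continuous_on_eq) (use P[OF k] in simp)
  qed
  show "?D k v \<bullet> (1, 0) = 0" if "0 < k" "k \<le> m" "v \<in> ?I" for k v using P[OF that(2,3)] that(1) by simp
  show "span {?D k v | k. k \<le> m} = UNIV" if "v \<in> ?I" for v by (rule sp[OF that])
  show "\<alpha> < \<beta>" "0 < m" "(1::real, 0::'b) \<noteq> 0" using ab m by (auto simp: zero_prod_def)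
qed

subsection \<open>Entropies and test functions\<close>

text \<open>The space-time flux of the entropy whose derivative is \<open>g\<close>, for
  \<open>g\<close> vanishing below \<open>c\<close>: when \<open>av\<close> has first component 1,
  the first component is the entropy itself and the second its spatial flux. Truncation at
  \<open>\<beta>\<close> makes it continuous on the whole line although \<open>av\<close> is
  controlled only on the range of the solution.\<close>

definition flux :: "real \<Rightarrow> real \<Rightarrow> (real \<Rightarrow> 'a::euclidean_space) \<Rightarrow> (real \<Rightarrow> real) \<Rightarrow> real \<Rightarrow> 'a" where
  "flux c \<beta> av g v = integral {c..min v \<beta>} (\<lambda>s. g s *\<^sub>R av s)"

locale kinetic_solution =
  fixes \<alpha> \<beta> :: real and av :: "real \<Rightarrow> real \<times> (real^'n)" and w :: "real \<times> (real^'n) \<Rightarrow> real"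
    and u :: "real \<Rightarrow> real^'n \<Rightarrow> real"
  assumes zero_range: "\<alpha> \<le> 0" "0 \<le> \<beta>" "\<alpha> < \<beta>"
    and av_cont: "continuous_on {\<alpha>..\<beta>} av"
    and av_fst: "\<And>v. v \<in> {\<alpha>..\<beta>} \<Longrightarrow> fst (av v) = 1"
    and w_meas [measurable]: "w \<in> borel_measurable borel"
    and w_range: "\<And>p. w p \<in> {\<alpha>..\<beta>}"
    and u_int: "\<And>t. 0 \<le> t \<Longrightarrow> integrable lebesgue (u t)"
    and u_cont: "\<And>s. 0 \<le> s \<Longrightarrow> ((\<lambda>t. L1_norm (\<lambda>x. u t x - u s x)) \<longlongrightarrow> 0) (at s within {0..})"
    and u_w: "AE t in lborel. 0 < t \<longrightarrow> (AE x in lborel. w (t, x) = u t x)"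
    and entropy: "\<And>c g \<psi>. 0 \<le> c \<Longrightarrow> c \<le> \<beta> \<Longrightarrow> continuous_on UNIV g \<Longrightarrow> mono g \<Longrightarrow> (\<And>s. s \<le> c \<Longrightarrow> g s = 0) \<Longrightarrow>
       test_function \<psi> \<Longrightarrow> 0 \<le> (LINT p|lborel. frechet_derivative \<psi> (at p) (flux c \<beta> av g (w p)))"

lemma fst_flux:
  assumes "continuous_on {c..\<beta>} g" "continuous_on {c..\<beta>} av" "\<And>v. v \<in> {c..\<beta>} \<Longrightarrow> fst (av v) = 1" "v \<le> \<beta>"
  shows "fst (flux c \<beta> av g v) = integral {c..v} g"
proof -
  have s: "{c..v} \<subseteq> {c..\<beta>}" using assms(4) by auto
  have "(\<lambda>s. g s *\<^sub>R av s) integrable_on {c..v}"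
    by (intro integrable_continuous_real continuous_intros continuous_on_subset[OF assms(1) s] continuous_on_subset[OF assms(2) s])
  from integral_linear[OF this bounded_linear_fst]
  have "fst (integral {c..v} (\<lambda>s. g s *\<^sub>R av s)) = integral {c..v} (\<lambda>s. fst (g s *\<^sub>R av s))" by (simp add: o_def)
  also have "\<dots> = integral {c..v} g"
    by (intro Henstock_Kurzweil_Integration.integral_cong) (use assms(3) s in auto)
  finally show ?thesis using assms(4) by (simp add: flux_def min_absorb1)
qed

lemma flux_continuous:
  assumes "continuous_on {c..\<beta>} g" "continuous_on {c..\<beta>} av" "c \<le> \<beta>"
  shows "continuous_on UNIV (flux c \<beta> av g)"
proof -
  have "continuous_on {c..\<beta>} (\<lambda>x. integral {c..x} (\<lambda>s. g s *\<^sub>R av s))"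
    by (intro indefinite_integral_continuous_1 integrable_continuous_real continuous_intros assms)
  then have "continuous_on UNIV (\<lambda>v. integral {c..max c (min v \<beta>)} (\<lambda>s. g s *\<^sub>R av s))"
    by (rule continuous_on_compose2) (use assms(3) in \<open>auto intro!: continuous_intros\<close>)
  moreover have "integral {c..max c (min v \<beta>)} (\<lambda>s. g s *\<^sub>R av s) = flux c \<beta> av g v" for v
    by (cases "c \<le> min v \<beta>") (auto simp: flux_def max_def)
  ultimately show ?thesis by (simp cong: continuous_on_cong)
qed

lemma ramp_derivative:
  fixes g :: "real \<Rightarrow> real"
  assumes g: "continuous_on UNIV g" "\<And>s. s \<le> c \<Longrightarrow> g s = 0"
  shows "((\<lambda>v. integral {c..v} g) has_real_derivative g v) (at v)"
proof -
  define L where "L = min c v - 1"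
  have gc: "continuous_on S g" for S using g(1) continuous_on_subset by blast
  have e: "integral {L..x} g = integral {c..x} g" if "L \<le> x" for x
  proof (cases "c \<le> x")
    case True
    have "integral {L..c} g + integral {c..x} g = integral {L..x} g"
      by (intro Henstock_Kurzweil_Integration.integral_combine integrable_continuous_real gc) (use True in \<open>auto simp: L_def\<close>)
    moreover have "integral {L..c} g = integral {L..c} (\<lambda>_. 0)"
      by (intro Henstock_Kurzweil_Integration.integral_cong) (simp add: g(2))
    ultimately show ?thesis by simp
  next
    case False
    have "integral {L..x} g = integral {L..x} (\<lambda>_. 0)"
      by (intro Henstock_Kurzweil_Integration.integral_cong) (use False g(2) in auto)
    then show ?thesis using False by simp
  qed
  have vL: "L < v" by (simp add: L_def)
  have "((\<lambda>x. integral {L..x} g) has_real_derivative g v) (at v within {L..v+1})"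
    by (rule integral_has_real_derivative[OF gc]) (use vL in auto)
  then have "((\<lambda>x. integral {L..x} g) has_real_derivative g v) (at v)"
    by (subst (asm) at_within_interior) (use vL in auto)
  moreover have "eventually (\<lambda>x. integral {c..x} g = integral {L..x} g) (nhds v)"
    using eventually_nhds_in_open[of "{L<..}" v] vL by (auto elim!: eventually_mono simp: e)
  ultimately show ?thesis by (subst DERIV_cong_ev[OF refl _ refl]) auto
qed

lemma entropy_flux_pair_ramp:
  fixes A a :: "real \<Rightarrow> real^'n"
  assumes ab: "\<alpha> < \<beta>" "\<alpha> \<le> c" and A: "\<And>v. v \<in> {\<alpha>..\<beta>} \<Longrightarrow> (A has_vector_derivative a v) (at v within {\<alpha>..\<beta>})"
    and ac: "continuous_on {\<alpha>..\<beta>} a" and g: "continuous_on UNIV g" "mono g" "\<And>s. s \<le> c \<Longrightarrow> g s = 0"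
  shows "entropy_flux_pair_on {\<alpha>..\<beta>} A (\<lambda>v. integral {c..v} g) (\<lambda>v. snd (flux c \<beta> (\<lambda>s. (1::real, a s)) g v))"
proof -
  have gc: "continuous_on S g" for S using g(1) continuous_on_subset by blast
  have d: "((\<lambda>v. integral {c..v} g) has_real_derivative g v) (at v)" for v by (rule ramp_derivative[OF g(1,3)])
  have conv: "convex_on UNIV (\<lambda>v. integral {c..v} g)"
    by (rule convex_on_realI[of _ _ g]) (use d g(2) in \<open>auto simp: mono_def\<close>)
  have snd_eq: "snd (flux c \<beta> (\<lambda>s. (1::real, a s)) g v) = integral {\<alpha>..v} (\<lambda>s. g s *\<^sub>R a s)" if v: "v \<in> {\<alpha>..\<beta>}" for v
  proof -
    have i1: "(\<lambda>s. g s *\<^sub>R a s) integrable_on {p..q}" if "\<alpha> \<le> p" "q \<le> \<beta>" for p q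
      by (intro integrable_continuous_real continuous_intros gc continuous_on_subset[OF ac]) (use that in auto)
    have z: "integral {\<alpha>..q} (\<lambda>s. g s *\<^sub>R a s) = 0" if "q \<le> c" for q
    proof -
      have "integral {\<alpha>..q} (\<lambda>s. g s *\<^sub>R a s) = integral {\<alpha>..q} (\<lambda>s. 0)"
        by (intro Henstock_Kurzweil_Integration.integral_cong) (use that g(3) in auto)
      then show ?thesis by simp
    qed
    have "(\<lambda>s. g s *\<^sub>R (1::real, a s)) integrable_on {c..v}"
      by (intro integrable_continuous_real continuous_intros gc continuous_on_subset[OF ac]) (use v ab in auto)
    from integral_linear[OF this bounded_linear_snd]
    have "snd (flux c \<beta> (\<lambda>s. (1::real, a s)) g v) = integral {c..v} (\<lambda>s. g s *\<^sub>R a s)"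
      using v by (simp add: o_def flux_def min_absorb1)
    also have "\<dots> = integral {\<alpha>..v} (\<lambda>s. g s *\<^sub>R a s)"
    proof (cases "c \<le> v")
      case True
      have "integral {\<alpha>..c} (\<lambda>s. g s *\<^sub>R a s) + integral {c..v} (\<lambda>s. g s *\<^sub>R a s) = integral {\<alpha>..v} (\<lambda>s. g s *\<^sub>R a s)"
        by (intro Henstock_Kurzweil_Integration.integral_combine i1) (use True ab v in auto)
      then show ?thesis using z[of c] by simp
    next
      case False
      then show ?thesis using z[of v] by simp
    qed
    finally show ?thesis .
  qed
  have dq: "((\<lambda>v. snd (flux c \<beta> (\<lambda>s. (1::real, a s)) g v)) has_vector_derivative g v *\<^sub>R a v) (at v within {\<alpha>..\<beta>})"
    if v: "v \<in> {\<alpha>..\<beta>}" for v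
  proof -
    have "((\<lambda>v. integral {\<alpha>..v} (\<lambda>s. g s *\<^sub>R a s)) has_vector_derivative g v *\<^sub>R a v) (at v within {\<alpha>..\<beta>})"
      by (rule integral_has_vector_derivative[OF _ v]) (intro continuous_intros gc ac)
    then show ?thesis by (rule has_vector_derivative_transform[OF v, rotated]) (simp add: snd_eq)
  qed
  have dA: "vector_derivative A (at v within {\<alpha>..\<beta>}) = a v" if v: "v \<in> {\<alpha>..\<beta>}" for v
    by (rule vector_derivative_within_closed_interval[OF ab(1) v A[OF v]])
  show ?thesis unfolding entropy_flux_pair_on_def
  proof (intro conjI ballI allI impI conv)
    show "continuous_on {\<alpha>..\<beta>} (\<lambda>v. snd (flux c \<beta> (\<lambda>s. (1::real, a s)) g v))"
      by (rule continuous_on_vector_derivative[OF dq])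
    fix v D assume v: "v \<in> {\<alpha>..\<beta>}" and D: "((\<lambda>v. integral {c..v} g) has_real_derivative D) (at v)"
    have "D = g v" by (rule DERIV_unique[OF D d])
    then show "((\<lambda>v. snd (flux c \<beta> (\<lambda>s. (1::real, a s)) g v)) has_vector_derivative D *\<^sub>R vector_derivative A (at v within {\<alpha>..\<beta>})) (at v within {\<alpha>..\<beta>})"
      using dq[OF v] dA[OF v] by simp
  qed
qed

lemma test_function_frechet:
  fixes \<psi> :: "real \<times> (real^'n) \<Rightarrow> real"
  assumes "smooth \<psi>"
  shows "frechet_derivative \<psi> (at p) (s, x) = s * time_deriv \<psi> p + x \<bullet> space_grad \<psi> p"
proof -
  interpret linear "frechet_derivative \<psi> (at p)"
    using smooth_has_derivative[OF assms] has_derivative_linear by blast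
  have "(s, x) = s *\<^sub>R (1, 0) + (\<Sum>i\<in>UNIV. (x $ i) *\<^sub>R (0, axis i 1))"
    by (simp add: prod_eq_iff fst_sum snd_sum basis_expansion flip: scalar_mult_eq_scaleR)
  then have "frechet_derivative \<psi> (at p) (s, x) = frechet_derivative \<psi> (at p) (s *\<^sub>R (1, 0) + (\<Sum>i\<in>UNIV. (x $ i) *\<^sub>R (0, axis i 1)))"
    by (rule arg_cong)
  also have "\<dots> = s * frechet_derivative \<psi> (at p) (1, 0) + (\<Sum>i\<in>UNIV. x $ i * frechet_derivative \<psi> (at p) (0, axis i 1))"
    by (simp only: add sum scale real_scaleR_def)
  finally show ?thesis by (simp add: time_deriv_def space_grad_def inner_vec_def)
qed

lemma AE_lebesgue_on_iff:
  assumes "S \<in> sets lebesgue"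
  shows "(AE p in lebesgue_on S. P p) \<longleftrightarrow> (AE p in lborel. p \<in> S \<longrightarrow> P p)"
  using assms by (simp add: AE_restrict_space_iff AE_completion_iff)

lemma const_not_integrable:
  fixes f :: "'a::euclidean_space \<Rightarrow> real"
  assumes f: "integrable lebesgue f" and e: "0 < e" "AE x in lborel. e \<le> \<bar>f x\<bar>"
  shows False
proof -
  have "integrable lebesgue (\<lambda>x::'a. e)"
    by (rule Bochner_Integration.integrable_bound[OF f]) (use e in \<open>auto simp: AE_completion_iff\<close>)
  then have "integrable lborel (\<lambda>x::'a. e)" by (simp add: integrable_completion)
  then show False using e(1) by (simp add: integrable_iff_bounded ennreal_mult_eq_top_iff ennreal_eq_0_iff emeasure_lborel_UNIV less_top[symmetric])
qed

text \<open>Some time slice takes its values in the interval almost everywhere. A function bounded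
  away from zero is not integrable over a space of infinite measure, so the interval must reach
  0.\<close>

lemma entropy_solution_range_zero:
  assumes ab: "\<alpha> < \<beta>" and sol: "entropy_solution_in {\<alpha>..\<beta>} A u\<^sub>0 u"
  shows "\<alpha> \<le> 0" "0 \<le> \<beta>"
proof -
  let ?S = "{0..} \<times> UNIV :: (real \<times> (real^'n)) set"
  have S: "?S \<in> sets lebesgue" by (intro sets_completionI_sets) (auto intro!: borel_closed closed_Times)
  have "AE p in lborel. p \<in> ?S \<longrightarrow> u (fst p) (snd p) \<in> {\<alpha>..\<beta>}"
    using sol unfolding entropy_solution_in_def AE_lebesgue_on_iff[OF S] by blast
  then have "AE p in lborel \<Otimes>\<^sub>M lborel. p \<in> ?S \<longrightarrow> u (fst p) (snd p) \<in> {\<alpha>..\<beta>}" by (simp only: lborel_prod)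
  from lborel_pair.AE_pair[OF this] have ae: "AE t in lborel. AE x in lborel. 0 \<le> t \<longrightarrow> u t x \<in> {\<alpha>..\<beta>}" by simp
  have "\<exists>t\<ge>0. AE x in lborel. u t x \<in> {\<alpha>..\<beta>}"
  proof (rule ccontr)
    assume neg: "\<not> ?thesis"
    have "AE t in (lborel::real measure). \<not> (0 \<le> t)"
      using ae
    proof eventually_elim
      case (elim t)
      then show ?case using neg by auto
    qed
    then have "emeasure lborel {0..1::real} = 0"
      by (intro AE_iff_measurable[THEN iffD1, of _ _ "\<lambda>t. \<not> (t \<in> {0..1})"]) (auto elim: eventually_mono)
    then show False by simp
  qed
  then obtain t where t: "t \<ge> 0" "AE x in lborel. u t x \<in> {\<alpha>..\<beta>}" by blast
  have int: "integrable lebesgue (u t)" using sol t(1) unfolding entropy_solution_in_def by blast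
  show "\<alpha> \<le> 0"
  proof (rule ccontr)
    assume "\<not> \<alpha> \<le> 0"
    then show False using t(2) by (intro const_not_integrable[OF int, of \<alpha>]) (auto elim!: eventually_mono)
  qed
  show "0 \<le> \<beta>"
  proof (rule ccontr)
    assume "\<not> 0 \<le> \<beta>"
    moreover have "AE x in lborel. - \<beta> \<le> \<bar>u t x\<bar>"
      using t(2) by eventually_elim (simp, linarith)
    ultimately show False by (intro const_not_integrable[OF int, of "- \<beta>"]) auto
  qed
qed

lemma smooth_borel_measurable: "smooth f \<Longrightarrow> f \<in> borel_measurable borel"
  by (rule borel_measurable_continuous_onI[OF smooth_continuous])

lemma test_function_off_support:
  assumes "test_function \<psi>" "fst p \<le> 0"
  shows "frechet_derivative \<psi> (at p) h = 0"
proof -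
  let ?K = "closure {p. \<psi> p \<noteq> 0}"
  have "p \<notin> ?K" using assms unfolding test_function_def by (auto simp: mem_Times_iff)
  moreover have "open (- ?K)" by (rule open_Compl[OF closed_closure])
  ultimately have "(\<psi> has_derivative (\<lambda>_. 0)) (at p)"
    by (intro has_derivative_transform_within_open[OF has_derivative_const[of 0], of "- ?K"])
       (use closure_subset[of "{p. \<psi> p \<noteq> 0}"] in auto)
  from fun_cong[OF frechet_derivative_at[OF this], of h] show ?thesis by simp
qed

lemma frechet_flux_measurable:
  assumes "smooth \<psi>" "continuous_on UNIV F" "w \<in> borel_measurable borel"
  shows "(\<lambda>p. frechet_derivative \<psi> (at p) (F (w p))) \<in> borel_measurable borel"
proof -
  have [measurable]: "(\<lambda>p. F (w p)) \<in> borel_measurable borel"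
    by (rule borel_measurable_continuous_on[OF assms(2,3)])
  have [measurable]: "pderiv_dir b \<psi> \<in> borel_measurable borel" for b
    by (intro smooth_borel_measurable smooth_pderiv_dir assms)
  have "(\<lambda>p. \<Sum>b\<in>Basis. (F (w p) \<bullet> b) * pderiv_dir b \<psi> p) \<in> borel_measurable borel" by measurable
  then show ?thesis
    by (subst frechet_derivative_basis_expansion[OF smooth_differentiable[OF assms(1)]])
qed

text \<open>Completeness of Lebesgue measure provides a Borel function equal to u almost everywhere.
  Derivatives of test functions vanish for t \<le> 0, so the entropy integral may be taken over all
  of space-time, whatever values \<open>w\<close> has there.\<close>

lemma entropy_solution_kinetic:
  fixes A a :: "real \<Rightarrow> real^'n"
  assumes ab: "\<alpha> < \<beta>" and A: "\<And>v. v \<in> {\<alpha>..\<beta>} \<Longrightarrow> (A has_vector_derivative a v) (at v within {\<alpha>..\<beta>})"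
    and ac: "continuous_on {\<alpha>..\<beta>} a" and sol: "entropy_solution_in {\<alpha>..\<beta>} A u\<^sub>0 u"
  shows "\<exists>w. kinetic_solution \<alpha> \<beta> (\<lambda>v. (1, a v)) w u"
proof -
  let ?S = "{0..} \<times> UNIV :: (real \<times> (real^'n)) set" and ?O = "{0<..} \<times> UNIV :: (real \<times> (real^'n)) set"
  have S: "?S \<in> sets lebesgue" by (intro sets_completionI_sets) (auto intro!: borel_closed closed_Times)
  have O: "?O \<in> sets lebesgue" by (intro sets_completionI_sets) (auto intro!: borel_open open_Times)
  have sol_m: "(\<lambda>p. u (fst p) (snd p)) \<in> borel_measurable (lebesgue_on ?S)"
    and sol_r: "AE p in lebesgue_on ?S. u (fst p) (snd p) \<in> {\<alpha>..\<beta>}"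
    and sol_i: "\<And>t. 0 \<le> t \<Longrightarrow> integrable lebesgue (u t)"
    and sol_c: "\<And>s. 0 \<le> s \<Longrightarrow> ((\<lambda>t. L1_norm (\<lambda>x. u t x - u s x)) \<longlongrightarrow> 0) (at s within {0..})"
    and sol_e: "\<And>\<eta> q \<phi>. entropy_flux_pair_on {\<alpha>..\<beta>} A \<eta> q \<Longrightarrow> test_function \<phi> \<Longrightarrow>
        0 \<le> (LINT p|lebesgue_on ?O. \<eta> (u (fst p) (snd p)) * time_deriv \<phi> p + q (u (fst p) (snd p)) \<bullet> space_grad \<phi> p)"
    using sol unfolding entropy_solution_in_def by blast+
  define f where "f p = (if p \<in> ?S then u (fst p) (snd p) else 0)" for p
  have fm: "f \<in> borel_measurable lebesgue"
    unfolding f_def[abs_def] by (rule borel_measurable_if_I[OF sol_m S])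
  from completion_ex_borel_measurable_real[OF fm] obtain g where g: "g \<in> borel_measurable lborel" "AE p in lborel. f p = g p" by blast
  have gm [measurable]: "g \<in> borel_measurable borel" using g(1) by simp
  note zr = entropy_solution_range_zero[OF ab sol]
  \<comment> \<open>Exceptional values and nonpositive times are reset to 0, which is admissible
    because 0 lies in the range.\<close>
  define w where "w p = (if 0 < fst p \<and> g p \<in> {\<alpha>..\<beta>} then g p else 0)" for p
  have [measurable]: "(fst :: real \<times> (real^'n) \<Rightarrow> real) \<in> borel_measurable borel"
    by (intro borel_measurable_continuous_onI continuous_on_fst continuous_on_id)
  have wm [measurable]: "w \<in> borel_measurable borel" unfolding w_def[abs_def] atLeastAtMost_iff by measurable
  have wr: "w p \<in> {\<alpha>..\<beta>}" for p using zr by (auto simp: w_def)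
  have wf: "AE p in lborel. 0 < fst p \<longrightarrow> w p = u (fst p) (snd p)"
    using g(2) sol_r[unfolded AE_lebesgue_on_iff[OF S]]
  proof eventually_elim
    case (elim p)
    then show ?case by (auto simp: w_def f_def mem_Times_iff)
  qed
  have "AE p in lborel \<Otimes>\<^sub>M lborel. 0 < fst p \<longrightarrow> w p = u (fst p) (snd p)" using wf by (simp only: lborel_prod)
  from lborel_pair.AE_pair[OF this] have uw: "AE t in lborel. 0 < t \<longrightarrow> (AE x in lborel. w (t, x) = u t x)"
    by (auto elim!: eventually_mono)
  have ent: "0 \<le> (LINT p|lborel. frechet_derivative \<psi> (at p) (flux c \<beta> (\<lambda>v. (1, a v)) g' (w p)))"
    if c: "0 \<le> c" "c \<le> \<beta>" and g': "continuous_on UNIV g'" "mono g'" "\<And>s. s \<le> c \<Longrightarrow> g' s = 0" and \<psi>: "test_function \<psi>" for c g' \<psi>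
  proof -
    have \<psi>s: "smooth \<psi>" using \<psi> by (simp add: test_function_def)
    define F where "F = flux c \<beta> (\<lambda>v. (1::real, a v)) g'"
    define \<eta> where "\<eta> v = integral {c..v} g'" for v
    define q where "q v = snd (F v)" for v
    have avc: "continuous_on {c..\<beta>} (\<lambda>v. (1::real, a v))"
      by (intro continuous_on_Pair continuous_on_const continuous_on_subset[OF ac]) (use c zr in auto)
    have gc: "continuous_on {c..\<beta>} g'" by (rule continuous_on_subset[OF g'(1) subset_UNIV])
    have Fc: "continuous_on UNIV F" unfolding F_def by (rule flux_continuous[OF gc avc c(2)])
    have \<eta>c: "continuous_on UNIV \<eta>" unfolding \<eta>_def[abs_def]
      by (auto simp: continuous_on_eq_continuous_within intro: DERIV_isCont[OF ramp_derivative[OF g'(1,3)]])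
    have qc: "continuous_on UNIV q" unfolding q_def[abs_def] by (intro continuous_on_snd Fc)
    have Feq: "F v = (\<eta> v, q v)" if "v \<in> {\<alpha>..\<beta>}" for v
      using fst_flux[OF gc avc, of v] that by (simp add: F_def \<eta>_def q_def prod_eq_iff)
    have pair: "entropy_flux_pair_on {\<alpha>..\<beta>} A \<eta> q"
      unfolding \<eta>_def[abs_def] q_def[abs_def] F_def
      by (rule entropy_flux_pair_ramp[OF ab _ A ac g']) (use zr c in auto)
    define Y where "Y p = frechet_derivative \<psi> (at p) (F (w p))" for p
    have Ym: "Y \<in> borel_measurable borel" unfolding Y_def[abs_def] by (rule frechet_flux_measurable[OF \<psi>s Fc wm])
    have fm' [measurable]: "f \<in> borel_measurable lebesgue" by (rule fm)
    have td: "time_deriv \<psi> \<in> borel_measurable lebesgue"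
      using smooth_borel_measurable[OF smooth_pderiv_dir[OF \<psi>s, of "(1, 0)"]] by (simp add: time_deriv_def[abs_def] measurable_completion)
    have sg: "space_grad \<psi> \<in> borel_measurable lebesgue"
    proof (rule measurable_completion)
      have "(\<lambda>p. \<chi> i. frechet_derivative \<psi> (at p) (0, axis i 1)) \<in> borel_measurable borel"
        by (intro borel_measurable_continuous_onI continuous_on_vec_lambda smooth_continuous smooth_pderiv_dir \<psi>s)
      then show "space_grad \<psi> \<in> borel_measurable lborel" by (simp add: space_grad_def[abs_def])
    qed
    have [measurable]: "(\<lambda>p. \<eta> (f p)) \<in> borel_measurable lebesgue" "(\<lambda>p. q (f p)) \<in> borel_measurable lebesgue"
      by (intro borel_measurable_continuous_on[OF _ fm] \<eta>c qc)+
    note [measurable] = td sg O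
    have "0 \<le> (LINT p|lebesgue_on ?O. \<eta> (u (fst p) (snd p)) * time_deriv \<psi> p + q (u (fst p) (snd p)) \<bullet> space_grad \<psi> p)"
      by (rule sol_e[OF pair \<psi>])
    also have "\<dots> = (LINT p|lebesgue_on ?O. \<eta> (f p) * time_deriv \<psi> p + q (f p) \<bullet> space_grad \<psi> p)"
      by (rule Bochner_Integration.integral_cong) (auto simp: f_def)
    also have "\<dots> = (LINT p|lebesgue. indicator ?O p *\<^sub>R (\<eta> (f p) * time_deriv \<psi> p + q (f p) \<bullet> space_grad \<psi> p))"
      by (rule integral_restrict_space) (use O in simp)
    also have "\<dots> = (LINT p|lebesgue. Y p)"
    proof (rule integral_cong_AE)
      show "(\<lambda>p. indicator ?O p *\<^sub>R (\<eta> (f p) * time_deriv \<psi> p + q (f p) \<bullet> space_grad \<psi> p)) \<in> borel_measurable lebesgue" by measurable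
      show "Y \<in> borel_measurable lebesgue" using Ym by (simp add: measurable_completion)
      show "AE p in lebesgue. indicator ?O p *\<^sub>R (\<eta> (f p) * time_deriv \<psi> p + q (f p) \<bullet> space_grad \<psi> p) = Y p"
        unfolding AE_completion_iff using wf
      proof eventually_elim
        case (elim p)
        show ?case
        proof (cases "0 < fst p")
          case True
          then have e: "f p = w p" using elim by (simp add: f_def mem_Times_iff)
          have "Y p = frechet_derivative \<psi> (at p) (\<eta> (w p), q (w p))" by (simp add: Y_def Feq[OF wr])
          also have "\<dots> = \<eta> (f p) * time_deriv \<psi> p + q (f p) \<bullet> space_grad \<psi> p" by (simp add: test_function_frechet[OF \<psi>s] e)
          finally show ?thesis using True by (simp add: mem_Times_iff)
        next
          case False
          then show ?thesis using test_function_off_support[OF \<psi>, of p] by (simp add: Y_def mem_Times_iff)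
        qed
      qed
    qed
    also have "\<dots> = (LINT p|lborel. Y p)" using Ym by (intro integral_completion) simp
    finally show ?thesis by (simp add: Y_def F_def)
  qed
  have "kinetic_solution \<alpha> \<beta> (\<lambda>v. (1, a v)) w u"
  proof
    show "continuous_on {\<alpha>..\<beta>} (\<lambda>v. (1::real, a v))" by (intro continuous_on_Pair continuous_on_const ac)
  qed (use zr ab wm wr sol_i sol_c uw ent in auto)
  then show ?thesis by blast
qed

subsection \<open>Decrease of the truncated mass\<close>

definition clip :: "real \<Rightarrow> real \<Rightarrow> real \<Rightarrow> real" where "clip c \<delta> s = max 0 (min 1 ((s - c) / \<delta>))"
text \<open>A regularisation, with Lipschitz derivative \<open>clip\<close>, of the positive part of
  v - c. It lies between the positive parts of v - c - \<delta> and of v - c, so that a higher level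
  can be compared with a lower one across a band.\<close>

definition kappa :: "real \<Rightarrow> real \<Rightarrow> real \<Rightarrow> real" where "kappa c \<delta> v = integral {c..v} (clip c \<delta>)"

lemma clip_continuous: "continuous_on S (clip c \<delta>)"
  unfolding clip_def[abs_def] divide_inverse by (intro continuous_intros)

lemma clip_bounds: "0 \<le> clip c \<delta> s" "clip c \<delta> s \<le> 1"
  by (auto simp: clip_def)

lemma clip_mono: "\<delta> > 0 \<Longrightarrow> mono (clip c \<delta>)"
proof (rule monoI)
  fix x y :: real assume "\<delta> > 0" "x \<le> y"
  then have "(x - c) / \<delta> \<le> (y - c) / \<delta>" by (intro divide_right_mono) auto
  then show "clip c \<delta> x \<le> clip c \<delta> y" unfolding clip_def by (simp add: max_def min_def)
qed

lemma clip_zero: "\<delta> > 0 \<Longrightarrow> s \<le> c \<Longrightarrow> clip c \<delta> s = 0"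
  using divide_nonpos_pos[of "s - c" \<delta>] by (simp add: clip_def)

lemma clip_one: "\<delta> > 0 \<Longrightarrow> c + \<delta> \<le> s \<Longrightarrow> clip c \<delta> s = 1"
  by (simp add: clip_def le_divide_eq)

lemma kappa_deriv: "\<delta> > 0 \<Longrightarrow> (kappa c \<delta> has_real_derivative clip c \<delta> v) (at v)"
  unfolding kappa_def[abs_def] by (rule ramp_derivative[OF clip_continuous clip_zero])

lemma kappa_zero: "v \<le> c \<Longrightarrow> kappa c \<delta> v = 0"
  by (cases "v = c") (auto simp: kappa_def)

lemma kappa_diff:
  assumes "\<delta> > 0" "v \<le> v'"
  shows "0 \<le> kappa c \<delta> v' - kappa c \<delta> v" "kappa c \<delta> v' - kappa c \<delta> v \<le> v' - v"
proof -
  have "0 \<le> kappa c \<delta> v' - kappa c \<delta> v \<and> kappa c \<delta> v' - kappa c \<delta> v \<le> v' - v"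
  proof (cases "v = v'")
    case False
    then have lt: "v < v'" using assms by simp
    from MVT2[OF lt kappa_deriv[OF assms(1)], of c] obtain z where
      z: "kappa c \<delta> v' - kappa c \<delta> v = (v' - v) * clip c \<delta> z" by blast
    have "(v' - v) * clip c \<delta> z \<le> (v' - v) * 1" using lt clip_bounds by (intro mult_left_mono) auto
    then show ?thesis using z lt clip_bounds(1)[of c \<delta> z] by simp
  qed simp
  then show "0 \<le> kappa c \<delta> v' - kappa c \<delta> v" "kappa c \<delta> v' - kappa c \<delta> v \<le> v' - v" by auto
qed

lemma kappa_lipschitz: assumes "\<delta> > 0" shows "\<bar>kappa c \<delta> v - kappa c \<delta> v'\<bar> \<le> \<bar>v - v'\<bar>"
  using kappa_diff[OF assms, of v v' c] kappa_diff[OF assms, of v' v c] by (cases "v \<le> v'") auto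

lemma kappa_nonneg: assumes "\<delta> > 0" shows "0 \<le> kappa c \<delta> v"
  using kappa_diff(1)[OF assms, of c v c] kappa_zero[of c c \<delta>] kappa_zero[of v c \<delta>] by (cases "c \<le> v") auto

lemma kappa_le: assumes "\<delta> > 0" shows "kappa c \<delta> v \<le> max 0 (v - c)"
  using kappa_diff(2)[OF assms, of c v c] kappa_zero[of c c \<delta>] kappa_zero[of v c \<delta>] by (cases "c \<le> v") auto

lemma kappa_le_abs: assumes "\<delta> > 0" "0 \<le> c" shows "kappa c \<delta> v \<le> \<bar>v\<bar>"
  using kappa_le[OF assms(1), of c v] assms(2) by auto

lemma kappa_ge: assumes "\<delta> > 0" shows "v - c - \<delta> \<le> kappa c \<delta> v"
proof (cases "c + \<delta> < v")
  case True
  from MVT2[OF True kappa_deriv[OF assms], of c] obtain z where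
    z: "c + \<delta> < z" "kappa c \<delta> v - kappa c \<delta> (c + \<delta>) = (v - (c + \<delta>)) * clip c \<delta> z" by blast
  then show ?thesis using kappa_nonneg[OF assms, of c "c + \<delta>"] clip_one[OF assms, of c z] by simp
next
  case False
  then show ?thesis using kappa_nonneg[OF assms, of c v] by simp
qed

lemma kappa_continuous: "\<delta> > 0 \<Longrightarrow> continuous_on S (kappa c \<delta>)"
  using kappa_deriv by (blast intro: DERIV_continuous_on has_field_derivative_at_within)

lemma kappa_measurable: "\<delta> > 0 \<Longrightarrow> kappa c \<delta> \<in> borel_measurable borel"
  by (rule borel_measurable_continuous_onI[OF kappa_continuous])

section \<open>Cut-off functions in space and time\<close>

lemma step'_bounded: "\<exists>Z\<ge>1. \<forall>x. step' x \<le> Z"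
proof -
  have "continuous_on {0..1} step'" by (rule continuous_on_subset[OF smooth_continuous[OF smooth_step'] subset_UNIV])
  then obtain m where m: "\<And>x. x \<in> {0..1} \<Longrightarrow> step' x \<le> step' m"
    using continuous_attains_sup[of "{0..1::real}" step'] by fastforce
  have "step' x \<le> max 1 (step' m)" for x
    using m[of x] step'_zero[of x] by (cases "x \<in> {0..1}") auto
  then show ?thesis by (intro exI[of _ "max 1 (step' m)"]) auto
qed

definition zeta :: "real \<Rightarrow> 'a::euclidean_space \<Rightarrow> real" where
  "zeta R x = 1 - step ((1 / R\<^sup>2) * (x \<bullet> x) - 1)"

lemma smooth_zeta: "smooth (zeta R)"
  unfolding zeta_def[abs_def]
  by (intro smooth_diff smooth_const smooth_compose_real[OF smooth_step] smooth_cmult smooth_norm_sq)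

lemma zeta_bounds: "0 \<le> zeta R x" "zeta R x \<le> 1"
  using step_bounds by (auto simp: zeta_def)

lemma zeta_one: assumes "R > 0" "norm x \<le> R" shows "zeta R x = 1"
proof -
  have "(norm x)\<^sup>2 \<le> R\<^sup>2" using assms by (intro power_mono) auto
  then have "x \<bullet> x \<le> R\<^sup>2" by (simp only: power2_norm_eq_inner)
  then show ?thesis using assms(1) by (simp add: zeta_def step_0 divide_le_eq)
qed

lemma zeta_zero: assumes "R > 0" "2 * R < norm x" shows "zeta R x = 0"
proof -
  have "(2 * R)\<^sup>2 \<le> (norm x)\<^sup>2" using assms by (intro power_mono) auto
  then have "4 * R\<^sup>2 \<le> x \<bullet> x" by (simp only: power2_norm_eq_inner) (simp add: power_mult_distrib)
  then have "2 * R\<^sup>2 \<le> x \<bullet> x" using zero_le_power2[of R] by linarith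
  then have "1 \<le> (1 / R\<^sup>2) * (x \<bullet> x) - 1" using assms(1) by (simp add: le_divide_eq)
  then show ?thesis by (simp add: zeta_def step_1)
qed

lemma zeta_deriv_bound:
  assumes "R > 0" "Z \<ge> 1" "\<And>x. step' x \<le> Z"
  shows "\<bar>frechet_derivative (zeta R) (at x) k\<bar> \<le> (4 * Z / R) * norm k"
proof -
  have i: "((\<lambda>x. (1 / R\<^sup>2) * (x \<bullet> x) - 1) has_derivative (\<lambda>h. (1 / R\<^sup>2) * (2 * (x \<bullet> h)))) (at x)"
  proof -
    have "((\<lambda>x. x \<bullet> x) has_derivative (\<lambda>h. 2 * (x \<bullet> h))) (at x)"
      by (rule has_derivative_eq_rhs, rule has_derivative_inner[OF has_derivative_ident has_derivative_ident])
         (simp add: fun_eq_iff inner_commute)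
    from has_derivative_diff[OF has_derivative_mult_right[OF this, of "1 / R\<^sup>2"] has_derivative_const[of 1]]
    show ?thesis by simp
  qed
  define y where "y = (1 / R\<^sup>2) * (x \<bullet> x) - 1"
  have s: "(step has_derivative (\<lambda>h. step' y * h)) (at ((1 / R\<^sup>2) * (x \<bullet> x) - 1))"
    using step_deriv[of y] by (simp add: has_field_derivative_def y_def)
  have "(zeta R has_derivative (\<lambda>h. 0 - step' y * ((1 / R\<^sup>2) * (2 * (x \<bullet> h))))) (at x)"
    unfolding zeta_def[abs_def] by (intro has_derivative_diff has_derivative_const has_derivative_compose[OF i s])
  from fun_cong[OF frechet_derivative_at[OF this], of k]
  have e: "frechet_derivative (zeta R) (at x) k = - (step' y * ((1 / R\<^sup>2) * (2 * (x \<bullet> k))))" by simp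
  show ?thesis
  proof (cases "norm x \<le> 2 * R")
    case True
    have "\<bar>x \<bullet> k\<bar> \<le> norm x * norm k" by (rule Cauchy_Schwarz_ineq2)
    also have "\<dots> \<le> 2 * R * norm k" using True by (intro mult_right_mono) auto
    finally have "(1 / R\<^sup>2) * (2 * \<bar>x \<bullet> k\<bar>) \<le> (1 / R\<^sup>2) * (2 * (2 * R * norm k))" by (intro mult_left_mono) auto
    also have "\<dots> = 4 / R * norm k" using assms(1) by (simp add: power2_eq_square)
    finally have q: "(1 / R\<^sup>2) * (2 * \<bar>x \<bullet> k\<bar>) \<le> 4 / R * norm k" .
    have "step' y * ((1 / R\<^sup>2) * (2 * \<bar>x \<bullet> k\<bar>)) \<le> Z * (4 / R * norm k)"
      by (rule mult_mono[OF assms(3) q]) (use assms in auto)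
    then show ?thesis unfolding e using step'_nonneg[of y] by (simp add: abs_mult mult.commute mult.left_commute)
  next
    case False
    then have "(2 * R)\<^sup>2 \<le> (norm x)\<^sup>2" using assms by (intro power_mono) auto
    then have "4 * R\<^sup>2 \<le> x \<bullet> x" by (simp only: power2_norm_eq_inner) (simp add: power_mult_distrib)
    then have "2 * R\<^sup>2 \<le> x \<bullet> x" using zero_le_power2[of R] by linarith
    then have "1 \<le> y" using assms(1) by (simp add: y_def le_divide_eq)
    then show ?thesis unfolding e using assms by (simp add: step'_zero)
  qed
qed

lemma linear_fst_pair: "linear (fst :: 'a::euclidean_space \<times> 'b::euclidean_space \<Rightarrow> 'a)"
  and linear_snd_pair: "linear (snd :: 'a \<times> 'b \<Rightarrow> 'b)"
  by (simp_all add: linear_iff)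

definition cutoff :: "(real \<Rightarrow> real) \<Rightarrow> real \<Rightarrow> real \<times> (real^'n) \<Rightarrow> real" where
  "cutoff f R p = f (fst p) * zeta R (snd p)"

lemma smooth_cutoff: "smooth f \<Longrightarrow> smooth (cutoff f R)"
  unfolding cutoff_def[abs_def]
  using smooth_compose_affine[OF _ linear_fst_pair, of f 0] smooth_compose_affine[OF smooth_zeta linear_snd_pair, of R 0]
  by (intro smooth_mult) auto

lemma cutoff_deriv:
  fixes p :: "real \<times> (real^'n)"
  assumes f: "\<And>t. (f has_real_derivative f' t) (at t)"
  shows "frechet_derivative (cutoff f R) (at p) h = f' (fst p) * fst h * zeta R (snd p) + f (fst p) * frechet_derivative (zeta R) (at (snd p)) (snd h)"
proof -
  have 1: "((\<lambda>p::real \<times> (real^'n). f (fst p)) has_derivative (\<lambda>h. f' (fst p) * fst h)) (at p)"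
    using has_derivative_compose[OF has_derivative_fst[OF has_derivative_ident] f[of "fst p", unfolded has_field_derivative_def]] by simp
  have 2: "((\<lambda>p::real \<times> (real^'n). zeta R (snd p)) has_derivative (\<lambda>h. frechet_derivative (zeta R) (at (snd p)) (snd h))) (at p)"
    by (rule has_derivative_compose[OF has_derivative_snd[OF has_derivative_ident] smooth_has_derivative[OF smooth_zeta]])
  have "(cutoff f R has_derivative (\<lambda>h. f (fst p) * frechet_derivative (zeta R) (at (snd p)) (snd h) + f' (fst p) * fst h * zeta R (snd p))) (at p)"
    unfolding cutoff_def[abs_def] by (rule has_derivative_mult[OF 1 2])
  from fun_cong[OF frechet_derivative_at[OF this], of h] show ?thesis by simp
qed

lemma cutoff_deriv_bound:
  assumes f: "\<And>t. (f has_real_derivative f' t) (at t)" and "R > 0" "Z \<ge> 1" "\<And>x. step' x \<le> Z" "\<And>t. 0 \<le> f t"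
  shows "\<bar>frechet_derivative (cutoff f R) (at p) h\<bar> \<le> norm h * (\<bar>f' (fst p)\<bar> + (4 * Z / R) * f (fst p))"
proof -
  have nf: "\<bar>fst h\<bar> \<le> norm h" and ns: "norm (snd h) \<le> norm h" using norm_fst_le[of "fst h" "snd h"] norm_snd_le[of "snd h" "fst h"] by auto
  have "\<bar>f' (fst p) * fst h * zeta R (snd p)\<bar> \<le> \<bar>f' (fst p)\<bar> * norm h * 1"
    unfolding abs_mult using nf zeta_bounds[of R "snd p"] by (intro mult_mono) auto
  moreover have "\<bar>f (fst p) * frechet_derivative (zeta R) (at (snd p)) (snd h)\<bar> \<le> f (fst p) * ((4 * Z / R) * norm h)"
  proof -
    have "\<bar>frechet_derivative (zeta R) (at (snd p)) (snd h)\<bar> \<le> (4 * Z / R) * norm (snd h)" by (rule zeta_deriv_bound[OF assms(2-4)])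
    also have "\<dots> \<le> (4 * Z / R) * norm h" using ns assms by (intro mult_left_mono) auto
    finally show ?thesis unfolding abs_mult using assms(5)[of "fst p"] by (intro mult_mono) auto
  qed
  ultimately show ?thesis unfolding cutoff_deriv[OF f] by (intro order_trans[OF abs_triangle_ineq]) (simp add: algebra_simps)
qed

lemma test_function_mult_support:
  fixes \<psi> :: "real \<times> (real^'n) \<Rightarrow> real"
  assumes \<psi>: "smooth \<psi>" "\<And>p. 0 \<le> \<psi> p" and f: "0 < s0" "\<And>t. t \<notin> {s0..s1} \<Longrightarrow> f t = 0" and R: "R > 0"
    and z: "\<And>p. cutoff f R p = 0 \<Longrightarrow> \<psi> p = 0"
  shows "test_function \<psi>"
proof -
  let ?K = "{s0..s1} \<times> cball (0 :: real^'n) (2 * R)"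
  have "{p. \<psi> p \<noteq> 0} \<subseteq> ?K"
  proof
    fix p assume "p \<in> {p. \<psi> p \<noteq> 0}"
    then have nz: "f (fst p) \<noteq> 0" "zeta R (snd p) \<noteq> 0" using z[of p] by (auto simp: cutoff_def)
    then have "fst p \<in> {s0..s1}" using f(2) by blast
    moreover have "norm (snd p) \<le> 2 * R" using nz(2) zeta_zero[OF R, of "snd p"] by (meson not_le)
    ultimately show "p \<in> ?K" by (simp add: mem_Times_iff)
  qed
  moreover have cK: "compact ?K" by (intro compact_Times compact_Icc compact_cball)
  ultimately have s: "closure {p. \<psi> p \<noteq> 0} \<subseteq> ?K" by (intro closure_minimal compact_imp_closed)
  have "compact (?K \<inter> closure {p. \<psi> p \<noteq> 0})" by (rule compact_Int_closed[OF cK closed_closure])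
  then have "compact (closure {p. \<psi> p \<noteq> 0})" using s by (simp add: inf.absorb2)
  moreover have "?K \<subseteq> {0<..} \<times> UNIV" using f(1) by auto
  ultimately show ?thesis using \<psi> s unfolding test_function_def by (meson subset_trans)
qed

context kinetic_solution
begin

definition mass :: "real \<Rightarrow> real \<Rightarrow> real \<Rightarrow> real" where
  "mass c \<delta> t = (LINT x|lebesgue. kappa c \<delta> (u t x))"

lemma kappa_u_integrable:
  assumes "\<delta> > 0" "0 \<le> c" "0 \<le> t" shows "integrable lebesgue (\<lambda>x. kappa c \<delta> (u t x))"
proof (rule Bochner_Integration.integrable_bound[OF u_int[OF assms(3)]])
  show "(\<lambda>x. kappa c \<delta> (u t x)) \<in> borel_measurable lebesgue"
    by (rule measurable_compose[OF borel_measurable_integrable[OF u_int[OF assms(3)]] kappa_measurable[OF assms(1)]])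
  show "AE x in lebesgue. norm (kappa c \<delta> (u t x)) \<le> norm (u t x)"
    using kappa_le_abs[OF assms(1,2)] kappa_nonneg[OF assms(1)] by (auto intro!: AE_I2)
qed

lemma mass_nonneg: "\<delta> > 0 \<Longrightarrow> 0 \<le> mass c \<delta> t"
  unfolding mass_def by (intro Bochner_Integration.integral_nonneg kappa_nonneg)

lemma mass_continuous:
  assumes d: "\<delta> > 0" "0 \<le> c" shows "continuous_on {0..} (mass c \<delta>)"
proof -
  have "(mass c \<delta> \<longlongrightarrow> mass c \<delta> s) (at s within {0..})" if s: "s \<in> {0..}" for s
  proof (rule Lim_null_comparison[THEN LIM_zero_cancel])
    show "\<forall>\<^sub>F t in at s within {0..}. norm (mass c \<delta> t - mass c \<delta> s) \<le> L1_norm (\<lambda>x. u t x - u s x)"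
      unfolding eventually_at_filter
    proof (intro always_eventually allI impI)
      fix t :: real assume "t \<in> {0..}"
      then have t: "0 \<le> t" and s: "0 \<le> s" using s by auto
      have di: "integrable lebesgue (\<lambda>x. kappa c \<delta> (u t x) - kappa c \<delta> (u s x))"
        by (intro Bochner_Integration.integrable_diff kappa_u_integrable d t s)
      have "mass c \<delta> t - mass c \<delta> s = (LINT x|lebesgue. kappa c \<delta> (u t x) - kappa c \<delta> (u s x))"
        unfolding mass_def using kappa_u_integrable[OF d t] kappa_u_integrable[OF d s] by simp
      also have "norm \<dots> \<le> (LINT x|lebesgue. norm (kappa c \<delta> (u t x) - kappa c \<delta> (u s x)))" by (rule integral_norm_bound)
      also have "\<dots> \<le> (LINT x|lebesgue. \<bar>u t x - u s x\<bar>)"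
        using kappa_lipschitz[OF d(1)] by (intro integral_mono integrable_norm di integrable_abs Bochner_Integration.integrable_diff u_int t s) auto
      finally show "norm (mass c \<delta> t - mass c \<delta> s) \<le> L1_norm (\<lambda>x. u t x - u s x)" by (simp add: L1_norm_def)
    qed
    show "((\<lambda>t. L1_norm (\<lambda>x. u t x - u s x)) \<longlongrightarrow> 0) (at s within {0..})" using s by (intro u_cont) simp
  qed
  then show ?thesis by (simp add: continuous_on_def)
qed

lemma mass_slice:
  assumes d: "\<delta> > 0" "0 \<le> c"
  shows "AE t in lborel. 0 < t \<longrightarrow> (\<integral>\<^sup>+x. ennreal (kappa c \<delta> (w (t, x))) \<partial>lborel) = ennreal (mass c \<delta> t)"
  using u_w
proof eventually_elim
  case (elim t)
  show ?case
  proof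
    assume t: "0 < t"
    then have ae: "AE x in lborel. w (t, x) = u t x" using elim by simp
    have [measurable]: "(\<lambda>x. w (t, x)) \<in> borel_measurable borel" using measurable_Pair2'[of t borel borel]
      by (intro measurable_compose[OF _ w_meas]) (simp add: borel_prod)
    have km: "(\<lambda>x. kappa c \<delta> (w (t, x))) \<in> borel_measurable borel"
      by (rule measurable_compose[OF _ kappa_measurable[OF d(1)]]) measurable
    have ki: "integrable lebesgue (\<lambda>x. kappa c \<delta> (u t x))" using t by (intro kappa_u_integrable d) simp
    have "(\<integral>\<^sup>+x. ennreal (kappa c \<delta> (w (t, x))) \<partial>lborel) = (\<integral>\<^sup>+x. ennreal (kappa c \<delta> (w (t, x))) \<partial>lebesgue)"
      using km by (simp add: nn_integral_completion)
    also have "\<dots> = (\<integral>\<^sup>+x. ennreal (kappa c \<delta> (u t x)) \<partial>lebesgue)"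
      by (rule nn_integral_cong_AE) (use ae in \<open>auto simp: AE_completion_iff elim!: eventually_mono\<close>)
    also have "\<dots> = ennreal (mass c \<delta> t)" unfolding mass_def
      by (rule nn_integral_eq_integral[OF ki]) (auto intro!: AE_I2 kappa_nonneg d)
    finally show "(\<integral>\<^sup>+x. ennreal (kappa c \<delta> (w (t, x))) \<partial>lborel) = ennreal (mass c \<delta> t)" .
  qed
qed

text \<open>Tonelli's theorem combined with \<open>mass_slice\<close>. The weight is supported in
  positive times because \<open>w\<close> represents the slices \<open>u t\<close> only there, and
  only for almost every t.\<close>

lemma weighted_mass:
  assumes d: "\<delta> > 0" "0 \<le> c" and h: "h \<in> borel_measurable borel" "\<And>t. 0 \<le> h t" "\<And>t. h t \<le> H" "\<forall>t. t \<notin> {a..b} \<longrightarrow> h t = 0" and ab: "0 < a"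
  shows "integrable lborel (\<lambda>p. h (fst p) * kappa c \<delta> (w p))" "integrable lborel (\<lambda>t. h t * mass c \<delta> t)"
    "(LINT p|lborel. h (fst p) * kappa c \<delta> (w p)) = (LINT t|lborel. h t * mass c \<delta> t)"
proof -
  note h = h(1-3) h(4)[rule_format]
  let ?f = "\<lambda>p. h (fst p) * kappa c \<delta> (w p)"
  have [measurable]: "(fst :: real \<times> (real^'n) \<Rightarrow> real) \<in> borel_measurable borel"
    by (intro borel_measurable_continuous_onI continuous_on_fst continuous_on_id)
  note [measurable] = h(1) kappa_measurable[OF d(1), of c]
  have fm: "?f \<in> borel_measurable borel" by measurable
  have hm: "h t * mass c \<delta> t = h t * mass c \<delta> (max 0 t)" for t using h(4)[of t] ab by (cases "t < 0") (auto simp: max_def)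
  have mc: "continuous_on UNIV (\<lambda>t. mass c \<delta> (max 0 t))"
    by (rule continuous_on_compose2[OF mass_continuous[OF d]]) (auto intro!: continuous_intros)
  have [measurable]: "(\<lambda>t. mass c \<delta> (max 0 t)) \<in> borel_measurable borel" by (rule borel_measurable_continuous_onI[OF mc])
  have mm: "(\<lambda>t. h t * mass c \<delta> t) \<in> borel_measurable borel" unfolding hm by measurable
  have H0: "0 \<le> H" using h(2)[of 0] h(3)[of 0] by linarith
  obtain B where B: "\<And>t. t \<in> {a..b} \<Longrightarrow> mass c \<delta> t \<le> B"
  proof (cases "a \<le> b")
    case True
    have "continuous_on {a..b} (mass c \<delta>)" by (rule continuous_on_subset[OF mass_continuous[OF d]]) (use ab in auto)
    then obtain m where "\<And>t. t \<in> {a..b} \<Longrightarrow> mass c \<delta> t \<le> mass c \<delta> m"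
      using continuous_attains_sup[of "{a..b}" "mass c \<delta>"] True by fastforce
    then show ?thesis by (rule that)
  qed (rule that[of 0], simp)
  show i2: "integrable lborel (\<lambda>t. h t * mass c \<delta> t)"
  proof (rule Bochner_Integration.integrable_bound)
    show "integrable lborel (\<lambda>t. (H * B) * indicator {a..b} t)" using emeasure_lborel_cbox_finite[of a b] by (intro integrable_mult_right integrable_real_indicator) (auto simp: less_top)
    show "AE t in lborel. norm (h t * mass c \<delta> t) \<le> norm (H * B * indicator {a..b} t)"
    proof (rule AE_I2)
      fix t
      show "norm (h t * mass c \<delta> t) \<le> norm (H * B * indicator {a..b} t)"
      proof (cases "t \<in> {a..b}")
        case True
        have "h t * mass c \<delta> t \<le> H * B" using h(2,3)[of t] H0 B[OF True] mass_nonneg[OF d(1), of c t] by (intro mult_mono) auto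
        moreover have "0 \<le> h t * mass c \<delta> t" using h(2)[of t] mass_nonneg[OF d(1), of c t] by simp
        ultimately show ?thesis using True by simp
      qed (simp add: h(4))
    qed
  qed (use mm in simp)
  have "(\<integral>\<^sup>+p. ennreal (?f p) \<partial>lborel) = (\<integral>\<^sup>+t. (\<integral>\<^sup>+x. ennreal (?f (t, x)) \<partial>lborel) \<partial>lborel)"
    using fm by (subst lborel_prod[symmetric], intro lborel.nn_integral_fst[symmetric]) (simp add: lborel_prod)
  also have "\<dots> = (\<integral>\<^sup>+t. ennreal (h t * mass c \<delta> t) \<partial>lborel)"
  proof (rule nn_integral_cong_AE)
    show "AE t in lborel. (\<integral>\<^sup>+x. ennreal (?f (t, x)) \<partial>lborel) = ennreal (h t * mass c \<delta> t)"
      using mass_slice[OF d]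
    proof eventually_elim
      case (elim t)
      show ?case
      proof (cases "0 < t")
        case True
        have [measurable]: "(\<lambda>x. w (t, x)) \<in> borel_measurable borel" using measurable_Pair2'[of t borel borel]
          by (intro measurable_compose[OF _ w_meas]) (simp add: borel_prod)
        have "(\<integral>\<^sup>+x. ennreal (?f (t, x)) \<partial>lborel) = (\<integral>\<^sup>+x. ennreal (h t) * ennreal (kappa c \<delta> (w (t, x))) \<partial>lborel)"
          using h(2) by (intro nn_integral_cong) (simp add: ennreal_mult')
        also have "\<dots> = ennreal (h t) * (\<integral>\<^sup>+x. ennreal (kappa c \<delta> (w (t, x))) \<partial>lborel)"
          by (intro nn_integral_cmult) measurable
        also have "\<dots> = ennreal (h t * mass c \<delta> t)" using elim True h(2) by (simp add: ennreal_mult')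
        finally show ?thesis .
      next
        case False
        then have "h t = 0" using ab by (intro h(4)) auto
        then show ?thesis by simp
      qed
    qed
  qed
  also have "\<dots> = ennreal (LINT t|lborel. h t * mass c \<delta> t)"
    by (rule nn_integral_eq_integral[OF i2]) (auto intro!: AE_I2 mult_nonneg_nonneg h mass_nonneg d)
  finally have nn: "(\<integral>\<^sup>+p. ennreal (?f p) \<partial>lborel) = ennreal (LINT t|lborel. h t * mass c \<delta> t)" .
  have f0: "0 \<le> ?f p" for p using h(2) kappa_nonneg[OF d(1)] by simp
  show "integrable lborel ?f"
    using fm nn f0 by (intro integrableI_nonneg) (auto intro!: AE_I2)
  show "(LINT p|lborel. ?f p) = (LINT t|lborel. h t * mass c \<delta> t)"
  proof -
    have "0 \<le> (LINT t|lborel. h t * mass c \<delta> t)"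
      by (rule Bochner_Integration.integral_nonneg) (intro mult_nonneg_nonneg h(2) mass_nonneg d(1))
    then show ?thesis using fm f0 nn by (subst integral_eq_nn_integral) (auto intro!: AE_I2)
  qed
qed

end

lemma smooth_step_affine: "smooth (\<lambda>t. step (k * t + b))"
  by (rule smooth_compose_real[OF smooth_step]) (intro smooth_add smooth_cmult smooth_const, use smooth_inner[of "1::real"] in simp)

lemma step_affine_deriv: "((\<lambda>t. step (k * t + b)) has_real_derivative k * step' (k * t + b)) (at t)"
  by (rule DERIV_cong[OF DERIV_chain2[OF step_deriv]]) (auto intro!: derivative_eq_intros)

lemma step'_integral:
  assumes "e > 0"
  shows "integrable lborel (\<lambda>t. step' ((t - s) / e) / e)" "(LINT t|lborel. step' ((t - s) / e) / e) = 1"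
proof -
  let ?f = "\<lambda>t. step' ((t - s) / e) / e"
  have c: "continuous_on UNIV ?f"
    by (intro continuous_intros continuous_on_compose2[OF smooth_continuous[OF smooth_step']]) (use assms in auto)
  have z: "?f t = 0" if "t \<notin> cbox s (s + e)" for t
    using that assms by (auto simp: step'_zero divide_le_0_iff le_divide_eq)
  show "integrable lborel ?f"
  proof (rule integrable_continuous_bounded_support[OF c, of "\<bar>s\<bar> + e"])
    fix t :: real assume "\<bar>s\<bar> + e < norm t"
    then have "t \<notin> cbox s (s + e)" using assms by auto
    then show "?f t = 0" by (rule z)
  qed
  have "(LINT t|lborel. ?f t) = integral {s..s+e} ?f" using lborel_integral_eq_integral_cbox[OF c, of s "s + e"] z by simp
  also have "\<dots> = step ((s + e - s) / e) - step ((s - s) / e)"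
  proof (rule integral_unique)
  show "(?f has_integral step ((s + e - s) / e) - step ((s - s) / e)) {s..s+e}"
  proof (rule fundamental_theorem_of_calculus)
    fix t
    have "((\<lambda>t. step ((1/e) * t + (- s / e))) has_real_derivative (1/e) * step' ((1/e) * t + (- s / e))) (at t)" by (rule step_affine_deriv)
    then have "((\<lambda>t. step ((t - s) / e)) has_real_derivative ?f t) (at t)" by (simp add: diff_divide_distrib)
    then show "((\<lambda>t. step ((t - s) / e)) has_vector_derivative ?f t) (at t within {s..s+e})"
      by (simp add: has_real_derivative_iff_has_vector_derivative has_vector_derivative_at_within)
  qed (use assms in simp)
  qed
  also have "\<dots> = 1" using assms by (simp add: step_0 step_1)
  finally show "(LINT t|lborel. ?f t) = 1" .
qed

section \<open>Monotonicity of the truncated mass\<close>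

context kinetic_solution
begin

lemma av_bound: "\<exists>A\<ge>1. \<forall>v\<in>{\<alpha>..\<beta>}. norm (av v) \<le> A"
proof -
  have "bounded (av ` {\<alpha>..\<beta>})" by (intro compact_imp_bounded compact_continuous_image av_cont compact_Icc)
  then obtain A where "\<And>v. v \<in> {\<alpha>..\<beta>} \<Longrightarrow> norm (av v) \<le> A" unfolding bounded_iff by blast
  then show ?thesis by (intro exI[of _ "max 1 A"]) (auto simp: le_max_iff_disj)
qed

lemma flux_norm_bound:
  assumes g: "continuous_on UNIV g" "\<And>s. \<bar>g s\<bar> \<le> M * clip c \<delta> s" and A: "\<And>v. v \<in> {\<alpha>..\<beta>} \<Longrightarrow> norm (av v) \<le> A" and c: "0 \<le> c" and d: "\<delta> > 0" "0 \<le> M" "0 \<le> A"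
    and v: "v \<le> \<beta>"
  shows "norm (flux c \<beta> av g v) \<le> M * A * kappa c \<delta> v"
proof -
  have ac: "continuous_on {c..v} av" by (rule continuous_on_subset[OF av_cont]) (use c v zero_range in auto)
  have gc: "continuous_on {c..v} g" by (rule continuous_on_subset[OF g(1) subset_UNIV])
  have "norm (integral {c..v} (\<lambda>s. g s *\<^sub>R av s)) \<le> integral {c..v} (\<lambda>s. (M * A) * clip c \<delta> s)"
  proof (rule integral_norm_bound_integral)
    show "(\<lambda>s. g s *\<^sub>R av s) integrable_on {c..v}" by (intro integrable_continuous_real continuous_intros ac gc)
    show "(\<lambda>s. (M * A) * clip c \<delta> s) integrable_on {c..v}" by (intro integrable_continuous_real continuous_intros clip_continuous)
    fix s assume s: "s \<in> {c..v}"
    then have "norm (av s) \<le> A" using c v zero_range by (intro A) auto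
    then have "\<bar>g s\<bar> * norm (av s) \<le> (M * clip c \<delta> s) * A" using g(2)[of s] d clip_bounds by (intro mult_mono) auto
    then show "norm (g s *\<^sub>R av s) \<le> (M * A) * clip c \<delta> s" by (simp add: mult_ac)
  qed
  also have "\<dots> = M * A * kappa c \<delta> v" by (simp add: kappa_def)
  finally show ?thesis using v by (simp add: flux_def min_absorb1)
qed

lemma flux_clip_props:
  assumes d: "\<delta> > 0" "0 \<le> c" "c \<le> \<beta>"
  shows "continuous_on UNIV (flux c \<beta> av (clip c \<delta>))" "fst (flux c \<beta> av (clip c \<delta>) (w p)) = kappa c \<delta> (w p)"
proof -
  have ac: "continuous_on {c..\<beta>} av" by (rule continuous_on_subset[OF av_cont]) (use d zero_range in auto)
  show "continuous_on UNIV (flux c \<beta> av (clip c \<delta>))" by (rule flux_continuous[OF clip_continuous ac d(3)])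
  show "fst (flux c \<beta> av (clip c \<delta>) (w p)) = kappa c \<delta> (w p)"
    unfolding kappa_def by (rule fst_flux[OF clip_continuous ac]) (use d zero_range w_range[of p] in \<open>auto intro!: av_fst\<close>)
qed

text \<open>Test the entropy \<open>kappa\<close> with a product of a time plateau and a spatial
  cut-off of radius R. The time derivative produces the two averages; the spatial gradient is of
  order 1/R, and the flux is dominated by a multiple of the entropy, which is integrable, so that
  term vanishes as R grows.\<close>

lemma mass_weak_decreasing:
  assumes d: "\<delta> > 0" "0 \<le> c" "c \<le> \<beta>" and st: "0 < s" "s < t" and e: "0 < e"
  shows "(LINT r|lborel. step' ((r - t) / e) / e * mass c \<delta> r) \<le> (LINT r|lborel. step' ((r - s) / e) / e * mass c \<delta> r)"
proof -
  obtain Z where Z: "Z \<ge> 1" "\<And>x. step' x \<le> Z" using step'_bounded by blast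
  obtain A where A: "A \<ge> 1" "\<And>v. v \<in> {\<alpha>..\<beta>} \<Longrightarrow> norm (av v) \<le> A" using av_bound by blast
  define h1 where "h1 r = step' ((r - s) / e) / e" for r
  define h2 where "h2 r = step' ((r - t) / e) / e" for r
  \<comment> \<open>A plateau rising on [s, s + e] and falling on [t, t + e]; its derivative is the
    difference of the two averaging kernels.\<close>
  define f where "f r = step ((1/e) * r + (- s / e)) - step ((1/e) * r + (- t / e))" for r
  have sf: "smooth f" unfolding f_def[abs_def] by (intro smooth_diff smooth_step_affine)
  have df: "(f has_real_derivative h1 r - h2 r) (at r)" for r
    unfolding f_def[abs_def] by (rule DERIV_cong[OF DERIV_diff[OF step_affine_deriv step_affine_deriv]])
      (simp add: h1_def h2_def diff_divide_distrib)
  have f0: "0 \<le> f r" for r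
    unfolding f_def using st e by (simp add: step_mono divide_right_mono)
  have f1: "f r \<le> 1" for r unfolding f_def using step_bounds(2)[of "1 / e * r + - s / e"] step_bounds(1)[of "1 / e * r + - t / e"] by linarith
  have fz: "f r = 0" if "r \<notin> {s..t+e}" for r
  proof (cases "r < s")
    case True
    then have "1 / e * r + - s / e \<le> 0" "1 / e * r + - t / e \<le> 0" using e st by (simp_all add: field_simps)
    then show ?thesis unfolding f_def by (simp only: step_0)
  next
    case False
    then have "1 \<le> 1 / e * r + - s / e" "1 \<le> 1 / e * r + - t / e" using e st that by (simp_all add: field_simps)
    then show ?thesis unfolding f_def by (simp only: step_1)
  qed
  have hz: "h1 r = 0 \<and> h2 r = 0" if "r \<notin> {s..t+e}" for r
    using that st e by (auto simp: h1_def h2_def step'_zero divide_le_0_iff le_divide_eq)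
  then have hz1: "\<forall>r. r \<notin> {s..t+e} \<longrightarrow> h1 r = 0" and hz2: "\<forall>r. r \<notin> {s..t+e} \<longrightarrow> h2 r = 0" and fz': "\<forall>r. r \<notin> {s..t+e} \<longrightarrow> f r = 0"
    using fz by blast+
  have hm: "h1 \<in> borel_measurable borel" "h2 \<in> borel_measurable borel"
    unfolding h1_def[abs_def] h2_def[abs_def]
    by (intro borel_measurable_continuous_onI continuous_intros continuous_on_compose2[OF smooth_continuous[OF smooth_step']]; use e in auto)+
  have h0: "0 \<le> h1 r" "0 \<le> h2 r" for r using step'_nonneg e by (auto simp: h1_def h2_def)
  have hH: "h1 r \<le> Z / e" "h2 r \<le> Z / e" for r using Z e by (auto simp: h1_def h2_def divide_right_mono)
  note W1 = weighted_mass[OF d(1,2) hm(1) h0(1) hH(1) hz1 st(1)]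
  note W2 = weighted_mass[OF d(1,2) hm(2) h0(2) hH(2) hz2 st(1)]
  note Wf = weighted_mass[OF d(1,2) smooth_borel_measurable[OF sf] f0 f1 fz' st(1)]
  let ?k = "\<lambda>p. kappa c \<delta> (w p)"
  let ?F = "\<lambda>p. flux c \<beta> av (clip c \<delta>) (w p)"
  have Fb: "norm (?F p) \<le> A * ?k p" for p
  proof -
    have "norm (?F p) \<le> 1 * A * ?k p"
      by (rule flux_norm_bound[OF clip_continuous _ A(2)]) (use A d w_range[of p] clip_bounds in auto)
    then show ?thesis by simp
  qed
  let ?C = "LINT p|lborel. f (fst p) * ?k p"
  have i2: "integrable lborel (\<lambda>p. h2 (fst p) * ?k p * zeta R (snd p))" for R
  proof (rule Bochner_Integration.integrable_bound[OF W2(1)])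
    have [measurable]: "(fst :: real \<times> (real^'n) \<Rightarrow> real) \<in> borel_measurable borel" "(snd :: real \<times> (real^'n) \<Rightarrow> real^'n) \<in> borel_measurable borel"
      by (intro borel_measurable_continuous_onI continuous_on_fst continuous_on_snd continuous_on_id)+
    note [measurable] = hm(2) kappa_measurable[OF d(1), of c] smooth_borel_measurable[OF smooth_zeta[where ?'a="real^'n", of R]]
    show "(\<lambda>p. h2 (fst p) * ?k p * zeta R (snd p)) \<in> borel_measurable lborel" by measurable
    show "AE p in lborel. norm (h2 (fst p) * ?k p * zeta R (snd p)) \<le> norm (h2 (fst p) * ?k p)"
      using zeta_bounds by (intro AE_I2) (auto simp: abs_mult abs_of_nonneg[OF zeta_bounds(1)] intro!: mult_left_le)
  qed
  have ineq: "(LINT p|lborel. h2 (fst p) * ?k p * zeta R (snd p)) \<le> (LINT p|lborel. h1 (fst p) * ?k p) + (4 * Z * A / R) * ?C" if R: "R > 0" for R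
  proof -
    let ?U = "\<lambda>p. h1 (fst p) * ?k p - h2 (fst p) * ?k p * zeta R (snd p) + (4 * Z * A / R) * (f (fst p) * ?k p)"
    let ?V = "\<lambda>p. frechet_derivative (cutoff f R) (at p) (?F p)"
    have tf: "test_function (cutoff f R)"
    proof (rule test_function_mult_support[OF smooth_cutoff[OF sf] _ st(1) fz R])
      show "0 \<le> cutoff f R p" for p using f0 zeta_bounds by (auto simp: cutoff_def intro!: mult_nonneg_nonneg)
    qed auto
    have k0: "0 \<le> ?k p" for p by (rule kappa_nonneg[OF d(1)])
    have iU: "integrable lborel ?U"
      by (intro Bochner_Integration.integrable_add Bochner_Integration.integrable_diff integrable_mult_right W1(1) i2 Wf(1))
    have iV: "integrable lborel ?V"
    proof (rule Bochner_Integration.integrable_bound)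
      show "integrable lborel (\<lambda>p. A * (h1 (fst p) * ?k p) + A * (h2 (fst p) * ?k p) + (A * (4 * Z / R)) * (f (fst p) * ?k p))"
        by (intro Bochner_Integration.integrable_add integrable_mult_right W1(1) W2(1) Wf(1))
      show "?V \<in> borel_measurable lborel"
        using frechet_flux_measurable[OF smooth_cutoff[OF sf] flux_clip_props(1)[OF d] w_meas] by simp
      show "AE p in lborel. norm (?V p) \<le> norm (A * (h1 (fst p) * ?k p) + A * (h2 (fst p) * ?k p) + (A * (4 * Z / R)) * (f (fst p) * ?k p))"
      proof (rule AE_I2)
        fix p
        have "norm (?V p) \<le> norm (?F p) * (\<bar>h1 (fst p) - h2 (fst p)\<bar> + (4 * Z / R) * f (fst p))"
          using cutoff_deriv_bound[OF df R Z f0, of p "?F p"] by simp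
        also have "\<dots> \<le> (A * ?k p) * ((h1 (fst p) + h2 (fst p)) + (4 * Z / R) * f (fst p))"
          using h0[of "fst p"] f0[of "fst p"] Fb[of p] R Z A k0[of p] by (intro mult_mono add_mono mult_nonneg_nonneg) auto
        finally show "norm (?V p) \<le> norm (A * (h1 (fst p) * ?k p) + A * (h2 (fst p) * ?k p) + (A * (4 * Z / R)) * (f (fst p) * ?k p))"
          by (simp add: algebra_simps)
      qed
    qed
    have pt: "?V p \<le> ?U p" for p
    proof -
      have "\<bar>frechet_derivative (zeta R) (at (snd p)) (snd (?F p))\<bar> \<le> (4 * Z / R) * norm (snd (?F p))" by (rule zeta_deriv_bound[OF R Z])
      also have "\<dots> \<le> (4 * Z / R) * (A * ?k p)"
        using order_trans[OF norm_snd_le[of "snd (?F p)" "fst (?F p)"]] Fb[of p] R Z by (intro mult_left_mono) auto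
      finally have "f (fst p) * frechet_derivative (zeta R) (at (snd p)) (snd (?F p)) \<le> f (fst p) * ((4 * Z / R) * (A * ?k p))"
        using f0 by (intro mult_left_mono) auto
      moreover have "(h1 (fst p) - h2 (fst p)) * ?k p * zeta R (snd p) \<le> h1 (fst p) * ?k p - h2 (fst p) * ?k p * zeta R (snd p)"
        using mult_left_le[of "zeta R (snd p)" "h1 (fst p) * ?k p"] zeta_bounds[of R "snd p"] h0(1)[of "fst p"] k0[of p] by (simp add: algebra_simps)
      ultimately show ?thesis unfolding cutoff_deriv[OF df] flux_clip_props(2)[OF d] by (simp add: algebra_simps)
    qed
    have "0 \<le> (LINT p|lborel. ?V p)"
      by (rule entropy[OF d(2,3) clip_continuous clip_mono[OF d(1)] clip_zero[OF d(1)] tf])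
    also have "\<dots> \<le> (LINT p|lborel. ?U p)" by (rule integral_mono[OF iV iU pt])
    also have "\<dots> = (LINT p|lborel. h1 (fst p) * ?k p) - (LINT p|lborel. h2 (fst p) * ?k p * zeta R (snd p)) + (4 * Z * A / R) * ?C"
      using W1(1) i2[of R] Wf(1) by (simp add: Bochner_Integration.integral_add Bochner_Integration.integral_diff Bochner_Integration.integrable_diff)
    finally show ?thesis by simp
  qed
  \<comment> \<open>In \<open>ineq\<close> the cut-off was bounded by 1 in the term at the earlier
    time, so only the term at the later time still contains it when R tends to infinity.\<close>
  have lim: "(\<lambda>k. LINT p|lborel. h2 (fst p) * ?k p * zeta (real (Suc k)) (snd p)) \<longlonglongrightarrow> (LINT p|lborel. h2 (fst p) * ?k p)"
  proof (rule integral_dominated_convergence[where w="\<lambda>p. h2 (fst p) * ?k p"])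
    show "AE p in lborel. (\<lambda>k. h2 (fst p) * ?k p * zeta (real (Suc k)) (snd p)) \<longlonglongrightarrow> h2 (fst p) * ?k p"
    proof (rule AE_I2)
      fix p :: "real \<times> (real^'n)"
      have "eventually (\<lambda>k. h2 (fst p) * ?k p * zeta (real (Suc k)) (snd p) = h2 (fst p) * ?k p) sequentially"
        using eventually_ge_at_top[of "nat \<lceil>norm (snd p)\<rceil>"]
      proof eventually_elim
        case (elim k)
        then have "norm (snd p) \<le> real (Suc k)" by linarith
        then show ?case by (simp add: zeta_one del: of_nat_Suc)
      qed
      then show "(\<lambda>k. h2 (fst p) * ?k p * zeta (real (Suc k)) (snd p)) \<longlonglongrightarrow> h2 (fst p) * ?k p" by (rule tendsto_eventually)
    qed
    show "AE p in lborel. norm (h2 (fst p) * ?k p * zeta (real (Suc k)) (snd p)) \<le> h2 (fst p) * ?k p" for k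
      using zeta_bounds[of "real (Suc k)"] h0 kappa_nonneg[OF d(1)] by (intro AE_I2) (auto simp: abs_mult abs_of_nonneg[OF zeta_bounds(1)] intro!: mult_left_le)
    show "(\<lambda>p. h2 (fst p) * ?k p * zeta (real (Suc k)) (snd p)) \<in> borel_measurable lborel" for k
      by (rule borel_measurable_integrable[OF i2])
    show "(\<lambda>p. h2 (fst p) * ?k p) \<in> borel_measurable lborel" by (rule borel_measurable_integrable[OF W2(1)])
  qed (rule W2(1))
  have lim': "(\<lambda>k. (LINT p|lborel. h1 (fst p) * ?k p) + (4 * Z * A / real (Suc k)) * ?C) \<longlonglongrightarrow> (LINT p|lborel. h1 (fst p) * ?k p) + (4 * Z * A * 0) * ?C"
    unfolding divide_inverse by (intro tendsto_intros LIMSEQ_inverse_real_of_nat)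
  have "(LINT p|lborel. h2 (fst p) * ?k p) \<le> (LINT p|lborel. h1 (fst p) * ?k p)"
    using LIMSEQ_le[OF lim lim'] ineq by (auto simp del: of_nat_Suc)
  then show ?thesis using W1(3) W2(3) unfolding h1_def h2_def by linarith
qed

lemma weighted_mass_bound:
  assumes d: "\<delta> > 0" "0 \<le> c" and e: "0 < e" and s: "0 < s" and m: "\<And>r. r \<in> {s..s+e} \<Longrightarrow> l \<le> mass c \<delta> r \<and> mass c \<delta> r \<le> M"
  shows "l \<le> (LINT r|lborel. step' ((r - s) / e) / e * mass c \<delta> r)" "(LINT r|lborel. step' ((r - s) / e) / e * mass c \<delta> r) \<le> M"
proof -
  let ?h = "\<lambda>r. step' ((r - s) / e) / e"
  have hz: "?h r = 0" if "r \<notin> {s..s+e}" for r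
    using that e by (auto simp: step'_zero divide_le_0_iff le_divide_eq)
  have h0: "0 \<le> ?h r" for r using step'_nonneg e by auto
  note I = step'_integral[OF e, of s]
  have le: "?h r * l \<le> ?h r * mass c \<delta> r \<and> ?h r * mass c \<delta> r \<le> ?h r * M" for r
  proof (cases "r \<in> {s..s+e}")
    case True
    then show ?thesis using m[OF True] h0[of r] by (intro conjI mult_left_mono) auto
  next
    case False
    show ?thesis unfolding hz[OF False] by simp
  qed
  have b: "norm (?h r * mass c \<delta> r) \<le> norm (?h r * max \<bar>M\<bar> \<bar>l\<bar>)" for r
  proof (cases "r \<in> {s..s+e}")
    case True
    then have "\<bar>mass c \<delta> r\<bar> \<le> \<bar>max \<bar>M\<bar> \<bar>l\<bar>\<bar>" using m[OF True] by linarith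
    then show ?thesis unfolding real_norm_def abs_mult[of "?h r"] by (rule mult_left_mono) simp
  next
    case False
    show ?thesis unfolding hz[OF False] by simp
  qed
  have meas: "(\<lambda>r. ?h r * mass c \<delta> r) \<in> borel_measurable lborel"
  proof -
    have mc: "continuous_on {s..s+e} (mass c \<delta>)" by (rule continuous_on_subset[OF mass_continuous[OF d]]) (use s in auto)
    have im: "(\<lambda>r. indicator {s..s+e} r *\<^sub>R mass c \<delta> r) \<in> borel_measurable borel"
      by (rule borel_measurable_continuous_on_indicator[OF _ mc]) simp
    have hm: "?h \<in> borel_measurable borel" using borel_measurable_integrable[OF I(1)] by simp
    have "(\<lambda>r. ?h r * (indicator {s..s+e} r *\<^sub>R mass c \<delta> r)) \<in> borel_measurable borel"
      by (rule borel_measurable_times[OF hm im])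
    also have "(\<lambda>r. ?h r * (indicator {s..s+e} r *\<^sub>R mass c \<delta> r)) = (\<lambda>r. ?h r * mass c \<delta> r)"
    proof (rule ext)
      show "?h r * (indicator {s..s+e} r *\<^sub>R mass c \<delta> r) = ?h r * mass c \<delta> r" for r
        using hz[of r] by (cases "r \<in> {s..s+e}") auto
    qed
    finally show ?thesis by simp
  qed
  have iM: "integrable lborel (\<lambda>r. ?h r * mass c \<delta> r)"
    by (rule Bochner_Integration.integrable_bound[OF integrable_mult_left[OF I(1), of "max \<bar>M\<bar> \<bar>l\<bar>"] meas])
       (rule AE_I2[OF b])
  have "l = (LINT r|lborel. ?h r * l)" using I by simp
  also have "\<dots> \<le> (LINT r|lborel. ?h r * mass c \<delta> r)"
    by (rule integral_mono[OF integrable_mult_left[OF I(1)] iM]) (use le in auto)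
  finally show "l \<le> (LINT r|lborel. ?h r * mass c \<delta> r)" .
  have "(LINT r|lborel. ?h r * mass c \<delta> r) \<le> (LINT r|lborel. ?h r * M)"
    by (rule integral_mono[OF iM integrable_mult_left[OF I(1)]]) (use le in auto)
  also have "\<dots> = M" using I by simp
  finally show "(LINT r|lborel. ?h r * mass c \<delta> r) \<le> M" .
qed

lemma mass_decreasing_pos:
  assumes d: "\<delta> > 0" "0 \<le> c" "c \<le> \<beta>" and st: "0 < s" "s < t"
  shows "mass c \<delta> t \<le> mass c \<delta> s"
proof (rule field_le_epsilon)
  fix e :: real assume e: "0 < e"
  have near: "\<exists>r0>0. \<forall>r'\<in>{r..r+r0}. \<bar>mass c \<delta> r' - mass c \<delta> r\<bar> < e / 2" if "0 < r" for r
  proof -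
    have "r \<in> {0..}" "0 < e / 2" using that e by auto
    from mp[OF spec[OF bspec[OF mass_continuous[OF d(1,2), unfolded continuous_on_iff] this(1)], of "e / 2"] this(2)]
    obtain r1 where r1: "r1 > 0" "\<And>x. x \<in> {0..} \<Longrightarrow> dist x r < r1 \<Longrightarrow> dist (mass c \<delta> x) (mass c \<delta> r) < e / 2" by blast
    show ?thesis
    proof (intro exI[of _ "r1/2"] conjI ballI)
      fix r' assume "r' \<in> {r..r+r1/2}"
      then show "\<bar>mass c \<delta> r' - mass c \<delta> r\<bar> < e / 2" using r1(2)[of r'] r1(1) that by (auto simp: dist_real_def)
    qed (use r1 in auto)
  qed
  obtain r1 r2 where r: "r1 > 0" "r2 > 0" "\<forall>r'\<in>{s..s+r1}. \<bar>mass c \<delta> r' - mass c \<delta> s\<bar> < e / 2"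
    "\<forall>r'\<in>{t..t+r2}. \<bar>mass c \<delta> r' - mass c \<delta> t\<bar> < e / 2"
    using near[of s] near[of t] st by force
  define h where "h = min r1 r2"
  have h: "h > 0" using r by (simp add: h_def)
  have n1: "mass c \<delta> s - e/2 \<le> mass c \<delta> r' \<and> mass c \<delta> r' \<le> mass c \<delta> s + e/2" if "r' \<in> {s..s+h}" for r'
  proof -
    have "r' \<in> {s..s+r1}" using that by (auto simp: h_def)
    from bspec[OF r(3) this] show ?thesis by linarith
  qed
  have n2: "mass c \<delta> t - e/2 \<le> mass c \<delta> r' \<and> mass c \<delta> r' \<le> mass c \<delta> t + e/2" if "r' \<in> {t..t+h}" for r'
  proof -
    have "r' \<in> {t..t+r2}" using that by (auto simp: h_def)
    from bspec[OF r(4) this] show ?thesis by linarith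
  qed
  have "0 < t" using st by simp
  from weighted_mass_bound(1)[OF d(1,2) h this n2] weighted_mass_bound(2)[OF d(1,2) h st(1) n1] mass_weak_decreasing[OF d st h]
  show "mass c \<delta> t \<le> mass c \<delta> s + e" by linarith
qed

text \<open>Test functions vanish near t = 0, so the initial time is reached only through continuity
  of the mass, which rests on continuity of the solution in L^1.\<close>

lemma mass_decreasing:
  assumes d: "\<delta> > 0" "0 \<le> c" "c \<le> \<beta>" and st: "0 \<le> s" "s \<le> t"
  shows "mass c \<delta> t \<le> mass c \<delta> s"
proof (cases "s = t")
  case False
  show ?thesis
  proof (cases "0 < s")
    case True
    then show ?thesis using mass_decreasing_pos[OF d True] False st by simp
  next
    case False
    then have s: "s = 0" "0 < t" using st \<open>s \<noteq> t\<close> by auto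
    have "(mass c \<delta> \<longlongrightarrow> mass c \<delta> 0) (at 0 within {0..})"
      using mass_continuous[OF d(1,2)] by (auto simp: continuous_on_def)
    then have "(mass c \<delta> \<longlongrightarrow> mass c \<delta> 0) (at_right 0)" by (rule tendsto_within_subset) auto
    moreover have "eventually (\<lambda>r. mass c \<delta> t \<le> mass c \<delta> r) (at_right 0)"
      using eventually_at_right_real[OF s(2)] by eventually_elim (auto intro!: mass_decreasing_pos d)
    ultimately have "mass c \<delta> t \<le> mass c \<delta> 0" by (intro tendsto_lowerbound) auto
    then show ?thesis using s by simp
  qed
qed simp

lemma slab_mass:
  assumes d: "\<delta> > 0" "0 \<le> c" "c \<le> \<beta>" and ab: "0 < a" "a \<le> b"
  shows "integrable lborel (\<lambda>p. indicator {a..b} (fst p) * kappa c \<delta> (w p))"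
    "(b - a) * mass c \<delta> b \<le> (LINT p|lborel. indicator {a..b} (fst p) * kappa c \<delta> (w p))"
    "(LINT p|lborel. indicator {a..b} (fst p) * kappa c \<delta> (w p)) \<le> (b - a) * mass c \<delta> a"
proof -
  have h: "(indicator {a..b} :: real \<Rightarrow> real) \<in> borel_measurable borel" "\<And>t. (0::real) \<le> indicator {a..b} t"
    "\<And>t. indicator {a..b} t \<le> (1::real)" "\<forall>t. t \<notin> {a..b} \<longrightarrow> indicator {a..b} t = (0::real)" by (auto simp: indicator_def)
  note W = weighted_mass[OF d(1,2) h ab(1)]
  show "integrable lborel (\<lambda>p. indicator {a..b} (fst p) * kappa c \<delta> (w p))" by (rule W(1))
  have I: "integrable lborel (\<lambda>t. indicator {a..b} t * k :: real)" "(LINT t|lborel. indicator {a..b} t * k) = (b - a) * k" for k :: real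
    using ab emeasure_lborel_cbox_finite[of a b] by (auto intro!: integrable_mult_left integrable_real_indicator simp: less_top)
  have le: "indicator {a..b} t * mass c \<delta> b \<le> indicator {a..b} t * mass c \<delta> t \<and> indicator {a..b} t * mass c \<delta> t \<le> indicator {a..b} t * mass c \<delta> a" for t
    using mass_decreasing[OF d, of t b] mass_decreasing[OF d, of a t] ab by (auto simp: indicator_def)
  have im: "integrable lborel (\<lambda>t. indicator {a..b} t * mass c \<delta> t)"
  proof (rule Bochner_Integration.integrable_bound[OF I(1)[of "mass c \<delta> a"]])
    have "continuous_on {a..b} (mass c \<delta>)" by (rule continuous_on_subset[OF mass_continuous[OF d(1,2)]]) (use ab in auto)
    from borel_measurable_continuous_on_indicator[OF _ this] show "(\<lambda>t. indicator {a..b} t * mass c \<delta> t) \<in> borel_measurable lborel" by simp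
    show "AE t in lborel. norm (indicator {a..b} t * mass c \<delta> t) \<le> norm (indicator {a..b} t * mass c \<delta> a)"
      using le mass_nonneg[OF d(1), of c] by (intro AE_I2) (auto simp: abs_mult)
  qed
  have "(b - a) * mass c \<delta> b = (LINT t|lborel. indicator {a..b} t * mass c \<delta> b)" by (rule I(2)[symmetric])
  also have "\<dots> \<le> (LINT t|lborel. indicator {a..b} t * mass c \<delta> t)" by (rule integral_mono[OF I(1) im]) (use le in auto)
  also have "\<dots> = (LINT p|lborel. indicator {a..b} (fst p) * kappa c \<delta> (w p))" by (rule W(3)[symmetric])
  finally show "(b - a) * mass c \<delta> b \<le> (LINT p|lborel. indicator {a..b} (fst p) * kappa c \<delta> (w p))" .
  have "(LINT p|lborel. indicator {a..b} (fst p) * kappa c \<delta> (w p)) = (LINT t|lborel. indicator {a..b} t * mass c \<delta> t)" by (rule W(3))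
  also have "\<dots> \<le> (LINT t|lborel. indicator {a..b} t * mass c \<delta> a)" by (rule integral_mono[OF im I(1)]) (use le in auto)
  also have "\<dots> = (b - a) * mass c \<delta> a" by (rule I(2))
  finally show "(LINT p|lborel. indicator {a..b} (fst p) * kappa c \<delta> (w p)) \<le> (b - a) * mass c \<delta> a" .
qed

lemma mass_le_L1:
  assumes "\<delta> > 0" "0 \<le> c" "0 \<le> t" shows "mass c \<delta> t \<le> L1_norm (u t)"
  unfolding mass_def L1_norm_def using u_int[OF assms(3)]
  by (intro integral_mono kappa_u_integrable kappa_le_abs assms integrable_abs)


end

subsection \<open>The dissipation estimate\<close>

lemma hessian_expand:
  fixes \<Phi> :: "'a::euclidean_space \<Rightarrow> real"
  assumes "smooth \<Phi>"
  shows "(\<Sum>b\<in>Basis. (\<xi> \<bullet> b) * pderiv_dir h (pderiv_dir b \<Phi>) z) = pderiv_dir h (pderiv_dir \<xi> \<Phi>) z"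
proof -
  have "pderiv_dir \<xi> \<Phi> = (\<lambda>x. \<Sum>b\<in>Basis. (\<xi> \<bullet> b) * pderiv_dir b \<Phi> x)"
    by (rule ext) (rule frechet_derivative_basis_expansion[OF smooth_differentiable[OF assms]])
  moreover have "((\<lambda>x. \<Sum>b\<in>Basis. (\<xi> \<bullet> b) * pderiv_dir b \<Phi> x) has_derivative
      (\<lambda>h. \<Sum>b\<in>Basis. (\<xi> \<bullet> b) * pderiv_dir h (pderiv_dir b \<Phi>) z)) (at z)"
    by (intro has_derivative_sum has_derivative_mult_right smooth_has_derivative smooth_pderiv_dir assms)
  ultimately have "(pderiv_dir \<xi> \<Phi> has_derivative (\<lambda>h. \<Sum>b\<in>Basis. (\<xi> \<bullet> b) * pderiv_dir h (pderiv_dir b \<Phi>) z)) (at z)" by simp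
  from fun_cong[OF frechet_derivative_at[OF this], of h] show ?thesis by simp
qed

lemma flux_linear_functional:
  fixes av :: "real \<Rightarrow> 'a::euclidean_space" and T :: "'a \<Rightarrow> real"
  assumes "continuous_on {c..\<beta>} av" "continuous_on UNIV h" "v \<le> \<beta>" "linear T"
  shows "((\<lambda>s. h s * T (av s)) has_integral T (flux c \<beta> av h v)) {c..v}"
proof -
  have "continuous_on {c..v} av" "continuous_on {c..v} h"
    using assms by (auto intro: continuous_on_subset)
  then have "(\<lambda>s. h s *\<^sub>R av s) integrable_on {c..v}" by (intro integrable_continuous_real continuous_intros)
  from has_integral_linear[OF integrable_integral[OF this], of T] assms(4)
  have "((\<lambda>s. T (h s *\<^sub>R av s)) has_integral T (integral {c..v} (\<lambda>s. h s *\<^sub>R av s))) {c..v}"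
    by (simp add: linear_conv_bounded_linear o_def)
  then show ?thesis using assms(3) by (simp add: linear_cmul[OF assms(4)] flux_def min_absorb1)
qed

lemma flux_combination:
  fixes av :: "real \<Rightarrow> 'a::euclidean_space"
  assumes "continuous_on {c..\<beta>} av" "continuous_on UNIV g" "continuous_on UNIV h"
  shows "flux c \<beta> av (\<lambda>s. r * g s + q * h s) v = r *\<^sub>R flux c \<beta> av g v + q *\<^sub>R flux c \<beta> av h v"
proof -
  have s: "{c..min v \<beta>} \<subseteq> {c..\<beta>}" by auto
  have i: "(\<lambda>s. g s *\<^sub>R av s) integrable_on {c..min v \<beta>}" "(\<lambda>s. h s *\<^sub>R av s) integrable_on {c..min v \<beta>}"
    by (intro integrable_continuous_real continuous_intros continuous_on_subset[OF assms(1) s] continuous_on_subset[OF assms(2) subset_UNIV]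
        continuous_on_subset[OF assms(3) subset_UNIV])+
  have "flux c \<beta> av (\<lambda>s. r * g s + q * h s) v = integral {c..min v \<beta>} (\<lambda>s. r *\<^sub>R (g s *\<^sub>R av s) + q *\<^sub>R (h s *\<^sub>R av s))"
    by (simp add: flux_def scaleR_add_left)
  also have "\<dots> = r *\<^sub>R flux c \<beta> av g v + q *\<^sub>R flux c \<beta> av h v"
    using i by (simp add: Henstock_Kurzweil_Integration.integral_add integrable_cmul flux_def del: scaleR_scaleR)
  finally show ?thesis .
qed

lemma frechet_flux_integrable:
  fixes \<psi> :: "'a::euclidean_space \<Rightarrow> real"
  assumes \<psi>: "smooth \<psi>" "\<And>p. R < norm p \<Longrightarrow> \<psi> p = 0" and F: "continuous_on UNIV F" "w \<in> borel_measurable borel" "\<And>p. norm (F (w p)) \<le> B"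
  shows "integrable lborel (\<lambda>p. frechet_derivative \<psi> (at p) (F (w p)))"
proof -
  have [measurable]: "(\<lambda>p. F (w p)) \<in> borel_measurable borel" by (rule borel_measurable_continuous_on[OF F(1,2)])
  have "integrable lborel (\<lambda>p. (F (w p) \<bullet> b) * pderiv_dir b \<psi> p)" if b: "b \<in> Basis" for b
  proof (rule Bochner_Integration.integrable_bound)
    have ip: "integrable lborel (pderiv_dir b \<psi>)"
      by (rule integrable_continuous_bounded_support[OF smooth_continuous[OF smooth_pderiv_dir[OF \<psi>(1)]]]) (rule smooth_pderiv_dir_support[OF \<psi>])
    then show "integrable lborel (\<lambda>p. B * \<bar>pderiv_dir b \<psi> p\<bar>)" by (intro integrable_mult_right integrable_abs)
    have [measurable]: "pderiv_dir b \<psi> \<in> borel_measurable borel" using borel_measurable_integrable[OF ip] by simp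
    show "(\<lambda>p. (F (w p) \<bullet> b) * pderiv_dir b \<psi> p) \<in> borel_measurable lborel" by measurable
    have "\<bar>F (w p) \<bullet> b\<bar> \<le> B" for p using Basis_le_norm[OF b, of "F (w p)"] F(3)[of p] by linarith
    then have "\<bar>F (w p) \<bullet> b\<bar> * \<bar>pderiv_dir b \<psi> p\<bar> \<le> B * \<bar>pderiv_dir b \<psi> p\<bar>" for p by (rule mult_right_mono) simp
    then show "AE p in lborel. norm ((F (w p) \<bullet> b) * pderiv_dir b \<psi> p) \<le> norm (B * \<bar>pderiv_dir b \<psi> p\<bar>)"
      unfolding real_norm_def abs_mult[of "F (w _) \<bullet> b"] by (intro AE_I2) (rule order_trans[OF _ abs_ge_self])
  qed
  then show ?thesis
    by (subst frechet_derivative_basis_expansion[OF smooth_differentiable[OF \<psi>(1)]]) (rule Bochner_Integration.integrable_sum)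
qed

lemma clip_mid:
  assumes "\<delta> > 0" "s \<in> {c..c+\<delta>}" shows "clip c \<delta> s = (s - c) / \<delta>"
proof -
  have "0 \<le> (s - c) / \<delta>" "(s - c) / \<delta> \<le> 1" using assms by auto
  then show ?thesis by (simp add: clip_def)
qed

context kinetic_solution
begin

text \<open>The tent has slope at most 2/\<delta> and the factor av s . y has size C and slope
  C/\<delta>, so the profile has slope at most 3 C/\<delta> on the band. There \<open>clip\<close>
  has slope 1/\<delta>, and outside the band both are constant. Hence adding or subtracting the
  profile keeps 3 C times \<open>clip\<close> nondecreasing, and the corresponding primitives are
  convex entropies.\<close>

lemma tent_profile:
  assumes d: "\<delta> > 0" "0 \<le> c" "c + \<delta> \<le> \<beta>" and C: "0 \<le> C"
    and y: "\<And>v. v \<in> {c..c+\<delta>} \<Longrightarrow> \<bar>av v \<bullet> y\<bar> \<le> C"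
      "\<And>v v'. v \<in> {c..c+\<delta>} \<Longrightarrow> v' \<in> {c..c+\<delta>} \<Longrightarrow> \<bar>av v \<bullet> y - av v' \<bullet> y\<bar> \<le> C / \<delta> * \<bar>v - v'\<bar>"
  defines "h \<equiv> \<lambda>s. tent c \<delta> s * (av s \<bullet> y)"
  shows "continuous_on UNIV h" "\<And>s. \<bar>h s\<bar> \<le> 2 * C * clip c \<delta> s" "\<And>s. s \<notin> {c..c+\<delta>} \<Longrightarrow> h s = 0"
    "mono (\<lambda>s. 3 * C * clip c \<delta> s + h s)" "mono (\<lambda>s. 3 * C * clip c \<delta> s - h s)"
proof -
  define cl where "cl s = max c (min (c + \<delta>) s)" for s
  have cl: "cl s \<in> {c..c+\<delta>}" "s \<in> {c..c+\<delta>} \<Longrightarrow> cl s = s" for s using d by (auto simp: cl_def)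
  show h0: "h s = 0" if "s \<notin> {c..c+\<delta>}" for s
    using that tent_zero[OF d(1), of s c] by (auto simp: h_def)
  have "h s = tent c \<delta> s * (av (cl s) \<bullet> y)" for s
    using h0[of s] cl(2)[of s] tent_zero[OF d(1), of s c] by (cases "s \<in> {c..c+\<delta>}") (auto simp: h_def)
  then have he: "h = (\<lambda>s. tent c \<delta> s * (av (cl s) \<bullet> y))" by auto
  have "continuous_on UNIV (\<lambda>s. av (cl s))"
  proof (rule continuous_on_compose2[OF av_cont])
    show "continuous_on UNIV cl" unfolding cl_def[abs_def] by (intro continuous_intros)
    have "cl s \<in> {\<alpha>..\<beta>}" for s using cl(1)[of s] d zero_range by auto
    then show "range cl \<subseteq> {\<alpha>..\<beta>}" by blast
  qed
  then show "continuous_on UNIV h" unfolding he by (intro continuous_intros tent_continuous)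
  show "\<bar>h s\<bar> \<le> 2 * C * clip c \<delta> s" for s
  proof (cases "s \<in> {c..c+\<delta>}")
    case True
    have "\<bar>h s\<bar> = tent c \<delta> s * \<bar>av s \<bullet> y\<bar>" using tent_bounds by (simp add: h_def abs_mult)
    also have "\<dots> \<le> (2 * (s - c) / \<delta>) * C"
      using tent_le[OF d(1), of c s] True y(1)[OF True] tent_bounds d by (intro mult_mono) auto
    also have "\<dots> = 2 * C * clip c \<delta> s" using clip_mid[OF d(1) True] by simp
    finally show ?thesis .
  next
    case False
    then show ?thesis unfolding h0[OF False] using C clip_bounds(1)[of c \<delta> s] by simp
  qed
  have hl: "\<bar>h s - h s'\<bar> \<le> 3 * C * (clip c \<delta> s' - clip c \<delta> s)" if le: "s \<le> s'" for s s'
  proof -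
    have ec': "h r = h (cl r) \<and> clip c \<delta> r = clip c \<delta> (cl r)" for r
    proof -
      consider "r \<in> {c..c+\<delta>}" | "r < c" | "c + \<delta> < r" by force
      then show "h r = h (cl r) \<and> clip c \<delta> r = clip c \<delta> (cl r)"
      proof (cases)
        case 1
        then show "h r = h (cl r) \<and> clip c \<delta> r = clip c \<delta> (cl r)" by (simp add: cl(2))
      next
        case 2
        then have "cl r = c" using d by (simp add: cl_def)
        then show "h r = h (cl r) \<and> clip c \<delta> r = clip c \<delta> (cl r)"
          using 2 tent_zero[OF d(1), of c c] h0[of r] clip_zero[OF d(1), of r c] clip_zero[OF d(1), of c c] by (auto simp: h_def)
      next
        case 3
        then have "cl r = c + \<delta>" using d by (simp add: cl_def)
        then show "h r = h (cl r) \<and> clip c \<delta> r = clip c \<delta> (cl r)"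
          using 3 tent_zero[OF d(1), of "c+\<delta>" c] h0[of r] clip_one[OF d(1), of c r] clip_one[OF d(1), of c "c + \<delta>"] by (auto simp: h_def)
      qed
    qed
    note ec = ec'[THEN conjunct1] ec'[THEN conjunct2]
    define r r' where "r = cl s" and "r' = cl s'"
    have r: "r \<in> {c..c+\<delta>}" "r' \<in> {c..c+\<delta>}" "r \<le> r'" using cl(1) le by (auto simp: r_def r'_def cl_def)
    have "h r - h r' = (tent c \<delta> r - tent c \<delta> r') * (av r \<bullet> y) + tent c \<delta> r' * (av r \<bullet> y - av r' \<bullet> y)"
      by (simp add: h_def algebra_simps)
    also have "\<bar>\<dots>\<bar> \<le> \<bar>tent c \<delta> r - tent c \<delta> r'\<bar> * \<bar>av r \<bullet> y\<bar> + \<bar>tent c \<delta> r'\<bar> * \<bar>av r \<bullet> y - av r' \<bullet> y\<bar>"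
      by (intro order_trans[OF abs_triangle_ineq]) (simp add: abs_mult)
    also have "\<dots> \<le> (2 / \<delta> * \<bar>r - r'\<bar>) * C + 1 * (C / \<delta> * \<bar>r - r'\<bar>)"
      using tent_lipschitz[OF d(1)] y(1)[OF r(1)] y(2)[OF r(1,2)] tent_bounds[of c \<delta> r'] d by (intro add_mono mult_mono) auto
    also have "\<dots> = 3 * C * ((r' - r) / \<delta>)" using r(3) by (simp add: divide_inverse algebra_simps)
    also have "(r' - r) / \<delta> = clip c \<delta> r' - clip c \<delta> r"
    proof -
      have "clip c \<delta> q = (q - c) / \<delta>" if "q \<in> {c..c+\<delta>}" for q by (rule clip_mid[OF d(1) that])
      then show ?thesis using r by (simp add: diff_divide_distrib)
    qed
    finally show ?thesis unfolding ec(1)[of s] ec(1)[of s'] ec(2)[of s] ec(2)[of s'] r_def r'_def .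
  qed
  show "mono (\<lambda>s. 3 * C * clip c \<delta> s + h s)"
  proof (rule monoI)
    fix s s' :: real assume "s \<le> s'"
    from hl[OF this] show "3 * C * clip c \<delta> s + h s \<le> 3 * C * clip c \<delta> s' + h s'" by (simp add: algebra_simps abs_le_iff)
  qed
  show "mono (\<lambda>s. 3 * C * clip c \<delta> s - h s)"
  proof (rule monoI)
    fix s s' :: real assume "s \<le> s'"
    from hl[OF this] show "3 * C * clip c \<delta> s - h s \<le> 3 * C * clip c \<delta> s' - h s'" by (simp add: algebra_simps abs_le_iff)
  qed
qed

text \<open>The entropies \<open>3C\<eta> \<plusminus> H\<close>, where \<open>H\<close> oscillates on the band \<open>[c, c + \<delta>]\<close>, are tested with
  \<open>\<chi>(1 \<minusplus> \<psi>)\<close>; the difference isolates the gradient of \<open>\<chi>\<psi>\<close> paired with the flux of \<open>H\<close>.\<close>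

lemma entropy_two_sided:
  assumes d: "\<delta> > 0" "0 \<le> c" "c \<le> \<beta>" and C: "0 \<le> C"
    and h: "continuous_on UNIV h" "mono (\<lambda>s. 3 * C * clip c \<delta> s + h s)" "mono (\<lambda>s. 3 * C * clip c \<delta> s - h s)" "\<And>s. s \<le> c \<Longrightarrow> h s = 0"
    and f: "smooth f" "\<And>t. 0 \<le> f t" "0 < s0" "\<And>t. t \<notin> {s0..s1} \<Longrightarrow> f t = 0" and R: "R > 0"
    and \<psi>: "smooth \<psi>" "\<And>p. \<bar>\<psi> p\<bar> \<le> 1"
  shows "integrable lborel (\<lambda>p. frechet_derivative (\<lambda>p. cutoff f R p * \<psi> p) (at p) (flux c \<beta> av h (w p)))"
    "integrable lborel (\<lambda>p. frechet_derivative (cutoff f R) (at p) (flux c \<beta> av (clip c \<delta>) (w p)))"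
    "(LINT p|lborel. frechet_derivative (\<lambda>p. cutoff f R p * \<psi> p) (at p) (flux c \<beta> av h (w p)))
       \<le> 3 * C * (LINT p|lborel. frechet_derivative (cutoff f R) (at p) (flux c \<beta> av (clip c \<delta>) (w p)))"
proof -
  let ?\<chi> = "cutoff f R :: real \<times> (real^'n) \<Rightarrow> real"
  have ac: "continuous_on {c..\<beta>} av" by (rule continuous_on_subset[OF av_cont]) (use d zero_range in auto)
  have sc: "smooth ?\<chi>" by (rule smooth_cutoff[OF f(1)])
  have sp: "smooth (\<lambda>p. ?\<chi> p * \<psi> p)" by (rule smooth_mult[OF sc \<psi>(1)])
  have c0: "0 \<le> ?\<chi> p" for p unfolding cutoff_def by (rule mult_nonneg_nonneg[OF f(2) zeta_bounds(1)])
  have cz: "?\<chi> p = 0" if p: "\<bar>s0\<bar> + \<bar>s1\<bar> + 2 * R < norm p" for p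
  proof -
    have "norm p \<le> \<bar>fst p\<bar> + norm (snd p)" using norm_Pair_le[of "fst p" "snd p"] by simp
    then have "\<bar>s0\<bar> + \<bar>s1\<bar> < \<bar>fst p\<bar> \<or> 2 * R < norm (snd p)" using p by linarith
    then show ?thesis
    proof
      assume "\<bar>s0\<bar> + \<bar>s1\<bar> < \<bar>fst p\<bar>"
      then have "fst p \<notin> {s0..s1}" by auto
      then show ?thesis using f(4) by (simp add: cutoff_def)
    next
      assume "2 * R < norm (snd p)"
      then show ?thesis using zeta_zero[OF R, of "snd p"] by (simp add: cutoff_def)
    qed
  qed
  have bF: "\<exists>B. \<forall>p. norm (F (w p)) \<le> B" if "continuous_on UNIV F" for F :: "real \<Rightarrow> real \<times> (real^'n)"
  proof -
    have "bounded (F ` {\<alpha>..\<beta>})" by (intro compact_imp_bounded compact_continuous_image continuous_on_subset[OF that] compact_Icc) auto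
    then show ?thesis unfolding bounded_iff using w_range by blast
  qed
  have Fh: "continuous_on UNIV (flux c \<beta> av h)" by (rule flux_continuous[OF continuous_on_subset[OF h(1) subset_UNIV] ac d(3)])
  have Fc: "continuous_on UNIV (flux c \<beta> av (clip c \<delta>))" by (rule flux_continuous[OF clip_continuous ac d(3)])
  obtain B B' where B: "\<And>p. norm (flux c \<beta> av h (w p)) \<le> B" "\<And>p. norm (flux c \<beta> av (clip c \<delta>) (w p)) \<le> B'"
    using bF[OF Fh] bF[OF Fc] by blast
  show i1: "integrable lborel (\<lambda>p. frechet_derivative (\<lambda>p. ?\<chi> p * \<psi> p) (at p) (flux c \<beta> av h (w p)))"
    by (rule frechet_flux_integrable[OF sp _ Fh w_meas B(1)]) (use cz in auto)
  show i2: "integrable lborel (\<lambda>p. frechet_derivative ?\<chi> (at p) (flux c \<beta> av (clip c \<delta>) (w p)))"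
    by (rule frechet_flux_integrable[OF sc cz Fc w_meas B(2)])
  have i3: "integrable lborel (\<lambda>p. frechet_derivative (\<lambda>p. ?\<chi> p * \<psi> p) (at p) (flux c \<beta> av (clip c \<delta>) (w p)))"
    by (rule frechet_flux_integrable[OF sp _ Fc w_meas B(2)]) (use cz in auto)
  have i4: "integrable lborel (\<lambda>p. frechet_derivative ?\<chi> (at p) (flux c \<beta> av h (w p)))"
    by (rule frechet_flux_integrable[OF sc cz Fh w_meas B(1)])
  let ?X = "LINT p|lborel. frechet_derivative ?\<chi> (at p) (flux c \<beta> av (clip c \<delta>) (w p))"
  let ?Y = "LINT p|lborel. frechet_derivative (\<lambda>p. ?\<chi> p * \<psi> p) (at p) (flux c \<beta> av h (w p))"
  let ?X' = "LINT p|lborel. frechet_derivative (\<lambda>p. ?\<chi> p * \<psi> p) (at p) (flux c \<beta> av (clip c \<delta>) (w p))"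
  let ?Y' = "LINT p|lborel. frechet_derivative ?\<chi> (at p) (flux c \<beta> av h (w p))"
  \<comment> \<open>Here q is the sign of the oscillating part of the entropy and e the sign of
    \<psi> in the test function; |\<psi>| \<le> 1 keeps the test function nonnegative.\<close>
  have main: "0 \<le> 3 * C * ?X + q * ?Y' + e * (3 * C * ?X') + e * q * ?Y"
    if q: "mono (\<lambda>s. 3 * C * clip c \<delta> s + q * h s)" and e: "\<bar>e\<bar> = 1" for q e :: real
  proof -
    let ?\<phi> = "\<lambda>p. ?\<chi> p + e * (?\<chi> p * \<psi> p)"
    have s\<phi>: "smooth ?\<phi>" by (intro smooth_add smooth_cmult sc sp)
    have \<phi>0: "0 \<le> ?\<phi> p" for p
    proof -
      have "\<bar>e * \<psi> p\<bar> \<le> 1" using \<psi>(2)[of p] e by (simp add: abs_mult)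
      then have "0 \<le> ?\<chi> p * (1 + e * \<psi> p)" using c0[of p] by (intro mult_nonneg_nonneg) auto
      then show ?thesis by (simp add: algebra_simps)
    qed
    have t\<phi>: "test_function ?\<phi>"
      by (rule test_function_mult_support[OF s\<phi> \<phi>0 f(3,4) R]) auto
    have D: "frechet_derivative ?\<phi> (at p) k = frechet_derivative ?\<chi> (at p) k + e * frechet_derivative (\<lambda>p. ?\<chi> p * \<psi> p) (at p) k" for p k
    proof -
      have "(?\<phi> has_derivative (\<lambda>k. frechet_derivative ?\<chi> (at p) k + e * frechet_derivative (\<lambda>p. ?\<chi> p * \<psi> p) (at p) k)) (at p)"
        by (intro has_derivative_add has_derivative_mult_right smooth_has_derivative sc sp)
      from fun_cong[OF frechet_derivative_at[OF this], of k] show ?thesis by simp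
    qed
    have lin: "frechet_derivative g (at p) ((3 * C) *\<^sub>R k + q *\<^sub>R k') = 3 * C * frechet_derivative g (at p) k + q * frechet_derivative g (at p) k'"
      if "smooth g" for g :: "real \<times> (real^'n) \<Rightarrow> real" and p k k'
    proof -
      have "linear (frechet_derivative g (at p))" using smooth_has_derivative[OF that] has_derivative_linear by blast
      then show ?thesis by (simp add: linear_add linear_cmul)
    qed
    have gc: "continuous_on UNIV (\<lambda>s. 3 * C * clip c \<delta> s + q * h s)" by (intro continuous_intros clip_continuous h(1))
    have "0 \<le> (LINT p|lborel. frechet_derivative ?\<phi> (at p) (flux c \<beta> av (\<lambda>s. 3 * C * clip c \<delta> s + q * h s) (w p)))"
      by (rule entropy[OF d(2,3) gc q _ t\<phi>]) (simp add: clip_zero[OF d(1)] h(4))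
    also have "\<dots> = (LINT p|lborel. 3 * C * frechet_derivative ?\<chi> (at p) (flux c \<beta> av (clip c \<delta>) (w p))
         + q * frechet_derivative ?\<chi> (at p) (flux c \<beta> av h (w p))
         + e * (3 * C * frechet_derivative (\<lambda>p. ?\<chi> p * \<psi> p) (at p) (flux c \<beta> av (clip c \<delta>) (w p)))
         + e * q * frechet_derivative (\<lambda>p. ?\<chi> p * \<psi> p) (at p) (flux c \<beta> av h (w p)))"
      unfolding flux_combination[OF ac clip_continuous h(1)] D lin[OF sc] lin[OF sp]
      by (rule Bochner_Integration.integral_cong) (simp_all add: distrib_left)
    also have "\<dots> = 3 * C * ?X + q * ?Y' + e * (3 * C * ?X') + e * q * ?Y"
      using i1 i2 i3 i4 by (simp add: Bochner_Integration.integral_add)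
    finally show ?thesis .
  qed
  \<comment> \<open>In both cases e q = -1. Adding them cancels the mixed terms ?Y' and ?X' and
    leaves 6 C ?X - 2 ?Y \<ge> 0.\<close>
  from main[of 1 "-1"] main[of "-1" 1] h(2,3) show "?Y \<le> 3 * C * ?X" by simp
qed

end

context kinetic_solution
begin

text \<open>V majorises the effect of differentiating the cut-off on any flux dominated by
  \<open>kappa\<close>. It has three parts, from the rise on [t0, t1], the fall on [t2, t2 + 1] and
  the spatial gradient; each has integral at most the mass at t0, because the mass
  decreases.\<close>

lemma time_cutoff:
  assumes d: "\<delta> > 0" "0 \<le> c" "c \<le> \<beta>" and t: "0 < t0" "t0 < t1" "t1 \<le> t2"
  shows "\<exists>f R V. smooth f \<and> (\<forall>t. 0 \<le> f t) \<and> (\<forall>t. t \<notin> {t0..t2+1} \<longrightarrow> f t = 0) \<and> (\<forall>t\<in>{t1..t2}. f t = 1) \<and>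
     R0 \<le> R \<and> 0 < R \<and> integrable lborel V \<and> (LINT p|lborel. V p) \<le> 3 * mass c \<delta> t0 \<and>
     (\<forall>p k M. 0 \<le> M \<longrightarrow> norm k \<le> M * kappa c \<delta> (w p) \<longrightarrow> \<bar>frechet_derivative (cutoff f R) (at p) k\<bar> \<le> M * V p)"
proof -
  obtain Z where Z: "Z \<ge> 1" "\<And>x. step' x \<le> Z" using step'_bounded by blast
  define e where "e = t1 - t0"
  have e: "e > 0" using t by (simp add: e_def)
  define h1 where "h1 r = step' ((r - t0) / e) / e" for r
  define h2 where "h2 r = step' ((r - t2) / 1) / 1" for r
  define f where "f r = step ((1/e) * r + (- t0 / e)) - step (1 * r + (- t2))" for r
  have sf: "smooth f" unfolding f_def[abs_def] by (intro smooth_diff smooth_step_affine)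
  have df: "(f has_real_derivative h1 r - h2 r) (at r)" for r
    unfolding f_def[abs_def] by (rule DERIV_cong[OF DERIV_diff[OF step_affine_deriv step_affine_deriv]])
      (simp add: h1_def h2_def diff_divide_distrib)
  have ge: "1 \<le> (1/e) * r + (- t0 / e)" if "t1 \<le> r" for r
  proof -
    have "1 \<le> (r - t0) / e" using that t e by (simp add: e_def)
    then show ?thesis by (simp add: diff_divide_distrib)
  qed
  have f1: "f r = 1" if "r \<in> {t1..t2}" for r
  proof -
    have "1 \<le> (1/e) * r + (- t0 / e)" by (rule ge) (use that in simp)
    then show ?thesis using that by (simp add: f_def step_0 step_1 del: times_divide_eq_left)
  qed
  have fz: "f r = 0" if "r \<notin> {t0..t2+1}" for r
  proof (cases "r < t0")
    case True
    then have "1 / e * r + - t0 / e \<le> 0" "1 * r + - t2 \<le> 0" using e t by (simp_all add: field_simps)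
    then show ?thesis unfolding f_def by (simp only: step_0)
  next
    case False
    then have "1 \<le> 1 / e * r + - t0 / e" "1 \<le> 1 * r + - t2" using ge[of r] t that by auto
    then show ?thesis unfolding f_def by (simp only: step_1)
  qed
  have f0: "0 \<le> f r" for r
  proof (cases "r \<le> t2")
    case True
    then show ?thesis using step_bounds(1)[of "1 / e * r + - t0 / e"] unfolding f_def by (subst (2) step_0) auto
  next
    case False
    then have "1 \<le> 1 / e * r + - t0 / e" using ge[of r] t by simp
    then show ?thesis using step_bounds(2)[of "1 * r + - t2"] unfolding f_def by (subst step_1) auto
  qed
  have fle: "f r \<le> 1" for r unfolding f_def using step_bounds(2)[of "1 / e * r + - t0 / e"] step_bounds(1)[of "1 * r + - t2"] by linarith
  have hz1: "\<forall>r. r \<notin> {t0..t0+e} \<longrightarrow> h1 r = 0" using e by (auto simp: h1_def step'_zero divide_le_0_iff le_divide_eq)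
  have hz2: "\<forall>r. r \<notin> {t2..t2+1} \<longrightarrow> h2 r = 0" by (auto simp: h2_def step'_zero)
  have hm: "h1 \<in> borel_measurable borel" "h2 \<in> borel_measurable borel"
    unfolding h1_def[abs_def] h2_def[abs_def]
    by (intro borel_measurable_continuous_onI continuous_intros continuous_on_compose2[OF smooth_continuous[OF smooth_step']]; use e in auto)+
  have h0: "0 \<le> h1 r" "0 \<le> h2 r" for r using step'_nonneg e by (auto simp: h1_def h2_def)
  have hH: "h1 r \<le> Z / e" "h2 r \<le> Z" for r using Z e by (auto simp: h1_def h2_def divide_right_mono)
  have t2: "0 < t2" "t0 \<le> t2 + 1" using t by auto
  have fz': "\<forall>r. r \<notin> {t0..t2+1} \<longrightarrow> f r = 0" using fz by blast
  note W1 = weighted_mass[OF d(1,2) hm(1) h0(1) hH(1) hz1 t(1)]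
  note W2 = weighted_mass[OF d(1,2) hm(2) h0(2) hH(2) hz2 t2(1)]
  note Wf = weighted_mass[OF d(1,2) smooth_borel_measurable[OF sf] f0 fle fz' t(1)]
  note S = slab_mass[OF d t(1) t2(2)]
  have m0: "0 \<le> mass c \<delta> r" for r by (rule mass_nonneg[OF d(1)])
  let ?k = "\<lambda>p. kappa c \<delta> (w p)"
  have b1: "(LINT p|lborel. h1 (fst p) * ?k p) \<le> mass c \<delta> t0"
    unfolding W1(3) unfolding h1_def
    by (rule weighted_mass_bound(2)[OF d(1,2) e t(1), of 0]) (use m0 mass_decreasing[OF d, of t0] t in auto)
  have b2: "(LINT p|lborel. h2 (fst p) * ?k p) \<le> mass c \<delta> t0"
    unfolding W2(3) unfolding h2_def
    by (rule weighted_mass_bound(2)[OF d(1,2) zero_less_one t2(1), of 0]) (use m0 mass_decreasing[OF d, of t0] t in auto)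
  have b3: "(LINT p|lborel. f (fst p) * ?k p) \<le> (t2 + 1 - t0) * mass c \<delta> t0"
  proof (rule order_trans[OF integral_mono[OF Wf(1) S(1)] S(3)])
    fix p :: "real \<times> (real^'n)"
    show "f (fst p) * ?k p \<le> indicator {t0..t2+1} (fst p) * ?k p"
      using fz[of "fst p"] fle[of "fst p"] kappa_nonneg[OF d(1)] by (intro mult_right_mono) (auto simp: indicator_def)
  qed
  \<comment> \<open>The last entry makes the spatial gradient, integrated over the life time of the
    cut-off, cost no more than one mass. The entry \<open>R0\<close> leaves room for a prescribed
    bounded set on which the cut-off is to be 1.\<close>
  define R where "R = max (max 1 R0) (4 * Z * (t2 + 1 - t0))"
  have R: "R0 \<le> R" "0 < R" "4 * Z * (t2 + 1 - t0) \<le> R" unfolding R_def by linarith+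
  define V where "V p = h1 (fst p) * ?k p + h2 (fst p) * ?k p + (4 * Z / R) * (f (fst p) * ?k p)" for p
  have iV: "integrable lborel V" unfolding V_def[abs_def]
    by (intro Bochner_Integration.integrable_add integrable_mult_right W1(1) W2(1) Wf(1))
  have "(LINT p|lborel. V p) = (LINT p|lborel. h1 (fst p) * ?k p) + (LINT p|lborel. h2 (fst p) * ?k p) + (4 * Z / R) * (LINT p|lborel. f (fst p) * ?k p)"
    unfolding V_def using W1(1) W2(1) Wf(1) by (simp add: Bochner_Integration.integral_add)
  also have "(4 * Z / R) * (LINT p|lborel. f (fst p) * ?k p) \<le> (4 * Z / R) * ((t2 + 1 - t0) * mass c \<delta> t0)"
    using R Z by (intro mult_left_mono b3) auto
  also have "\<dots> = (4 * Z * (t2 + 1 - t0) / R) * mass c \<delta> t0" by simp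
  also have "\<dots> \<le> 1 * mass c \<delta> t0" using R m0 by (intro mult_right_mono) auto
  finally have iV3: "(LINT p|lborel. V p) \<le> 3 * mass c \<delta> t0" using b1 b2 by linarith
  have bd: "\<bar>frechet_derivative (cutoff f R) (at p) k\<bar> \<le> M * V p" if M: "0 \<le> M" "norm k \<le> M * ?k p" for p and k :: "real \<times> (real^'n)" and M
  proof -
    have "\<bar>frechet_derivative (cutoff f R) (at p) k\<bar> \<le> norm k * (\<bar>h1 (fst p) - h2 (fst p)\<bar> + (4 * Z / R) * f (fst p))"
      by (rule cutoff_deriv_bound[OF df R(2) Z f0])
    also have "\<dots> \<le> (M * ?k p) * ((h1 (fst p) + h2 (fst p)) + (4 * Z / R) * f (fst p))"
      using h0[of "fst p"] f0[of "fst p"] M R Z kappa_nonneg[OF d(1), of c "w p"] by (intro mult_mono add_mono mult_nonneg_nonneg) auto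
    also have "\<dots> = M * V p" by (simp add: V_def algebra_simps)
    finally show ?thesis .
  qed
  show ?thesis
    by (rule exI[of _ f], rule exI[of _ R], rule exI[of _ V]) (use sf f0 fz f1 R iV iV3 bd in blast)
qed

text \<open>Integrating the tent-weighted products of the coordinates of av from c to v gives a
  matrix that is positive semidefinite for every v and equal to \<delta> times the identity once v
  is past the band. S is \<mu> times the trace of its product with the Hessian of \<Phi>:
  nonnegative by convexity, and a multiple of the Laplacian past the band.\<close>

lemma dissipation_pointwise:
  fixes z :: "real \<times> (real^'n)"
  assumes d: "\<delta> > 0" "0 \<le> c" "c + \<delta> \<le> \<beta>"
    and inn: "\<And>b b'. b \<in> Basis \<Longrightarrow> b' \<in> Basis \<Longrightarrow>
       ((\<lambda>v. tent c \<delta> v * (av v \<bullet> y b) * (av v \<bullet> y b')) has_integral (if b = b' then \<delta> else 0)) {c..c+\<delta>}"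
    and h: "\<And>b. b \<in> Basis \<Longrightarrow> continuous_on UNIV (\<lambda>s. tent c \<delta> s * (av s \<bullet> y b))"
    and \<Phi>: "smooth \<Phi>" "convex_on UNIV \<Phi>" and l: "\<mu> > 0" and v: "v \<le> \<beta>"
  defines "S \<equiv> \<Sum>b\<in>Basis. frechet_derivative (pderiv_dir b \<Phi>) (at z) (\<mu> *\<^sub>R coords y (flux c \<beta> av (\<lambda>s. tent c \<delta> s * (av s \<bullet> y b)) v))"
  shows "0 \<le> S" "c + \<delta> \<le> v \<Longrightarrow> S = \<mu> * \<delta> * lap \<Phi> z"
proof -
  define T where "T b x = frechet_derivative (pderiv_dir b \<Phi>) (at z) (\<mu> *\<^sub>R coords y x)" for b x
  have lf: "linear (frechet_derivative (pderiv_dir b \<Phi>) (at z))" for b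
    using smooth_has_derivative[OF smooth_pderiv_dir[OF \<Phi>(1)]] has_derivative_linear by blast
  have lT: "linear (T b)" for b
    unfolding T_def[abs_def] using linear_compose[OF linear_compose_scale_right[OF linear_coords] lf] by (simp only: o_def)
  have ac: "continuous_on {c..\<beta>} av" by (rule continuous_on_subset[OF av_cont]) (use d zero_range in auto)
  let ?h = "\<lambda>b s. tent c \<delta> s * (av s \<bullet> y b)"
  have I: "((\<lambda>s. ?h b s * T b (av s)) has_integral T b (flux c \<beta> av (?h b) v)) {c..v}" if "b \<in> Basis" for b
    by (rule flux_linear_functional[OF ac h[OF that] v lT])
  have Seq: "S = (\<Sum>b\<in>Basis. T b (flux c \<beta> av (?h b) v))" by (simp add: S_def T_def)
  have "((\<lambda>s. \<Sum>b\<in>Basis. ?h b s * T b (av s)) has_integral S) {c..v}"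
    unfolding Seq by (rule has_integral_sum[OF finite_Basis I])
  then show "0 \<le> S"
  proof (rule has_integral_nonneg)
    fix s
    define \<xi> where "\<xi> = coords y (av s)"
    have "(\<Sum>b\<in>Basis. ?h b s * T b (av s)) = tent c \<delta> s * (\<mu> * (\<Sum>b\<in>Basis. (\<xi> \<bullet> b) * pderiv_dir \<xi> (pderiv_dir b \<Phi>) z))"
      unfolding sum_distrib_left by (rule sum.cong) (simp_all add: T_def \<xi>_def coords_inner inner_commute[of "av s"] linear_cmul[OF lf])
    also have "\<dots> = tent c \<delta> s * (\<mu> * pderiv_dir \<xi> (pderiv_dir \<xi> \<Phi>) z)" by (simp only: hessian_expand[OF \<Phi>(1)])
    also have "0 \<le> \<dots>" using l tent_bounds smooth_convex_second_deriv[OF \<Phi>] by (intro mult_nonneg_nonneg) auto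
    finally show "0 \<le> (\<Sum>b\<in>Basis. ?h b s * T b (av s))" .
  qed
  show "S = \<mu> * \<delta> * lap \<Phi> z" if cv: "c + \<delta> \<le> v"
  proof -
    have "T b (flux c \<beta> av (?h b) v) = \<mu> * \<delta> * pderiv_dir b (pderiv_dir b \<Phi>) z" if b: "b \<in> Basis" for b
    proof -
      have Te: "?h b s * T b (av s) = (\<Sum>b'\<in>Basis. (\<mu> * pderiv_dir b' (pderiv_dir b \<Phi>) z) * (tent c \<delta> s * (av s \<bullet> y b) * (av s \<bullet> y b')))" for s
        unfolding T_def linear_cmul[OF lf] frechet_derivative_basis_expansion[OF smooth_differentiable[OF smooth_pderiv_dir[OF \<Phi>(1)]], of b z "coords y (av s)"]
        by (simp add: sum_distrib_left coords_inner inner_commute[of "av s"] mult_ac)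
      have "((\<lambda>s. ?h b s * T b (av s)) has_integral (\<Sum>b'\<in>Basis. (\<mu> * pderiv_dir b' (pderiv_dir b \<Phi>) z) * (if b = b' then \<delta> else 0))) {c..c+\<delta>}"
        unfolding Te by (intro has_integral_sum finite_Basis has_integral_mult_right inn b)
      also have "(\<Sum>b'\<in>Basis. (\<mu> * pderiv_dir b' (pderiv_dir b \<Phi>) z) * (if b = b' then \<delta> else 0)) = \<mu> * \<delta> * pderiv_dir b (pderiv_dir b \<Phi>) z"
        using b by (simp add: if_distrib cong: if_cong)
      finally have "((\<lambda>s. ?h b s * T b (av s)) has_integral \<mu> * \<delta> * pderiv_dir b (pderiv_dir b \<Phi>) z) {c..v}"
        by (rule has_integral_on_superset) (use cv tent_zero[OF d(1), of _ c] in auto)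
      from has_integral_unique[OF I[OF b] this] show ?thesis .
    qed
    then show ?thesis by (simp add: Seq lap_def sum_distrib_left)
  qed
qed

text \<open>Sum the two-sided entropy inequalities over all directions, with the partial derivatives
  of \<Phi> in the coordinates \<open>\<mu> *\<^sub>R coords y p\<close> as oscillating factors;
  they are bounded by 1 because \<Phi> is 1-Lipschitz. Per direction the cost is 9 C A masses from
  the nonoscillating entropy and 6 C A from derivatives falling on the cut-off, 15 in total.\<close>

lemma dissipation:
  fixes C A :: real
  assumes d: "\<delta> > 0" "0 \<le> c" "c + \<delta> \<le> \<beta>" and C: "0 \<le> C"
    and inn: "\<And>b b'. b \<in> Basis \<Longrightarrow> b' \<in> Basis \<Longrightarrow>
       ((\<lambda>v. tent c \<delta> v * (av v \<bullet> y b) * (av v \<bullet> y b')) has_integral (if b = b' then \<delta> else 0)) {c..c+\<delta>}"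
    and yb: "\<And>b v. b \<in> Basis \<Longrightarrow> v \<in> {c..c+\<delta>} \<Longrightarrow> \<bar>av v \<bullet> y b\<bar> \<le> C"
    and yl: "\<And>b v v'. b \<in> Basis \<Longrightarrow> v \<in> {c..c+\<delta>} \<Longrightarrow> v' \<in> {c..c+\<delta>} \<Longrightarrow> \<bar>av v \<bullet> y b - av v' \<bullet> y b\<bar> \<le> C / \<delta> * \<bar>v - v'\<bar>"
    and A: "0 \<le> A" "\<And>v. v \<in> {\<alpha>..\<beta>} \<Longrightarrow> norm (av v) \<le> A"
    and \<Phi>: "smooth \<Phi>" "convex_on UNIV \<Phi>" "\<And>h x. \<bar>pderiv_dir h \<Phi> x\<bar> \<le> norm h"
    and l: "\<mu> > 0" and t: "0 < t0" "t0 < t1" "t1 \<le> t2"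
    and E: "E \<in> sets borel" "bounded E" "\<And>p. p \<in> E \<Longrightarrow> fst p \<in> {t1..t2} \<and> c + \<delta> \<le> w p \<and> L \<le> lap \<Phi> (\<mu> *\<^sub>R coords y p)"
  shows "\<mu> * \<delta> * L * measure lborel E \<le> 15 * real DIM(real \<times> (real^'n)) * C * A * mass c \<delta> t0"
proof -
  have cb: "c \<le> \<beta>" using d by linarith
  obtain R0 where R0: "\<And>p. p \<in> E \<Longrightarrow> norm p \<le> R0" using E(2) bounded_iff by blast
  obtain f R V where f: "smooth f" "\<And>t. 0 \<le> f t" "\<And>t. t \<notin> {t0..t2+1} \<Longrightarrow> f t = 0" "\<And>t. t \<in> {t1..t2} \<Longrightarrow> f t = 1"
    and R: "R0 \<le> R" "0 < R" and V: "integrable lborel V" "(LINT p|lborel. V p) \<le> 3 * mass c \<delta> t0"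
    and D: "\<And>p k M. 0 \<le> M \<Longrightarrow> norm k \<le> M * kappa c \<delta> (w p) \<Longrightarrow> \<bar>frechet_derivative (cutoff f R) (at p) k\<bar> \<le> M * V p"
    using time_cutoff[OF d(1,2) cb t, of R0] by blast
  define h where "h b s = tent c \<delta> s * (av s \<bullet> y b)" for b s
  have T: "continuous_on UNIV (h b)" "mono (\<lambda>s. 3 * C * clip c \<delta> s + h b s)" "mono (\<lambda>s. 3 * C * clip c \<delta> s - h b s)"
    "\<And>s. \<bar>h b s\<bar> \<le> 2 * C * clip c \<delta> s" if b: "b \<in> Basis" for b
  proof -
    show "continuous_on UNIV (h b)" unfolding h_def[abs_def] by (rule tent_profile(1)[OF d C yb[OF b] yl[OF b]])
    show "mono (\<lambda>s. 3 * C * clip c \<delta> s + h b s)" unfolding h_def by (rule tent_profile(4)[OF d C yb[OF b] yl[OF b]])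
    show "mono (\<lambda>s. 3 * C * clip c \<delta> s - h b s)" unfolding h_def by (rule tent_profile(5)[OF d C yb[OF b] yl[OF b]])
    show "\<bar>h b s\<bar> \<le> 2 * C * clip c \<delta> s" for s unfolding h_def by (rule tent_profile(2)[OF d C yb[OF b] yl[OF b]])
  qed
  have hc: "h b s = 0" if "s \<le> c" for b s using tent_zero[OF d(1), of s c] that by (simp add: h_def)
  define q where "q p = \<mu> *\<^sub>R coords y p" for p
  have lq: "linear q" unfolding q_def[abs_def] by (rule linear_compose_scale_right[OF linear_coords])
  define \<psi> where "\<psi> b p = pderiv_dir b \<Phi> (q p)" for b p
  have s\<psi>: "smooth (\<psi> b)" for b
    using smooth_compose_affine[OF smooth_pderiv_dir[OF \<Phi>(1), of b] lq, where v=0] by (simp add: \<psi>_def[abs_def])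
  have \<psi>1: "\<bar>\<psi> b p\<bar> \<le> 1" if "b \<in> Basis" for b p using \<Phi>(3)[of "q p" b] that by (simp add: \<psi>_def)
  let ?\<chi> = "cutoff f R :: real \<times> (real^'n) \<Rightarrow> real"
  let ?F = "\<lambda>b p. flux c \<beta> av (h b) (w p)"
  let ?U = "\<lambda>b p. frechet_derivative (\<lambda>p. ?\<chi> p * \<psi> b p) (at p) (?F b p)"
  let ?Fc = "\<lambda>p. flux c \<beta> av (clip c \<delta>) (w p)"
  have sc: "smooth ?\<chi>" by (rule smooth_cutoff[OF f(1)])
  have c0: "0 \<le> ?\<chi> p" for p unfolding cutoff_def by (rule mult_nonneg_nonneg[OF f(2) zeta_bounds(1)])
  have iU: "integrable lborel (?U b)" if b: "b \<in> Basis" for b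
    by (rule entropy_two_sided(1)[OF d(1,2) cb C T(1-3)[OF b] hc f(1,2) t(1) f(3) R(2) s\<psi> \<psi>1[OF b]])
  have iD: "integrable lborel (\<lambda>p. frechet_derivative ?\<chi> (at p) (?Fc p))" if b: "b \<in> Basis" for b :: "real \<times> (real^'n)"
    by (rule entropy_two_sided(2)[OF d(1,2) cb C T(1-3)[OF b] hc f(1,2) t(1) f(3) R(2) s\<psi> \<psi>1[OF b]])
  have UD: "(LINT p|lborel. ?U b p) \<le> 3 * C * (LINT p|lborel. frechet_derivative ?\<chi> (at p) (?Fc p))" if b: "b \<in> Basis" for b
    by (rule entropy_two_sided(3)[OF d(1,2) cb C T(1-3)[OF b] hc f(1,2) t(1) f(3) R(2) s\<psi> \<psi>1[OF b]])
  have wle: "w p \<le> \<beta>" for p using w_range[of p] by simp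
  have Fcb: "norm (?Fc p) \<le> A * kappa c \<delta> (w p)" for p
  proof -
    have "norm (?Fc p) \<le> 1 * A * kappa c \<delta> (w p)"
      by (rule flux_norm_bound[OF clip_continuous _ A(2) d(2,1) _ A(1) wle]) (use clip_bounds in auto)
    then show ?thesis by simp
  qed
  have Fb: "norm (?F b p) \<le> (2 * C * A) * kappa c \<delta> (w p)" if "b \<in> Basis" for b p
    by (rule flux_norm_bound[OF T(1)[OF that] T(4)[OF that] A(2) d(2,1) _ A(1) wle]) (use C in auto)
  have m0: "0 \<le> mass c \<delta> t0" by (rule mass_nonneg[OF d(1)])
  have Ub: "(LINT p|lborel. ?U b p) \<le> 9 * C * A * mass c \<delta> t0" if b: "b \<in> Basis" for b
  proof -
    have "(LINT p|lborel. ?U b p) \<le> 3 * C * (LINT p|lborel. frechet_derivative ?\<chi> (at p) (?Fc p))" by (rule UD[OF b])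
    also have "\<dots> \<le> 3 * C * (LINT p|lborel. A * V p)"
    proof (intro mult_left_mono integral_mono iD[OF b] integrable_mult_right V(1))
      show "frechet_derivative ?\<chi> (at p) (?Fc p) \<le> A * V p" for p using D[OF A(1) Fcb[of p]] by linarith
    qed (use C in auto)
    also have "\<dots> = 3 * C * (A * (LINT p|lborel. V p))" by simp
    also have "\<dots> \<le> 3 * C * (A * (3 * mass c \<delta> t0))" by (intro mult_left_mono V(2)) (use C A in auto)
    finally show ?thesis by simp
  qed
  have pt: "\<mu> * \<delta> * L * indicator E p \<le> (\<Sum>b\<in>Basis. ?U b p + 2 * C * A * V p)" for p
  proof -
    let ?S = "\<Sum>b\<in>Basis. frechet_derivative (pderiv_dir b \<Phi>) (at (q p)) (\<mu> *\<^sub>R coords y (?F b p))"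
    have S: "0 \<le> ?S" "c + \<delta> \<le> w p \<Longrightarrow> ?S = \<mu> * \<delta> * lap \<Phi> (q p)"
      unfolding h_def[abs_def]
      by (rule dissipation_pointwise[OF d inn T(1)[unfolded h_def[abs_def]] \<Phi>(1,2) l wle[of p]]; assumption?)+
    have U: "?\<chi> p * frechet_derivative (pderiv_dir b \<Phi>) (at (q p)) (\<mu> *\<^sub>R coords y (?F b p)) \<le> ?U b p + 2 * C * A * V p" if b: "b \<in> Basis" for b
    proof -
      have "(\<psi> b has_derivative (\<lambda>k. frechet_derivative (pderiv_dir b \<Phi>) (at (q p)) (q k))) (at p)"
        unfolding \<psi>_def[abs_def]
        by (rule has_derivative_compose[OF linear_imp_has_derivative[OF lq] smooth_has_derivative[OF smooth_pderiv_dir[OF \<Phi>(1)]]])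
      from has_derivative_mult[OF smooth_has_derivative[OF sc] this]
      have "((\<lambda>p. ?\<chi> p * \<psi> b p) has_derivative (\<lambda>k. ?\<chi> p * frechet_derivative (pderiv_dir b \<Phi>) (at (q p)) (q k) + frechet_derivative ?\<chi> (at p) k * \<psi> b p)) (at p)" .
      from fun_cong[OF frechet_derivative_at[OF this], of "?F b p"]
      have "?U b p = ?\<chi> p * frechet_derivative (pderiv_dir b \<Phi>) (at (q p)) (q (?F b p)) + frechet_derivative ?\<chi> (at p) (?F b p) * \<psi> b p" by simp
      moreover have "\<bar>frechet_derivative ?\<chi> (at p) (?F b p) * \<psi> b p\<bar> \<le> (2 * C * A * V p) * 1"
      proof -
        have "0 \<le> 2 * C * A" using C A by simp
        from D[OF this Fb[OF b, of p]] have Db: "\<bar>frechet_derivative ?\<chi> (at p) (?F b p)\<bar> \<le> 2 * C * A * V p" .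
        show ?thesis unfolding abs_mult by (rule mult_mono[OF Db \<psi>1[OF b] order_trans[OF abs_ge_zero Db] abs_ge_zero])
      qed
      ultimately show ?thesis by (simp add: q_def abs_le_iff)
    qed
    have "\<mu> * \<delta> * L * indicator E p \<le> ?\<chi> p * ?S"
    proof (cases "p \<in> E")
      case True
      have "norm (snd p) \<le> R" using R0[OF True] R norm_snd_le[of "snd p" "fst p"] by simp
      then have "?\<chi> p = 1" using E(3)[OF True] f(4) zeta_one[OF R(2)] by (simp add: cutoff_def)
      moreover have "\<mu> * \<delta> * L \<le> \<mu> * \<delta> * lap \<Phi> (q p)"
        using E(3)[OF True] l d by (intro mult_left_mono) (auto simp: q_def)
      ultimately show ?thesis using True S(2) E(3)[OF True] by simp
    next
      case False
      then show ?thesis using S(1) c0[of p] by simp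
    qed
    also have "\<dots> \<le> (\<Sum>b\<in>Basis. ?U b p + 2 * C * A * V p)"
      unfolding sum_distrib_left by (rule sum_mono) (rule U)
    finally show ?thesis .
  qed
  have iI: "integrable lborel (\<lambda>p. \<mu> * \<delta> * L * indicator E p)"
    using emeasure_bounded_finite[OF E(2)] E(1) by (intro integrable_mult_right integrable_real_indicator) auto
  have iS: "integrable lborel (\<lambda>p. \<Sum>b\<in>Basis. ?U b p + 2 * C * A * V p)"
    by (intro Bochner_Integration.integrable_sum Bochner_Integration.integrable_add integrable_mult_right iU V(1))
  have "\<mu> * \<delta> * L * measure lborel E = (LINT p|lborel. \<mu> * \<delta> * L * indicator E p)" using E(1) by simp
  also have "\<dots> \<le> (LINT p|lborel. (\<Sum>b\<in>Basis. ?U b p + 2 * C * A * V p))" by (rule integral_mono[OF iI iS pt])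
  also have "\<dots> = (\<Sum>b\<in>Basis. (LINT p|lborel. ?U b p) + 2 * C * A * (LINT p|lborel. V p))"
    using iU V(1) by (subst Bochner_Integration.integral_sum) (auto intro!: sum.cong simp: Bochner_Integration.integral_add)
  also have "\<dots> \<le> sum (\<lambda>b. 15 * C * A * mass c \<delta> t0) (Basis :: (real \<times> (real^'n)) set)"
  proof (rule sum_mono)
    fix b :: "real \<times> (real^'n)" assume b: "b \<in> Basis"
    have "2 * C * A * (LINT p|lborel. V p) \<le> 2 * C * A * (3 * mass c \<delta> t0)" using V C A by (intro mult_left_mono) auto
    then show "(LINT p|lborel. ?U b p) + 2 * C * A * (LINT p|lborel. V p) \<le> 15 * C * A * mass c \<delta> t0" using Ub[OF b] by linarith
  qed
  also have "\<dots> = 15 * real DIM(real \<times> (real^'n)) * C * A * mass c \<delta> t0" by (simp only: sum_constant mult_ac)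
  finally show ?thesis .
qed

end

section \<open>The measure of superlevel sets\<close>

lemma powr_cancel_exponent: "0 \<le> x \<Longrightarrow> 0 < q \<Longrightarrow> x powr q \<le> y \<Longrightarrow> x \<le> y powr (1 / q)" for x y q :: real
  using powr_mono2[of "1/q" "x powr q" y] by (simp add: powr_powr)

text \<open>N cells of side h have total volume X = N h^n. A Laplacian of order N^(-1/n) and the
  scaling factor 1/h combine with X to a power of X alone, so the uncontrolled grid size drops
  out.\<close>

lemma grid_scaling:
  fixes h N :: real
  assumes "0 < n" "0 < h" "0 < N"
  shows "N * h ^ n * root n (1 / N) / h = (N * h ^ n) powr (1 - 1 / n)"
proof -
  have X: "0 < N * h ^ n" using assms by simp
  have "(N * h ^ n) powr (1 / n) = root n (N * h ^ n)" using assms X by (simp add: root_powr_inverse)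
  also have "\<dots> = root n N * h" using assms by (simp add: real_root_mult real_root_power_cancel)
  finally have r: "(N * h ^ n) powr (1 / n) = root n N * h" .
  have "(N * h ^ n) powr (1 - 1 / n) = (N * h ^ n) / (root n N * h)" using X r by (simp add: powr_diff)
  also have "\<dots> = N * h ^ n * root n (1 / N) / h" using assms by (simp add: real_root_divide)
  finally show ?thesis by simp
qed

text \<open>Used with \<theta> = 1 - 1/n to return from the volume in adapted coordinates to the
  original one; what remains of the distortion is its power 1/n. The factor 1/2 absorbs
  2^\<theta>.\<close>

lemma volume_scaling:
  fixes e vp \<theta> :: real
  assumes "0 < vp" "0 \<le> e" "0 \<le> \<theta>" "\<theta> \<le> 1"
  shows "vp powr (1 - \<theta>) * e powr \<theta> / 2 \<le> vp * (e / (2 * vp)) powr \<theta>"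
proof -
  have "vp powr (1 - \<theta>) * e powr \<theta> / 2 \<le> vp powr (1 - \<theta>) * e powr \<theta> / 2 powr \<theta>"
    using assms powr_mono[of \<theta> 1 "2::real"] by (intro divide_left_mono) auto
  also have "\<dots> = vp powr (1 - \<theta>) * vp powr \<theta> * (e / (2 * vp)) powr \<theta>"
    using assms by (simp add: powr_divide powr_mult)
  also have "\<dots> = vp * (e / (2 * vp)) powr \<theta>" using assms by (simp add: powr_add[symmetric])
  finally show ?thesis .
qed

context kinetic_solution
begin

text \<open>In adapted coordinates select the grid cells in which the image S of E has density at
  least 1/2, build the potential concentrated at their corners, and apply \<open>dissipation\<close>
  to the part of E that falls into these cells. The constant 240 is 15 from the dissipation times 8
  from grid scale and density times 2 from \<open>volume_scaling\<close>.\<close>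

lemma superlevel_bounded:
  fixes C A c0 k :: real
  defines "n \<equiv> DIM(real \<times> (real^'n))"
  assumes ad: "adapted_coords av \<alpha> \<beta> K \<delta>0 C k" and k: "0 < k" and C: "0 \<le> C"
    and A: "0 \<le> A" "\<And>v. v \<in> {\<alpha>..\<beta>} \<Longrightarrow> norm (av v) \<le> A" and c0: "0 < c0"
    and pot: "\<And>P::(real \<times> (real^'n)) set. finite P \<Longrightarrow> P \<noteq> {} \<Longrightarrow> \<exists>\<Phi>. smooth \<Phi> \<and> convex_on UNIV \<Phi> \<and> (\<forall>h x. \<bar>pderiv_dir h \<Phi> x\<bar> \<le> norm h) \<and>
      (\<forall>p\<in>P. \<forall>x\<in>cball p (1/4). c0 * root n (1 / card P) \<le> lap \<Phi> x)"
    and d: "\<delta> > 0" "\<delta> \<le> \<delta>0" "0 \<le> c" "c + \<delta> \<le> \<beta>" and t: "0 < t0" "t0 < t1" "t1 \<le> t2"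
    and E: "E \<in> sets borel" "bounded E" "\<And>p. p \<in> E \<Longrightarrow> fst p \<in> {t1..t2} \<and> c + \<delta> \<le> w p"
  shows "c0 * \<delta> * (k * \<delta> ^ K) powr (1 / n) * measure lborel E powr (1 - 1 / n) \<le> 240 * (real n)\<^sup>2 * C * A * mass c \<delta> t0"
proof (cases "measure lborel E = 0")
  case True
  then show ?thesis using C A mass_nonneg[OF d(1)] by (simp add: mult_nonneg_nonneg)
next
  case False
  then have e0: "0 < measure lborel E" using measure_nonneg[of lborel E] by linarith
  have n: "0 < n" by (simp add: n_def)
  have ac: "\<alpha> \<le> c" using d zero_range by simp
  from ad[unfolded adapted_coords_def, rule_format, OF d(1,2) ac d(4)]
  obtain y where y: "inj (coords y)" "k * \<delta> ^ K \<le> vfac (coords y)"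
    and innA: "\<forall>b\<in>Basis. \<forall>b'\<in>Basis. ((\<lambda>v. tent c \<delta> v * (av v \<bullet> y b) * (av v \<bullet> y b')) has_integral (if b = b' then \<delta> else 0)) {c..c + \<delta>}"
    and ybA: "\<forall>b\<in>Basis. \<forall>v\<in>{c..c + \<delta>}. \<bar>av v \<bullet> y b\<bar> \<le> C"
    and ylA: "\<forall>b\<in>Basis. \<forall>v\<in>{c..c + \<delta>}. \<forall>w\<in>{c..c + \<delta>}. \<bar>av v \<bullet> y b - av w \<bullet> y b\<bar> \<le> C / \<delta> * \<bar>v - w\<bar>"
    by (elim exE conjE) (rule that)
  note inn = innA[rule_format] and yb = ybA[rule_format] and yl = ylA[rule_format]
  define P where "P = coords y"
  have lP: "linear P" and iP: "inj P" using linear_coords y(1) by (auto simp: P_def)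
  define vp where "vp = vfac P"
  have vp: "0 < vp" unfolding vp_def by (rule vfac_pos[OF lP iP])
  from linear_injective_isomorphism[OF lP iP, OF refl]
  obtain Q where QA: "linear Q" "\<forall>x. Q (P x) = x" "\<forall>x. P (Q x) = x" by (elim exE conjE) (rule that)
  note Q = QA(1) QA(2)[rule_format] QA(3)[rule_format]
  define S where "S = {z. Q z \<in> E}"
  have Sm: "S \<in> sets borel" unfolding S_def by (rule linear_vimage_borel[OF Q(1) E(1)])
  have SE: "S = P ` E"
  proof (intro set_eqI iffI)
    fix z assume "z \<in> S"
    then show "z \<in> P ` E" using imageI[of "Q z" E P] Q(3)[of z] by (simp add: S_def)
  next
    fix z assume "z \<in> P ` E"
    then show "z \<in> S" using Q(2) by (auto simp: S_def)
  qed
  have Sb: "bounded S" unfolding SE using lP E(2) by (auto simp: linear_conv_bounded_linear intro: bounded_linear_image)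
  have vm: "measure lborel {p. P p \<in> B} = vp * measure lborel B" if "B \<in> sets borel" for B
    unfolding vp_def by (rule vfac_measure[OF lP iP that])
  have ES: "measure lborel E = vp * measure lborel S" using vm[OF Sm] by (simp add: S_def Q)
  then have S0: "0 < measure lborel S" using e0 vp by (simp add: zero_less_mult_iff)
  from grid_density[OF Sb Sm S0, folded n_def]
  obtain h :: real and G where h: "h > 0" and G: "finite G" "G \<noteq> {}" "measure lborel S / 2 \<le> card G * h ^ n"
    and cellA: "\<forall>p\<in>G. h ^ n / 2 \<le> measure lborel (S \<inter> {x. corner h x = p})"
    by (elim exE conjE) (rule that)
  note cell = cellA[rule_format]
  define N where "N = real (card G)"
  have N: "0 < N" using G by (simp add: N_def card_gt_0_iff)
  \<comment> \<open>A point of a cell is within n h of its corner. After this scaling the distance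
    is at most 1/4, the radius on which the potential has a large Laplacian.\<close>
  define \<mu> where "\<mu> = 1 / (4 * n * h)"
  have mu: "\<mu> > 0" using n h by (simp add: \<mu>_def)
  have cG: "card ((\<lambda>x. \<mu> *\<^sub>R x) ` G) = card G" using mu by (intro card_image) (auto simp: inj_on_def)
  have "finite ((\<lambda>x. \<mu> *\<^sub>R x) ` G)" "(\<lambda>x. \<mu> *\<^sub>R x) ` G \<noteq> {}" using G by auto
  from pot[OF this, unfolded cG, folded N_def]
  obtain \<Phi> where \<Phi>A: "smooth \<Phi>" "convex_on UNIV \<Phi>" and \<Phi>B: "\<forall>h x. \<bar>pderiv_dir h \<Phi> x\<bar> \<le> norm h"
    and lapA: "\<forall>p\<in>(\<lambda>x. \<mu> *\<^sub>R x) ` G. \<forall>x\<in>cball p (1/4). c0 * root n (1 / N) \<le> lap \<Phi> x"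
    by (elim exE conjE) (rule that)
  note \<Phi> = \<Phi>A \<Phi>B[rule_format] and lapG = bspec[OF bspec[OF lapA]]
  define S1 where "S1 = (\<Union>g\<in>G. S \<inter> {x. corner h x = g})"
  have cm: "S \<inter> {x. corner h x = g} \<in> sets borel" for g
  proof -
    have "corner h -` {g} \<inter> space borel \<in> sets borel" by (rule measurable_sets[OF corner_measurable]) simp
    then show ?thesis using Sm by (auto simp: vimage_def)
  qed
  have S1m: "S1 \<in> sets borel" unfolding S1_def using G(1) cm by (intro sets.finite_UN) auto
  have "measure lborel S1 = (\<Sum>g\<in>G. measure lborel (S \<inter> {x. corner h x = g}))"
    unfolding S1_def
  proof (rule measure_finite_Union[OF G(1)])
    show "emeasure lborel (S \<inter> {x. corner h x = g}) \<noteq> \<infinity>" for g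
      using emeasure_bounded_finite[OF bounded_subset[OF Sb, of "S \<inter> {x. corner h x = g}"]] by auto
  qed (use cm in \<open>auto simp: disjoint_family_on_def\<close>)
  also have "\<dots> \<ge> (\<Sum>g\<in>G. h ^ n / 2)" by (rule sum_mono) (rule cell)
  finally have S1X: "N * h ^ n / 2 \<le> measure lborel S1" by (simp add: N_def)
  \<comment> \<open>The part of E that lies in the dense cells. It has volume at least vp X/2, where
    X is the total volume of these cells.\<close>
  define E1 where "E1 = {p. P p \<in> S1}"
  have E1m: "E1 \<in> sets borel" unfolding E1_def by (rule linear_vimage_borel[OF lP S1m])
  have E1E: "E1 \<subseteq> E" by (auto simp: E1_def S1_def S_def Q)
  have E1c: "fst p \<in> {t1..t2} \<and> c + \<delta> \<le> w p \<and> c0 * root n (1 / N) \<le> lap \<Phi> (\<mu> *\<^sub>R coords y p)" if p: "p \<in> E1" for p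
  proof -
    define g where "g = corner h (P p)"
    have g: "g \<in> G" using p by (auto simp: E1_def S1_def g_def)
    have "norm (\<mu> *\<^sub>R g - \<mu> *\<^sub>R P p) = \<mu> * norm (P p - g)" using mu by (simp add: scaleR_diff_right[symmetric] norm_minus_commute)
    also have "\<dots> \<le> \<mu> * (n * h)" using dist_corner[OF h, of "P p"] mu unfolding g_def n_def by (intro mult_left_mono) auto
    also have "\<dots> = 1/4" using n h by (simp add: \<mu>_def)
    finally have "\<mu> *\<^sub>R P p \<in> cball (\<mu> *\<^sub>R g) (1/4)" by (simp add: dist_norm)
    from lapG[OF imageI[OF g] this] show ?thesis using E(3)[of p] p E1E by (auto simp: P_def)
  qed
  have dis: "\<mu> * \<delta> * (c0 * root n (1 / N)) * measure lborel E1 \<le> 15 * real n * C * A * mass c \<delta> t0"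
    unfolding n_def
    by (rule dissipation[OF d(1,3,4) C inn yb yl A \<Phi> mu t E1m bounded_subset[OF E(2) E1E] E1c[unfolded n_def]])
  have rN: "0 \<le> root n (1 / N)" using real_root_ge_zero[of "1 / N" n] N by simp
  define X where "X = N * h ^ n"
  have "c0 * \<delta> * (vp * X powr (1 - 1 / n)) = c0 * \<delta> * vp * (X * root n (1 / N) / h)"
    using grid_scaling[OF n h N] by (simp add: X_def)
  also have "\<dots> = 8 * real n * (\<mu> * \<delta> * (c0 * root n (1 / N)) * (vp * (X / 2)))" using n h by (simp add: \<mu>_def)
  also have "\<dots> \<le> 8 * real n * (\<mu> * \<delta> * (c0 * root n (1 / N)) * measure lborel E1)"
  proof (intro mult_left_mono)
    show "vp * (X / 2) \<le> measure lborel E1" unfolding E1_def vm[OF S1m] X_def using S1X vp by (intro mult_left_mono) auto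
  qed (use mu d c0 rN in auto)
  also have "\<dots> \<le> 8 * real n * (15 * real n * C * A * mass c \<delta> t0)" by (intro mult_left_mono dis) simp
  finally have m1: "c0 * \<delta> * (vp * X powr (1 - 1 / n)) \<le> 120 * (real n)\<^sup>2 * C * A * mass c \<delta> t0" by (simp add: power2_eq_square)
  have th: "0 \<le> 1 - 1 / real n" "1 - 1 / real n \<le> 1" using n by auto
  have "(k * \<delta> ^ K) powr (1 / n) * measure lborel E powr (1 - 1 / n) / 2 \<le> vp powr (1 / n) * measure lborel E powr (1 - 1 / n) / 2"
    using y(2) k d by (intro divide_right_mono mult_right_mono powr_mono2) (auto simp: vp_def P_def)
  also have "\<dots> \<le> vp * (measure lborel E / (2 * vp)) powr (1 - 1 / n)"
    using volume_scaling[OF vp _ th, of "measure lborel E"] by simp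
  also have "\<dots> \<le> vp * X powr (1 - 1 / n)"
    using G(3) vp th ES by (intro mult_left_mono powr_mono2) (auto simp: X_def N_def)
  finally have "c0 * \<delta> * ((k * \<delta> ^ K) powr (1 / n) * measure lborel E powr (1 - 1 / n) / 2) \<le> c0 * \<delta> * (vp * X powr (1 - 1 / n))"
    using c0 d by (intro mult_left_mono) auto
  then show ?thesis using m1 by simp
qed

text \<open>Solving the previous estimate for the measure gives the exponent 1/(1 - 1/n) = 1 + 1/d,
  which exceeds 1 and drives the iteration. Exhaustion by balls passes from bounded subsets to the
  full superlevel set.\<close>

lemma superlevel:
  fixes C A c0 k :: real
  defines "n \<equiv> DIM(real \<times> (real^'n))"
  assumes ad: "adapted_coords av \<alpha> \<beta> K \<delta>0 C k" and k: "0 < k" and C: "0 \<le> C"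
    and A: "0 \<le> A" "\<And>v. v \<in> {\<alpha>..\<beta>} \<Longrightarrow> norm (av v) \<le> A" and c0: "0 < c0"
    and pot: "\<And>P::(real \<times> (real^'n)) set. finite P \<Longrightarrow> P \<noteq> {} \<Longrightarrow> \<exists>\<Phi>. smooth \<Phi> \<and> convex_on UNIV \<Phi> \<and> (\<forall>h x. \<bar>pderiv_dir h \<Phi> x\<bar> \<le> norm h) \<and>
      (\<forall>p\<in>P. \<forall>x\<in>cball p (1/4). c0 * root n (1 / card P) \<le> lap \<Phi> x)"
    and Q: "240 * (real n)\<^sup>2 * C * A / (c0 * k powr (1 / n)) \<le> Q"
    and d: "\<delta> > 0" "\<delta> \<le> \<delta>0" "0 \<le> c" "c + \<delta> \<le> \<beta>" and t: "0 < t0" "t0 < t1" "t1 \<le> t2"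
  shows "emeasure lborel {p. t1 \<le> fst p \<and> fst p \<le> t2 \<and> c + \<delta> \<le> w p}
     \<le> ennreal ((Q * \<delta> powr - (1 + K / n) * mass c \<delta> t0) powr (1 + 1 / CARD('n)))"
proof -
  let ?E = "{p. t1 \<le> fst p \<and> fst p \<le> t2 \<and> c + \<delta> \<le> w p}"
  define Y where "Y = Q * \<delta> powr - (1 + K / n) * mass c \<delta> t0"
  have nd: "real n = 1 + CARD('n)" by (simp add: n_def)
  have d0: "0 < real CARD('n)" by simp
  have n0: "0 < real n" using nd by linarith
  have th1: "1 - 1 / real n = CARD('n) / real n"
  proof -
    have "(real n - 1) / real n = 1 - 1 / real n" using n0 by (simp add: diff_divide_distrib)
    moreover have "real n - 1 = CARD('n)" using nd by simp
    ultimately show ?thesis by simp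
  qed
  have th2: "1 / (1 - 1 / real n) = 1 + 1 / CARD('n)"
  proof -
    have "1 / (1 - 1 / real n) = real n / CARD('n)" unfolding th1 by simp
    also have "\<dots> = 1 + 1 / CARD('n)" unfolding nd using d0 by (simp add: add_divide_distrib)
    finally show ?thesis .
  qed
  have th3: "0 < 1 - 1 / real n" unfolding th1 using d0 n0 by simp
  note th = th1 th2 th3
  have [measurable]: "(fst :: real \<times> (real^'n) \<Rightarrow> real) \<in> borel_measurable borel"
    by (intro borel_measurable_continuous_onI continuous_on_fst continuous_on_id)
  have Em: "?E \<in> sets borel" by measurable
  have bd: "measure lborel F \<le> Y powr (1 + 1 / CARD('n))" if F: "F \<in> sets borel" "bounded F" "F \<subseteq> ?E" for F
  proof -
    have Fp: "fst p \<in> {t1..t2} \<and> c + \<delta> \<le> w p" if "p \<in> F" for p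
      using subsetD[OF F(3) that] by simp
    have bnd: "c0 * \<delta> * (k * \<delta> ^ K) powr (1 / n) * measure lborel F powr (1 - 1 / n) \<le> 240 * (real n)\<^sup>2 * C * A * mass c \<delta> t0"
      unfolding n_def
      by (rule superlevel_bounded[OF ad k C A c0 pot[unfolded n_def] d t F(1,2) Fp])
    have dK: "\<delta> ^ K = \<delta> powr real K" using powr_realpow[OF d(1), of K] by simp
    have pk: "(k * \<delta> ^ K) powr (1 / n) = k powr (1 / n) * \<delta> powr (K / n)"
      unfolding dK using k by (simp add: powr_mult powr_powr)
    have pd: "\<delta> powr (1 + K / n) = \<delta> * \<delta> powr (K / n)" using d(1) by (simp add: powr_add)
    have eq: "c0 * \<delta> * (k * \<delta> ^ K) powr (1 / n) * measure lborel F powr (1 - 1 / n)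
        = (c0 * k powr (1 / n)) * (\<delta> powr (1 + K / n) * measure lborel F powr (1 - 1 / n))"
      unfolding pk pd by (simp only: mult_ac)
    have pos: "0 < c0 * k powr (1 / n)" using c0 k by simp
    have dp: "0 < \<delta> powr (1 + K / n)" using d(1) by simp
    have "240 * (real n)\<^sup>2 * C * A \<le> Q * (c0 * k powr (1 / n))" using Q by (simp only: pos_divide_le_eq[OF pos])
    from mult_right_mono[OF this mass_nonneg[OF d(1), of c t0]]
    have "240 * (real n)\<^sup>2 * C * A * mass c \<delta> t0 \<le> (c0 * k powr (1 / n)) * (Q * mass c \<delta> t0)" by (simp only: mult_ac)
    from order_trans[OF bnd[unfolded eq] this]
    have "\<delta> powr (1 + K / n) * measure lborel F powr (1 - 1 / n) \<le> Q * mass c \<delta> t0"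
      by (simp only: mult_le_cancel_left_pos[OF pos])
    then have "measure lborel F powr (1 - 1 / n) \<le> Q * mass c \<delta> t0 / \<delta> powr (1 + K / n)"
      unfolding pos_le_divide_eq[OF dp] by (simp only: mult.commute)
    also have "\<dots> = Y" unfolding Y_def powr_minus by (simp only: divide_inverse mult_ac)
    finally have "measure lborel F powr (1 - 1 / n) \<le> Y" .
    from powr_cancel_exponent[OF measure_nonneg th(3) this] show ?thesis unfolding th(2) .
  qed
  define F where "F i = ?E \<inter> cball 0 (real i)" for i
  have Fs: "F i \<in> sets borel" for i unfolding F_def by (intro sets.Int Em borel_closed closed_cball)
  have Fm: "range F \<subseteq> sets lborel" using Fs by auto
  have "emeasure lborel (F i) \<le> ennreal (Y powr (1 + 1 / CARD('n)))" for i
  proof -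
    have b: "bounded (F i)" unfolding F_def by (rule bounded_subset[OF bounded_cball Int_lower2])
    have e: "emeasure lborel (F i) = ennreal (measure lborel (F i))"
      using emeasure_bounded_finite[OF b] by (simp add: emeasure_eq_ennreal_measure less_top)
    show ?thesis unfolding e by (rule ennreal_leI, rule bd[OF Fs b]) (simp add: F_def)
  qed
  then have s1: "(SUP i. emeasure lborel (F i)) \<le> ennreal (Y powr (1 + 1 / CARD('n)))" by (intro SUP_least)
  have "incseq F"
  proof (rule monoI)
    fix i j :: nat assume "i \<le> j"
    then show "F i \<subseteq> F j" unfolding F_def by (intro Int_mono order_refl subset_cball) simp
  qed
  then have s2: "(SUP i. emeasure lborel (F i)) = emeasure lborel (\<Union>i. F i)" by (rule SUP_emeasure_incseq[OF Fm])
  have s3: "(\<Union>i. F i) = ?E"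
  proof (rule equalityI; rule subsetI)
    fix p assume "p \<in> (\<Union>i. F i)"
    then show "p \<in> ?E" unfolding F_def by (elim UN_E IntD1)
  next
    fix p assume p: "p \<in> ?E"
    from real_arch_simple[of "norm p"] obtain i where "norm p \<le> real i" by (elim exE) (rule that)
    then have "p \<in> F i" unfolding F_def by (intro IntI p) simp
    then show "p \<in> (\<Union>i. F i)" by (intro UN_I UNIV_I)
  qed
  show ?thesis using s1 unfolding s2 s3 Y_def .
qed

end

subsection \<open>De Giorgi iteration\<close>

text \<open>The ansatz m k \<le> M r^k with r = b^(-d) is reproduced by the recursion: the extra
  factor (r^k)^(1/d) is b^(-k), which cancels the growth b^k, and the smallness of D M^(1/d)
  supplies the next factor r.\<close>

lemma fast_decay:
  fixes m :: "nat \<Rightarrow> real"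
  assumes m: "\<And>k. 0 \<le> m k" "\<And>k. m (Suc k) \<le> D * b ^ k * m k powr (1 + 1 / d)" "m 0 \<le> M"
    and p: "0 \<le> D" "1 < b" "0 < d" "0 < M" and small: "D * M powr (1 / d) \<le> b powr - d"
  shows "m \<longlonglongrightarrow> 0"
proof -
  define r where "r = b powr - d"
  have r: "0 < r" "r < 1" using p powr_less_mono[of "- d" 0 b] by (auto simp: r_def)
  have rk: "(r ^ k) powr (1 / d) = 1 / b ^ k" for k
  proof -
    have "(r ^ k) powr (1 / d) = b powr - real k" using p by (simp add: r_def powr_powr flip: powr_realpow)
    then show ?thesis using p by (simp add: powr_minus_divide powr_realpow)
  qed
  have le: "m k \<le> M * r ^ k" for k
  proof (induction k)
    case (Suc k)
    have Mr: "0 < M * r ^ k" using p r by simp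
    have "m (Suc k) \<le> D * b ^ k * m k powr (1 + 1 / d)" by (rule m(2))
    also have "\<dots> \<le> D * b ^ k * (M * r ^ k) powr (1 + 1 / d)"
      using Suc m(1) p by (intro mult_left_mono powr_mono2) auto
    also have "(M * r ^ k) powr (1 + 1 / d) = (M * r ^ k) * (M powr (1 / d) * (r ^ k) powr (1 / d))"
      using Mr p r by (simp add: powr_add powr_mult)
    also have "D * b ^ k * ((M * r ^ k) * (M powr (1 / d) * (r ^ k) powr (1 / d))) = (D * M powr (1 / d)) * (M * r ^ k)"
      using p by (simp add: rk)
    also have "\<dots> \<le> r * (M * r ^ k)" using small Mr by (intro mult_right_mono) (auto simp: r_def)
    finally show ?case by (simp add: mult_ac)
  qed (use m(3) in simp)
  have "(\<lambda>k. M * r ^ k) \<longlonglongrightarrow> M * 0" using r by (intro tendsto_mult_left LIMSEQ_realpow_zero) auto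
  then show ?thesis
    by (intro tendsto_sandwich[where f="\<lambda>_. 0" and h="\<lambda>k. M * r ^ k" and g=m]) (use le m(1) in auto)
qed

context kinetic_solution
begin

text \<open>The bound u \<le> V almost everywhere at time s, expressed by truncated masses so that
  their monotonicity carries it to later times.\<close>

definition bounded_above :: "real \<Rightarrow> real \<Rightarrow> bool" where
  "bounded_above V s \<longleftrightarrow> (\<forall>\<delta>>0. mass V \<delta> s = 0)"

lemma bounded_above_later:
  assumes "bounded_above V s" "0 \<le> V" "V \<le> \<beta>" "0 \<le> s" "s \<le> t" shows "bounded_above V t"
  unfolding bounded_above_def
proof (intro allI impI)
  fix \<delta> :: real assume d: "\<delta> > 0"
  have "mass V \<delta> t \<le> mass V \<delta> s" by (rule mass_decreasing[OF d assms(2-5)])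
  then show "mass V \<delta> t = 0" using assms(1) d mass_nonneg[OF d, of V t] by (simp add: bounded_above_def)
qed

text \<open>The range is prescribed only almost everywhere in space-time. The mass at time t is at
  most its average over [t/2, t], and this average vanishes.\<close>

lemma bounded_above_top: assumes "0 < t" shows "bounded_above \<beta> t"
  unfolding bounded_above_def
proof (intro allI impI)
  fix \<delta> :: real assume d: "\<delta> > 0"
  have "kappa \<beta> \<delta> (w p) = 0" for p using w_range[of p] by (intro kappa_zero) auto
  then have "(t - t / 2) * mass \<beta> \<delta> t \<le> 0"
    using slab_mass(2)[OF d zero_range(2) order_refl, of "t/2" t] assms by simp
  then have "mass \<beta> \<delta> t \<le> 0" using assms by (simp add: mult_le_0_iff)
  then show "mass \<beta> \<delta> t = 0" using mass_nonneg[OF d, of \<beta> t] by linarith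
qed

lemma bounded_above_AE:
  assumes "bounded_above V t" "0 \<le> V" "0 \<le> t" shows "AE x in lebesgue. u t x \<le> V"
proof -
  have "AE x in lebesgue. u t x \<le> V + 1 / real (Suc i)" for i
  proof -
    let ?d = "1 / real (Suc i)"
    have d: "?d > 0" by simp
    have "(LINT x|lebesgue. kappa V ?d (u t x)) = 0" using assms(1) d unfolding bounded_above_def mass_def by blast
    then have "AE x in lebesgue. kappa V ?d (u t x) = 0"
      using integral_nonneg_eq_0_iff_AE[OF kappa_u_integrable[OF d assms(2,3)]] kappa_nonneg[OF d] by simp
    then show ?thesis
    proof eventually_elim
      case (elim x)
      then show ?case using kappa_ge[OF d, of "u t x" V] by linarith
    qed
  qed
  then have "AE x in lebesgue. \<forall>i. u t x \<le> V + 1 / real (Suc i)" unfolding AE_all_countable by blast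
  then show ?thesis
  proof eventually_elim
    case (elim x)
    show ?case
    proof (rule field_le_epsilon)
      fix e :: real assume "0 < e"
      then obtain i where "1 / real (Suc i) < e" using nat_approx_posE by blast
      then show "u t x \<le> V + e" using elim[rule_format, of i] by linarith
    qed
  qed
qed

text \<open>By monotonicity the mass at t2 is at most its average over the slab. The integrand
  vanishes unless w exceeds c' \<ge> c1, and almost everywhere it is at most 2 V: taking V also as
  band width in \<open>bounded_above\<close> gives w \<le> 2 V.\<close>

lemma slab_superlevel:
  assumes V: "bounded_above V s" "0 < V" "V \<le> \<beta>" "0 < s" and t: "s \<le> t1" "t1 \<le> t2"
    and c: "0 \<le> c'" "c' \<le> \<beta>" "\<delta>' > 0" "c1 \<le> c'"
    and fin: "emeasure lborel {p. t1 \<le> fst p \<and> fst p \<le> t2 \<and> c1 \<le> w p} \<le> ennreal Y" "0 \<le> Y"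
  shows "(t2 - t1) * mass c' \<delta>' t2 \<le> 2 * V * Y"
proof -
  let ?E = "{p. t1 \<le> fst p \<and> fst p \<le> t2 \<and> c1 \<le> w p}"
  have t1: "0 < t1" using V t by linarith
  have [measurable]: "(fst :: real \<times> (real^'n) \<Rightarrow> real) \<in> borel_measurable borel"
    by (intro borel_measurable_continuous_onI continuous_on_fst continuous_on_id)
  have Em: "?E \<in> sets borel" by measurable
  have Ef: "emeasure lborel ?E < \<infinity>" using fin(1) by (rule le_less_trans) simp
  have mE: "measure lborel ?E \<le> Y" using fin by (simp add: measure_def enn2real_leI)
  have b1: "bounded_above V t1" by (rule bounded_above_later[OF V(1) _ V(3) _ t(1)]) (use V in auto)
  have V0: "0 \<le> V" using V by simp
  note S = slab_mass[OF V(2) V0 V(3) t1 t(2)]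
  have "(LINT p|lborel. indicator {t1..t2} (fst p) * kappa V V (w p)) = 0"
  proof (rule antisym)
    show "(LINT p|lborel. indicator {t1..t2} (fst p) * kappa V V (w p)) \<le> 0" using S(3) b1 V(2) by (simp add: bounded_above_def)
    show "0 \<le> (LINT p|lborel. indicator {t1..t2} (fst p) * kappa V V (w p))"
      by (intro Bochner_Integration.integral_nonneg mult_nonneg_nonneg kappa_nonneg V(2)) simp
  qed
  then have ae: "AE p in lborel. indicator {t1..t2} (fst p) * kappa V V (w p) = 0"
    using integral_nonneg_eq_0_iff_AE[OF S(1)] kappa_nonneg[OF V(2)] by simp
  note S' = slab_mass[OF c(3,1,2) t1 t(2)]
  have "(LINT p|lborel. indicator {t1..t2} (fst p) * kappa c' \<delta>' (w p)) \<le> (LINT p|lborel. 2 * V * indicator ?E p)"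
  proof (rule integral_mono_AE[OF S'(1)])
    show "integrable lborel (\<lambda>p. 2 * V * indicator ?E p :: real)"
      using Ef Em by (intro integrable_mult_right integrable_real_indicator) auto
    show "AE p in lborel. indicator {t1..t2} (fst p) * kappa c' \<delta>' (w p) \<le> 2 * V * indicator ?E p"
      using ae
    proof eventually_elim
      case (elim p)
      show ?case
      proof (cases "fst p \<in> {t1..t2} \<and> c' < w p")
        case True
        then have "kappa V V (w p) = 0" using elim by simp
        then have "w p \<le> 2 * V" using kappa_ge[OF V(2), of "w p" V] by linarith
        then have "kappa c' \<delta>' (w p) \<le> 2 * V" using kappa_le[OF c(3), of c' "w p"] c V by linarith
        then show ?thesis using True c by (simp add: indicator_def)
      next
        case False
        then have z: "indicator {t1..t2} (fst p) * kappa c' \<delta>' (w p) = 0" using kappa_zero[of "w p" c' \<delta>'] by (auto simp: indicator_def)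
        show ?thesis unfolding z using V by simp
      qed
    qed
  qed
  also have "\<dots> = 2 * V * measure lborel ?E" using Em by simp
  also have "\<dots> \<le> 2 * V * Y" using mE V by (intro mult_left_mono) auto
  finally show ?thesis using S'(2) by linarith
qed

text \<open>Levels rise from 0 to V/2 and times from s to s + \<tau>, both with gaps halving at each
  step, and the band between consecutive levels has width proportional to the gap. In b = 2^(2 + e)
  one factor 2 comes from the shrinking time slab and 2^(1 + e) from the band width; the constant
  \<Gamma> is what turns the smallness condition of \<open>fast_decay\<close> into an
  equality.\<close>

lemma halving:
  fixes d e Q \<sigma> \<theta> \<delta>0 M V s :: real
  defines "b \<equiv> 2 powr (2 + e)"
  defines "\<Gamma> \<equiv> 8 * Q powr (1 + 1 / d) * (\<theta> / 4) powr - (1 + e) * b powr d"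
  assumes SL: "\<And>c \<delta> t0 t1 t2. 0 < \<delta> \<Longrightarrow> \<delta> \<le> \<delta>0 \<Longrightarrow> 0 \<le> c \<Longrightarrow> c + \<delta> \<le> \<beta> \<Longrightarrow> 0 < t0 \<Longrightarrow> t0 < t1 \<Longrightarrow> t1 \<le> t2 \<Longrightarrow>
      emeasure lborel {p. t1 \<le> fst p \<and> fst p \<le> t2 \<and> c + \<delta> \<le> w p} \<le> ennreal ((Q * \<delta> powr - \<sigma> * mass c \<delta> t0) powr (1 + 1 / d))"
    and p: "0 < d" "0 < e" "0 < Q" "\<sigma> * (1 + 1 / d) = 1 + e" "0 < \<theta>" "\<theta> \<le> 1" "\<theta> * \<beta> \<le> \<delta>0"
    and V: "bounded_above V s" "0 < V" "V \<le> \<beta>" "0 < s" and M: "0 < M" "\<And>\<delta>. \<delta> > 0 \<Longrightarrow> mass 0 \<delta> s \<le> M"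
    and \<tau>: "\<tau> = \<Gamma> * M powr (1 / d) * V powr - e"
  shows "bounded_above (V / 2) (s + \<tau>)"
proof -
  have b: "1 < b" "0 < b" unfolding b_def using p(2) powr_less_mono[of 0 "2 + e" 2] by auto
  have \<Gamma>: "0 < \<Gamma>" using p b by (simp add: \<Gamma>_def)
  have tau: "0 < \<tau>" using \<Gamma> M V by (simp add: \<tau>)
  define z where "z k = 1 / (2::real) ^ k" for k :: nat
  have z: "0 < z k" "z k \<le> 1" "z (Suc k) = z k / 2" for k by (simp_all add: z_def divide_le_eq)
  define c where "c k = V / 2 * (1 - z k)" for k
  define \<delta> where "\<delta> k = \<theta> * V / 4 * z k" for k
  define T where "T k = s + \<tau> * (1 - z k)" for k
  define m where "m k = mass (c k) (\<delta> k) (T k)" for k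
  have dk: "0 < \<delta> k" for k using p V z by (simp add: \<delta>_def)
  have dk0: "\<delta> k \<le> \<delta>0" for k
  proof -
    have "\<theta> * V \<le> \<delta>0" using mult_left_mono[OF V(3), of \<theta>] p by linarith
    moreover have "\<theta> * V * z k \<le> \<theta> * V * 1" using p V z by (intro mult_left_mono) auto
    moreover have "0 < \<theta> * V * z k" using p V z by simp
    ultimately show ?thesis by (simp add: \<delta>_def)
  qed
  have ck: "0 \<le> c k" "c k \<le> V / 2" for k using V z[of k] by (auto simp: c_def mult_le_cancel_left1)
  have cd: "c k + \<delta> k \<le> c (Suc k)" for k
  proof -
    have le: "\<theta> * (V * z k) \<le> 1 * (V * z k)" using p V z[of k] by (intro mult_right_mono) auto
    have eq: "V / 2 * (1 - z k / 2) - (V / 2 * (1 - z k) + \<theta> * V / 4 * z k) = (1 * (V * z k) - \<theta> * (V * z k)) / 4"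
      by (simp add: field_simps)
    have "0 \<le> V / 2 * (1 - z k / 2) - (V / 2 * (1 - z k) + \<theta> * V / 4 * z k)" unfolding eq using le by simp
    then show ?thesis unfolding c_def \<delta>_def z(3) by (simp only: diff_ge_0_iff_ge)
  qed
  have Tk: "s \<le> T k" "T k \<le> s + \<tau>" for k using tau z[of k] by (auto simp: T_def mult_le_cancel_left1)
  define D where "D = 8 * V / \<tau> * (Q * (\<theta> * V / 4) powr - \<sigma>) powr (1 + 1 / d)"
  have rec: "m (Suc k) \<le> D * b ^ k * m k powr (1 + 1 / d)" for k
  proof -
    define Y where "Y = (Q * \<delta> k powr - \<sigma> * m k) powr (1 + 1 / d)"
    \<comment> \<open>The midpoint of the time gap: the first half is spent on the time cut-off in
      the superlevel estimate, the second half is the slab over which the mass is averaged.\<close>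
    let ?t1 = "T k + \<tau> / 4 * z k"
    have gap: "T (Suc k) - ?t1 = \<tau> / 4 * z k" by (simp add: T_def z(3) algebra_simps)
    have tz: "0 < \<tau> / 4 * z k" using tau z[of k] by simp
    have t: "0 < T k" "T k < ?t1" "?t1 \<le> T (Suc k)" using V(4) Tk(1)[of k] tz gap by linarith+
    have cb: "c k + \<delta> k \<le> \<beta>" using cd[of k] ck(2)[of "Suc k"] V by linarith
    have "(T (Suc k) - ?t1) * mass (c (Suc k)) (\<delta> (Suc k)) (T (Suc k)) \<le> 2 * V * Y"
    proof (rule slab_superlevel[OF V _ t(3) ck(1) _ dk cd])
      show "s \<le> ?t1" using Tk(1)[of k] t by linarith
      show "c (Suc k) \<le> \<beta>" using ck(2)[of "Suc k"] V by linarith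
      show "emeasure lborel {p. ?t1 \<le> fst p \<and> fst p \<le> T (Suc k) \<and> c k + \<delta> k \<le> w p} \<le> ennreal Y"
        unfolding Y_def m_def by (rule SL[OF dk dk0 ck(1) cb t])
    qed (simp add: Y_def)
    then have "\<tau> / 4 * z k * m (Suc k) \<le> 2 * V * Y" by (simp only: gap m_def)
    then have "m (Suc k) \<le> 8 * V / \<tau> * (1 / z k) * Y" using tau z[of k] by (simp add: field_simps)
    also have "Y = (Q * (\<theta> * V / 4) powr - \<sigma>) powr (1 + 1 / d) * (z k powr - \<sigma>) powr (1 + 1 / d) * m k powr (1 + 1 / d)"
    proof -
      define a where "a = \<theta> * V / 4"
      have a: "0 < a" "\<delta> k = a * z k" using p V by (simp_all add: a_def \<delta>_def)
      have mk: "0 \<le> m k" unfolding m_def by (rule mass_nonneg[OF dk])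
      show ?thesis unfolding Y_def a(2) a_def[symmetric] using p(3) a(1) z(1)[of k] mk by (simp add: powr_mult)
    qed
    also have "(z k powr - \<sigma>) powr (1 + 1 / d) = z k powr - (1 + e)" using p(4) by (simp add: powr_powr)
    also have "8 * V / \<tau> * (1 / z k) * ((Q * (\<theta> * V / 4) powr - \<sigma>) powr (1 + 1 / d) * z k powr - (1 + e) * m k powr (1 + 1 / d))
      = D * ((1 / z k) * z k powr - (1 + e)) * m k powr (1 + 1 / d)" by (simp add: D_def)
    also have "(1 / z k) * z k powr - (1 + e) = b ^ k"
    proof -
      have zk: "z k = 2 powr - real k" by (simp add: z_def powr_minus_divide powr_realpow)
      have "1 / z k = 2 powr real k" unfolding zk by (simp add: powr_minus_divide)
      moreover have "z k powr - (1 + e) = 2 powr (real k * (1 + e))" by (simp only: zk powr_powr minus_mult_minus)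
      ultimately have "(1 / z k) * z k powr - (1 + e) = 2 powr real k * 2 powr (real k * (1 + e))" by (rule arg_cong2[where f=times])
      also have "\<dots> = 2 powr ((2 + e) * real k)" by (simp add: powr_add[symmetric] algebra_simps)
      also have "\<dots> = b ^ k" using b by (simp add: b_def powr_powr[symmetric] powr_realpow)
      finally show ?thesis .
    qed
    finally show ?thesis .
  qed
  have small: "D * M powr (1 / d) \<le> b powr - d"
  proof -
    have "(Q * (\<theta> * V / 4) powr - \<sigma>) powr (1 + 1 / d) = Q powr (1 + 1 / d) * ((\<theta> / 4 * V) powr - \<sigma>) powr (1 + 1 / d)"
      using p by (simp add: powr_mult)
    also have "((\<theta> / 4 * V) powr - \<sigma>) powr (1 + 1 / d) = (\<theta> / 4 * V) powr - (1 + e)" using p(4) by (simp add: powr_powr)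
    also have "\<dots> = (\<theta> / 4) powr - (1 + e) * V powr - (1 + e)" by (rule powr_mult)
    also have "V powr - (1 + e) = V powr - e / V"
    proof -
      have eq: "- (1 + e) = - e - 1" by simp
      show ?thesis unfolding eq powr_diff using V(2) by simp
    qed
    finally have E: "(Q * (\<theta> * V / 4) powr - \<sigma>) powr (1 + 1 / d) = Q powr (1 + 1 / d) * ((\<theta> / 4) powr - (1 + e) * (V powr - e / V))" .
    have tb: "\<tau> / b powr d = 8 * Q powr (1 + 1 / d) * (\<theta> / 4) powr - (1 + e) * M powr (1 / d) * V powr - e"
      using b unfolding \<tau> \<Gamma>_def by simp
    have "D * M powr (1 / d) = 8 * Q powr (1 + 1 / d) * (\<theta> / 4) powr - (1 + e) * M powr (1 / d) * V powr - e / \<tau>"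
      unfolding D_def E using V(2) by simp
    also have "\<dots> = (\<tau> / b powr d) / \<tau>" unfolding tb ..
    also have "\<dots> = b powr - d" using tau by (simp add: powr_minus_divide)
    finally show ?thesis by simp
  qed
  have lim: "m \<longlonglongrightarrow> 0"
  proof (rule fast_decay[OF _ rec _ _ b(1) p(1) M(1) small])
    show "0 \<le> m k" for k unfolding m_def by (rule mass_nonneg[OF dk])
    show "m 0 \<le> M" using M(2)[OF dk[of 0]] by (simp add: m_def c_def T_def z_def)
    show "0 \<le> D" using V tau by (simp add: D_def)
  qed
  \<comment> \<open>Every step stays below the final level: the upper end of its band is at most
    V/2, so the truncation at V/2 lies below \<open>kappa (c k) (\<delta> k)\<close>. The limit in k
    then gives mass zero.\<close>
  have cmp: "mass (V / 2) \<epsilon> (s + \<tau>) \<le> m k" if e: "\<epsilon> > 0" for \<epsilon> k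
  proof -
    have T0: "0 \<le> T k" using Tk(1)[of k] V by linarith
    have "mass (V / 2) \<epsilon> (s + \<tau>) \<le> mass (V / 2) \<epsilon> (T k)"
      by (rule mass_decreasing[OF e _ _ T0 Tk(2)]) (use V in auto)
    also have "\<dots> \<le> m k" unfolding m_def mass_def
    proof (intro integral_mono kappa_u_integrable e dk ck T0)
      fix x
      show "kappa (V / 2) \<epsilon> (u (T k) x) \<le> kappa (c k) (\<delta> k) (u (T k) x)"
        using kappa_le[OF e, of "V / 2" "u (T k) x"] kappa_ge[OF dk[of k], of "u (T k) x" "c k"]
          kappa_nonneg[OF dk[of k], of "c k" "u (T k) x"] cd[of k] ck(2)[of "Suc k"] by linarith
    qed (use V in auto)
    finally show ?thesis .
  qed
  have "mass (V / 2) \<epsilon> (s + \<tau>) = 0" if e: "\<epsilon> > 0" for \<epsilon>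
  proof (rule antisym)
    show "mass (V / 2) \<epsilon> (s + \<tau>) \<le> 0"
      by (rule LIMSEQ_le_const[OF lim]) (use cmp[OF e] in blast)
    show "0 \<le> mass (V / 2) \<epsilon> (s + \<tau>)" by (rule mass_nonneg[OF e])
  qed
  then show ?thesis unfolding bounded_above_def by blast
qed

text \<open>Halving \<beta>/2^j takes a time proportional to 2^(e j), a geometric progression whose
  sum telescopes to q \<rho>^j with \<rho> = 2^e. Inverting the relation between elapsed time and
  number of halvings gives decay like t^(-1/e). The initial delay t/2 is there because the range
  bound is available only at positive times.\<close>

lemma algebraic_decay:
  fixes d e Q \<sigma> \<theta> \<delta>0 M t :: real
  defines "b \<equiv> 2 powr (2 + e)"
  defines "\<Gamma> \<equiv> 8 * Q powr (1 + 1 / d) * (\<theta> / 4) powr - (1 + e) * b powr d"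
  assumes SL: "\<And>c \<delta> t0 t1 t2. 0 < \<delta> \<Longrightarrow> \<delta> \<le> \<delta>0 \<Longrightarrow> 0 \<le> c \<Longrightarrow> c + \<delta> \<le> \<beta> \<Longrightarrow> 0 < t0 \<Longrightarrow> t0 < t1 \<Longrightarrow> t1 \<le> t2 \<Longrightarrow>
      emeasure lborel {p. t1 \<le> fst p \<and> fst p \<le> t2 \<and> c + \<delta> \<le> w p} \<le> ennreal ((Q * \<delta> powr - \<sigma> * mass c \<delta> t0) powr (1 + 1 / d))"
    and p: "0 < d" "0 < e" "0 < Q" "\<sigma> * (1 + 1 / d) = 1 + e" "0 < \<theta>" "\<theta> \<le> 1" "\<theta> * \<beta> \<le> \<delta>0"
    and \<beta>: "0 < \<beta>" and M: "0 < M" "L1_norm (u 0) \<le> M" and t: "0 < t"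
  shows "AE x in lebesgue. u t x \<le> 2 * \<beta> * (2 * \<Gamma> * \<beta> powr - e / (2 powr e - 1)) powr (1 / e) * M powr (1 / (d * e)) * t powr - (1 / e)"
proof -
  have b: "0 < b" by (simp add: b_def)
  have \<Gamma>: "0 < \<Gamma>" using p b by (simp add: \<Gamma>_def)
  define \<rho> where "\<rho> = 2 powr e"
  have \<rho>: "1 < \<rho>" using p powr_less_mono[of 0 e 2] by (simp add: \<rho>_def)
  define q where "q = \<Gamma> * M powr (1 / d) * \<beta> powr - e / (\<rho> - 1)"
  have q: "0 < q" using \<Gamma> M \<beta> \<rho> by (simp add: q_def)
  have mM: "mass 0 \<delta> s \<le> M" if "\<delta> > 0" "0 \<le> s" for \<delta> s
    using mass_decreasing[OF that(1) order_refl zero_range(2) order_refl that(2)] mass_le_L1[OF that(1) order_refl order_refl] M by linarith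
  have up: "bounded_above (\<beta> / 2 ^ j) (t / 2 + q * \<rho> ^ j)" for j
  proof (induction j)
    case 0
    show ?case using bounded_above_top[of "t / 2 + q"] t q by simp
  next
    case (Suc j)
    have s: "0 < t / 2 + q * \<rho> ^ j" using t q \<rho> by (simp add: add_pos_nonneg)
    have V: "0 < \<beta> / 2 ^ j" "\<beta> / 2 ^ j \<le> \<beta>" using \<beta> by (auto simp: divide_le_eq mult_le_cancel_left1)
    have "bounded_above (\<beta> / 2 ^ j / 2) ((t / 2 + q * \<rho> ^ j) + \<Gamma> * M powr (1 / d) * (\<beta> / 2 ^ j) powr - e)"
      unfolding \<Gamma>_def b_def
      by (rule halving[OF SL p Suc V s M(1) mM[OF _ less_imp_le[OF s]] refl])
    moreover have "\<Gamma> * M powr (1 / d) * (\<beta> / 2 ^ j) powr - e = q * \<rho> ^ Suc j - q * \<rho> ^ j"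
    proof -
      have "(\<beta> / 2 ^ j) powr - e = \<beta> powr - e / (2 ^ j) powr - e" using \<beta> by (simp add: powr_divide)
      also have "((2::real) ^ j) powr - e = 1 / \<rho> ^ j"
        by (simp add: \<rho>_def powr_powr powr_minus_divide mult.commute flip: powr_realpow)
      finally have "(\<beta> / 2 ^ j) powr - e = \<beta> powr - e * \<rho> ^ j" by simp
      moreover have "q * (\<rho> - 1) = \<Gamma> * M powr (1 / d) * \<beta> powr - e" using \<rho> by (simp add: q_def)
      ultimately have "\<Gamma> * M powr (1 / d) * (\<beta> / 2 ^ j) powr - e = q * (\<rho> - 1) * \<rho> ^ j" by simp
      then show ?thesis by (simp add: algebra_simps)
    qed
    ultimately show ?case by (simp add: mult_ac)
  qed
  obtain j where "t / (2 * q) < \<rho> ^ j" using real_arch_pow[OF \<rho>] by blast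
  then have ex: "\<exists>j. t / (2 * q) < \<rho> ^ j" by blast
  \<comment> \<open>The bound at stage J itself need not hold by time t, but the one at stage J - 1
    does. This loses one halving, hence the factor 2 in front.\<close>
  define J where "J = (LEAST j. t / (2 * q) < \<rho> ^ j)"
  have J: "t / (2 * q) < \<rho> ^ J" unfolding J_def by (rule LeastI_ex[OF ex])
  have "\<exists>W. bounded_above W t \<and> 0 \<le> W \<and> W \<le> 2 * \<beta> / 2 ^ J"
  proof (cases J)
    case 0
    then show ?thesis using bounded_above_top[OF t] \<beta> by (intro exI[of _ \<beta>]) auto
  next
    case (Suc i)
    have "\<not> t / (2 * q) < \<rho> ^ i" using not_less_Least[of i "\<lambda>j. t / (2 * q) < \<rho> ^ j"] Suc by (simp add: J_def)
    then have "t / 2 + q * \<rho> ^ i \<le> t" using q by (simp add: not_less le_divide_eq mult_ac)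
    moreover have "\<beta> / 2 ^ i \<le> \<beta>" using \<beta> by (auto simp: divide_le_eq mult_le_cancel_left1)
    ultimately have "bounded_above (\<beta> / 2 ^ i) t"
      using bounded_above_later[OF up[of i], of t] \<beta> t q \<rho> by simp
    then show ?thesis using \<beta> Suc by (intro exI[of _ "\<beta> / 2 ^ i"]) auto
  qed
  then obtain W where W: "bounded_above W t" "0 \<le> W" "W \<le> 2 * \<beta> / 2 ^ J" by blast
  have "t / (2 * q) \<le> (2 powr real J) powr e"
    using J by (simp add: \<rho>_def powr_powr mult.commute flip: powr_realpow)
  then have "(t / (2 * q)) powr (1 / e) \<le> ((2 powr real J) powr e) powr (1 / e)" using t q p by (intro powr_mono2) auto
  also have "\<dots> = 2 ^ J" using p by (simp add: powr_powr powr_realpow)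
  finally have J2: "(t / (2 * q)) powr (1 / e) \<le> 2 ^ J" .
  have tq: "0 < (t / (2 * q)) powr (1 / e)" using t q by simp
  have "2 * \<beta> / 2 ^ J \<le> 2 * \<beta> / (t / (2 * q)) powr (1 / e)" using J2 tq \<beta> by (intro divide_left_mono) auto
  also have "\<dots> = 2 * \<beta> * ((2 * q) powr (1 / e) * t powr - (1 / e))" using t q by (simp add: powr_divide powr_minus_divide)
  also have "2 * q = (2 * \<Gamma> * \<beta> powr - e / (2 powr e - 1)) * M powr (1 / d)" by (simp add: q_def \<rho>_def)
  also have "((2 * \<Gamma> * \<beta> powr - e / (2 powr e - 1)) * M powr (1 / d)) powr (1 / e)
      = (2 * \<Gamma> * \<beta> powr - e / (2 powr e - 1)) powr (1 / e) * M powr (1 / (d * e))"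
    using \<Gamma> \<rho> by (subst powr_mult) (auto simp: powr_powr \<rho>_def)
  finally have "W \<le> 2 * \<beta> * (2 * \<Gamma> * \<beta> powr - e / (2 powr e - 1)) powr (1 / e) * M powr (1 / (d * e)) * t powr - (1 / e)"
    using W(3) by (simp add: mult_ac)
  with bounded_above_AE[OF W(1,2)] t show ?thesis by (auto elim!: eventually_mono)
qed

end

subsection \<open>The decay estimate\<close>

text \<open>The constant is chosen before the solution: it involves only the interval, the adapted
  coordinates, the speed bound and the dimension. If \<beta> \<le> 0 the range already makes u
  nonpositive, and B = 0 serves.\<close>

lemma upper_decay:
  fixes A a :: "real \<Rightarrow> real^'n" and \<delta>0 C k :: real
  assumes ab: "\<alpha> < \<beta>" and AB: "\<forall>v\<in>{\<alpha>..\<beta>}. (A has_vector_derivative a v) (at v within {\<alpha>..\<beta>})"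
    and ac: "continuous_on {\<alpha>..\<beta>} a" and ad: "adapted_coords (\<lambda>v. (1::real, a v)) \<alpha> \<beta> K \<delta>0 C k" and pos: "0 < \<delta>0" "1 \<le> C" "0 < k"
  shows "\<exists>B\<ge>0. \<forall>u\<^sub>0 u t M. entropy_solution_in {\<alpha>..\<beta>} A u\<^sub>0 u \<longrightarrow> 0 < t \<longrightarrow> 0 < M \<longrightarrow> L1_norm u\<^sub>0 \<le> M \<longrightarrow>
     (AE x in lebesgue. u t x \<le> \<beta>) \<and> (AE x in lebesgue. u t x \<le> B * M powr (1 / (1 + real K)) * t powr - (CARD('n) / (1 + real K)))"
proof -
  let ?av = "\<lambda>v. (1::real, a v)"
  note A = bspec[OF AB]
  have top: "AE x in lebesgue. u t x \<le> \<beta>" if sol: "entropy_solution_in {\<alpha>..\<beta>} A u\<^sub>0 u" and t: "0 < t" for u\<^sub>0 u t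
  proof -
    obtain w where "kinetic_solution \<alpha> \<beta> ?av w u" using entropy_solution_kinetic[OF ab A ac sol] by blast
    then interpret kinetic_solution \<alpha> \<beta> ?av w u .
    show ?thesis by (rule bounded_above_AE[OF bounded_above_top[OF t] zero_range(2)]) (use t in simp)
  qed
  show ?thesis
  proof (cases "0 < \<beta>")
    case False
    have nonpos: "AE x in lebesgue. u t x \<le> 0" if sol: "entropy_solution_in {\<alpha>..\<beta>} A u\<^sub>0 u" and t: "0 < t" for u\<^sub>0 u t
      using top[OF sol t] False by (auto elim!: eventually_mono)
    show ?thesis
    proof (rule exI[of _ 0], rule conjI[OF order_refl], intro allI impI)
      fix u\<^sub>0 u t M
      assume sol: "entropy_solution_in {\<alpha>..\<beta>} A u\<^sub>0 u" and t: "0 < (t::real)" and M: "0 < M" "L1_norm u\<^sub>0 \<le> M"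
      from top[OF sol t] nonpos[OF sol t]
      show "(AE x in lebesgue. u t x \<le> \<beta>) \<and> (AE x in lebesgue. u t x \<le> 0 * M powr (1 / (1 + real K)) * t powr - (CARD('n) / (1 + real K)))"
        unfolding mult_zero_left by (rule conjI)
    qed
  next
    case \<beta>: True
    define n where "n = DIM(real \<times> (real^'n))"
    define d where "d = real CARD('n)"
    \<comment> \<open>The volume exponent K and the gain 1 + 1/d combine to this e, so that 1/e =
      d/(1 + K) and 1/(d e) = 1/(1 + K) are the exponents of time and mass.\<close>
    define e where "e = (1 + real K) / d"
    define \<sigma> where "\<sigma> = 1 + K / real n"
    \<comment> \<open>Keeps every band used at heights V \<le> \<beta> below the width \<delta>0 up
      to which adapted coordinates exist.\<close>
    define \<theta> where "\<theta> = min 1 (\<delta>0 / \<beta>)"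
    have d: "0 < d" by (simp add: d_def)
    have nd: "real n = 1 + d" by (simp add: n_def d_def)
    have e: "0 < e" using d by (simp add: e_def)
    have s: "\<sigma> * (1 + 1 / d) = 1 + e" 
    proof -
      have d1: "1 + d \<noteq> 0" using d by linarith
      have "\<sigma> = (1 + d + K) / (1 + d)" unfolding \<sigma>_def nd using d1 by (simp add: add_divide_distrib)
      moreover have "1 + 1 / d = (1 + d) / d" using d by (simp add: add_divide_distrib)
      ultimately have "\<sigma> * (1 + 1 / d) = (1 + d + K) / d" using d1 by simp
      also have "\<dots> = 1 + e" using d by (simp add: e_def add_divide_distrib)
      finally show ?thesis .
    qed
    have th: "0 < \<theta>" "\<theta> \<le> 1" "\<theta> * \<beta> \<le> \<delta>0"
    proof -
      show "0 < \<theta>" "\<theta> \<le> 1" using pos \<beta> by (auto simp: \<theta>_def)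
      have "\<theta> \<le> \<delta>0 / \<beta>" by (simp add: \<theta>_def)
      then show "\<theta> * \<beta> \<le> \<delta>0" using \<beta> by (simp add: le_divide_eq)
    qed
    from concentrated_convex_potential[where 'a="real \<times> (real^'n)"]
    obtain c0 where c0: "c0 > 0" and potA: "\<forall>P::(real \<times> (real^'n)) set. finite P \<longrightarrow> P \<noteq> {} \<longrightarrow>
        (\<exists>\<Phi>. smooth \<Phi> \<and> convex_on UNIV \<Phi> \<and> (\<forall>h x. \<bar>pderiv_dir h \<Phi> x\<bar> \<le> norm h) \<and>
          (\<forall>p\<in>P. \<forall>x\<in>cball p (1/4). c0 * root DIM(real \<times> (real^'n)) (1 / card P) \<le> lap \<Phi> x))"
      by (elim exE conjE) (rule that)
    note pot = potA[rule_format]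
    have "bounded (?av ` {\<alpha>..\<beta>})"
      by (intro compact_imp_bounded compact_continuous_image continuous_on_Pair continuous_on_const ac compact_Icc)
    then obtain A0 where A0: "\<And>v. v \<in> {\<alpha>..\<beta>} \<Longrightarrow> norm (?av v) \<le> A0" unfolding bounded_iff by blast
    have A00: "0 \<le> A0" using A0[of \<beta>] ab norm_ge_zero[of "?av \<beta>"] by (meson atLeastAtMost_iff less_imp_le order_refl order_trans)
    \<comment> \<open>The maximum with 1 ensures positivity when the quotient vanishes.\<close>
    define Q where "Q = max 1 (240 * (real n)\<^sup>2 * C * A0 / (c0 * k powr (1 / real n)))"
    have Q: "0 < Q" "240 * (real n)\<^sup>2 * C * A0 / (c0 * k powr (1 / real n)) \<le> Q" by (simp_all add: Q_def)
    have C0: "0 \<le> C" using pos by simp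
    define b where "b = 2 powr (2 + e)"
    define \<Gamma> where "\<Gamma> = 8 * Q powr (1 + 1 / d) * (\<theta> / 4) powr - (1 + e) * b powr d"
    define B where "B = 2 * \<beta> * (2 * \<Gamma> * \<beta> powr - e / (2 powr e - 1)) powr (1 / e)"
    have B: "0 \<le> B" using \<beta> by (simp add: B_def)
    have main: "AE x in lebesgue. u t x \<le> B * M powr (1 / (1 + real K)) * t powr - (CARD('n) / (1 + real K))"
      if sol: "entropy_solution_in {\<alpha>..\<beta>} A u\<^sub>0 u" and t: "0 < t" and M: "0 < M" "L1_norm u\<^sub>0 \<le> M" for u\<^sub>0 u t M
    proof -
      obtain w where "kinetic_solution \<alpha> \<beta> ?av w u" using entropy_solution_kinetic[OF ab A ac sol] by blast
      then interpret kinetic_solution \<alpha> \<beta> ?av w u .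
      have "L1_norm (u 0) = L1_norm u\<^sub>0" unfolding L1_norm_def
      proof (rule integral_cong_AE)
        have "u 0 \<in> borel_measurable lebesgue" "u\<^sub>0 \<in> borel_measurable lebesgue"
          using sol u_int[of 0] unfolding entropy_solution_in_def in_L1_Linf_def by (auto intro: borel_measurable_integrable)
        then show "(\<lambda>x. \<bar>u 0 x\<bar>) \<in> borel_measurable lebesgue" "(\<lambda>x. \<bar>u\<^sub>0 x\<bar>) \<in> borel_measurable lebesgue" by simp_all
        show "AE x in lebesgue. \<bar>u 0 x\<bar> = \<bar>u\<^sub>0 x\<bar>"
          using sol unfolding entropy_solution_in_def by (auto elim!: eventually_mono)
      qed
      then have M': "L1_norm (u 0) \<le> M" using M(2) by simp
      have SL: "emeasure lborel {p. t1 \<le> fst p \<and> fst p \<le> t2 \<and> c + \<delta> \<le> w p} \<le> ennreal ((Q * \<delta> powr - \<sigma> * mass c \<delta> t0) powr (1 + 1 / d))"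
        if "0 < \<delta>" "\<delta> \<le> \<delta>0" "0 \<le> c" "c + \<delta> \<le> \<beta>" "0 < t0" "t0 < t1" "t1 \<le> t2" for c \<delta> t0 t1 t2
        unfolding \<sigma>_def d_def n_def
        by (rule superlevel[OF ad pos(3) C0 A00 A0 c0 pot Q(2)[unfolded n_def] that])
      have "1 / (d * e) = 1 / (1 + real K)" "1 / e = CARD('n) / (1 + real K)" using d by (simp_all add: e_def d_def)
      with algebraic_decay[OF SL d e Q(1) s th \<beta> M(1) M' t] show ?thesis
        unfolding B_def \<Gamma>_def b_def by simp
    qed
    show ?thesis
    proof (rule exI[of _ B], rule conjI[OF B], intro allI impI)
      fix u\<^sub>0 u t M
      assume sol: "entropy_solution_in {\<alpha>..\<beta>} A u\<^sub>0 u" and t: "0 < (t::real)" and M: "0 < M" "L1_norm u\<^sub>0 \<le> M"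
      from top[OF sol t] main[OF sol t M]
      show "(AE x in lebesgue. u t x \<le> \<beta>) \<and> (AE x in lebesgue. u t x \<le> B * M powr (1 / (1 + real K)) * t powr - (CARD('n) / (1 + real K)))"
        by (rule conjI)
    qed
  qed
qed

section \<open>Reflection of the equation and conclusion\<close>

lemma has_vector_derivative_reflect:
  fixes f :: "real \<Rightarrow> 'a::real_normed_vector"
  assumes "(f has_vector_derivative D) (at (- v) within {\<alpha>..\<beta>})"
  shows "((\<lambda>x. f (- x)) has_vector_derivative - D) (at v within {- \<beta>..- \<alpha>})"
proof -
  have "((\<lambda>x. - x) has_vector_derivative - 1) (at v within {- \<beta>..- \<alpha>})"
    by (rule has_vector_derivative_minus[OF has_vector_derivative_id])
  from vector_diff_chain_within[OF this, of f D] assms show ?thesis by (simp add: o_def)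
qed

lemma entropy_flux_pair_reflect:
  fixes A a :: "real \<Rightarrow> real^'n"
  assumes ab: "\<alpha> < \<beta>" and A: "\<And>v. v \<in> {\<alpha>..\<beta>} \<Longrightarrow> (A has_vector_derivative a v) (at v within {\<alpha>..\<beta>})"
    and pair: "entropy_flux_pair_on {- \<beta>..- \<alpha>} (\<lambda>v. - A (- v)) \<eta> q"
  shows "entropy_flux_pair_on {\<alpha>..\<beta>} A (\<lambda>v. \<eta> (- v)) (\<lambda>v. q (- v))"
  unfolding entropy_flux_pair_on_def
proof (intro conjI ballI allI impI)
  have conv: "convex_on UNIV \<eta>" using pair by (simp add: entropy_flux_pair_on_def)
  have "\<eta> (- (r *\<^sub>R x + s *\<^sub>R y)) \<le> r * \<eta> (- x) + s * \<eta> (- y)" if "0 \<le> r" "0 \<le> s" "r + s = 1" for r s x y :: real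
  proof -
    have "r *\<^sub>R (- x) + s *\<^sub>R (- y) = - (r *\<^sub>R x + s *\<^sub>R y)" by simp
    with conv[unfolded convex_on_def, THEN conjunct2, rule_format, of "- x" "- y" r s] that show ?thesis by simp
  qed
  then show "convex_on UNIV (\<lambda>v. \<eta> (- v))" unfolding convex_on_def by simp
  show "continuous_on {\<alpha>..\<beta>} (\<lambda>v. q (- v))"
    by (rule continuous_on_compose2[of "{- \<beta>..- \<alpha>}" q]) (use pair in \<open>auto simp: entropy_flux_pair_on_def intro!: continuous_intros\<close>)
  fix v D assume v: "v \<in> {\<alpha>..\<beta>}" and D: "((\<lambda>v. \<eta> (- v)) has_real_derivative D) (at v)"
  have mv: "- v \<in> {- \<beta>..- \<alpha>}" using v by simp
  have "((\<lambda>v. \<eta> (- v)) has_real_derivative D) (at (- (- v)))" using D by simp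
  from DERIV_chain2[OF this DERIV_minus[OF DERIV_ident]]
  have "(\<eta> has_real_derivative - D) (at (- v))" by simp
  from pair[unfolded entropy_flux_pair_on_def, THEN conjunct2, THEN conjunct2, rule_format, OF mv this]
  have qd: "(q has_vector_derivative (- D) *\<^sub>R vector_derivative (\<lambda>v. - A (- v)) (at (- v) within {- \<beta>..- \<alpha>})) (at (- v) within {- \<beta>..- \<alpha>})" .
  have "((\<lambda>x. - A (- x)) has_vector_derivative a v) (at (- v) within {- \<beta>..- \<alpha>})"
    using has_vector_derivative_minus[OF has_vector_derivative_reflect[of A "a v" "- v"]] A[OF v] by simp
  then have "vector_derivative (\<lambda>v. - A (- v)) (at (- v) within {- \<beta>..- \<alpha>}) = a v"
    by (intro vector_derivative_within_closed_interval) (use ab mv in auto)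
  moreover have "vector_derivative A (at v within {\<alpha>..\<beta>}) = a v"
    by (intro vector_derivative_within_closed_interval A v ab)
  ultimately show "((\<lambda>v. q (- v)) has_vector_derivative D *\<^sub>R vector_derivative A (at v within {\<alpha>..\<beta>})) (at v within {\<alpha>..\<beta>})"
    using has_vector_derivative_reflect[OF qd] by simp
qed

text \<open>Reversing the sign of u turns the flux A into v \<mapsto> -A(-v), whose speed is v
  \<mapsto> a(-v). Entropies correspond under v \<mapsto> -v, so upper bounds for the reflected
  equation are lower bounds for the original one.\<close>

lemma entropy_solution_reflect:
  fixes A a :: "real \<Rightarrow> real^'n"
  assumes ab: "\<alpha> < \<beta>" and A: "\<And>v. v \<in> {\<alpha>..\<beta>} \<Longrightarrow> (A has_vector_derivative a v) (at v within {\<alpha>..\<beta>})"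
    and sol: "entropy_solution_in {\<alpha>..\<beta>} A u\<^sub>0 u"
  shows "entropy_solution_in {- \<beta>..- \<alpha>} (\<lambda>v. - A (- v)) (\<lambda>x. - u\<^sub>0 x) (\<lambda>t x. - u t x)"
proof -
  have sol_m: "(\<lambda>p. u (fst p) (snd p)) \<in> borel_measurable (lebesgue_on ({0..} \<times> UNIV))"
    and sol_l: "in_L1_Linf u\<^sub>0" and sol_0: "AE x in lebesgue. u 0 x = u\<^sub>0 x"
    and sol_b: "\<exists>M. AE p in lebesgue_on ({0..} \<times> UNIV). \<bar>u (fst p) (snd p)\<bar> \<le> M"
    and sol_r: "AE p in lebesgue_on ({0..} \<times> UNIV). u (fst p) (snd p) \<in> {\<alpha>..\<beta>}"
    and sol_i: "\<And>t. 0 \<le> t \<Longrightarrow> integrable lebesgue (u t)"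
    and sol_c: "\<And>s. 0 \<le> s \<Longrightarrow> ((\<lambda>t. L1_norm (\<lambda>x. u t x - u s x)) \<longlongrightarrow> 0) (at s within {0..})"
    and sol_e: "\<And>\<eta> q \<phi>. entropy_flux_pair_on {\<alpha>..\<beta>} A \<eta> q \<Longrightarrow> test_function \<phi> \<Longrightarrow>
        0 \<le> (LINT p|lebesgue_on ({0<..} \<times> UNIV). \<eta> (u (fst p) (snd p)) * time_deriv \<phi> p + q (u (fst p) (snd p)) \<bullet> space_grad \<phi> p)"
    using sol unfolding entropy_solution_in_def by blast+
  have L: "L1_norm (\<lambda>x. - u t x - - u s x) = L1_norm (\<lambda>x. u t x - u s x)" for t s
    by (simp add: L1_norm_def abs_minus_commute)
  have ent: "0 \<le> (LINT p|lebesgue_on ({0<..} \<times> UNIV). \<eta> (- u (fst p) (snd p)) * time_deriv \<phi> p + q (- u (fst p) (snd p)) \<bullet> space_grad \<phi> p)"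
    if pair: "entropy_flux_pair_on {- \<beta>..- \<alpha>} (\<lambda>v. - A (- v)) \<eta> q" and "test_function \<phi>" for \<eta> q \<phi>
    by (rule sol_e[OF entropy_flux_pair_reflect[OF ab A pair] that(2)])
  have p1: "in_L1_Linf (\<lambda>x. - u\<^sub>0 x)" using sol_l by (simp add: in_L1_Linf_def)
  have p2: "integrable lebesgue (\<lambda>x. - u t x)" if "0 \<le> t" for t using sol_i[OF that] by simp
  have p3: "((\<lambda>t. L1_norm (\<lambda>x. - u t x - - u s x)) \<longlongrightarrow> 0) (at s within {0..})" if "0 \<le> s" for s
    unfolding L by (rule sol_c[OF that])
  have p4: "(\<lambda>p. - u (fst p) (snd p)) \<in> borel_measurable (lebesgue_on ({0..} \<times> UNIV))" by (rule borel_measurable_uminus[OF sol_m])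
  have p5: "\<exists>M. AE p in lebesgue_on ({0..} \<times> UNIV). \<bar>- u (fst p) (snd p)\<bar> \<le> M" unfolding abs_minus_cancel by (rule sol_b)
  have p6: "AE p in lebesgue_on ({0..} \<times> UNIV). - u (fst p) (snd p) \<in> {- \<beta>..- \<alpha>}"
    using sol_r by eventually_elim simp
  have p7: "AE x in lebesgue. - u 0 x = - u\<^sub>0 x" using sol_0 by eventually_elim simp
  show ?thesis unfolding entropy_solution_in_def
    by (intro conjI allI impI; (rule p1 p2 p3 p4 p5 p6 p7 ent; assumption?))
qed

text \<open>Reversal exchanges the ends of each band, and the tent is symmetric about its midpoint.
  The same vectors y and constants therefore serve for the reversed curve.\<close>

lemma adapted_coords_reflect:
  assumes "adapted_coords g \<alpha> \<beta> K \<delta>0 C k"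
  shows "adapted_coords (\<lambda>v. g (- v)) (- \<beta>) (- \<alpha>) K \<delta>0 C k"
  unfolding adapted_coords_def
proof (intro allI impI)
  fix c \<delta> :: real assume d: "0 < \<delta>" "\<delta> \<le> \<delta>0" and c: "- \<beta> \<le> c" "c + \<delta> \<le> - \<alpha>"
  define c' where "c' = - (c + \<delta>)"
  have c': "\<alpha> \<le> c'" "c' + \<delta> \<le> \<beta>" using c by (auto simp: c'_def)
  from assms[unfolded adapted_coords_def, rule_format, OF d c']
  obtain y where y: "inj (coords y)" "k * \<delta> ^ K \<le> vfac (coords y)"
    and innA: "\<forall>b\<in>Basis. \<forall>b'\<in>Basis. ((\<lambda>v. tent c' \<delta> v * (g v \<bullet> y b) * (g v \<bullet> y b')) has_integral (if b = b' then \<delta> else 0)) {c'..c' + \<delta>}"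
    and ybA: "\<forall>b\<in>Basis. \<forall>v\<in>{c'..c' + \<delta>}. \<bar>g v \<bullet> y b\<bar> \<le> C"
    and ylA: "\<forall>b\<in>Basis. \<forall>v\<in>{c'..c' + \<delta>}. \<forall>w\<in>{c'..c' + \<delta>}. \<bar>g v \<bullet> y b - g w \<bullet> y b\<bar> \<le> C / \<delta> * \<bar>v - w\<bar>"
    by (elim exE conjE) (rule that)
  note inn = innA[rule_format] and yb = bspec[OF bspec[OF ybA]] and yl = bspec[OF bspec[OF bspec[OF ylA]]]
  have tent: "tent c' \<delta> (- v) = tent c \<delta> v" for v
  proof -
    have "2 * (- v - c') / \<delta> - 1 = - (2 * (v - c) / \<delta> - 1)" using d by (simp add: c'_def field_simps)
    then show ?thesis unfolding tent_def by (simp only: abs_minus_cancel)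
  qed
  have i: "{- (c' + \<delta>)..- c'} = {c..c + \<delta>}" by (simp add: c'_def)
  have mem: "- v \<in> {c'..c' + \<delta>}" if "v \<in> {c..c + \<delta>}" for v using that by (auto simp: c'_def)
  show "\<exists>y. inj (coords y) \<and> k * \<delta> ^ K \<le> vfac (coords y) \<and>
       (\<forall>b\<in>Basis. \<forall>b'\<in>Basis. ((\<lambda>v. tent c \<delta> v * (g (- v) \<bullet> y b) * (g (- v) \<bullet> y b')) has_integral (if b = b' then \<delta> else 0)) {c..c + \<delta>}) \<and>
       (\<forall>b\<in>Basis. \<forall>v\<in>{c..c + \<delta>}. \<bar>g (- v) \<bullet> y b\<bar> \<le> C) \<and>
       (\<forall>b\<in>Basis. \<forall>v\<in>{c..c + \<delta>}. \<forall>w\<in>{c..c + \<delta>}. \<bar>g (- v) \<bullet> y b - g (- w) \<bullet> y b\<bar> \<le> C / \<delta> * \<bar>v - w\<bar>)"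
  proof (rule exI[of _ y], intro conjI ballI y)
    fix b b' :: 'a assume "b \<in> Basis" "b' \<in> Basis"
    from iffD2[OF has_integral_reflect_real inn[OF this]]
    show "((\<lambda>v. tent c \<delta> v * (g (- v) \<bullet> y b) * (g (- v) \<bullet> y b')) has_integral (if b = b' then \<delta> else 0)) {c..c + \<delta>}"
      unfolding tent i .
  next
    show "\<bar>g (- v) \<bullet> y b\<bar> \<le> C" if "b \<in> Basis" "v \<in> {c..c + \<delta>}" for b v by (rule yb[OF that(1) mem[OF that(2)]])
    show "\<bar>g (- v) \<bullet> y b - g (- w) \<bullet> y b\<bar> \<le> C / \<delta> * \<bar>v - w\<bar>" if "b \<in> Basis" "v \<in> {c..c + \<delta>}" "w \<in> {c..c + \<delta>}" for b v w
      using yl[OF that(1) mem[OF that(2)] mem[OF that(3)]] by (simp add: abs_minus_commute)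
  qed
qed

lemma weight_sum:
  assumes "N \<le> m" shows "real (\<Sum>i<N. m - i) = real N * (2 * real m - real N + 1) / 2"
  using assms
proof (induction N)
  case (Suc N)
  then show ?case by (simp add: of_nat_diff field_simps)
qed simp

text \<open>For X \<le> 1 the larger exponent gives the smaller power, so the decay bound is the
  stronger one; for X > 1 the power with the smaller exponent is at least 1 and the bound K
  suffices.\<close>

lemma powr_interpolate:
  fixes x B K X \<gamma> \<gamma>' :: real
  assumes "x \<le> B * X powr \<gamma>'" "x \<le> K" "0 < X" "0 < \<gamma>" "\<gamma> < \<gamma>'" "0 \<le> B" "0 \<le> K"
  shows "x \<le> max B K * X powr \<gamma>"
proof (cases "X \<le> 1")
  case True
  have "B * X powr \<gamma>' \<le> max B K * X powr \<gamma>" using assms True by (intro mult_mono powr_mono') auto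
  then show ?thesis using assms(1) by linarith
next
  case False
  have "K * 1 \<le> max B K * X powr \<gamma>" using assms False by (intro mult_mono ge_one_powr_ge_zero) auto
  then show ?thesis using assms(2) by linarith
qed

theorem theorem1p5:
  fixes A a :: "real \<Rightarrow> real^'n" and I :: "real set" and \<alpha> \<beta> :: real and m :: nat
    and a_tilde :: "real \<Rightarrow> real \<times> (real^'n)" and d \<gamma>\<^sub>0 :: real
  assumes "\<alpha> < \<beta>" and "I = {\<alpha>..\<beta>}"
    and "\<And>v. v \<in> I \<Longrightarrow> (A has_vector_derivative a v) (at v within I)"
    and "0 < m"
    and "class_C_on m I a"
    and "a_tilde = (\<lambda>v. (1, a v))"
    and "\<And>v. v \<in> I \<Longrightarrow> span {nth_deriv_on I k a_tilde v | k. k \<le> m} = UNIV"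
    and "d = real CARD('n)"
    and "\<gamma>\<^sub>0 = inverse (1 + d * (2 * real m - d + 1) / 2)"
  shows "\<forall>\<gamma>\<in>{0<..<\<gamma>\<^sub>0}. \<exists>C :: real \<Rightarrow> real. \<forall>u\<^sub>0 u.
           entropy_solution_in I A u\<^sub>0 u \<longrightarrow>
           (\<forall>t>0. AE x in lebesgue.
              \<bar>u t x\<bar> \<le> C (Linf_norm u\<^sub>0) * L1_norm u\<^sub>0 powr \<gamma> * t powr (- (d * \<gamma>)))"
proof -
  note ab = assms(1)
  have I: "I = {\<alpha>..\<beta>}" by (rule assms(2))
  have A: "\<And>v. v \<in> {\<alpha>..\<beta>} \<Longrightarrow> (A has_vector_derivative a v) (at v within {\<alpha>..\<beta>})" using assms(3) unfolding I .
  have cls: "class_C_on m {\<alpha>..\<beta>} a" using assms(5) unfolding I .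
  have ac: "continuous_on {\<alpha>..\<beta>} a" using cls unfolding class_C_on_def by (metis le0 nth_deriv_on.simps(1))
  have sp: "\<And>v. v \<in> {\<alpha>..\<beta>} \<Longrightarrow> span {nth_deriv_on {\<alpha>..\<beta>} k (\<lambda>v. (1::real, a v)) v | k. k \<le> m} = UNIV"
    using assms(7) unfolding I assms(6) .
  interpret nc: nondeg_curve "\<lambda>k. nth_deriv_on {\<alpha>..\<beta>} k (\<lambda>v. (1::real, a v))" \<alpha> \<beta> m "(1, 0)"
    by (rule nondeg_curve_lift[OF ab assms(4) cls sp])
  define K where "K = (\<Sum>i<DIM(real \<times> (real^'n)) - 1. m - i)"
  obtain \<delta>0 C k where ad: "0 < \<delta>0" "1 \<le> C" "0 < k" "adapted_coords (\<lambda>v. (1::real, a v)) \<alpha> \<beta> K \<delta>0 C k"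
    using nc.adapted_coords_exist[folded K_def, unfolded nth_deriv_on.simps(1)] by (elim exE conjE) (rule that)
  \<comment> \<open>Spanning forces d + 1 distinct orders among 0, ..., m. With d \<le> m the
    natural-number differences in \<open>K\<close> are genuine, and the closed formula for the sum
    is valid.\<close>
  have dm: "CARD('n) \<le> m"
  proof -
    have v: "\<beta> \<in> {\<alpha>..\<beta>}" using ab by simp
    from nc.uniform_frame obtain \<kappa> where \<kappa>: "0 < \<kappa>"
      and fr: "\<forall>v\<in>{\<alpha>..\<beta>}. \<exists>sel. inj_on sel Basis \<and> sel ` Basis \<subseteq> {..m} \<and> (\<forall>x. \<kappa> * norm x \<le> norm (nc.frame sel v x))"
      by (elim exE conjE) (rule that)
    from bspec[OF fr v] obtain sel where sel: "inj_on sel Basis" "sel ` Basis \<subseteq> {..m}" "\<forall>x. \<kappa> * norm x \<le> norm (nc.frame sel \<beta> x)"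
      by (elim exE conjE) (rule that)
    show ?thesis using nc.frame_weight(1)[OF v sel(1,2) \<kappa> sel(3)[rule_format]] by simp
  qed
  have K: "real K = d * (2 * real m - d + 1) / 2" using weight_sum[OF dm] by (simp add: K_def assms(8))
  have g0: "\<gamma>\<^sub>0 = 1 / (1 + real K)" by (simp add: assms(9) K inverse_eq_divide)
  have A': "\<And>v. v \<in> {- \<beta>..- \<alpha>} \<Longrightarrow> ((\<lambda>v. - A (- v)) has_vector_derivative a (- v)) (at v within {- \<beta>..- \<alpha>})"
    using has_vector_derivative_minus[OF has_vector_derivative_reflect[OF A]] by simp
  have ac': "continuous_on {- \<beta>..- \<alpha>} (\<lambda>v. a (- v))"
    by (rule continuous_on_compose2[OF ac]) (auto intro!: continuous_intros)
  have ab': "- \<beta> < - \<alpha>" using ab by simp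
  have AB: "\<forall>v\<in>{\<alpha>..\<beta>}. (A has_vector_derivative a v) (at v within {\<alpha>..\<beta>})" by (intro ballI A)
  have A'B: "\<forall>v\<in>{- \<beta>..- \<alpha>}. ((\<lambda>v. - A (- v)) has_vector_derivative a (- v)) (at v within {- \<beta>..- \<alpha>})" by (intro ballI A')
  from upper_decay[OF ab AB ac ad(4,1-3)]
  obtain B1 where B1z: "0 \<le> B1" and B1A: "\<forall>u\<^sub>0 u t M. entropy_solution_in {\<alpha>..\<beta>} A u\<^sub>0 u \<longrightarrow> 0 < t \<longrightarrow> 0 < M \<longrightarrow> L1_norm u\<^sub>0 \<le> M \<longrightarrow>
     (AE x in lebesgue. u t x \<le> \<beta>) \<and> (AE x in lebesgue. u t x \<le> B1 * M powr (1 / (1 + real K)) * t powr - (CARD('n) / (1 + real K)))"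
    by (elim exE conjE) (rule that)
  note B1 = B1z B1A[rule_format]
  from upper_decay[OF ab' A'B ac' adapted_coords_reflect[OF ad(4)] ad(1-3)]
  obtain B2 where B2z: "0 \<le> B2" and B2A: "\<forall>u\<^sub>0 u t M. entropy_solution_in {- \<beta>..- \<alpha>} (\<lambda>v. - A (- v)) u\<^sub>0 u \<longrightarrow> 0 < t \<longrightarrow> 0 < M \<longrightarrow> L1_norm u\<^sub>0 \<le> M \<longrightarrow>
     (AE x in lebesgue. u t x \<le> - \<alpha>) \<and> (AE x in lebesgue. u t x \<le> B2 * M powr (1 / (1 + real K)) * t powr - (CARD('n) / (1 + real K)))"
    by (elim exE conjE) (rule that)
  note B2 = B2z B2A[rule_format]
  define B where "B = max B1 B2"
  define R where "R = max \<bar>\<alpha>\<bar> \<bar>\<beta>\<bar>"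
  have B: "0 \<le> B" "B1 \<le> B" "B2 \<le> B" using B1(1) by (auto simp: B_def)
  have R: "0 \<le> R" "\<beta> \<le> R" "- \<alpha> \<le> R" by (auto simp: R_def)
  \<comment> \<open>The estimate at the critical exponent, with upper bounds from u and lower bounds
    from -u. It is stated for any positive M that dominates the initial mass, so that zero mass can
    be treated by a limit.\<close>
  have main: "AE x in lebesgue. \<bar>u t x\<bar> \<le> B * M powr \<gamma>\<^sub>0 * t powr - (d * \<gamma>\<^sub>0) \<and> \<bar>u t x\<bar> \<le> R"
    if sol: "entropy_solution_in {\<alpha>..\<beta>} A u\<^sub>0 u" and t: "0 < t" and M: "0 < M" "L1_norm u\<^sub>0 \<le> M" for u\<^sub>0 u t M
  proof -
    have M': "L1_norm (\<lambda>x. - u\<^sub>0 x) \<le> M" using M by (simp add: L1_norm_def)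
    let ?X = "M powr \<gamma>\<^sub>0 * t powr - (d * \<gamma>\<^sub>0)"
    have X: "0 \<le> ?X" by simp
    have ex: "B' * M powr (1 / (1 + real K)) * t powr - (CARD('n) / (1 + real K)) = B' * ?X" for B' by (simp add: g0 assms(8))
    from B1(2)[OF sol t M] B2(2)[OF entropy_solution_reflect[OF ab A sol] t M(1) M']
    have "AE x in lebesgue. u t x \<le> \<beta>" "AE x in lebesgue. u t x \<le> B1 * ?X"
      "AE x in lebesgue. - u t x \<le> - \<alpha>" "AE x in lebesgue. - u t x \<le> B2 * ?X" unfolding ex by blast+
    then show ?thesis
    proof eventually_elim
      case (elim x)
      have "B1 * ?X \<le> B * ?X" "B2 * ?X \<le> B * ?X" using B X by (auto intro!: mult_right_mono)
      then show ?case using elim R unfolding abs_le_iff mult.assoc by linarith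
    qed
  qed
  show ?thesis
  \<comment> \<open>The same constant works for all exponents and all solutions with values in I:
    \<open>B\<close> measures the decay and \<open>R\<close> bounds the range.\<close>
  proof (intro ballI exI[of _ "\<lambda>_. max B R"] allI impI)
    fix \<gamma> u\<^sub>0 u t assume \<gamma>: "\<gamma> \<in> {0<..<\<gamma>\<^sub>0}" and sol: "entropy_solution_in I A u\<^sub>0 u" and t: "(0::real) < t"
    note sol = sol[unfolded I]
    let ?M = "L1_norm u\<^sub>0"
    have M0: "0 \<le> ?M" by (simp add: L1_norm_def)
    show "AE x in lebesgue. \<bar>u t x\<bar> \<le> max B R * ?M powr \<gamma> * t powr - (d * \<gamma>)"
    proof (cases "?M = 0")
      case False
      then have M: "0 < ?M" using M0 by simp
      \<comment> \<open>The quantity M t^(-d), on which the decay bound depends only through its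
        powers; interpolation between exponents then involves a single variable.\<close>
      define X where "X = ?M * t powr - d"
      have X: "0 < X" using M t by (simp add: X_def)
      have Xp: "X powr g = ?M powr g * t powr - (d * g)" for g
        using M t by (simp add: X_def powr_mult powr_powr)
      from main[OF sol t M order_refl] show ?thesis
      proof eventually_elim
        case (elim x)
        have "\<bar>u t x\<bar> \<le> max B R * X powr \<gamma>"
          by (rule powr_interpolate[OF _ _ X _ _ B(1) R(1), of _ \<gamma>\<^sub>0]) (use elim \<gamma> in \<open>auto simp: Xp mult.assoc\<close>)
        then show ?case by (simp add: Xp mult.assoc)
      qed
    next
      case True
      \<comment> \<open>With zero initial mass the decay bound is applied with M = 1/(i + 1) for all
        i and shows that u vanishes. The right-hand side of the claim is then 0, because 0 raised to
        any real exponent by \<open>powr\<close> is 0.\<close>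
      have "AE x in lebesgue. \<bar>u t x\<bar> \<le> B * (1 / real (Suc i)) powr \<gamma>\<^sub>0 * t powr - (d * \<gamma>\<^sub>0)" for i
        using main[OF sol t, of "1 / real (Suc i)"] True by (auto elim!: eventually_mono)
      then have "AE x in lebesgue. \<forall>i. \<bar>u t x\<bar> \<le> B * (1 / real (Suc i)) powr \<gamma>\<^sub>0 * t powr - (d * \<gamma>\<^sub>0)"
        unfolding AE_all_countable by blast
      then show ?thesis
      proof eventually_elim
        case (elim x)
        have g0p: "0 < \<gamma>\<^sub>0" using \<gamma> by auto
        have "(\<lambda>i. (1 / real (Suc i)) powr \<gamma>\<^sub>0) \<longlonglongrightarrow> 0"
          by (rule tendsto_zero_powrI[OF _ tendsto_const _ g0p])
             (use LIMSEQ_inverse_real_of_nat in \<open>auto simp: inverse_eq_divide\<close>)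
        then have "(\<lambda>i. B * (1 / real (Suc i)) powr \<gamma>\<^sub>0 * t powr - (d * \<gamma>\<^sub>0)) \<longlonglongrightarrow> B * 0 * t powr - (d * \<gamma>\<^sub>0)"
          by (intro tendsto_intros)
        then have "\<bar>u t x\<bar> \<le> B * 0 * t powr - (d * \<gamma>\<^sub>0)" by (rule LIMSEQ_le_const) (use elim in blast)
        then show ?case using True by simp
      qed
    qed
  qed
qed

end
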